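(* Let $0<\rho<1$, $T>0$, $\Omega=(0,\pi)\times(0,T]$, $a>\frac12$, and let $B:C[0,\pi]\to\mathbb{C}$ be a bounded linear functional. Suppose: (1) $t^{1-\rho}f(x,t)\in C^a_x(\overline{\Omega})$; (2) $\varphi\in C_2^a[0,\pi]$ and $\varphi\in C^a[0,\pi]$; (3) $t^{1-\rho}\psi(t)\in C[0,T]$ and $t^{1-\rho}\partial_t^\rho\psi(t)\in C[0,T]$; (4) $q\in C_2^a[0,\pi]$ and $B[q]\neq 0$. Let $\{u,p\}$ be the solution of the inverse problem $$i\,\partial_t^\rho u(x,t)-u_{xx}(x,t)=p(t)q(x)+f(x,t),\quad (x,t)\in\Omega,$$ $$u(0,t)=u(\pi,t)=0,\quad 0<t\le T,$$ $$\lim_{t\to0}J_t^{\rho-1}u(x,t)=\varphi(x),\quad 0\le x\le\pi,$$ $$B[u(\cdot,t)]=\psi(t),\quad 0<t\le T,$$ meaning that these conditions hold and $\partial_t^\rho u,\ u_{xx}\in C(\Omega)$, $t^{1-\rho}u\in C(\overline{\Omega})$, $t^{1-\rho}p\in C[0,T]$. Then $$\|t^{1-\rho}\partial_t^\rho u\|_{C(\overline{\Omega})}+\|t^{1-\rho}u_{xx}\|_{C(\overline{\Omega})}+\|t^{1-\rho}p\|_{C[0,T]}$$ $$\le C_{\rho,q,B}\Big[\|\varphi_{xx}\|_{C^a[0,\pi]}+\|t^{1-\rho}\psi\|_{C[0,T]}+\|t^{1-\rho}\partial_t^\rho\psi\|_{C[0,T]}+\|t^{1-\rho}f\|_{C_x^a(\overline{\Omega})}\Big],$$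 where $C_{\rho,q,B}$ is a constant depending only on $\rho$, $q$ and $B$.
   Context: Functions are complex-valued. For $\sigma<0$, $J_t^\sigma h(t)=\frac{1}{\Gamma(-\sigma)}\int_0^t\frac{h(\xi)}{(t-\xi)^{\sigma+1}}\,d\xi$, $t>0$. The Riemann-Liouville derivative of order $\rho\in(0,1)$ is $\partial_t^\rho h(t)=\frac{d}{dt}J_t^{\rho-1}h(t)$. A statement such as $t^{1-\rho}h\in C(\overline\Omega)$ (or in another class of functions up to $t=0$) means that $t^{1-\rho}h$, defined for $t>0$, extends continuously to $t=0$ and the extension is in that class. $\|\cdot\|_{C(\overline\Omega)}$ and $\|\cdot\|_{C[0,T]}$ are max-norms. Hölder classes: $g\in C^a[0,\pi]$ means $g\in C[0,\pi]$, $g(0)=g(\pi)=0$ and $\sup_{|x_1-x_2|\le\delta}|g(x_1)-g(x_2)|\le C\delta^a$ with $C$ independent of $\delta$; the smallest such $C$ is $\|g\|_{C^a[0,\pi]}$. A continuous function $h$ on $[0,\pi]\times[0,T]$ belongs to $C_x^a(\overline\Omega)$ if $h(0,t)=h(\pi,t)=0$ for all $t\in[0,T]$ and $\sup_{|x_1-x_2|\le\delta}|h(x_1,t)-h(x_2,t)|\le C\delta^a$ with $C$ independent of $t,\delta$; the smallest such $C$ is $\|h\|_{C_x^a(\overline\Omega)}$. $g\in C_2^a[0,\pi]$ means $g''\in C^a[0,\pi]$ (in particular $g''(0)=g''(\pi)=0$) and $g(0)=g(\pi)=0$.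
   Formalization: The constant is allowed to depend on T as well as on ρ, q and B; a constant independent of T does not exist, since for suitable two-mode sine data p grows like a Mittag-Leffler function in T while the right-hand side stays fixed. *)

theory Defs
  imports "HOL-Analysis.Analysis"
begin

section \<open>Continuous extension and max-norms\<close>

text \<open>
  The extension of \<open>h\<close> from \<open>D\<close> by its limits; see \<open>continuous_cont_ext_iff\<close> below.
\<close>

definition cont_ext :: "'a::topological_space set \<Rightarrow> ('a \<Rightarrow> complex) \<Rightarrow> 'a \<Rightarrow> complex" where
  "cont_ext D h z = (if z \<in> D then h z else Lim (at z within D) h)"

lemma cont_ext_eqI:
  assumes "continuous_on (closure D) g" "\<And>z. z \<in> D \<Longrightarrow> g z = h z" "z \<in> closure D"
  shows "cont_ext D h z = g z"
proof (cases "z \<in> D")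
  case True
  then show ?thesis using assms(2) by (simp add: cont_ext_def)
next
  case False
  have "(g \<longlongrightarrow> g z) (at z within D)"
    using assms(1,3) by (auto simp: continuous_on_def intro: tendsto_within_subset[OF _ closure_subset])
  then have "(h \<longlongrightarrow> g z) (at z within D)"
    by (rule Lim_transform_eventually) (auto simp: eventually_at_filter assms(2))
  moreover have "at z within D \<noteq> bot"
  proof
    assume "at z within D = bot"
    then have "\<not> z islimpt D" by (simp add: trivial_limit_within)
    then show False using False assms(3) by (simp add: closure_def)
  qed
  ultimately show ?thesis using False by (simp add: cont_ext_def tendsto_Lim)
qed

lemma continuous_cont_ext_iff:
  "continuous_on (closure D) (cont_ext D h) \<longleftrightarrow>
     (\<exists>g. continuous_on (closure D) g \<and> (\<forall>z\<in>D. g z = h z))"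
proof
  assume "continuous_on (closure D) (cont_ext D h)"
  then show "\<exists>g. continuous_on (closure D) g \<and> (\<forall>z\<in>D. g z = h z)"
    by (intro exI[of _ "cont_ext D h"]) (simp add: cont_ext_def)
next
  assume "\<exists>g. continuous_on (closure D) g \<and> (\<forall>z\<in>D. g z = h z)"
  then obtain g where g: "continuous_on (closure D) g" "\<And>z. z \<in> D \<Longrightarrow> g z = h z" by blast
  have "cont_ext D h z = g z" if "z \<in> closure D" for z
    using g that by (rule cont_ext_eqI)
  then show "continuous_on (closure D) (cont_ext D h)"
    using g(1) by (simp cong: continuous_on_cong)
qed

definition max_norm :: "'a set \<Rightarrow> ('a \<Rightarrow> complex) \<Rightarrow> real" where
  "max_norm K g = (SUP z\<in>K. cmod (g z))"

text \<open>
  The function \<open>t powr (1 - \<rho>) * h\<close>, continuously extended to \<open>t = 0\<close>.  In the two-variable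
  version \<open>X\<close> is the set of \<open>x\<close> for which \<open>h x t\<close> is given: \<open>{0..pi}\<close> for \<open>u\<close> and \<open>f\<close>, and
  \<open>{0<..<pi}\<close> for derivatives of \<open>u\<close>, which are then extended to \<open>x = 0\<close> and \<open>x = pi\<close> as well.
\<close>

definition wext :: "real \<Rightarrow> real \<Rightarrow> (real \<Rightarrow> complex) \<Rightarrow> real \<Rightarrow> complex" where
  "wext \<rho> T h = cont_ext {0<..T} (\<lambda>t. (t powr (1 - \<rho>)) *\<^sub>R h t)"

definition wext2 ::
  "real \<Rightarrow> real \<Rightarrow> real set \<Rightarrow> (real \<Rightarrow> real \<Rightarrow> complex) \<Rightarrow> real \<times> real \<Rightarrow> complex" where
  "wext2 \<rho> T X h = cont_ext (X \<times> {0<..T}) (\<lambda>(x, t). (t powr (1 - \<rho>)) *\<^sub>R h x t)"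

section \<open>Riemann--Liouville operators\<close>

definition RL_J :: "real \<Rightarrow> (real \<Rightarrow> complex) \<Rightarrow> real \<Rightarrow> complex" where
  "RL_J \<sigma> h t =
     (1 / Gamma (- \<sigma>)) *\<^sub>R (LINT \<xi>:{0<..<t}|lborel. (1 / (t - \<xi>) powr (\<sigma> + 1)) *\<^sub>R h \<xi>)"

text \<open>
  Functions of time are given on \<open>{0<..T}\<close> only, so the derivative at \<open>t = T\<close> is one-sided.
\<close>

definition RL_differentiable :: "real \<Rightarrow> real \<Rightarrow> (real \<Rightarrow> complex) \<Rightarrow> real \<Rightarrow> bool" where
  "RL_differentiable T \<rho> h t \<longleftrightarrow> RL_J (\<rho> - 1) h differentiable (at t within {0<..T})"

definition RL_deriv :: "real \<Rightarrow> real \<Rightarrow> (real \<Rightarrow> complex) \<Rightarrow> real \<Rightarrow> complex" where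
  "RL_deriv T \<rho> h t = vector_derivative (RL_J (\<rho> - 1) h) (at t within {0<..T})"

section \<open>Second derivatives in the space variable\<close>

definition twice_differentiable_on :: "(real \<Rightarrow> complex) \<Rightarrow> real set \<Rightarrow> bool" where
  "twice_differentiable_on g S \<longleftrightarrow>
     g differentiable_on S \<and> (\<lambda>y. vector_derivative g (at y within S)) differentiable_on S"

definition deriv2 :: "real set \<Rightarrow> (real \<Rightarrow> complex) \<Rightarrow> real \<Rightarrow> complex" where
  "deriv2 S g x = vector_derivative (\<lambda>y. vector_derivative g (at y within S)) (at x within S)"

section \<open>Hoelder classes\<close>

definition holder_bound :: "real \<Rightarrow> (real \<Rightarrow> complex) \<Rightarrow> real \<Rightarrow> bool" where
  "holder_bound a g C \<longleftrightarrow>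
     (\<forall>\<delta>>0. \<forall>x\<^sub>1\<in>{0..pi}. \<forall>x\<^sub>2\<in>{0..pi}.
        \<bar>x\<^sub>1 - x\<^sub>2\<bar> \<le> \<delta> \<longrightarrow> cmod (g x\<^sub>1 - g x\<^sub>2) \<le> C * \<delta> powr a)"

definition Ca :: "real \<Rightarrow> (real \<Rightarrow> complex) set" where
  "Ca a = {g. continuous_on {0..pi} g \<and> g 0 = 0 \<and> g pi = 0 \<and> (\<exists>C. holder_bound a g C)}"

definition Ca_norm :: "real \<Rightarrow> (real \<Rightarrow> complex) \<Rightarrow> real" where
  "Ca_norm a g = Inf {C. holder_bound a g C}"

definition Cxa :: "real \<Rightarrow> real \<Rightarrow> (real \<times> real \<Rightarrow> complex) set" where
  "Cxa a T = {h. continuous_on ({0..pi} \<times> {0..T}) h \<and>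
     (\<forall>t\<in>{0..T}. h (0, t) = 0 \<and> h (pi, t) = 0) \<and>
     (\<exists>C. \<forall>t\<in>{0..T}. holder_bound a (\<lambda>x. h (x, t)) C)}"

definition Cxa_norm :: "real \<Rightarrow> real \<Rightarrow> (real \<times> real \<Rightarrow> complex) \<Rightarrow> real" where
  "Cxa_norm a T h = Inf {C. \<forall>t\<in>{0..T}. holder_bound a (\<lambda>x. h (x, t)) C}"

definition C2a :: "real \<Rightarrow> (real \<Rightarrow> complex) set" where
  "C2a a = {g. twice_differentiable_on g {0..pi} \<and> deriv2 {0..pi} g \<in> Ca a \<and> g 0 = 0 \<and> g pi = 0}"

section \<open>Bounded linear functionals on C[0,pi]\<close>

text \<open>
  Elements of \<open>C[0,pi]\<close> are represented by functions on the reals that are continuous on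
  \<open>{0..pi}\<close>; linearity and boundedness force \<open>B g\<close> to depend only on \<open>g\<close> restricted to \<open>{0..pi}\<close>.
\<close>

definition bounded_functional_C :: "((real \<Rightarrow> complex) \<Rightarrow> complex) \<Rightarrow> bool" where
  "bounded_functional_C B \<longleftrightarrow>
     (\<forall>g h. continuous_on {0..pi} g \<longrightarrow> continuous_on {0..pi} h \<longrightarrow>
        B (\<lambda>x. g x + h x) = B g + B h) \<and>
     (\<forall>c g. continuous_on {0..pi} g \<longrightarrow> B (\<lambda>x. c * g x) = c * B g) \<and>
     (\<exists>K. \<forall>g. continuous_on {0..pi} g \<longrightarrow> cmod (B g) \<le> K * max_norm {0..pi} g)"

section \<open>The inverse problem\<close>

definition inverse_solution ::
  "real \<Rightarrow> real \<Rightarrow> ((real \<Rightarrow> complex) \<Rightarrow> complex) \<Rightarrow> (real \<Rightarrow> complex) \<Rightarrow>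
   (real \<Rightarrow> real \<Rightarrow> complex) \<Rightarrow> (real \<Rightarrow> complex) \<Rightarrow> (real \<Rightarrow> complex) \<Rightarrow>
   (real \<Rightarrow> real \<Rightarrow> complex) \<Rightarrow> (real \<Rightarrow> complex) \<Rightarrow> bool" where
  "inverse_solution \<rho> T B q f \<phi> \<psi> u p \<longleftrightarrow>
     (\<forall>x\<in>{0<..<pi}. \<forall>t\<in>{0<..T}. RL_differentiable T \<rho> (u x) t) \<and>
     (\<forall>t\<in>{0<..T}. twice_differentiable_on (\<lambda>x. u x t) {0<..<pi}) \<and>
     continuous_on ({0<..<pi} \<times> {0<..T}) (\<lambda>(x, t). RL_deriv T \<rho> (u x) t) \<and>
     continuous_on ({0<..<pi} \<times> {0<..T}) (\<lambda>(x, t). deriv2 {0<..<pi} (\<lambda>y. u y t) x) \<and>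
     continuous_on ({0..pi} \<times> {0..T}) (wext2 \<rho> T {0..pi} u) \<and>
     continuous_on {0..T} (wext \<rho> T p) \<and>
     (\<forall>x\<in>{0<..<pi}. \<forall>t\<in>{0<..T}.
        \<i> * RL_deriv T \<rho> (u x) t - deriv2 {0<..<pi} (\<lambda>y. u y t) x = p t * q x + f x t) \<and>
     (\<forall>t\<in>{0<..T}. u 0 t = 0 \<and> u pi t = 0) \<and>
     (\<forall>x\<in>{0..pi}. ((\<lambda>t. RL_J (\<rho> - 1) (u x) t) \<longlongrightarrow> \<phi> x) (at_right 0)) \<and>
     (\<forall>t\<in>{0<..T}. B (\<lambda>x. u x t) = \<psi> t)"

end

theory Submission
  imports Defs "HOL-Complex_Analysis.Complex_Analysis" "HOL-Real_Asymp.Real_Asymp"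
begin

text \<open>
  The constant must not depend on \<open>a\<close>, whereas bounds obtained by summing absolute values of sine coefficients
  degenerate as \<open>a\<close> tends to 1/2.  Instead the resolvent of the $k$-th mode is written as a superposition of
  cosines, $E_{\rho,\rho}(i k^2) = \int_0^\infty N_0(y)\, 2\cos(k y)\, dy$ with $N_0$ integrable, and
  $-k^2 E_{\rho,\rho}(i k^2) = \int_0^\infty N_2(y)\, (2\cos(k y) - 2)\, dy$ with $\sqrt{y}\, N_2(y)$ integrable.
  After scaling by $t^{\rho/2}$ the cosines become shifts of odd periodic extensions, so $t^{1-\rho} u_{xx}$ is an
  average of shifts of $\varphi''$ and $q''$, and of second differences of $f$, for which Hoelder exponent 1/2 suffices.
  That this formula really gives $u_{xx}$ follows by comparing sine coefficients: these satisfy a scalar fractional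
  equation whose solution is unique, and a continuous function with vanishing sine coefficients is zero.
  Applying $B$ to the equation, with $B[\partial_t^\rho u] = \partial_t^\rho \psi$, expresses $p\, B[q]$ through
  $\psi$, $f$ and $B[u_{xx}]$.  The last term is bounded by the data and a weakly singular integral of $|p|$,
  and a Gronwall argument concludes.
\<close>

section \<open>Integrals over intervals and rays\<close>

text \<open>The cosines come from a Laplace transform. If M is the square root of i z^\<rho> with
  positive real part, then i / (M^2 + k^2) = 1 / (z^\<rho> - i k^2), while 2 M / (M^2 + k^2) is the
  transform of 2 cos (k y) at M. A Hankel integral of the symbol 1 / (z^\<rho> - i k^2) thus becomes
  an integral of cosines against a weight that no longer sees k.

  That the Hankel integral solves the scalar fractional equation is checked directly in Volterra
  form: the power kernel is itself a superposition of decaying exponentials, and the error terms on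
  the two rays cancel once both are rotated to the positive axis.

  A solution has u_xx only for x strictly between 0 and pi, with no control as x tends to an
  endpoint or t to 0. The equation is therefore first integrated over a time interval [e, t]: the
  time integral of u_xx is then a combination of functions continuous on all of [0, pi], and Green's
  formula and the initial condition are reached by limits. For the same reason \<open>B\<close> is
  applied to integrated identities, and its exchange with time integrals rests on linearity and
  boundedness alone.\<close>

lemma set_Fubini:
  fixes f :: "real \<Rightarrow> real \<Rightarrow> 'a::{banach, second_countable_topology}"
  assumes sets: "A \<in> sets borel" "B \<in> sets borel"
    and meas: "(\<lambda>(x, y). f x y) \<in> borel_measurable borel"
    and inner: "\<And>x. x \<in> A \<Longrightarrow> set_integrable lborel B (f x)"
    and outer: "set_integrable lborel A g"
    and bound: "\<And>x. x \<in> A \<Longrightarrow> (LINT y:B|lborel. norm (f x y)) \<le> g x"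
  shows "(LINT x:A|lborel. LINT y:B|lborel. f x y) = (LINT y:B|lborel. LINT x:A|lborel. f x y)"
    and "set_integrable lborel A (\<lambda>x. LINT y:B|lborel. f x y)"
    and "set_integrable lborel B (\<lambda>y. LINT x:A|lborel. f x y)"
    and "AE y in lborel. y \<in> B \<longrightarrow> set_integrable lborel A (\<lambda>x. f x y)"
proof -
  note sets[measurable]
  define h where "h x y = indicator A x *\<^sub>R indicator B y *\<^sub>R f x y" for x y
  have [measurable]: "(\<lambda>(x, y). f x y) \<in> borel_measurable (lborel \<Otimes>\<^sub>M lborel)"
    using meas by (simp add: lborel_prod)
  have hm: "(\<lambda>(x, y). h x y) \<in> borel_measurable (lborel \<Otimes>\<^sub>M lborel)"
    unfolding h_def by measurable
  have int: "integrable (lborel \<Otimes>\<^sub>M lborel) (\<lambda>(x, y). h x y)"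
  proof (rule lborel_pair.Fubini_integrable[OF hm])
    show "AE x in lborel. integrable lborel (\<lambda>y. case (x, y) of (x, y) \<Rightarrow> h x y)"
    proof (rule AE_I2)
      fix x :: real
      show "integrable lborel (\<lambda>y. case (x, y) of (x, y) \<Rightarrow> h x y)"
        using inner[of x] by (cases "x \<in> A") (auto simp: h_def set_integrable_def)
    qed
    show "integrable lborel (\<lambda>x. \<integral>y. norm (case (x, y) of (x, y) \<Rightarrow> h x y) \<partial>lborel)"
    proof (rule Bochner_Integration.integrable_bound)
      show "integrable lborel (\<lambda>x. indicator A x *\<^sub>R g x)"
        using outer by (simp add: set_integrable_def)
      have "(\<lambda>(x, y). norm (h x y)) \<in> borel_measurable (lborel \<Otimes>\<^sub>M lborel)"
        using hm by measurable
      then show "(\<lambda>x. \<integral>y. norm (case (x, y) of (x, y) \<Rightarrow> h x y) \<partial>lborel) \<in> borel_measurable lborel"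
        using lborel.borel_measurable_lebesgue_integral[of "\<lambda>x y. norm (h x y)" lborel] by simp
      show "AE x in lborel. norm (\<integral>y. norm (case (x, y) of (x, y) \<Rightarrow> h x y) \<partial>lborel)
              \<le> norm (indicator A x *\<^sub>R g x)"
      proof (rule AE_I2)
        fix x :: real
        show "norm (\<integral>y. norm (case (x, y) of (x, y) \<Rightarrow> h x y) \<partial>lborel)
              \<le> norm (indicator A x *\<^sub>R g x)"
        proof (cases "x \<in> A")
          case True
          then have "(\<integral>y. norm (h x y) \<partial>lborel) = (LINT y:B|lborel. norm (f x y))"
            unfolding set_lebesgue_integral_def
            by (intro Bochner_Integration.integral_cong) (auto simp: h_def indicator_def)
          moreover have "0 \<le> (\<integral>y. norm (h x y) \<partial>lborel)" by simp
          ultimately show ?thesis using bound[OF True] True by auto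
        qed (simp add: h_def)
      qed
    qed
  qed
  have eqx: "(\<integral>y. h x y \<partial>lborel) = indicator A x *\<^sub>R (LINT y:B|lborel. f x y)" for x
    by (cases "x \<in> A") (simp_all add: h_def set_lebesgue_integral_def)
  have eqy: "(\<integral>x. h x y \<partial>lborel) = indicator B y *\<^sub>R (LINT x:A|lborel. f x y)" for y
  proof -
    have "(\<lambda>x. h x y) = (\<lambda>x. indicator B y *\<^sub>R (indicator A x *\<^sub>R f x y))"
      by (auto simp: h_def indicator_def)
    then show ?thesis by (cases "y \<in> B") (simp_all add: set_lebesgue_integral_def)
  qed
  show "(LINT x:A|lborel. LINT y:B|lborel. f x y) = (LINT y:B|lborel. LINT x:A|lborel. f x y)"
    using lborel_pair.Fubini_integral[OF int]
    by (simp add: eqx eqy) (simp add: set_lebesgue_integral_def)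
  show "set_integrable lborel A (\<lambda>x. LINT y:B|lborel. f x y)"
    using lborel_pair.integrable_fst'[OF int] by (simp add: eqx set_integrable_def)
  show "set_integrable lborel B (\<lambda>y. LINT x:A|lborel. f x y)"
    using lborel_pair.integrable_snd[OF int] by (simp add: eqy set_integrable_def)
  from lborel_pair.AE_integrable_snd[OF int]
  show "AE y in lborel. y \<in> B \<longrightarrow> set_integrable lborel A (\<lambda>x. f x y)"
    by (rule AE_mp) (auto simp: h_def set_integrable_def)
qed

text \<open>Dominated convergence tested along sequences. The parameter lives in a metric space so
  that it can be a pair or a triple of position, time and shift.\<close>

lemma set_integral_continuous_param:
  fixes f :: "'p::metric_space \<Rightarrow> real \<Rightarrow> 'a::{banach, second_countable_topology}"
  assumes sets: "B \<in> sets borel"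
    and cont: "\<And>y. y \<in> B \<Longrightarrow> continuous_on S (\<lambda>p. f p y)"
    and meas: "\<And>p. p \<in> S \<Longrightarrow> f p \<in> borel_measurable borel"
    and bound: "\<And>p y. p \<in> S \<Longrightarrow> y \<in> B \<Longrightarrow> norm (f p y) \<le> g y"
    and int: "set_integrable lborel B g"
  shows "continuous_on S (\<lambda>p. LINT y:B|lborel. f p y)"
  unfolding continuous_on_sequentially
proof (intro allI ballI impI)
  fix p a assume *: "a \<in> S" "(\<forall>n. p n \<in> S) \<and> p \<longlonglongrightarrow> a"
  note sets[measurable]
  show "((\<lambda>p. LINT y:B|lborel. f p y) \<circ> p) \<longlonglongrightarrow> (LINT y:B|lborel. f a y)"
    unfolding o_def set_lebesgue_integral_def
  proof (rule integral_dominated_convergence[where w = "\<lambda>y. indicator B y *\<^sub>R g y"])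
    show "(\<lambda>y. indicator B y *\<^sub>R f a y) \<in> borel_measurable lborel"
      using meas[OF *(1)] by simp
    show "(\<lambda>y. indicator B y *\<^sub>R f (p n) y) \<in> borel_measurable lborel" for n
      using meas[of "p n"] * by simp
    show "integrable lborel (\<lambda>y. indicator B y *\<^sub>R g y)"
      using int by (simp add: set_integrable_def)
    show "AE y in lborel. norm (indicator B y *\<^sub>R f (p n) y) \<le> indicator B y *\<^sub>R g y" for n
      using bound[of "p n"] * by (auto simp: indicator_def)
    show "AE y in lborel. (\<lambda>n. indicator B y *\<^sub>R f (p n) y) \<longlonglongrightarrow> indicator B y *\<^sub>R f a y"
    proof (rule AE_I2)
      fix y
      show "(\<lambda>n. indicator B y *\<^sub>R f (p n) y) \<longlonglongrightarrow> indicator B y *\<^sub>R f a y"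
      proof (cases "y \<in> B")
        case True
        have "((\<lambda>p. f p y) \<circ> p) \<longlonglongrightarrow> f a y"
          using cont[OF True] * unfolding continuous_on_sequentially by blast
        then show ?thesis using True by (simp add: o_def)
      qed simp
    qed
  qed
qed

lemma set_integrable_dom:
  fixes f :: "real \<Rightarrow> 'a::{banach, second_countable_topology}"
  assumes "B \<in> sets borel" "f \<in> borel_measurable borel" "set_integrable lborel B g"
    and "\<And>y. y \<in> B \<Longrightarrow> norm (f y) \<le> g y"
  shows "set_integrable lborel B f"
proof -
  note assms(1,2)[measurable]
  show ?thesis
  proof (rule set_integrable_bound[OF assms(3)])
    show "set_borel_measurable lborel B f" unfolding set_borel_measurable_def by measurable
    show "AE x in lborel. x \<in> B \<longrightarrow> norm (f x) \<le> norm (g x)"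
      using assms(4) by fastforce
  qed
qed

text \<open>The bound survives non-integrability of \<open>f\<close>: the integral is then 0 by
  convention, and \<open>g\<close> is nonnegative because it dominates a norm.\<close>

lemma set_integral_norm_le:
  fixes f :: "real \<Rightarrow> 'a::{banach, second_countable_topology}"
  assumes "set_integrable lborel B g" "\<And>y. y \<in> B \<Longrightarrow> norm (f y) \<le> g y"
  shows "norm (LINT y:B|lborel. f y) \<le> (LINT y:B|lborel. g y)"
proof (cases "integrable lborel (\<lambda>y. indicator B y *\<^sub>R f y)")
  case True
  have "norm (LINT y:B|lborel. f y) \<le> (\<integral>y. norm (indicator B y *\<^sub>R f y) \<partial>lborel)"
    unfolding set_lebesgue_integral_def by (rule integral_norm_bound)
  also have "\<dots> \<le> (LINT y:B|lborel. g y)"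
    unfolding set_lebesgue_integral_def
    using assms integrable_norm[OF True] by (intro integral_mono) (auto simp: set_integrable_def indicator_def)
  finally show ?thesis .
next
  case False
  then have "(LINT y:B|lborel. f y) = 0"
    by (simp add: set_lebesgue_integral_def not_integrable_integral_eq)
  moreover have "0 \<le> (LINT y:B|lborel. g y)"
    unfolding set_lebesgue_integral_def
  proof (intro integral_nonneg_AE AE_I2)
    fix y show "0 \<le> indicator B y *\<^sub>R g y"
      using order_trans[OF norm_ge_zero assms(2), of y] by (auto simp: indicator_def)
  qed
  ultimately show ?thesis by simp
qed

lemma set_integral_scale:
  fixes f :: "real \<Rightarrow> 'a::{banach, second_countable_topology}"
  assumes "c > 0"
  shows "(LINT r:{0<..}|lborel. f r) = c *\<^sub>R (LINT r:{0<..}|lborel. f (c * r))"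
    and "set_integrable lborel {0<..} (\<lambda>r. f (c * r)) \<longleftrightarrow> set_integrable lborel {0<..} f"
proof -
  have *: "(\<lambda>x. indicator {0<..} (0 + c * x) *\<^sub>R f (0 + c * x)) = (\<lambda>x. indicator {0<..} x *\<^sub>R f (c * x))"
    using assms by (auto simp: indicator_def zero_less_mult_iff)
  show "(LINT r:{0<..}|lborel. f r) = c *\<^sub>R (LINT r:{0<..}|lborel. f (c * r))"
    unfolding set_lebesgue_integral_def
    by (subst lborel_integral_real_affine[of c _ 0]) (use assms * in auto)
  show "set_integrable lborel {0<..} (\<lambda>r. f (c * r)) \<longleftrightarrow> set_integrable lborel {0<..} f"
    unfolding set_integrable_def
    using lborel_integrable_real_affine_iff[of c "\<lambda>x. indicator {0<..} x *\<^sub>R f x" 0] assms *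
    by simp
qed

lemma set_integral_scale_interval:
  fixes f :: "real \<Rightarrow> 'a::{banach, second_countable_topology}"
  assumes "c > 0"
  shows "(LINT r:{0<..<c}|lborel. f r) = c *\<^sub>R (LINT r:{0<..<1}|lborel. f (c * r))"
    and "set_integrable lborel {0<..<1} (\<lambda>r. f (c * r)) \<longleftrightarrow> set_integrable lborel {0<..<c} f"
proof -
  have *: "(\<lambda>x. indicator {0<..<c} (0 + c * x) *\<^sub>R f (0 + c * x)) = (\<lambda>x. indicator {0<..<1} x *\<^sub>R f (c * x))"
    using assms by (auto simp: indicator_def zero_less_mult_iff)
  show "(LINT r:{0<..<c}|lborel. f r) = c *\<^sub>R (LINT r:{0<..<1}|lborel. f (c * r))"
    unfolding set_lebesgue_integral_def
    by (subst lborel_integral_real_affine[of c _ 0]) (use assms * in auto)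
  show "set_integrable lborel {0<..<1} (\<lambda>r. f (c * r)) \<longleftrightarrow> set_integrable lborel {0<..<c} f"
    unfolding set_integrable_def
    using lborel_integrable_real_affine_iff[of c "\<lambda>x. indicator {0<..<c} x *\<^sub>R f x" 0] assms *
    by simp
qed

lemma gamma_integral:
  fixes b c :: real
  assumes "b > -1" "c > 0"
  shows "set_integrable lborel {0<..} (\<lambda>r. r powr b * exp (-(c * r)))"
    and "(LINT r:{0<..}|lborel. r powr b * exp (-(c * r))) = Gamma (b + 1) / c powr (b + 1)"
proof -
  have h: "((\<lambda>t. t powr (b + 1 - 1) / exp t) has_integral Gamma (b + 1)) {0<..}"
  proof -
    have "((\<lambda>t. t powr (b + 1 - 1) / exp t) has_integral Gamma (b + 1)) {0..}"
      using Gamma_integral_real[of "b + 1"] assms by auto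
    then have "((\<lambda>t. if t \<in> {0<..} then t powr (b + 1 - 1) / exp t else 0) has_integral Gamma (b + 1)) {0..}"
      by (rule has_integral_spike [of "{0}", rotated 2]) auto
    then show ?thesis by (subst (asm) has_integral_restrict) auto
  qed
  \<comment> \<open>Nonnegativity upgrades the gauge integral of the Gamma function to a Lebesgue
    integral.\<close>
  have ai: "(\<lambda>t. t powr b / exp t) absolutely_integrable_on {0<..}"
    using h by (intro nonnegative_absolutely_integrable_1) (auto simp: integrable_on_def)
  have i1: "set_integrable lborel {0<..} (\<lambda>t. t powr b / exp t)"
  proof -
    have "integrable lebesgue (\<lambda>t. indicator {0<..} t *\<^sub>R (t powr b / exp t))"
      using ai by (simp add: set_integrable_def)
    then show ?thesis unfolding set_integrable_def
      by (subst (asm) integrable_completion) measurable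
  qed
  have v1: "(LINT t:{0<..}|lborel. t powr b / exp t) = Gamma (b + 1)"
    using set_borel_integral_eq_integral(2)[OF i1] integral_unique[OF h] by simp
  have eq: "r powr b * exp (-(c * r)) = c powr (-b) * ((c * r) powr b / exp (c * r))" if "r \<in> {0<..}" for r
    using that assms by (simp add: powr_mult powr_minus exp_minus field_simps)
  have i2: "set_integrable lborel {0<..} (\<lambda>r. c powr (-b) * ((c * r) powr b / exp (c * r)))"
    using i1 set_integral_scale(2)[OF assms(2), of "\<lambda>t. t powr b / exp t"]
    by (intro set_integrable_mult_right) blast
  then show "set_integrable lborel {0<..} (\<lambda>r. r powr b * exp (-(c * r)))"
    by (rule iffD2[OF set_integrable_cong[OF refl refl eq], rotated]) simp
  have "(LINT r:{0<..}|lborel. r powr b * exp (-(c * r))) =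
      (LINT r:{0<..}|lborel. c powr (-b) * ((c * r) powr b / exp (c * r)))"
    by (rule set_lebesgue_integral_cong) (auto simp: eq)
  also have "\<dots> = c powr (-b) * (LINT r:{0<..}|lborel. ((c * r) powr b / exp (c * r)))"
    by (rule set_integral_mult_right)
  also have "(LINT r:{0<..}|lborel. ((c * r) powr b / exp (c * r))) = Gamma (b + 1) / c"
    using v1 set_integral_scale(1)[OF assms(2), of "\<lambda>t. t powr b / exp t"] assms by (simp add: field_simps)
  finally show "(LINT r:{0<..}|lborel. r powr b * exp (-(c * r))) = Gamma (b + 1) / c powr (b + 1)"
    using assms by (simp add: powr_add powr_minus field_simps)
qed

lemma beta_integral:
  fixes a b :: real
  assumes "a > 0" "b > 0"
  shows "set_integrable lborel {0<..<1} (\<lambda>s. s powr (a - 1) * (1 - s) powr (b - 1))"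
    and "(LINT s:{0<..<1}|lborel. s powr (a - 1) * (1 - s) powr (b - 1)) = Beta a b"
proof -
  show i: "set_integrable lborel {0<..<1} (\<lambda>s. s powr (a - 1) * (1 - s) powr (b - 1))"
    by (rule set_integrable_subset[OF integrable_Beta[OF assms]]) auto
  have "((\<lambda>t. t powr (a - 1) * (1 - t) powr (b - 1)) has_integral Beta a b) {0<..<1}"
    using has_integral_Beta_real[OF assms] by (simp add: has_integral_Icc_iff_Ioo)
  from integral_unique[OF this]
  show "(LINT s:{0<..<1}|lborel. s powr (a - 1) * (1 - s) powr (b - 1)) = Beta a b"
    using set_borel_integral_eq_integral(2)[OF i] by simp
qed

lemma ray_FTC:
  fixes f F :: "real \<Rightarrow> complex"
  assumes "\<And>x. x > 0 \<Longrightarrow> (F has_vector_derivative f x) (at x)"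
    and "continuous_on {0<..} f" "set_integrable lborel {0<..} f"
    and "(F \<longlongrightarrow> A) (at_right 0)" "(F \<longlongrightarrow> B) at_top"
  shows "(LINT x:{0<..}|lborel. f x) = B - A"
proof -
  have e: "einterval 0 \<infinity> = {0<..}"
    by (auto simp: einterval_def)
  have "(LBINT x=0..\<infinity>. f x) = B - A"
  proof (rule interval_integral_FTC_integrable[where F = F])
    show "\<And>x. 0 < ereal x \<Longrightarrow> ereal x < \<infinity> \<Longrightarrow> isCont f x"
      using assms(2) by (simp add: continuous_on_eq_continuous_at)
    show "((F \<circ> real_of_ereal) \<longlongrightarrow> A) (at_right 0)"
      using assms(4) by (simp add: zero_ereal_def ereal_tendsto_simps)
    show "((F \<circ> real_of_ereal) \<longlongrightarrow> B) (at_left \<infinity>)"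
      using assms(5) by (simp add: ereal_tendsto_simps)
  qed (use assms(1,3) in \<open>auto simp: e\<close>)
  then show ?thesis by (simp add: interval_lebesgue_integral_def e)
qed

lemma exp_integral_complex:
  fixes M :: complex
  assumes "Re M > 0"
  shows "set_integrable lborel {0<..} (\<lambda>y. exp (-(M * of_real y)))"
    and "(LINT y:{0<..}|lborel. exp (-(M * of_real y))) = 1 / M"
proof -
  show i: "set_integrable lborel {0<..} (\<lambda>y. exp (-(M * of_real y)))"
  proof (rule set_integrable_dom[OF _ _ gamma_integral(1)[of 0 "Re M"]])
    show "(\<lambda>y. exp (-(M * of_real y))) \<in> borel_measurable borel"
      by (intro borel_measurable_continuous_onI continuous_intros)
  qed (use assms in auto)
  have "(LINT y:{0<..}|lborel. exp (-(M * of_real y))) = 0 - (-(1 / M))"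
  proof (rule ray_FTC[OF _ _ i])
    have M: "M \<noteq> 0" using assms by auto
    show "((\<lambda>y. - exp (-(M * of_real y)) / M) has_vector_derivative exp (-(M * of_real x))) (at x)" for x
      by (rule has_vector_derivative_real_field) (auto intro!: derivative_eq_intros simp: M)
    show "((\<lambda>y. - exp (-(M * of_real y)) / M) \<longlongrightarrow> -(1 / M)) (at_right 0)"
      using M by (auto intro!: tendsto_eq_intros)
    show "((\<lambda>y. - exp (-(M * of_real y)) / M) \<longlongrightarrow> 0) at_top"
    proof (rule tendsto_norm_zero_cancel)
      have "((\<lambda>y. exp (-(Re M * y)) / norm M) \<longlongrightarrow> 0) at_top"
      proof -
        have "((\<lambda>y. exp (-(c * y)) / d) \<longlongrightarrow> 0) at_top" if "c > 0" "d > 0" for c d :: real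
          using that by real_asymp
        then show ?thesis using assms M by simp
      qed
      then show "((\<lambda>y. norm (- exp (-(M * of_real y)) / M)) \<longlongrightarrow> 0) at_top"
        by (simp add: norm_divide)
    qed
  qed (auto intro!: continuous_intros)
  then show "(LINT y:{0<..}|lborel. exp (-(M * of_real y))) = 1 / M" by simp
qed

text \<open>The two exponentials hidden in the cosine shift \<open>M\<close> by an imaginary number
  and keep its real part. This Laplace transform is the source of the cosine representation.\<close>

lemma exp_cos_integral:
  fixes M :: complex and \<kappa> :: real
  assumes "Re M > 0"
  shows "set_integrable lborel {0<..} (\<lambda>y. exp (-(M * of_real y)) * of_real (2 * cos (\<kappa> * y)))"
    and "(LINT y:{0<..}|lborel. exp (-(M * of_real y)) * of_real (2 * cos (\<kappa> * y))) =
           2 * M / (M\<^sup>2 + of_real \<kappa> ^ 2)"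
proof -
  define M1 M2 where "M1 = M - \<i> * of_real \<kappa>" and "M2 = M + \<i> * of_real \<kappa>"
  have r: "Re M1 > 0" "Re M2 > 0" using assms by (auto simp: M1_def M2_def)
  have eq: "exp (-(M * of_real y)) * of_real (2 * cos (\<kappa> * y)) =
      exp (-(M1 * of_real y)) + exp (-(M2 * of_real y))" for y
  proof -
    have "of_real (2 * cos (\<kappa> * y)) = exp (\<i> * of_real (\<kappa> * y)) + exp (-(\<i> * of_real (\<kappa> * y)))"
      by (simp add: cos_exp_eq flip: cos_of_real)
    then have "exp (-(M * of_real y)) * of_real (2 * cos (\<kappa> * y)) =
        exp (-(M * of_real y) + \<i> * of_real (\<kappa> * y)) + exp (-(M * of_real y) + -(\<i> * of_real (\<kappa> * y)))"
      by (simp only: exp_add distrib_left)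
    then show ?thesis by (simp add: M1_def M2_def algebra_simps)
  qed
  show "set_integrable lborel {0<..} (\<lambda>y. exp (-(M * of_real y)) * of_real (2 * cos (\<kappa> * y)))"
    unfolding eq by (intro set_integral_add exp_integral_complex r)
  have nz: "M1 \<noteq> 0" "M2 \<noteq> 0" using r by auto
  have p: "M1 * M2 = M\<^sup>2 + of_real \<kappa> ^ 2" by (simp add: M1_def M2_def power2_eq_square algebra_simps)
  have "(LINT y:{0<..}|lborel. exp (-(M * of_real y)) * of_real (2 * cos (\<kappa> * y))) = 1 / M1 + 1 / M2"
    unfolding eq using exp_integral_complex[OF r(1)] exp_integral_complex[OF r(2)]
    by (simp only: set_integral_add)
  also have "\<dots> = (M2 + M1) / (M1 * M2)"
    using nz by (simp add: add_frac_eq)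
  also have "M2 + M1 = 2 * M" by (simp add: M1_def M2_def)
  finally show "(LINT y:{0<..}|lborel. exp (-(M * of_real y)) * of_real (2 * cos (\<kappa> * y))) =
           2 * M / (M\<^sup>2 + of_real \<kappa> ^ 2)"
    by (simp only: p)
qed

text \<open>Here \<open>h\<close> is read in the coordinate w = ln z: a sector becomes a convex
  strip, powers of z become single-valued, and dz = exp w dw explains the factor
  \<open>exp w\<close> below. A primitive exists on the strip, and the two ray integrals differ only
  by limits of its increments at both ends, which vanish because r g(r) does.\<close>

lemma ray_rotation:
  fixes h :: "complex \<Rightarrow> complex" and a b \<alpha> \<beta> :: real
  assumes hol: "h holomorphic_on {w. a < Im w \<and> Im w < b}"
    and ab: "a < \<alpha>" "\<alpha> < b" "a < \<beta>" "\<beta> < b"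
    and bound: "\<And>r \<phi>. r > 0 \<Longrightarrow> \<phi> \<in> closed_segment \<alpha> \<beta> \<Longrightarrow> norm (h (Complex (ln r) \<phi>)) \<le> g r"
    and lim0: "((\<lambda>r. r * g r) \<longlongrightarrow> 0) (at_right 0)" and limi: "((\<lambda>r. r * g r) \<longlongrightarrow> 0) at_top"
    and int: "set_integrable lborel {0<..} (\<lambda>r. h (Complex (ln r) \<alpha>))"
      "set_integrable lborel {0<..} (\<lambda>r. h (Complex (ln r) \<beta>))"
  shows "cis \<alpha> * (LINT r:{0<..}|lborel. h (Complex (ln r) \<alpha>)) =
         cis \<beta> * (LINT r:{0<..}|lborel. h (Complex (ln r) \<beta>))"
proof -
  define S where "S = {w. a < Im w \<and> Im w < b}"
  have S: "open S" "convex S"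
  proof -
    have *: "S = {w. Im w > a} \<inter> {w. Im w < b}" by (auto simp: S_def)
    show "open S" unfolding * by (intro open_Int open_halfspace_Im_gt open_halfspace_Im_lt)
    show "convex S" unfolding * by (intro convex_Int convex_halfspace_Im_gt convex_halfspace_Im_lt)
  qed
  have "(\<lambda>w. h w * exp w) holomorphic_on S"
    using hol unfolding S_def by (intro holomorphic_intros)
  then obtain P where P': "\<And>w. w \<in> S \<Longrightarrow> (P has_field_derivative h w * exp w) (at w within S)"
    using holomorphic_convex_primitive'[OF S(2,1)] by metis
  have P: "(P has_field_derivative h w * exp w) (at w)" if "w \<in> S" for w
    using P'[OF that] at_within_open[OF that S(1)] by simp
  have ex: "exp (Complex (ln r) \<phi>) = of_real r * cis \<phi>" if "r > 0" for r \<phi>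
    using that by (simp add: exp_eq_polar exp_of_real[symmetric])
  have inS: "Complex x \<phi> \<in> S" if "\<phi> \<in> closed_segment \<alpha> \<beta>" for x \<phi>
    using that ab by (auto simp: S_def closed_segment_eq_real_ivl split: if_splits)
  have C: "((\<lambda>r. Complex (ln r) \<phi>) has_vector_derivative of_real (1 / r)) (at r)" if "r > 0" for r \<phi>
  proof -
    have "((\<lambda>r. of_real (ln r) + \<i> * of_real \<phi>) has_vector_derivative of_real (1 / r)) (at r)"
      using that by (auto intro!: derivative_eq_intros simp: has_real_derivative_iff_has_vector_derivative[symmetric])
    then show ?thesis by (simp add: Complex_eq)
  qed
  have hc: "continuous_on S h" using hol holomorphic_on_imp_continuous_on S_def by blast
  have cC: "continuous_on {0<..} (\<lambda>r. h (Complex (ln r) \<phi>))" if "\<phi> \<in> closed_segment \<alpha> \<beta>" for \<phi>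
    by (rule continuous_on_compose2[OF hc])
      (use inS[OF that] in \<open>auto intro!: continuous_intros simp: Complex_eq\<close>)
  have FD: "((\<lambda>r. P (Complex (ln r) \<phi>)) has_vector_derivative cis \<phi> * h (Complex (ln r) \<phi>)) (at r)"
    if "r > 0" "\<phi> \<in> closed_segment \<alpha> \<beta>" for r \<phi>
  proof -
    have "((P \<circ> (\<lambda>r. Complex (ln r) \<phi>)) has_vector_derivative
       of_real (1 / r) * (h (Complex (ln r) \<phi>) * exp (Complex (ln r) \<phi>))) (at r)"
      by (rule field_vector_diff_chain_at[OF C[OF that(1)] P[OF inS[OF that(2)]]])
    then show ?thesis using that ex by (simp add: o_def mult_ac)
  qed
  let ?D = "\<lambda>r. P (Complex (ln r) \<beta>) - P (Complex (ln r) \<alpha>)"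
  \<comment> \<open>The mean value inequality on the vertical segment between the two lines takes
    the place of an estimate on a circular arc of radius \<open>r\<close>.\<close>
  have Db: "norm (?D r) \<le> r * g r * \<bar>\<beta> - \<alpha>\<bar>" if "r > 0" for r
  proof -
    let ?s = "closed_segment (Complex (ln r) \<alpha>) (Complex (ln r) \<beta>)"
    have s: "Re w = ln r \<and> Im w \<in> closed_segment \<alpha> \<beta>" if "w \<in> ?s" for w
    proof -
      obtain u where u: "0 \<le> u" "u \<le> 1" "w = (1 - u) *\<^sub>R Complex (ln r) \<alpha> + u *\<^sub>R Complex (ln r) \<beta>"
        using \<open>w \<in> ?s\<close> by (auto simp: closed_segment_def)
      then have "Re w = ln r" "Im w = (1 - u) *\<^sub>R \<alpha> + u *\<^sub>R \<beta>"
        unfolding u(3) by (simp_all add: left_diff_distrib)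
      then show ?thesis using u by (auto simp: closed_segment_def)
    qed
    have s': "w = Complex (ln r) (Im w)" if "w \<in> ?s" for w
      using s[OF that] by (metis complex.collapse)
    have "norm (?D r) \<le> (r * g r) * norm (Complex (ln r) \<beta> - Complex (ln r) \<alpha>)"
    proof (rule field_differentiable_bound[of ?s])
      fix w assume w: "w \<in> ?s"
      have "w \<in> S" using s'[OF w] s[OF w] inS by metis
      then show "(P has_field_derivative h w * exp w) (at w within ?s)"
        using P has_field_derivative_at_within by blast
      have "norm (h w) \<le> g r" using bound[OF that, of "Im w"] s[OF w] s'[OF w] by metis
      moreover have "norm (exp w) = r" using s[OF w] that by simp
      ultimately show "norm (h w * exp w) \<le> r * g r"
        using that by (simp add: norm_mult mult.commute mult_left_mono del: norm_exp_eq_Re)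
    qed auto
    also have "norm (Complex (ln r) \<beta> - Complex (ln r) \<alpha>) = \<bar>\<beta> - \<alpha>\<bar>"
      by (simp add: cmod_def)
    finally show ?thesis .
  qed
  have "(LINT r:{0<..}|lborel. cis \<beta> * h (Complex (ln r) \<beta>) - cis \<alpha> * h (Complex (ln r) \<alpha>)) = 0 - 0"
  proof (rule ray_FTC[where F = ?D])
    show "(?D has_vector_derivative cis \<beta> * h (Complex (ln r) \<beta>) - cis \<alpha> * h (Complex (ln r) \<alpha>)) (at r)"
      if "r > 0" for r
      by (intro has_vector_derivative_diff FD that) auto
    show "continuous_on {0<..} (\<lambda>r. cis \<beta> * h (Complex (ln r) \<beta>) - cis \<alpha> * h (Complex (ln r) \<alpha>))"
      by (intro continuous_intros cC) auto
    show "set_integrable lborel {0<..} (\<lambda>r. cis \<beta> * h (Complex (ln r) \<beta>) - cis \<alpha> * h (Complex (ln r) \<alpha>))"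
      using int by (intro set_integral_diff set_integrable_mult_right)
    have e: "eventually (\<lambda>r. norm (?D r) \<le> r * g r * \<bar>\<beta> - \<alpha>\<bar>) (at_right 0)"
      using eventually_at_right_less[of "0::real"] by eventually_elim (rule Db)
    show "(?D \<longlongrightarrow> 0) (at_right 0)"
      by (rule Lim_null_comparison[OF e]) (use tendsto_mult_left_zero[OF lim0] in auto)
    have e: "eventually (\<lambda>r. norm (?D r) \<le> r * g r * \<bar>\<beta> - \<alpha>\<bar>) at_top"
      using eventually_gt_at_top[of "0::real"] by eventually_elim (rule Db)
    show "(?D \<longlongrightarrow> 0) at_top"
      by (rule Lim_null_comparison[OF e]) (use tendsto_mult_left_zero[OF limi] in auto)
  qed
  then show ?thesis using int by (simp add: set_integral_diff)
qed

section \<open>The Mittag-Leffler function as a superposition of cosines\<close>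

text \<open>Rotating by the mean of the two angles places both terms symmetrically about the real
  axis, where each has real part equal to its modulus times the cosine of half the angle
  difference.\<close>

lemma norm_add_polar:
  assumes "r \<ge> 0" "q \<ge> 0"
  shows "cos ((a - b) / 2) * (r + q) \<le> norm (of_real r * cis a + of_real q * cis b)"
proof -
  let ?z = "of_real r * cis a + of_real q * cis b"
  have "Re (?z * cis (-((a + b) / 2))) = r * cos (a - (a + b) / 2) + q * cos (b - (a + b) / 2)"
    by (simp add: distrib_right mult.assoc cis_mult cos_diff)
  also have "a - (a + b) / 2 = (a - b) / 2" by (simp add: field_simps)
  also have "cos (b - (a + b) / 2) = cos ((a - b) / 2)"
    by (subst cos_minus[symmetric]) (rule arg_cong[where f = cos], simp add: field_simps)
  finally have "cos ((a - b) / 2) * (r + q) = Re (?z * cis (-((a + b) / 2)))"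
    by (simp add: algebra_simps)
  also have "\<dots> \<le> norm (?z * cis (-((a + b) / 2)))" by (rule complex_Re_le_cmod)
  also have "\<dots> = norm ?z" by (simp add: norm_mult)
  finally show ?thesis .
qed

locale fractional_order =
  fixes \<rho> :: real
  assumes rho: "0 < \<rho>" "\<rho> < 1"
begin

definition \<theta> :: real where "\<theta> = pi / (1 + \<rho>)"
text \<open>The sign \<open>s\<close> selects the upper or the lower ray of the contour.\<close>

definition \<omega> :: "real \<Rightarrow> complex" where "\<omega> s = cis (s * \<theta>)"
definition \<omega>\<rho> :: "real \<Rightarrow> complex" where "\<omega>\<rho> s = cis (s * \<rho> * \<theta>)"
text \<open>A square root of \<open>\<i> * \<omega>\<rho> s\<close>. Its angle lies strictly between
  0 and pi/2 on both rays, so the exponentials in \<open>kern\<close> decay in y.\<close>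

definition \<mu> :: "real \<Rightarrow> complex" where "\<mu> s = cis (pi / 4 + s * \<rho> * \<theta> / 2)"
text \<open>The sign is the orientation of the contour, which comes in along the lower ray and
  leaves along the upper one.\<close>

definition c0 :: "real \<Rightarrow> complex" where "c0 s = of_real s / (2 * pi * \<i>)"
definition cc :: real where "cc = - cos \<theta>"
definition dd :: real where "dd = cos (pi / 4 + \<rho> * \<theta> / 2)"

lemma theta: "pi / 2 < \<theta>" "\<theta> < pi" "\<rho> * \<theta> < pi / 2" "0 < \<theta>" "0 < \<rho> * \<theta>"
proof -
  show "pi / 2 < \<theta>" "\<theta> < pi" "0 < \<theta>" "0 < \<rho> * \<theta>"
    using rho by (simp_all add: \<theta>_def field_simps)
  have "\<rho> * pi * 2 < pi * (1 + \<rho>)" using rho by (simp add: algebra_simps)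
  then show "\<rho> * \<theta> < pi / 2" using rho by (simp add: \<theta>_def field_simps)
qed

lemma cc_pos: "cc > 0"
  using cos_lt_zero_pi[of \<theta>] theta by (simp add: cc_def)

lemma dd_pos: "dd > 0"
  using theta unfolding dd_def by (intro cos_gt_zero_pi) auto

lemma Re_omega: "s \<in> {1, -1} \<Longrightarrow> Re (\<omega> s) = - cc"
  by (auto simp: \<omega>_def cc_def)

lemma dd_le: 
  assumes "s \<in> {1, -1}"
  shows "dd \<le> cos (pi / 4 + s * \<rho> * \<theta> / 2)"
proof -
  have "cos (pi / 4 + \<rho> * \<theta> / 2) \<le> cos \<bar>pi / 4 - \<rho> * \<theta> / 2\<bar>"
    using theta by (intro cos_monotone_0_pi_le) (auto simp: abs_if)
  then have "dd \<le> cos (pi / 4 - \<rho> * \<theta> / 2)" by (simp add: dd_def)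
  then show ?thesis using assms by (auto simp: dd_def)
qed

lemma Re_mu: "s \<in> {1, -1} \<Longrightarrow> dd \<le> Re (\<mu> s)"
  using dd_le by (simp add: \<mu>_def)

lemma mu_square: "s \<in> {1, -1} \<Longrightarrow> \<mu> s ^ 2 = \<i> * \<omega>\<rho> s"
proof -
  have "\<mu> s ^ 2 = cis (pi / 2 + s * \<rho> * \<theta>)"
    by (simp add: \<mu>_def Complex.DeMoivre distrib_left)
  also have "\<dots> = cis (pi / 2) * cis (s * \<rho> * \<theta>)" by (simp only: cis_mult)
  finally show ?thesis by (simp add: \<omega>\<rho>_def)
qed

lemma phase_nonzero [simp]: "\<omega> s \<noteq> 0" "\<omega>\<rho> s \<noteq> 0" "\<mu> s \<noteq> 0"
  by (simp_all add: \<omega>_def \<omega>\<rho>_def \<mu>_def)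

lemma norm_phase [simp]: "norm (\<omega>\<rho> s) = 1" "norm (\<mu> s) = 1"
  by (simp_all add: \<omega>_def \<omega>\<rho>_def \<mu>_def)

text \<open>The Laplace symbol 1 / (z^\<rho> - i l) at the point z = r
  \<open>\<omega> s\<close>.\<close>

definition sym :: "real \<Rightarrow> real \<Rightarrow> real \<Rightarrow> complex" where
  "sym s l r = 1 / (of_real (r powr \<rho>) * \<omega>\<rho> s - \<i> * of_real l)"

text \<open>Half the angle between z^\<rho> and -i is exactly the angle of \<open>\<mu> s\<close>,
  so the constant \<open>dd\<close> that bounds the real part of \<open>\<mu> s\<close> also keeps
  the contour away from the pole.\<close>

lemma sym_bound:
  assumes "s \<in> {1, -1}" "l \<ge> 0"
  shows "dd * (r powr \<rho> + l) \<le> norm (of_real (r powr \<rho>) * \<omega>\<rho> s - \<i> * of_real l)"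
proof -
  have "dd * (r powr \<rho> + l) \<le> cos ((s * \<rho> * \<theta> - (- pi / 2)) / 2) * (r powr \<rho> + l)"
    using dd_le[OF assms(1)] assms by (intro mult_right_mono) (auto simp: field_simps)
  also have "\<dots> \<le> norm (of_real (r powr \<rho>) * cis (s * \<rho> * \<theta>) + of_real l * cis (- pi / 2))"
    by (rule norm_add_polar) (use assms in auto)
  also have "cis (- pi / 2) = - \<i>" by (simp add: cis_minus_pi_half)
  finally show ?thesis by (simp add: \<omega>\<rho>_def mult.commute)
qed

text \<open>Up to constant phases, the contour integral over one ray of z^\<beta> exp z exp (-M y),
  where M is the root of i z^\<rho> with positive real part.\<close>

definition kern :: "real \<Rightarrow> real \<Rightarrow> real \<Rightarrow> complex" where
  "kern \<beta> s y = (LINT r:{0<..}|lborel. of_real (r powr \<beta>) * exp (of_real r * \<omega> s) *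
     exp (- (of_real (r powr (\<rho> / 2)) * \<mu> s * of_real y)))"

lemma kern_measurable [measurable]: "kern \<beta> s \<in> borel_measurable borel"
  unfolding kern_def set_lebesgue_integral_def by measurable

text \<open>Integrating y^a against exp (- dd r^(\<rho>/2) y) costs the power r^(-\<rho>/2 (a+1)).
  The second exponent condition says that what is left of r^\<beta> is still integrable at 0; at
  infinity exp z decays.\<close>

lemma kern_Fubini:
  assumes s: "s \<in> {1, -1}" and [measurable]: "h \<in> borel_measurable borel"
    and h: "\<And>y. y > 0 \<Longrightarrow> \<bar>h y\<bar> \<le> K * y powr a"
    and a: "a > -1" "\<beta> - \<rho> / 2 * (a + 1) > -1"
  shows "set_integrable lborel {0<..} (\<lambda>y. kern \<beta> s y * of_real (h y))"
    and "(LINT y:{0<..}|lborel. kern \<beta> s y * of_real (h y)) =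
      (LINT r:{0<..}|lborel. of_real (r powr \<beta>) * exp (of_real r * \<omega> s) *
        (LINT y:{0<..}|lborel. exp (- (of_real (r powr (\<rho> / 2)) * \<mu> s * of_real y)) * of_real (h y)))"
proof -
  define f where "f r y = of_real (r powr \<beta>) * exp (of_real r * \<omega> s) *
     exp (- (of_real (r powr (\<rho> / 2)) * \<mu> s * of_real y)) * of_real (h y)" for r y
  define g where "g r y = K * (r powr \<beta> * exp (- (cc * r))) * (y powr a * exp (- (dd * r powr (\<rho> / 2) * y)))" for r y
  define G where "G r = K * Gamma (a + 1) / dd powr (a + 1) * (r powr (\<beta> - \<rho> / 2 * (a + 1)) * exp (- (cc * r)))" for r
  have fg: "norm (f r y) \<le> g r y" if "r > 0" "y > 0" for r y
  proof -
    have "Re (of_real (r powr (\<rho> / 2)) * \<mu> s * of_real y) \<ge> dd * r powr (\<rho> / 2) * y"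
      using Re_mu[OF s] that by (simp add: mult.commute mult_right_mono)
    then have 1: "norm (exp (- (of_real (r powr (\<rho> / 2)) * \<mu> s * of_real y))) \<le> exp (- (dd * r powr (\<rho> / 2) * y))"
      by simp
    have 2: "norm (exp (of_real r * \<omega> s)) = exp (- (cc * r))"
      using Re_omega[OF s] by (simp add: mult.commute)
    have "norm (f r y) = (r powr \<beta> * exp (- (cc * r))) * (norm (exp (- (of_real (r powr (\<rho> / 2)) * \<mu> s * of_real y))) * \<bar>h y\<bar>)"
      unfolding f_def norm_mult 2 by simp
    also have "\<dots> \<le> (r powr \<beta> * exp (- (cc * r))) * (exp (- (dd * r powr (\<rho> / 2) * y)) * (K * y powr a))"
      using 1 h[OF that(2)] by (intro mult_left_mono mult_mono) auto
    finally show ?thesis by (simp add: g_def mult_ac)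
  qed
  have gi: "set_integrable lborel {0<..} (g r)" and gv: "(LINT y:{0<..}|lborel. g r y) = G r" if "r > 0" for r
  proof -
    have p: "dd * r powr (\<rho> / 2) > 0" using dd_pos that by simp
    note gam = gamma_integral[OF a(1) p]
    show "set_integrable lborel {0<..} (g r)"
      unfolding g_def by (intro set_integrable_mult_right gam)
    have v: "(LINT y:{0<..}|lborel. g r y) = K * (r powr \<beta> * exp (- (cc * r))) * (Gamma (a + 1) / (dd * r powr (\<rho> / 2)) powr (a + 1))"
      unfolding g_def using gam(2) by simp
    have e: "r powr \<beta> / (dd * r powr (\<rho> / 2)) powr (a + 1) = r powr (\<beta> - \<rho> / 2 * (a + 1)) / dd powr (a + 1)"
      using that dd_pos by (simp add: powr_mult powr_powr powr_diff)
    have "(LINT y:{0<..}|lborel. g r y) =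
        K * Gamma (a + 1) * exp (- (cc * r)) * (r powr \<beta> / (dd * r powr (\<rho> / 2)) powr (a + 1))"
      using v by simp
    then show "(LINT y:{0<..}|lborel. g r y) = G r"
      unfolding e by (simp add: G_def)
  qed
  have Gi: "set_integrable lborel {0<..} G"
    unfolding G_def by (intro set_integrable_mult_right gamma_integral a(2) cc_pos)
  have fm: "(\<lambda>(r, y). f r y) \<in> borel_measurable borel"
    unfolding f_def borel_prod[symmetric] by measurable
  have fm1: "f r \<in> borel_measurable borel" for r
    unfolding f_def by measurable
  have fi: "set_integrable lborel {0<..} (f r)" if "r \<in> {0<..}" for r
    using that by (intro set_integrable_dom[OF _ fm1 gi]) (auto intro: fg)
  have fb: "(LINT y:{0<..}|lborel. norm (f r y)) \<le> G r" if "r \<in> {0<..}" for r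
  proof -
    have "norm (LINT y:{0<..}|lborel. norm (f r y)) \<le> (LINT y:{0<..}|lborel. g r y)"
      by (rule set_integral_norm_le) (use that gi fg in auto)
    then show ?thesis using gv that by auto
  qed
  have k: "(LINT r:{0<..}|lborel. f r y) = kern \<beta> s y * of_real (h y)" for y
    unfolding f_def kern_def by simp
  have k2: "(LINT y:{0<..}|lborel. f r y) = of_real (r powr \<beta>) * exp (of_real r * \<omega> s) *
        (LINT y:{0<..}|lborel. exp (- (of_real (r powr (\<rho> / 2)) * \<mu> s * of_real y)) * of_real (h y))" for r
    by (simp only: f_def mult.assoc set_integral_mult_right)
  note F = set_Fubini[where A = "{0<..}" and B = "{0<..}" and f = f and g = G, OF _ _ fm fi Gi fb, simplified]
  show "set_integrable lborel {0<..} (\<lambda>y. kern \<beta> s y * of_real (h y))"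
    using F(3) by (simp add: k)
  show "(LINT y:{0<..}|lborel. kern \<beta> s y * of_real (h y)) =
      (LINT r:{0<..}|lborel. of_real (r powr \<beta>) * exp (of_real r * \<omega> s) *
        (LINT y:{0<..}|lborel. exp (- (of_real (r powr (\<rho> / 2)) * \<mu> s * of_real y)) * of_real (h y)))"
    using F(1) by (simp only: k k2)
qed

text \<open>
  \<open>eML l\<close> is the Mittag-Leffler function $E_{\rho,\rho}(i l)$, written as the Hankel contour integral
  over the two rays with angles \<open>\<theta>\<close> and \<open>- \<theta>\<close>.  This angle exceeds \<open>pi / 2\<close>, so that the exponential
  decays, while \<open>\<rho> * \<theta> < pi / 2\<close> keeps the rays away from the singularity at $z^\rho = i l$.
\<close>

definition eML :: "real \<Rightarrow> complex" where
  "eML l = (\<Sum>s\<in>{1, -1}. c0 s * \<omega> s * (LINT r:{0<..}|lborel. exp (of_real r * \<omega> s) * sym s l r))"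

text \<open>The phases of \<open>n0\<close> and \<open>n2\<close> are fixed by the cosine transforms
  \<open>N0_cos\<close> and \<open>N2_cos\<close>: multiplied by the phase of the transform, each
  must leave i / (M^2 + \<kappa>^2), which is the symbol.\<close>

definition n0 :: "real \<Rightarrow> complex" where "n0 s = c0 s * (\<omega> s / \<omega>\<rho> s * \<mu> s / 2)"
definition n2 :: "real \<Rightarrow> complex" where "n2 s = c0 s * (\<i> / 2 * \<mu> s * \<omega> s)"

definition N0 :: "real \<Rightarrow> complex" where
  "N0 y = (\<Sum>s\<in>{1, -1}. n0 s * kern (- \<rho> / 2) s y)"

definition N2 :: "real \<Rightarrow> complex" where
  "N2 y = (\<Sum>s\<in>{1, -1}. n2 s * kern (\<rho> / 2) s y)"

lemma N_measurable [measurable]: "N0 \<in> borel_measurable borel" "N2 \<in> borel_measurable borel"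
  unfolding N0_def N2_def by measurable

lemma N0_integrable: "set_integrable lborel {0<..} N0"
proof -
  have "set_integrable lborel {0<..} (kern (- \<rho> / 2) s)" if "s \<in> {1, -1}" for s
    using kern_Fubini(1)[OF that, of "\<lambda>_. 1" 1 0 "- \<rho> / 2"] rho by simp
  then show ?thesis unfolding N0_def by (simp add: set_integral_add)
qed

lemma N2_integrable: "set_integrable lborel {0<..} (\<lambda>y. N2 y * of_real (sqrt y))"
proof -
  have "set_integrable lborel {0<..} (\<lambda>y. kern (\<rho> / 2) s y * of_real (sqrt y))" if "s \<in> {1, -1}" for s
    using kern_Fubini(1)[OF that, of sqrt 1 "1/2" "\<rho> / 2"] rho by (simp add: powr_half_sqrt)
  then have "set_integrable lborel {0<..} (\<lambda>y. c * (kern (\<rho> / 2) s y * of_real (sqrt y)))" if "s \<in> {1, -1}" for s c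
    using that by (intro set_integrable_mult_right) auto
  then have "set_integrable lborel {0<..} (\<lambda>y. c * (kern (\<rho> / 2) 1 y * of_real (sqrt y)) + d * (kern (\<rho> / 2) (-1) y * of_real (sqrt y)))" for c d
    by (intro set_integral_add) auto
  then show ?thesis unfolding N2_def by (simp add: distrib_right mult.assoc)
qed

text \<open>Since M^2 = i z^\<rho>, the Laplace denominator factors as i (z^\<rho> - i \<kappa>^2);
  this is the bridge from cosine transforms to the symbol.\<close>

lemma mult_sym:
  assumes s: "s \<in> {1, -1}" and r: "r > 0"
  defines "M \<equiv> of_real (r powr (\<rho> / 2)) * \<mu> s"
  shows "Re M > 0" "\<i> / (M\<^sup>2 + of_real \<kappa> ^ 2) = sym s (\<kappa>\<^sup>2) r"
    "M\<^sup>2 + of_real \<kappa> ^ 2 \<noteq> 0"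
proof -
  show "Re M > 0" using Re_mu[OF s] dd_pos r by (simp add: M_def)
  have "M\<^sup>2 = of_real (r powr \<rho>) * (\<i> * \<omega>\<rho> s)"
  proof -
    have "of_real (r powr (\<rho> / 2)) ^ 2 = (of_real (r powr \<rho>) :: complex)"
      by (simp add: power2_eq_square powr_add[symmetric] flip: of_real_mult)
    then show ?thesis by (simp add: M_def power_mult_distrib mu_square[OF s])
  qed
  then have e: "M\<^sup>2 + of_real \<kappa> ^ 2 = \<i> * (of_real (r powr \<rho>) * \<omega>\<rho> s - \<i> * of_real (\<kappa>\<^sup>2))"
    by (simp add: algebra_simps)
  have "0 < dd * (r powr \<rho> + \<kappa>\<^sup>2)" using dd_pos r by (simp add: add_pos_nonneg)
  also have "\<dots> \<le> norm (of_real (r powr \<rho>) * \<omega>\<rho> s - \<i> * of_real (\<kappa>\<^sup>2))"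
    by (rule sym_bound[OF s]) simp
  finally have "of_real (r powr \<rho>) * \<omega>\<rho> s - \<i> * of_real (\<kappa>\<^sup>2) \<noteq> 0" by auto
  then show "\<i> / (M\<^sup>2 + of_real \<kappa> ^ 2) = sym s (\<kappa>\<^sup>2) r" "M\<^sup>2 + of_real \<kappa> ^ 2 \<noteq> 0"
    unfolding e sym_def by auto
qed

text \<open>After exchanging integrals the y-integral is 2 M / (M^2 + \<kappa>^2). The weight
  r^(-\<rho>/2) strips M of its modulus, and the remaining phases combine into
  \<open>\<mu> s\<close> squared, that is \<open>\<i> * \<omega>\<rho> s\<close>.\<close>

lemma N0_cos: "(LINT y:{0<..}|lborel. N0 y * of_real (2 * cos (\<kappa> * y))) = eML (\<kappa>\<^sup>2)"
proof -
  have *: "set_integrable lborel {0<..} (\<lambda>y. kern (- \<rho> / 2) s y * of_real (2 * cos (\<kappa> * y)))"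
    "(\<omega> s / \<omega>\<rho> s * \<mu> s / 2) * (LINT y:{0<..}|lborel. kern (- \<rho> / 2) s y * of_real (2 * cos (\<kappa> * y))) =
      \<omega> s * (LINT r:{0<..}|lborel. exp (of_real r * \<omega> s) * sym s (\<kappa>\<^sup>2) r)"
    if s: "s \<in> {1, -1}" for s
  proof -
    note F = kern_Fubini[OF s, of "\<lambda>y. 2 * cos (\<kappa> * y)" 2 0 "- \<rho> / 2"]
    have m: "(\<lambda>y. 2 * cos (\<kappa> * y)) \<in> borel_measurable borel" by measurable
    have b: "\<bar>2 * cos (\<kappa> * y)\<bar> \<le> 2 * y powr 0" if "y > 0" for y
      using that abs_cos_le_one[of "\<kappa> * y"] by (simp add: abs_mult)
    show "set_integrable lborel {0<..} (\<lambda>y. kern (- \<rho> / 2) s y * of_real (2 * cos (\<kappa> * y)))"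
      by (rule F(1)[OF m b]) (use rho in auto)
    have "(\<omega> s / \<omega>\<rho> s * \<mu> s / 2) * (LINT y:{0<..}|lborel. kern (- \<rho> / 2) s y * of_real (2 * cos (\<kappa> * y))) =
      (\<omega> s / \<omega>\<rho> s * \<mu> s / 2) * (LINT r:{0<..}|lborel. of_real (r powr (- \<rho> / 2)) * exp (of_real r * \<omega> s) *
        (LINT y:{0<..}|lborel. exp (- (of_real (r powr (\<rho> / 2)) * \<mu> s * of_real y)) * of_real (2 * cos (\<kappa> * y))))"
      by (subst F(2)[OF m b]) (use rho in auto)
    also have "\<dots> = (LINT r:{0<..}|lborel. (\<omega> s / \<omega>\<rho> s * \<mu> s / 2) * (of_real (r powr (- \<rho> / 2)) * exp (of_real r * \<omega> s) *
        (LINT y:{0<..}|lborel. exp (- (of_real (r powr (\<rho> / 2)) * \<mu> s * of_real y)) * of_real (2 * cos (\<kappa> * y)))))"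
      by (rule set_integral_mult_right[symmetric])
    also have "\<dots> = (LINT r:{0<..}|lborel. \<omega> s * (exp (of_real r * \<omega> s) * sym s (\<kappa>\<^sup>2) r))"
    proof (rule set_lebesgue_integral_cong)
      show "\<forall>r. r \<in> {0<..} \<longrightarrow> (\<omega> s / \<omega>\<rho> s * \<mu> s / 2) * (of_real (r powr (- \<rho> / 2)) * exp (of_real r * \<omega> s) *
        (LINT y:{0<..}|lborel. exp (- (of_real (r powr (\<rho> / 2)) * \<mu> s * of_real y)) * of_real (2 * cos (\<kappa> * y)))) =
        \<omega> s * (exp (of_real r * \<omega> s) * sym s (\<kappa>\<^sup>2) r)"
      proof (intro allI impI)
        fix r :: real assume "r \<in> {0<..}"
        then have r: "r > 0" by simp
        define M where "M = of_real (r powr (\<rho> / 2)) * \<mu> s"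
        note ms = mult_sym[OF s r, folded M_def]
        have i: "(LINT y:{0<..}|lborel. exp (- (of_real (r powr (\<rho> / 2)) * \<mu> s * of_real y)) * of_real (2 * cos (\<kappa> * y))) = 2 * M / (M\<^sup>2 + of_real \<kappa> ^ 2)"
          using exp_cos_integral(2)[OF ms(1), of \<kappa>] unfolding M_def .
        have rr: "of_real (r powr (- \<rho> / 2)) * M = \<mu> s"
          using r by (simp add: M_def powr_minus)
        have "(\<omega> s / \<omega>\<rho> s * \<mu> s / 2) * (of_real (r powr (- \<rho> / 2)) * exp (of_real r * \<omega> s) * (2 * M / (M\<^sup>2 + of_real \<kappa> ^ 2))) =
           \<omega> s / \<omega>\<rho> s * \<mu> s * exp (of_real r * \<omega> s) * (of_real (r powr (- \<rho> / 2)) * M) / (M\<^sup>2 + of_real \<kappa> ^ 2)"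
          by (simp add: mult_ac)
        also have "\<dots> = \<omega> s / \<omega>\<rho> s * exp (of_real r * \<omega> s) * (\<mu> s)\<^sup>2 / (M\<^sup>2 + of_real \<kappa> ^ 2)"
          unfolding rr by (simp add: power2_eq_square mult_ac)
        also have "\<dots> = \<omega> s * exp (of_real r * \<omega> s) * (\<i> / (M\<^sup>2 + of_real \<kappa> ^ 2))"
          unfolding mu_square[OF s] by simp
        finally show "(\<omega> s / \<omega>\<rho> s * \<mu> s / 2) * (of_real (r powr (- \<rho> / 2)) * exp (of_real r * \<omega> s) *
          (LINT y:{0<..}|lborel. exp (- (of_real (r powr (\<rho> / 2)) * \<mu> s * of_real y)) * of_real (2 * cos (\<kappa> * y)))) =
          \<omega> s * (exp (of_real r * \<omega> s) * sym s (\<kappa>\<^sup>2) r)"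
          unfolding i ms(2) by (simp add: mult_ac)
      qed
    qed simp
    also have "\<dots> = \<omega> s * (LINT r:{0<..}|lborel. exp (of_real r * \<omega> s) * sym s (\<kappa>\<^sup>2) r)"
      by (rule set_integral_mult_right)
    finally show "(\<omega> s / \<omega>\<rho> s * \<mu> s / 2) * (LINT y:{0<..}|lborel. kern (- \<rho> / 2) s y * of_real (2 * cos (\<kappa> * y))) =
      \<omega> s * (LINT r:{0<..}|lborel. exp (of_real r * \<omega> s) * sym s (\<kappa>\<^sup>2) r)" .
  qed
  let ?k = "\<lambda>s y. kern (- \<rho> / 2) s y * of_real (2 * cos (\<kappa> * y))"
  have "(LINT y:{0<..}|lborel. N0 y * of_real (2 * cos (\<kappa> * y))) = (LINT y:{0<..}|lborel. n0 1 * ?k 1 y + n0 (-1) * ?k (-1) y)"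
    by (intro set_lebesgue_integral_cong) (auto simp: N0_def algebra_simps)
  also have "\<dots> = (LINT y:{0<..}|lborel. n0 1 * ?k 1 y) + (LINT y:{0<..}|lborel. n0 (-1) * ?k (-1) y)"
    by (intro set_integral_add set_integrable_mult_right *) auto
  also have "\<dots> = c0 1 * ((\<omega> 1 / \<omega>\<rho> 1 * \<mu> 1 / 2) * (LINT y:{0<..}|lborel. ?k 1 y)) + c0 (-1) * ((\<omega> (-1) / \<omega>\<rho> (-1) * \<mu> (-1) / 2) * (LINT y:{0<..}|lborel. ?k (-1) y))"
    by (simp only: set_integral_mult_right n0_def mult.assoc)
  also have "\<dots> = eML (\<kappa>\<^sup>2)"
    by (subst (1 2) *(2)) (auto simp: eML_def mult.assoc)
  finally show ?thesis .
qed

text \<open>The bounds z^2 and 4 are interpolated to the power 1/2, the same exponent that is later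
  available from the Hoelder condition.\<close>

lemma cos_minus_one_bound: "\<bar>2 * cos z - 2\<bar> \<le> 4 * sqrt \<bar>z\<bar>" for z :: real
proof (cases "\<bar>z\<bar> \<le> 1")
  case True
  have "1 - z\<^sup>2 / 2 \<le> cos z" 
  proof -
    have "(sin (z / 2))\<^sup>2 \<le> (z / 2)\<^sup>2"
      using abs_sin_x_le_abs_x[of "z / 2"] by (simp add: abs_le_square_iff[symmetric])
    then show ?thesis using cos_double_sin[of "z / 2"] by (simp add: power_divide)
  qed
  then have "\<bar>2 * cos z - 2\<bar> \<le> \<bar>z\<bar> * \<bar>z\<bar>"
    using cos_le_one[of z] zero_le_square[of z] by (simp add: power2_eq_square)
  also have "\<dots> \<le> \<bar>z\<bar> * 1" using True by (intro mult_left_mono) auto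
  also have "\<dots> \<le> sqrt \<bar>z\<bar>" using True mult_left_le[of "\<bar>z\<bar>" "\<bar>z\<bar>"] by (intro real_le_rsqrt) (simp add: power2_eq_square)
  also have "\<dots> \<le> 4 * sqrt \<bar>z\<bar>" by simp
  finally show ?thesis .
next
  case False
  then have "1 \<le> sqrt \<bar>z\<bar>" by simp
  moreover have "\<bar>2 * cos z - 2\<bar> \<le> 4" using cos_ge_minus_one[of z] cos_le_one[of z] by linarith
  ultimately show ?thesis by linarith
qed

lemma N2_cos: "(LINT y:{0<..}|lborel. N2 y * of_real (2 * cos (\<kappa> * y) - 2)) = - (of_real \<kappa> ^ 2) * eML (\<kappa>\<^sup>2)"
proof -
  have *: "set_integrable lborel {0<..} (\<lambda>y. kern (\<rho> / 2) s y * of_real (2 * cos (\<kappa> * y) - 2))"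
    "(\<i> / 2 * \<mu> s * \<omega> s) * (LINT y:{0<..}|lborel. kern (\<rho> / 2) s y * of_real (2 * cos (\<kappa> * y) - 2)) =
      - (of_real \<kappa> ^ 2) * \<omega> s * (LINT r:{0<..}|lborel. exp (of_real r * \<omega> s) * sym s (\<kappa>\<^sup>2) r)"
    if s: "s \<in> {1, -1}" for s
  proof -
    note F = kern_Fubini[OF s, of "\<lambda>y. 2 * cos (\<kappa> * y) - 2" "4 * sqrt \<bar>\<kappa>\<bar>" "1/2" "\<rho> / 2"]
    have m: "(\<lambda>y. 2 * cos (\<kappa> * y) - 2) \<in> borel_measurable borel" by measurable
    have b: "\<bar>2 * cos (\<kappa> * y) - 2\<bar> \<le> 4 * sqrt \<bar>\<kappa>\<bar> * y powr (1/2)" if "y > 0" for y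
      using that cos_minus_one_bound[of "\<kappa> * y"] by (simp add: abs_mult real_sqrt_mult powr_half_sqrt)
    have a: "(1/2::real) > -1" "\<rho> / 2 - \<rho> / 2 * (1/2 + 1) > -1" using rho by auto
    show "set_integrable lborel {0<..} (\<lambda>y. kern (\<rho> / 2) s y * of_real (2 * cos (\<kappa> * y) - 2))"
      by (rule F(1)[OF m b a])
    have "(\<i> / 2 * \<mu> s * \<omega> s) * (LINT y:{0<..}|lborel. kern (\<rho> / 2) s y * of_real (2 * cos (\<kappa> * y) - 2)) =
      (\<i> / 2 * \<mu> s * \<omega> s) * (LINT r:{0<..}|lborel. of_real (r powr (\<rho> / 2)) * exp (of_real r * \<omega> s) *
        (LINT y:{0<..}|lborel. exp (- (of_real (r powr (\<rho> / 2)) * \<mu> s * of_real y)) * of_real (2 * cos (\<kappa> * y) - 2)))"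
      by (subst F(2)[OF m b a]) auto
    also have "\<dots> = (LINT r:{0<..}|lborel. (\<i> / 2 * \<mu> s * \<omega> s) * (of_real (r powr (\<rho> / 2)) * exp (of_real r * \<omega> s) *
        (LINT y:{0<..}|lborel. exp (- (of_real (r powr (\<rho> / 2)) * \<mu> s * of_real y)) * of_real (2 * cos (\<kappa> * y) - 2))))"
      by (rule set_integral_mult_right[symmetric])
    also have "\<dots> = (LINT r:{0<..}|lborel. - (of_real \<kappa> ^ 2) * \<omega> s * (exp (of_real r * \<omega> s) * sym s (\<kappa>\<^sup>2) r))"
    proof (rule set_lebesgue_integral_cong)
      show "\<forall>r. r \<in> {0<..} \<longrightarrow> (\<i> / 2 * \<mu> s * \<omega> s) * (of_real (r powr (\<rho> / 2)) * exp (of_real r * \<omega> s) *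
        (LINT y:{0<..}|lborel. exp (- (of_real (r powr (\<rho> / 2)) * \<mu> s * of_real y)) * of_real (2 * cos (\<kappa> * y) - 2))) =
        - (of_real \<kappa> ^ 2) * \<omega> s * (exp (of_real r * \<omega> s) * sym s (\<kappa>\<^sup>2) r)"
      proof (intro allI impI)
        fix r :: real assume "r \<in> {0<..}"
        then have r: "r > 0" by simp
        define M where "M = of_real (r powr (\<rho> / 2)) * \<mu> s"
        note ms = mult_sym[OF s r, folded M_def]
        have nz: "M \<noteq> 0" using ms(1) by auto
        have "(LINT y:{0<..}|lborel. exp (- (M * of_real y)) * of_real (2 * cos (\<kappa> * y) - 2)) =
           (LINT y:{0<..}|lborel. exp (- (M * of_real y)) * of_real (2 * cos (\<kappa> * y)) - 2 * exp (- (M * of_real y)))"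
          by (intro set_lebesgue_integral_cong) (auto simp: algebra_simps)
        also have "\<dots> = 2 * M / (M\<^sup>2 + of_real \<kappa> ^ 2) - 2 * (1 / M)"
          by (subst set_integral_diff(2))
            (simp_all only: exp_cos_integral[OF ms(1)] exp_integral_complex[OF ms(1)] set_integrable_mult_right set_integral_mult_right)
        \<comment> \<open>Subtracting the transform 2 / M of the constant 2 produces the factor
          \<kappa>^2, and so the second derivative.\<close>
        also have "\<dots> = - 2 * of_real \<kappa> ^ 2 / (M * (M\<^sup>2 + of_real \<kappa> ^ 2))"
          using nz ms(3) by (simp add: diff_frac_eq) (simp add: field_simps power2_eq_square)
        finally have i: "(LINT y:{0<..}|lborel. exp (- (of_real (r powr (\<rho> / 2)) * \<mu> s * of_real y)) * of_real (2 * cos (\<kappa> * y) - 2)) =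
           - 2 * of_real \<kappa> ^ 2 / (M * (M\<^sup>2 + of_real \<kappa> ^ 2))"
          unfolding M_def .
        have "(\<i> / 2 * \<mu> s * \<omega> s) * (of_real (r powr (\<rho> / 2)) * exp (of_real r * \<omega> s) * (- 2 * of_real \<kappa> ^ 2 / (M * (M\<^sup>2 + of_real \<kappa> ^ 2)))) =
           - (of_real \<kappa> ^ 2) * \<omega> s * exp (of_real r * \<omega> s) * ((of_real (r powr (\<rho> / 2)) * \<mu> s) / M) * (\<i> / (M\<^sup>2 + of_real \<kappa> ^ 2))"
          by (simp add: mult_ac)
        also have "(of_real (r powr (\<rho> / 2)) * \<mu> s) / M = 1"
          using nz by (simp add: M_def)
        finally show "(\<i> / 2 * \<mu> s * \<omega> s) * (of_real (r powr (\<rho> / 2)) * exp (of_real r * \<omega> s) *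
          (LINT y:{0<..}|lborel. exp (- (of_real (r powr (\<rho> / 2)) * \<mu> s * of_real y)) * of_real (2 * cos (\<kappa> * y) - 2))) =
          - (of_real \<kappa> ^ 2) * \<omega> s * (exp (of_real r * \<omega> s) * sym s (\<kappa>\<^sup>2) r)"
          unfolding i ms(2) by (simp add: mult_ac)
      qed
    qed simp
    also have "\<dots> = - (of_real \<kappa> ^ 2) * \<omega> s * (LINT r:{0<..}|lborel. exp (of_real r * \<omega> s) * sym s (\<kappa>\<^sup>2) r)"
      by (rule set_integral_mult_right)
    finally show "(\<i> / 2 * \<mu> s * \<omega> s) * (LINT y:{0<..}|lborel. kern (\<rho> / 2) s y * of_real (2 * cos (\<kappa> * y) - 2)) =
      - (of_real \<kappa> ^ 2) * \<omega> s * (LINT r:{0<..}|lborel. exp (of_real r * \<omega> s) * sym s (\<kappa>\<^sup>2) r)" .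
  qed
  let ?k = "\<lambda>s y. kern (\<rho> / 2) s y * of_real (2 * cos (\<kappa> * y) - 2)"
  have "(LINT y:{0<..}|lborel. N2 y * of_real (2 * cos (\<kappa> * y) - 2)) = (LINT y:{0<..}|lborel. n2 1 * ?k 1 y + n2 (-1) * ?k (-1) y)"
    by (intro set_lebesgue_integral_cong) (auto simp: N2_def algebra_simps)
  also have "\<dots> = (LINT y:{0<..}|lborel. n2 1 * ?k 1 y) + (LINT y:{0<..}|lborel. n2 (-1) * ?k (-1) y)"
    by (intro set_integral_add set_integrable_mult_right *) auto
  also have "\<dots> = c0 1 * ((\<i> / 2 * \<mu> 1 * \<omega> 1) * (LINT y:{0<..}|lborel. ?k 1 y)) + c0 (-1) * ((\<i> / 2 * \<mu> (-1) * \<omega> (-1)) * (LINT y:{0<..}|lborel. ?k (-1) y))"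
    by (simp only: set_integral_mult_right n2_def mult.assoc)
  also have "\<dots> = - (of_real \<kappa> ^ 2) * eML (\<kappa>\<^sup>2)"
    by (subst (1 2) *(2)) (auto simp: eML_def algebra_simps)
  finally show ?thesis .
qed

end

section \<open>Stieltjes transforms and Hankel integrals on the contour\<close>

lemma set_integrable_of_real:
  "set_integrable M A f \<Longrightarrow> set_integrable M A (\<lambda>x. complex_of_real (f x))"
  using complex_of_real_integrable_eq[of M "\<lambda>x. indicator A x * f x"]
  by (simp add: set_integrable_def scaleR_conv_of_real)

text \<open>Writing 1 / (q + x) as the integral of exp (-(q + x) t) over t and exchanging the order
  leaves two Gamma integrals.\<close>

lemma stieltjes_integral:
  fixes b x :: real
  assumes b: "0 < b" "b < 1" and x: "x > 0"
  shows "set_integrable lborel {0<..} (\<lambda>q. q powr (-b) / (q + x))"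
    and "(LINT q:{0<..}|lborel. q powr (-b) / (q + x)) = Gamma (1 - b) * Gamma b * x powr (-b)"
proof -
  define f where "f t q = q powr (-b) * exp (- ((q + x) * t))" for t q :: real
  have feq: "f t q = exp (- (x * t)) * (q powr (-b) * exp (- (t * q)))" for t q
    by (simp add: f_def exp_add[symmetric] algebra_simps)
  have fi: "set_integrable lborel {0<..} (f t)" and fv: "(LINT q:{0<..}|lborel. f t q) = Gamma (1 - b) * (t powr (b - 1) * exp (- (x * t)))"
    if "t > 0" for t
  proof -
    note g = gamma_integral[of "-b" t]
    show "set_integrable lborel {0<..} (f t)"
      unfolding feq by (intro set_integrable_mult_right g) (use b that in auto)
    have "(LINT q:{0<..}|lborel. f t q) = exp (- (x * t)) * (Gamma (1 - b) / t powr (1 - b))"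
      unfolding feq using g(2) b that by simp
    moreover have "t powr (b - 1) = 1 / t powr (1 - b)"
      by (metis minus_diff_eq powr_minus_divide)
    ultimately show "(LINT q:{0<..}|lborel. f t q) = Gamma (1 - b) * (t powr (b - 1) * exp (- (x * t)))"
      by simp
  qed
  have fm: "(\<lambda>(t, q). f t q) \<in> borel_measurable borel"
    unfolding f_def borel_prod[symmetric] by measurable
  have Gi: "set_integrable lborel {0<..} (\<lambda>t. Gamma (1 - b) * (t powr (b - 1) * exp (- (x * t))))"
    by (intro set_integrable_mult_right gamma_integral) (use b x in auto)
  have inner: "(LINT t:{0<..}|lborel. f t q) = q powr (-b) / (q + x)" if "q > 0" for q
  proof -
    have "(LINT t:{0<..}|lborel. f t q) = (LINT t:{0<..}|lborel. q powr (-b) * (t powr 0 * exp (- ((q + x) * t))))"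
      by (intro set_lebesgue_integral_cong) (auto simp: f_def)
    also have "\<dots> = q powr (-b) * (LINT t:{0<..}|lborel. t powr 0 * exp (- ((q + x) * t)))"
      by (rule set_integral_mult_right)
    also have "\<dots> = q powr (-b) / (q + x)"
      using gamma_integral(2)[of 0 "q + x"] that x by simp
    finally show ?thesis .
  qed
  note F = set_Fubini[where A = "{0<..}" and B = "{0<..}" and f = f, OF _ _ fm _ Gi]
  have nn: "\<bar>f t q\<bar> = f t q" for t q by (simp add: f_def)
  have F1: "(LINT t:{0<..}|lborel. LINT q:{0<..}|lborel. f t q) = (LINT q:{0<..}|lborel. LINT t:{0<..}|lborel. f t q)"
    by (rule F(1)) (auto simp: fi fv nn)
  have F3: "set_integrable lborel {0<..} (\<lambda>q. LINT t:{0<..}|lborel. f t q)"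
    by (rule F(3)) (auto simp: fi fv nn)
  show "set_integrable lborel {0<..} (\<lambda>q. q powr (-b) / (q + x))"
    by (rule iffD1[OF set_integrable_cong F3]) (auto simp: inner)
  have "(LINT q:{0<..}|lborel. q powr (-b) / (q + x)) = (LINT q:{0<..}|lborel. LINT t:{0<..}|lborel. f t q)"
    by (intro set_lebesgue_integral_cong) (auto simp: inner)
  also have "\<dots> = (LINT t:{0<..}|lborel. Gamma (1 - b) * (t powr (b - 1) * exp (- (x * t))))"
    unfolding F1[symmetric] by (intro set_lebesgue_integral_cong) (auto simp: fv)
  also have "\<dots> = Gamma (1 - b) * (LINT t:{0<..}|lborel. t powr (b - 1) * exp (- (x * t)))"
    by (rule set_integral_mult_right)
  also have "\<dots> = Gamma (1 - b) * Gamma b * x powr (-b)"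
    using gamma_integral(2)[of "b - 1" x] b x by (simp add: powr_minus_divide)
  finally show "(LINT q:{0<..}|lborel. q powr (-b) / (q + x)) = Gamma (1 - b) * Gamma b * x powr (-b)" .
qed

lemma Gamma_reflection_sin:
  fixes x :: real
  assumes "0 < x" "x < 1"
  shows "Gamma x * Gamma (1 - x) * sin (pi * x) = pi"
proof -
  have s: "sin (pi * x) > 0" using assms by (intro sin_gt_zero) auto
  have "complex_of_real (Gamma x * Gamma (1 - x)) = of_real (pi / sin (pi * x))"
    using Gamma_reflection_complex[of "of_real x"] Gamma_complex_of_real[of x] Gamma_complex_of_real[of "1 - x"]
    by (simp flip: sin_of_real)
  then have "Gamma x * Gamma (1 - x) = pi / sin (pi * x)" by (simp only: of_real_eq_iff)
  then show ?thesis using s by simp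
qed

lemma exp_Complex_ln: "r > 0 \<Longrightarrow> exp (of_real a * Complex (ln r) \<phi>) = of_real (r powr a) * cis (a * \<phi>)"
  by (simp add: exp_eq_polar powr_def)

lemma exp_Complex_ln1: "r > 0 \<Longrightarrow> exp (Complex (ln r) \<phi>) = of_real r * cis \<phi>"
  using exp_Complex_ln[of r 1 \<phi>] by simp

lemma exp_polar: "exp w = of_real (exp (Re w)) * cis (Im w)"
  by (simp add: exp_eq_polar)

context fractional_order begin

definition ee :: real where "ee = cos (\<theta> / 2)"

lemma ee_pos: "ee > 0"
  unfolding ee_def using theta by (intro cos_gt_zero_pi) auto

lemma norm_ray_add:
  assumes "\<bar>\<phi> - \<psi>\<bar> \<le> \<theta>" "r \<ge> 0" "q \<ge> 0"
  shows "ee * (r + q) \<le> norm (of_real r * cis \<phi> + of_real q * cis \<psi>)"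
proof -
  have "ee \<le> cos \<bar>(\<phi> - \<psi>) / 2\<bar>" unfolding ee_def
    using assms theta by (intro cos_monotone_0_pi_le) auto
  then have "ee \<le> cos ((\<phi> - \<psi>) / 2)" by (simp only: cos_abs_real)
  then have "ee * (r + q) \<le> cos ((\<phi> - \<psi>) / 2) * (r + q)"
    using assms by (intro mult_right_mono) auto
  also have "\<dots> \<le> norm (of_real r * cis \<phi> + of_real q * cis \<psi>)"
    by (rule norm_add_polar) (use assms in auto)
  finally show ?thesis .
qed

lemma norm_omega_add:
  assumes "s \<in> {1, -1}" "r \<ge> 0" "q \<ge> 0"
  shows "ee * (r + q) \<le> norm (of_real r * \<omega> s + of_real q)"
  using norm_ray_add[of "s * \<theta>" 0 r q] assms theta by (auto simp: \<omega>_def)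

text \<open>The q-integral is rotated from the positive axis to the ray through r
  \<open>\<omega> s\<close>. There the denominator is q + r times a phase, and the real Stieltjes
  integral applies.\<close>

lemma stieltjes_ray:
  assumes s: "s \<in> {1, -1}" and r: "r > 0"
  shows "set_integrable lborel {0<..} (\<lambda>q. of_real (q powr (-\<rho>)) / (of_real r * \<omega> s + of_real q))"
    and "(LINT q:{0<..}|lborel. of_real (q powr (-\<rho>)) / (of_real r * \<omega> s + of_real q)) =
      of_real (Gamma \<rho> * Gamma (1 - \<rho>) * r powr (-\<rho>)) / \<omega>\<rho> s"
proof -
  define \<phi>0 where "\<phi>0 = s * \<theta>"
  have abs: "\<bar>\<phi>0\<bar> = \<theta>" using s theta by (auto simp: \<phi>0_def)
  define h where "h w = exp (of_real (-\<rho>) * w) / (exp w + of_real r * cis \<phi>0)" for w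
  define g where "g q = q powr (-\<rho>) / (ee * (q + r))" for q
  have h: "h (Complex (ln q) \<phi>) = of_real (q powr (-\<rho>)) * cis (-\<rho> * \<phi>) / (of_real q * cis \<phi> + of_real r * cis \<phi>0)"
    if "q > 0" for q \<phi>
    unfolding h_def using that by (simp only: exp_Complex_ln exp_Complex_ln1)
  have gi: "set_integrable lborel {0<..} g"
  proof -
    have "g = (\<lambda>q. (1 / ee) * (q powr (-\<rho>) / (q + r)))" by (auto simp: g_def)
    then show ?thesis using stieltjes_integral(1)[OF rho r] by (simp only: set_integrable_mult_right)
  qed
  have h0: "h (Complex (ln q) 0) = of_real (q powr (-\<rho>)) / (of_real r * \<omega> s + of_real q)" if "q > 0" for q
    using h[OF that, of 0] by (simp add: \<omega>_def \<phi>0_def add.commute)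
  have h1: "cis \<phi>0 * h (Complex (ln q) \<phi>0) = of_real (q powr (-\<rho>) / (q + r)) / \<omega>\<rho> s" if "q > 0" for q
  proof -
    have "of_real q * cis \<phi>0 + of_real r * cis \<phi>0 = of_real (q + r) * cis \<phi>0" by (simp add: distrib_right)
    moreover have "cis (- \<rho> * \<phi>0) = 1 / \<omega>\<rho> s" by (simp add: \<omega>\<rho>_def \<phi>0_def mult_ac cis_inverse[symmetric] inverse_eq_divide)
    ultimately show ?thesis using that r unfolding h[OF that] by simp
  qed
  have bound: "norm (h (Complex (ln q) \<phi>)) \<le> g q" if "q > 0" "\<phi> \<in> closed_segment 0 \<phi>0" for q \<phi>
  proof -
    have "\<bar>\<phi> - \<phi>0\<bar> \<le> \<theta>" using that abs by (auto simp: closed_segment_eq_real_ivl split: if_splits)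
    then have "ee * (q + r) \<le> norm (of_real q * cis \<phi> + of_real r * cis \<phi>0)"
      using that r by (intro norm_ray_add) auto
    moreover have "0 < ee * (q + r)" using ee_pos that r by simp
    ultimately show ?thesis unfolding h[OF that(1)] g_def
      by (simp add: norm_divide norm_mult frac_le)
  qed
  have m0: "set_integrable lborel {0<..} (\<lambda>q. of_real (q powr (-\<rho>)) / (of_real r * \<omega> s + of_real q))"
  proof (rule set_integrable_dom[OF _ _ gi])
    fix q :: real assume "q \<in> {0<..}"
    then show "norm (of_real (q powr (-\<rho>)) / (of_real r * \<omega> s + of_real q)) \<le> g q"
      using bound[of q 0] h0[of q] by simp
  qed auto
  then show "set_integrable lborel {0<..} (\<lambda>q. of_real (q powr (-\<rho>)) / (of_real r * \<omega> s + of_real q))" .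
  have i0: "set_integrable lborel {0<..} (\<lambda>q. h (Complex (ln q) 0))"
    by (rule iffD1[OF set_integrable_cong m0]) (auto simp: h0)
  have m1: "set_integrable lborel {0<..} (\<lambda>q. of_real (q powr (-\<rho>) / (q + r)) / \<omega>\<rho> s / cis \<phi>0)"
    by (intro set_integrable_divide set_integrable_of_real stieltjes_integral(1) rho r)
  have i1: "set_integrable lborel {0<..} (\<lambda>q. h (Complex (ln q) \<phi>0))"
  proof (rule iffD1[OF set_integrable_cong m1])
    fix q :: real assume "q \<in> {0<..}"
    then show "of_real (q powr (-\<rho>) / (q + r)) / \<omega>\<rho> s / cis \<phi>0 = h (Complex (ln q) \<phi>0)"
      using h1[of q] by (metis cis_neq_zero greaterThan_iff nonzero_mult_div_cancel_left)
  qed auto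
  have rot: "cis 0 * (LINT q:{0<..}|lborel. h (Complex (ln q) 0)) = cis \<phi>0 * (LINT q:{0<..}|lborel. h (Complex (ln q) \<phi>0))"
  \<comment> \<open>The strip is limited by the directions opposite to r \<open>\<omega> s\<close>,
    the only ones in which the denominator can vanish.\<close>
  proof (rule ray_rotation[where a = "\<phi>0 - pi" and b = "\<phi>0 + pi" and g = g, OF _ _ _ _ _ bound _ _ i0 i1])
    show "h holomorphic_on {w. \<phi>0 - pi < Im w \<and> Im w < \<phi>0 + pi}"
      unfolding h_def
    proof (intro holomorphic_intros)
      fix w assume "w \<in> {w. \<phi>0 - pi < Im w \<and> Im w < \<phi>0 + pi}"
      then have "cos ((Im w - \<phi>0) / 2) > 0" by (intro cos_gt_zero_pi) auto
      then have "0 < cos ((Im w - \<phi>0) / 2) * (exp (Re w) + r)" using r by (simp add: add_pos_pos)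
      also have "\<dots> \<le> norm (exp w + of_real r * cis \<phi>0)"
        unfolding exp_polar[of w] using r by (intro norm_add_polar) auto
      finally show "exp w + of_real r * cis \<phi>0 \<noteq> 0" by auto
    qed
    show "((\<lambda>q. q * g q) \<longlongrightarrow> 0) (at_right 0)" "((\<lambda>q. q * g q) \<longlongrightarrow> 0) at_top"
      using rho ee_pos r unfolding g_def by real_asymp+
  qed (use abs theta in auto)
  have "(LINT q:{0<..}|lborel. of_real (q powr (-\<rho>)) / (of_real r * \<omega> s + of_real q)) = (LINT q:{0<..}|lborel. h (Complex (ln q) 0))"
    by (intro set_lebesgue_integral_cong) (auto simp: h0)
  also have "\<dots> = (LINT q:{0<..}|lborel. cis \<phi>0 * h (Complex (ln q) \<phi>0))"
    using rot by simp
  also have "\<dots> = (LINT q:{0<..}|lborel. of_real (q powr (-\<rho>) / (q + r)) / \<omega>\<rho> s)"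
    by (intro set_lebesgue_integral_cong) (auto simp: h1)
  also have "\<dots> = of_real (LINT q:{0<..}|lborel. q powr (-\<rho>) / (q + r)) / \<omega>\<rho> s"
    by (simp only: set_integral_divide_zero set_integral_complex_of_real)
  finally show "(LINT q:{0<..}|lborel. of_real (q powr (-\<rho>)) / (of_real r * \<omega> s + of_real q)) =
      of_real (Gamma \<rho> * Gamma (1 - \<rho>) * r powr (-\<rho>)) / \<omega>\<rho> s"
    unfolding stieltjes_integral(2)[OF rho r] by (simp add: mult_ac)
qed

lemma sym_measurable [measurable]: "sym s l \<in> borel_measurable borel"
  unfolding sym_def by measurable

lemma sym_le:
  assumes "s \<in> {1, -1}" "l \<ge> 0" "r > 0"
  shows "norm (sym s l r) \<le> 1 / dd * (1 / (r powr \<rho> + l))" "norm (sym s l r) \<le> 1 / dd * r powr (-\<rho>)"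
proof -
  have p: "r powr \<rho> > 0" using assms by simp
  have "0 < dd * (r powr \<rho> + l)" using dd_pos p assms by (simp add: add_pos_nonneg)
  then show 1: "norm (sym s l r) \<le> 1 / dd * (1 / (r powr \<rho> + l))"
    using sym_bound[OF assms(1,2), of r] unfolding sym_def norm_divide
    by (simp add: divide_left_mono mult_pos_pos frac_le)
  have "1 / (r powr \<rho> + l) \<le> r powr (-\<rho>)"
    using p assms by (simp add: powr_minus_divide frac_le)
  then have "1 / dd * (1 / (r powr \<rho> + l)) \<le> 1 / dd * r powr (-\<rho>)"
    using dd_pos by (intro mult_left_mono) auto
  with 1 show "norm (sym s l r) \<le> 1 / dd * r powr (-\<rho>)" by linarith
qed

text \<open>Because l is positive, the symbol is bounded near r = 0, so any smaller power
  r^(-\<delta>) dominates it at the price of a constant depending on l. The resolvent equation needs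
  such a milder singularity.\<close>

lemma sym_le_delta:
  assumes "s \<in> {1, -1}" "l > 0" "r > 0" "0 \<le> \<delta>" "\<delta> \<le> \<rho>"
  shows "norm (sym s l r) \<le> 1 / (dd * min 1 l) * r powr (-\<delta>)"
proof -
  have "min 1 l * r powr \<delta> \<le> r powr \<rho> + l"
  proof (cases "r \<le> 1")
    case True
    then have "r powr \<delta> \<le> 1" using assms powr_le1[of \<delta> r] by simp
    then have "min 1 l * r powr \<delta> \<le> l * 1" using assms by (intro mult_mono) auto
    moreover have "r powr \<rho> \<ge> 0" by simp
    ultimately show ?thesis by linarith
  next
    case False
    then have "r powr \<delta> \<le> r powr \<rho>" using assms by (intro powr_mono) auto
    then have "min 1 l * r powr \<delta> \<le> 1 * r powr \<rho>" using assms by (intro mult_mono) auto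
    then show ?thesis using assms by linarith
  qed
  moreover have "min 1 l * r powr \<delta> > 0" using assms by simp
  ultimately have "1 / (r powr \<rho> + l) \<le> 1 / (min 1 l * r powr \<delta>)" by (intro frac_le) auto
  then have "1 / dd * (1 / (r powr \<rho> + l)) \<le> 1 / dd * (1 / (min 1 l * r powr \<delta>))"
    using dd_pos by (intro mult_left_mono) auto
  also have "\<dots> = 1 / (dd * min 1 l) * r powr (-\<delta>)" by (simp add: powr_minus_divide)
  finally show ?thesis using sym_le(1)[of s l r] assms by linarith
qed

text \<open>Both rays can be rotated to the positive axis without meeting a singularity. There they
  give the same integral, which the opposite orientations in \<open>c0\<close> cancel.\<close>

lemma sym_ray_cancel:
  assumes l: "l > 0" and q: "q > 0"
  shows "(\<Sum>s\<in>{1, -1}. c0 s * \<omega> s * (LINT r:{0<..}|lborel. sym s l r / (of_real r * \<omega> s + of_real q))) = 0"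
proof -
  define h where "h w = 1 / ((exp (of_real \<rho> * w) + of_real l * cis (- pi / 2)) * (exp w + of_real q * cis 0))" for w
  define g where "g r = 1 / ((dd * (r powr \<rho> + l)) * (ee * (r + q)))" for r
  \<comment> \<open>The first zeros of the two factors are at angle pi/(2\<rho>), where z^\<rho> = i
    l, and at angle pi, where z = -q.\<close>
  define b where "b = min pi (pi / (2 * \<rho>))"
  have b: "\<theta> < b" using theta rho by (auto simp: b_def field_simps)
  have h: "h (Complex (ln r) \<phi>) = 1 / ((of_real (r powr \<rho>) * cis (\<rho> * \<phi>) + of_real l * cis (- pi / 2)) * (of_real r * cis \<phi> + of_real q * cis 0))"
    if "r > 0" for r \<phi>
    unfolding h_def using that by (simp only: exp_Complex_ln exp_Complex_ln1)
  have dd_cos: "dd \<le> cos ((\<rho> * \<phi> - (- pi / 2)) / 2)" if "\<bar>\<phi>\<bar> \<le> \<theta>" for \<phi>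
  proof -
    have "\<bar>\<rho> * \<phi>\<bar> \<le> \<rho> * \<theta>" using that rho by (simp add: abs_mult)
    then have "cos (pi / 4 + \<rho> * \<theta> / 2) \<le> cos \<bar>(\<rho> * \<phi> - (- pi / 2)) / 2\<bar>"
      using theta by (intro cos_monotone_0_pi_le) (auto simp: abs_if split: if_splits)
    then show ?thesis by (simp only: dd_def cos_abs_real)
  qed
  have bound: "norm (h (Complex (ln r) \<phi>)) \<le> g r" if "r > 0" "\<bar>\<phi>\<bar> \<le> \<theta>" for r \<phi>
  proof -
    have "dd * (r powr \<rho> + l) \<le> cos ((\<rho> * \<phi> - (- pi / 2)) / 2) * (r powr \<rho> + l)"
      using l by (intro mult_right_mono dd_cos that) (auto intro: add_nonneg_nonneg)
    also have "\<dots> \<le> norm (of_real (r powr \<rho>) * cis (\<rho> * \<phi>) + of_real l * cis (- pi / 2))"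
      by (rule norm_add_polar) (use l in auto)
    finally have 1: "dd * (r powr \<rho> + l) \<le> norm (of_real (r powr \<rho>) * cis (\<rho> * \<phi>) + of_real l * cis (- pi / 2))" .
    have 2: "ee * (r + q) \<le> norm (of_real r * cis \<phi> + of_real q * cis 0)"
      using that q by (intro norm_ray_add) auto
    have p: "0 < dd * (r powr \<rho> + l)" "0 < ee * (r + q)"
      using dd_pos ee_pos l q that by (auto intro!: mult_pos_pos add_pos_pos)
    show ?thesis unfolding h[OF that(1)] g_def norm_divide norm_mult norm_one
      by (rule frac_le[OF _ _ mult_pos_pos[OF p] mult_mono[OF 1 2 norm_ge_zero less_imp_le[OF p(2)]]]) auto
  qed
  have gi: "set_integrable lborel {0<..} g"
  proof (rule set_integrable_dom[where g = "\<lambda>r. 1 / (dd * ee) * (r powr (-\<rho>) / (r + q))"])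
    show "set_integrable lborel {0<..} (\<lambda>r. 1 / (dd * ee) * (r powr (-\<rho>) / (r + q)))"
      by (intro set_integrable_mult_right stieltjes_integral(1) rho q)
    show "g \<in> borel_measurable borel" unfolding g_def by measurable
    fix r :: real assume "r \<in> {0<..}"
    then have r: "r > 0" by simp
    have "1 / (r powr \<rho> + l) \<le> r powr (-\<rho>)"
      using r l by (simp add: powr_minus_divide frac_le)
    then have "1 / (dd * ee * (r + q)) * (1 / (r powr \<rho> + l)) \<le> 1 / (dd * ee * (r + q)) * r powr (-\<rho>)"
      using dd_pos ee_pos r q by (intro mult_left_mono) auto
    moreover have "norm (g r) = 1 / (dd * ee * (r + q)) * (1 / (r powr \<rho> + l))"
      using dd_pos ee_pos r q l by (simp add: g_def abs_mult add_pos_pos mult_ac)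
    ultimately show "norm (g r) \<le> 1 / (dd * ee) * (r powr (-\<rho>) / (r + q))" by (simp add: mult_ac)
  qed auto
  have hm: "(\<lambda>r. h (Complex (ln r) \<phi>)) \<in> borel_measurable borel" for \<phi>
    unfolding h_def Complex_eq by measurable
  have hi: "set_integrable lborel {0<..} (\<lambda>r. h (Complex (ln r) \<phi>))" if "\<bar>\<phi>\<bar> \<le> \<theta>" for \<phi>
    by (rule set_integrable_dom[OF _ hm gi]) (use bound that in auto)
  have rot: "\<omega> s * (LINT r:{0<..}|lborel. sym s l r / (of_real r * \<omega> s + of_real q)) = (LINT r:{0<..}|lborel. h (Complex (ln r) 0))"
    if s: "s \<in> {1, -1}" for s
  proof -
    have abs: "\<bar>s * \<theta>\<bar> = \<theta>" using s theta by auto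
    have e: "sym s l r / (of_real r * \<omega> s + of_real q) = h (Complex (ln r) (s * \<theta>))" if "r > 0" for r
      unfolding h[OF that] by (simp add: sym_def \<omega>\<rho>_def \<omega>_def mult_ac cis_minus_pi_half)
    have "cis 0 * (LINT r:{0<..}|lborel. h (Complex (ln r) 0)) = cis (s * \<theta>) * (LINT r:{0<..}|lborel. h (Complex (ln r) (s * \<theta>)))"
    proof (rule ray_rotation[where a = "- b" and b = b and g = g, OF _ _ _ _ _ bound _ _ hi hi])
      show "h holomorphic_on {w. - b < Im w \<and> Im w < b}"
        unfolding h_def
      proof (intro holomorphic_intros)
        fix w assume w: "w \<in> {w. - b < Im w \<and> Im w < b}"
        then have w0: "\<bar>Im w\<bar> < b" by auto
        have "b \<le> pi / (2 * \<rho>)" by (simp add: b_def)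
        then have "\<rho> * b \<le> pi / 2" using rho by (simp add: field_simps)
        moreover have "\<bar>\<rho> * Im w\<bar> < \<rho> * b" using w0 rho by (simp add: abs_mult)
        ultimately have w1: "\<bar>Im w\<bar> < pi" "\<bar>\<rho> * Im w\<bar> < pi / 2"
          using w0 by (auto simp: b_def)
        have "cos ((Im w - 0) / 2) > 0" using w1 by (intro cos_gt_zero_pi) auto
        then have "0 < cos ((Im w - 0) / 2) * (exp (Re w) + q)" using q by (simp add: add_pos_pos)
        also have "\<dots> \<le> norm (exp w + of_real q * cis 0)"
          unfolding exp_polar[of w] using q by (intro norm_add_polar) auto
        finally have 1: "exp w + of_real q * cis 0 \<noteq> 0" by auto
        have "cos ((Im (of_real \<rho> * w) - (- pi / 2)) / 2) > 0" using w1 by (intro cos_gt_zero_pi) auto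
        then have "0 < cos ((Im (of_real \<rho> * w) - (- pi / 2)) / 2) * (exp (Re (of_real \<rho> * w)) + l)" using l by (simp add: add_pos_pos)
        also have "\<dots> \<le> norm (exp (of_real \<rho> * w) + of_real l * cis (- pi / 2))"
          unfolding exp_polar[of "of_real \<rho> * w"] using l by (intro norm_add_polar) auto
        finally have 2: "exp (of_real \<rho> * w) + of_real l * cis (- pi / 2) \<noteq> 0" by auto
        from 1 2 show "(exp (of_real \<rho> * w) + of_real l * cis (- pi / 2)) * (exp w + of_real q * cis 0) \<noteq> 0" by simp
      qed
      show "((\<lambda>q. q * g q) \<longlongrightarrow> 0) (at_right 0)" "((\<lambda>q. q * g q) \<longlongrightarrow> 0) at_top"
        using rho ee_pos dd_pos l q unfolding g_def by real_asymp+
      show "\<bar>\<phi>\<bar> \<le> \<theta>" if "\<phi> \<in> closed_segment 0 (s * \<theta>)" for \<phi>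
        using that abs by (auto simp: closed_segment_eq_real_ivl split: if_splits)
    qed (use abs theta b in \<open>auto simp: abs_if split: if_splits\<close>)
    moreover have "(LINT r:{0<..}|lborel. sym s l r / (of_real r * \<omega> s + of_real q)) = (LINT r:{0<..}|lborel. h (Complex (ln r) (s * \<theta>)))"
      by (intro set_lebesgue_integral_cong) (auto simp: e)
    ultimately show ?thesis by (simp add: \<omega>_def)
  qed
  then show ?thesis by (simp add: mult.assoc) (simp add: c0_def)
qed

text \<open>Hankel's formula for 1 / Gamma \<rho>. Both rays are turned onto the negative axis,
  where they give the same Gamma integral with conjugate phases; the difference of the phases is a
  sine, and the reflection formula finishes.\<close>

lemma hankel:
  assumes t: "t > 0"
  shows "s \<in> {1, -1} \<Longrightarrow> set_integrable lborel {0<..} (\<lambda>r. exp (of_real (t * r) * \<omega> s) * (of_real (r powr (-\<rho>)) / \<omega>\<rho> s))"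
    and "(\<Sum>s\<in>{1, -1}. c0 s * \<omega> s * (LINT r:{0<..}|lborel. exp (of_real (t * r) * \<omega> s) * (of_real (r powr (-\<rho>)) / \<omega>\<rho> s))) =
      of_real (t powr (\<rho> - 1) / Gamma \<rho>)"
proof -
  define h where "h w = exp (of_real t * exp w) * exp (of_real (-\<rho>) * w)" for w :: complex
  define g where "g r = r powr (-\<rho>) * exp (- (cc * t * r))" for r
  have h: "h (Complex (ln r) \<phi>) = exp (of_real t * (of_real r * cis \<phi>)) * (of_real (r powr (-\<rho>)) * cis (-\<rho> * \<phi>))"
    if "r > 0" for r \<phi>
    unfolding h_def using that by (simp only: exp_Complex_ln exp_Complex_ln1)
  have gi: "set_integrable lborel {0<..} g"
    unfolding g_def by (intro gamma_integral) (use rho cc_pos t in auto)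
  have bound: "norm (h (Complex (ln r) \<phi>)) \<le> g r" if "r > 0" "cos \<phi> \<le> - cc" for r \<phi>
  proof -
    have "t * r * cos \<phi> \<le> t * r * (- cc)" using t that by (intro mult_left_mono) auto
    then show ?thesis unfolding h[OF that(1)] g_def by (simp add: norm_mult mult_left_mono mult_ac)
  qed
  have hm: "(\<lambda>r. h (Complex (ln r) \<phi>)) \<in> borel_measurable borel" for \<phi>
    unfolding h_def Complex_eq by measurable
  have hi: "set_integrable lborel {0<..} (\<lambda>r. h (Complex (ln r) \<phi>))" if "cos \<phi> \<le> - cc" for \<phi>
    by (rule set_integrable_dom[OF _ hm gi]) (use bound that in auto)
  have cosle: "cos \<phi> \<le> - cc" if "\<theta> \<le> \<bar>\<phi>\<bar>" "\<bar>\<phi>\<bar> \<le> pi" for \<phi>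
    using cos_monotone_0_pi_le[of \<theta> "\<bar>\<phi>\<bar>"] theta that by (simp add: cc_def)
  have e: "exp (of_real (t * r) * \<omega> s) * (of_real (r powr (-\<rho>)) / \<omega>\<rho> s) = h (Complex (ln r) (s * \<theta>))" if "r > 0" for r s
    unfolding h[OF that] by (simp add: \<omega>_def \<omega>\<rho>_def mult_ac cis_inverse[symmetric] inverse_eq_divide)
  show int: "set_integrable lborel {0<..} (\<lambda>r. exp (of_real (t * r) * \<omega> s) * (of_real (r powr (-\<rho>)) / \<omega>\<rho> s))"
    if "s \<in> {1, -1}" for s
  proof (rule iffD2[OF set_integrable_cong hi])
    show "cos (s * \<theta>) \<le> - cc" using that by (auto simp: cc_def)
  qed (simp_all only: e greaterThan_iff)
  have rot: "\<omega> s * (LINT r:{0<..}|lborel. exp (of_real (t * r) * \<omega> s) * (of_real (r powr (-\<rho>)) / \<omega>\<rho> s)) =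
      - cis (- (s * (\<rho> * pi))) * of_real (Gamma (1 - \<rho>) * t powr (\<rho> - 1))"
    if s: "s \<in> {1, -1}" for s
  proof -
    have c: "cis (s * pi) = -1" "cis (pi * s) = -1" using s by (auto simp: complex_eq_iff)
    have "(LINT r:{0<..}|lborel. exp (of_real (t * r) * \<omega> s) * (of_real (r powr (-\<rho>)) / \<omega>\<rho> s)) = (LINT r:{0<..}|lborel. h (Complex (ln r) (s * \<theta>)))"
      by (rule set_lebesgue_integral_cong, simp, intro allI impI, rule e, simp)
    \<comment> \<open>In the logarithmic coordinate the integrand is entire, so any strip containing
      the angles up to pi in absolute value will do; half-width 4 exceeds pi.\<close>
    moreover have "cis (s * \<theta>) * (LINT r:{0<..}|lborel. h (Complex (ln r) (s * \<theta>))) = cis (s * pi) * (LINT r:{0<..}|lborel. h (Complex (ln r) (s * pi)))"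
    proof (rule ray_rotation[where a = "- 4" and b = 4 and g = g, OF _ _ _ _ _ bound _ _ hi hi])
      show "h holomorphic_on {w. - 4 < Im w \<and> Im w < 4}"
        unfolding h_def by (intro holomorphic_intros)
      show "((\<lambda>r. r * g r) \<longlongrightarrow> 0) (at_right 0)" "((\<lambda>r. r * g r) \<longlongrightarrow> 0) at_top"
        using rho cc_pos t unfolding g_def by real_asymp+
      show "cos \<phi> \<le> - cc" if "\<phi> \<in> closed_segment (s * \<theta>) (s * pi)" for \<phi>
        using that s theta by (intro cosle) (auto simp: closed_segment_eq_real_ivl split: if_splits)
    qed (use s theta pi_less_4 in \<open>auto intro!: cosle\<close>)
    moreover have "(LINT r:{0<..}|lborel. h (Complex (ln r) (s * pi))) = (LINT r:{0<..}|lborel. cis (- (s * (\<rho> * pi))) * of_real (r powr (-\<rho>) * exp (- (t * r))))"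
      by (intro set_lebesgue_integral_cong) (auto simp: h c mult_ac exp_of_real[symmetric])
    moreover have "\<dots> = cis (- (s * (\<rho> * pi))) * of_real (LINT r:{0<..}|lborel. r powr (-\<rho>) * exp (- (t * r)))"
      by (simp only: set_integral_mult_right set_integral_complex_of_real)
    moreover have "(LINT r:{0<..}|lborel. r powr (-\<rho>) * exp (- (t * r))) = Gamma (1 - \<rho>) * t powr (\<rho> - 1)"
      using gamma_integral(2)[of "-\<rho>" t] rho t powr_minus_divide[of t "1 - \<rho>"] by simp
    ultimately show ?thesis by (simp add: \<omega>_def c)
  qed
  have "(\<Sum>s\<in>{1, -1}. c0 s * \<omega> s * (LINT r:{0<..}|lborel. exp (of_real (t * r) * \<omega> s) * (of_real (r powr (-\<rho>)) / \<omega>\<rho> s))) =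
     (\<Sum>s\<in>{1, -1}. c0 s * (- cis (- (s * (\<rho> * pi))) * of_real (Gamma (1 - \<rho>) * t powr (\<rho> - 1))))"
    by (intro sum.cong refl) (simp only: mult.assoc rot)
  also have "\<dots> = (cis (\<rho> * pi) - cis (- (\<rho> * pi))) / (2 * pi * \<i>) * of_real (Gamma (1 - \<rho>) * t powr (\<rho> - 1))"
    by (simp add: c0_def diff_divide_distrib algebra_simps)
  also have "cis (\<rho> * pi) - cis (- (\<rho> * pi)) = 2 * \<i> * of_real (sin (pi * \<rho>))"
    by (simp add: complex_eq_iff mult.commute)
  also have "2 * \<i> * of_real (sin (pi * \<rho>)) / (2 * pi * \<i>) * of_real (Gamma (1 - \<rho>) * t powr (\<rho> - 1)) =
     of_real (sin (pi * \<rho>) / pi * (Gamma (1 - \<rho>) * t powr (\<rho> - 1)))"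
    by simp
  also have "sin (pi * \<rho>) / pi * (Gamma (1 - \<rho>) * t powr (\<rho> - 1)) = t powr (\<rho> - 1) / Gamma \<rho>"
  proof -
    have "Gamma \<rho> > 0" using rho by (intro Gamma_real_pos)
    then have "sin (pi * \<rho>) * Gamma (1 - \<rho>) = pi / Gamma \<rho>"
      using Gamma_reflection_sin[OF rho] by (simp add: field_simps)
    then have "sin (pi * \<rho>) * Gamma (1 - \<rho>) / pi * t powr (\<rho> - 1) = t powr (\<rho> - 1) / Gamma \<rho>" by simp
    then show ?thesis by simp
  qed
  finally show "(\<Sum>s\<in>{1, -1}. c0 s * \<omega> s * (LINT r:{0<..}|lborel. exp (of_real (t * r) * \<omega> s) * (of_real (r powr (-\<rho>)) / \<omega>\<rho> s))) =
      of_real (t powr (\<rho> - 1) / Gamma \<rho>)" .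
qed

end

section \<open>The resolvent equation\<close>

lemma set_integral_Icc_Ioo:
  fixes f :: "real \<Rightarrow> 'a::{banach, second_countable_topology}"
  assumes "a \<le> b"
  shows "(LINT u:{a..b}|lborel. f u) = (LINT u:{a<..<b}|lborel. f u)"
  by (rule set_integral_discrete_difference[where X = "{a, b}"]) (use assms in auto)

lemma exp_primitive:
  fixes w C :: complex
  assumes "w \<noteq> 0"
  shows "((\<lambda>u. C * exp (of_real u * w) / w) has_vector_derivative C * exp (of_real u * w)) (at u within S)"
proof -
  have "((\<lambda>z. C * exp (z * w) / w) has_field_derivative C * (exp (of_real u * w) * w) / w) (at (of_real u))"
    by (intro derivative_intros DERIV_cmult DERIV_cdivide) (auto intro!: derivative_eq_intros)
  then have "((\<lambda>z. C * exp (z * w) / w) has_field_derivative C * exp (of_real u * w)) (at (of_real u))"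
    using assms by simp
  from has_vector_derivative_real_field[OF this] show ?thesis
    by (rule has_vector_derivative_at_within)
qed

lemma beta_interval:
  fixes a b t :: real
  assumes "a > 0" "b > 0" "t > 0"
  shows "set_integrable lborel {0<..<t} (\<lambda>u. (t - u) powr (a - 1) * u powr (b - 1))"
    and "(LINT u:{0<..<t}|lborel. (t - u) powr (a - 1) * u powr (b - 1)) = Beta b a * t powr (a + b - 1)"
proof -
  have e: "(t - t * u) powr (a - 1) * (t * u) powr (b - 1) = t powr (a + b - 2) * (u powr (b - 1) * (1 - u) powr (a - 1))"
    if "u \<in> {0<..<1}" for u
  proof -
    have "t - t * u = t * (1 - u)" by (simp add: algebra_simps)
    then show ?thesis using that assms by (simp add: powr_mult powr_add[symmetric])
  qed
  have "set_integrable lborel {0<..<1} (\<lambda>u. t powr (a + b - 2) * (u powr (b - 1) * (1 - u) powr (a - 1)))"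
    by (intro set_integrable_mult_right beta_integral assms)
  then have "set_integrable lborel {0<..<1} (\<lambda>u. (t - t * u) powr (a - 1) * (t * u) powr (b - 1))"
    by (rule iffD2[OF set_integrable_cong, rotated 3]) (simp_all only: e)
  then show "set_integrable lborel {0<..<t} (\<lambda>u. (t - u) powr (a - 1) * u powr (b - 1))"
    using set_integral_scale_interval(2)[OF assms(3), of "\<lambda>u. (t - u) powr (a - 1) * u powr (b - 1)"] by blast
  have "(LINT u:{0<..<1}|lborel. (t - t * u) powr (a - 1) * (t * u) powr (b - 1)) = (LINT u:{0<..<1}|lborel. t powr (a + b - 2) * (u powr (b - 1) * (1 - u) powr (a - 1)))"
    by (intro set_lebesgue_integral_cong) (auto simp: e)
  also have "\<dots> = t powr (a + b - 2) * Beta b a"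
    using beta_integral(2)[OF assms(2,1)] by simp
  finally have "(LINT u:{0<..<t}|lborel. (t - u) powr (a - 1) * u powr (b - 1)) = t * (t powr (a + b - 2) * Beta b a)"
    using set_integral_scale_interval(1)[OF assms(3), of "\<lambda>u. (t - u) powr (a - 1) * u powr (b - 1)"] by simp
  moreover have "t * t powr (a + b - 2) = t powr (a + b - 1)"
    using assms powr_add[of t 1 "a + b - 2"] by simp
  ultimately show "(LINT u:{0<..<t}|lborel. (t - u) powr (a - 1) * u powr (b - 1)) = Beta b a * t powr (a + b - 1)"
    by (metis mult.assoc mult.commute)
qed

context fractional_order begin

definition resolvent :: "real \<Rightarrow> real \<Rightarrow> complex" where
  "resolvent l t = of_real (t powr (\<rho> - 1)) * eML (l * t powr \<rho>)"

text \<open>The symbol is homogeneous: replacing r by t r and l by l t^\<rho> multiplies it by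
  t^(-\<rho>). The substitution therefore moves all time dependence into the exponential.\<close>

lemma resolvent_contour:
  assumes t: "t > 0" 
  shows "resolvent l t = (\<Sum>s\<in>{1, -1}. c0 s * \<omega> s * (LINT r:{0<..}|lborel. exp (of_real (t * r) * \<omega> s) * sym s l r))"
proof -
  have *: "of_real (t powr (\<rho> - 1)) * (LINT r:{0<..}|lborel. exp (of_real r * \<omega> s) * sym s (l * t powr \<rho>) r) =
      (LINT r:{0<..}|lborel. exp (of_real (t * r) * \<omega> s) * sym s l r)" for s
  proof -
    have sy: "sym s (l * t powr \<rho>) (t * r) = of_real (t powr (-\<rho>)) * sym s l r" if "r > 0" for r
    proof -
      have "of_real ((t * r) powr \<rho>) * \<omega>\<rho> s - \<i> * of_real (l * t powr \<rho>) =
          of_real (t powr \<rho>) * (of_real (r powr \<rho>) * \<omega>\<rho> s - \<i> * of_real l)"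
        using t that by (simp add: powr_mult algebra_simps)
      then show ?thesis by (simp add: sym_def powr_minus inverse_eq_divide)
    qed
    have "of_real (t powr (\<rho> - 1)) * (LINT r:{0<..}|lborel. exp (of_real r * \<omega> s) * sym s (l * t powr \<rho>) r) =
        of_real (t powr (\<rho> - 1)) * (t *\<^sub>R (LINT r:{0<..}|lborel. exp (of_real (t * r) * \<omega> s) * sym s (l * t powr \<rho>) (t * r)))"
      by (subst set_integral_scale(1)[OF t]) simp
    also have "(LINT r:{0<..}|lborel. exp (of_real (t * r) * \<omega> s) * sym s (l * t powr \<rho>) (t * r)) =
        (LINT r:{0<..}|lborel. of_real (t powr (-\<rho>)) * (exp (of_real (t * r) * \<omega> s) * sym s l r))"
      by (intro set_lebesgue_integral_cong) (auto simp: sy)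
    also have "\<dots> = of_real (t powr (-\<rho>)) * (LINT r:{0<..}|lborel. exp (of_real (t * r) * \<omega> s) * sym s l r)"
      by (rule set_integral_mult_right)
    also have "of_real (t powr (\<rho> - 1)) * (t *\<^sub>R (of_real (t powr (-\<rho>)) * z)) = z" for z :: complex
    proof -
      have "t powr (\<rho> - 1) * (t * t powr (-\<rho>)) = t powr (\<rho> - 1) * (t powr 1 * t powr (-\<rho>))"
        using t by (simp only: powr_one less_imp_le)
      also have "\<dots> = t powr (\<rho> - 1 + (1 + -\<rho>))" by (simp only: powr_add)
      also have "\<dots> = 1" using t by simp
      finally have "t powr (\<rho> - 1) * (t * t powr (-\<rho>)) = 1" .
      then have "complex_of_real (t powr (\<rho> - 1) * (t * t powr (-\<rho>))) * z = z" by simp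
      then show ?thesis by (simp add: scaleR_conv_of_real mult_ac)
    qed
    finally show ?thesis .
  qed
  show ?thesis
    unfolding resolvent_def eML_def sum_distrib_left *[symmetric] by (intro sum.cong refl) (simp add: mult_ac)
qed

lemma exp_ray_norm: "s \<in> {1, -1} \<Longrightarrow> norm (exp (of_real x * \<omega> s)) = exp (- (cc * x))"
  using Re_omega by (simp add: mult.commute)

lemma ray_integrable:
  assumes "s \<in> {1, -1}" "l \<ge> 0" "t > 0"
  shows "set_integrable lborel {0<..} (\<lambda>r. exp (of_real (t * r) * \<omega> s) * sym s l r)"
    and "(LINT r:{0<..}|lborel. norm (exp (of_real (t * r) * \<omega> s) * sym s l r)) \<le> 1 / dd * (Gamma (1 - \<rho>) / (cc * t) powr (1 - \<rho>))"
proof -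
  have p: "cc * t > 0" using cc_pos assms by simp
  note g = gamma_integral[of "-\<rho>" "cc * t", OF _ p]
  have gi: "set_integrable lborel {0<..} (\<lambda>r. 1 / dd * (r powr (-\<rho>) * exp (- (cc * t * r))))"
    using rho by (intro set_integrable_mult_right g) auto
  have b: "norm (exp (of_real (t * r) * \<omega> s) * sym s l r) \<le> 1 / dd * (r powr (-\<rho>) * exp (- (cc * t * r)))" if "r \<in> {0<..}" for r
  proof -
    have "exp (- (cc * (t * r))) * norm (sym s l r) \<le> exp (- (cc * (t * r))) * (1 / dd * r powr (-\<rho>))"
      using sym_le(2)[OF assms(1,2)] that by (intro mult_left_mono) auto
    then show ?thesis unfolding norm_mult exp_ray_norm[OF assms(1)] by (simp only: mult_ac)
  qed
  have m: "(\<lambda>r. exp (of_real (t * r) * \<omega> s) * sym s l r) \<in> borel_measurable borel" by measurable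
  show "set_integrable lborel {0<..} (\<lambda>r. exp (of_real (t * r) * \<omega> s) * sym s l r)"
    by (rule set_integrable_dom[OF _ m gi b]) auto
  have "norm (LINT r:{0<..}|lborel. norm (exp (of_real (t * r) * \<omega> s) * sym s l r)) \<le> (LINT r:{0<..}|lborel. 1 / dd * (r powr (-\<rho>) * exp (- (cc * t * r))))"
    by (rule set_integral_norm_le[OF gi]) (use b in auto)
  also have "\<dots> = 1 / dd * (Gamma (1 - \<rho>) / (cc * t) powr (1 - \<rho>))"
    using g(2) rho by simp
  finally show "(LINT r:{0<..}|lborel. norm (exp (of_real (t * r) * \<omega> s) * sym s l r)) \<le> 1 / dd * (Gamma (1 - \<rho>) / (cc * t) powr (1 - \<rho>))"
    by simp
qed

definition frac_kernel :: "real \<Rightarrow> real \<Rightarrow> real" where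
  "frac_kernel a t = t powr (a - 1) / Gamma a"

lemma frac_kernel_measurable [measurable]: "frac_kernel a \<in> borel_measurable borel"
  unfolding frac_kernel_def by measurable

text \<open>Written as a superposition of exp (-q (t - u)) over q, the power kernel makes the
  convolution with exp (u z) elementary. The upper limit gives z^(-\<rho>) exp (t z) by
  \<open>stieltjes_ray\<close>; the lower limit gives the correction term.\<close>

lemma frac_kernel_conv_exp:
  assumes s: "s \<in> {1, -1}" and r: "r > 0" and t: "t > 0"
  defines "z \<equiv> of_real r * \<omega> s"
  defines "c \<equiv> complex_of_real (1 / (Gamma \<rho> * Gamma (1 - \<rho>)))"
  shows "(LINT u:{0<..<t}|lborel. of_real (frac_kernel \<rho> (t - u)) * exp (of_real u * z)) =
     exp (of_real t * z) * (of_real (r powr (-\<rho>)) / \<omega>\<rho> s) - c * (LINT q:{0<..}|lborel. of_real (q powr (-\<rho>) * exp (- (q * t))) / (z + of_real q))"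
proof -
  have Gp: "Gamma \<rho> > 0" "Gamma (1 - \<rho>) > 0" using rho by (auto intro: Gamma_real_pos)
  define f where "f u q = complex_of_real (q powr (-\<rho>) * exp (- (q * (t - u)))) * exp (of_real u * z)" for u q
  have nz: "norm (exp (of_real u * z)) \<le> 1" if "u > 0" for u
  proof -
    have "norm (exp (of_real (u * r) * \<omega> s)) \<le> 1"
      unfolding exp_ray_norm[OF s] using cc_pos r that by simp
    then show ?thesis by (simp add: z_def mult_ac)
  qed
  have fm: "(\<lambda>(u, q). f u q) \<in> borel_measurable borel"
    unfolding f_def borel_prod[symmetric] by measurable
  have g: "set_integrable lborel {0<..} (\<lambda>q. q powr (-\<rho>) * exp (- (q * (t - u))))"
    "(LINT q:{0<..}|lborel. q powr (-\<rho>) * exp (- (q * (t - u)))) = Gamma (1 - \<rho>) * (t - u) powr (\<rho> - 1)" if "u < t" for u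
    using gamma_integral[of "-\<rho>" "t - u"] rho that powr_minus_divide[of "t - u" "1 - \<rho>"]
    by (simp_all add: mult.commute)
  have gi: "set_integrable lborel {0<..<t} (\<lambda>u. Gamma (1 - \<rho>) * (t - u) powr (\<rho> - 1))"
  proof (intro set_integrable_mult_right)
    have "set_integrable lborel {0<..<t} (\<lambda>u. (t - u) powr (\<rho> - 1) * u powr (1 - 1))"
      using rho t by (intro beta_interval(1)) auto
    then show "set_integrable lborel {0<..<t} (\<lambda>u. (t - u) powr (\<rho> - 1))"
      by (rule iffD1[OF set_integrable_cong, rotated 3]) auto
  qed
  have fi: "set_integrable lborel {0<..} (f u)" if "u \<in> {0<..<t}" for u
    unfolding f_def using that by (intro set_integrable_mult_left set_integrable_of_real g) auto
  have fb: "(LINT q:{0<..}|lborel. norm (f u q)) \<le> Gamma (1 - \<rho>) * (t - u) powr (\<rho> - 1)" if "u \<in> {0<..<t}" for u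
  proof -
    have "norm (LINT q:{0<..}|lborel. norm (f u q)) \<le> (LINT q:{0<..}|lborel. q powr (-\<rho>) * exp (- (q * (t - u))))"
    proof (rule set_integral_norm_le)
      show "norm (norm (f u q)) \<le> q powr (-\<rho>) * exp (- (q * (t - u)))" for q
        using nz[of u] that mult_left_le[of "norm (exp (of_real u * z))" "q powr (-\<rho>) * exp (- (q * (t - u)))"]
        by (simp add: f_def norm_mult)
    qed (use that g in auto)
    then show ?thesis using g(2) that by simp
  qed
  note F = set_Fubini(1)[where A = "{0<..<t}" and B = "{0<..}" and f = f, OF _ _ fm fi gi fb, simplified]
  have i1: "c * (LINT q:{0<..}|lborel. f u q) = of_real (frac_kernel \<rho> (t - u)) * exp (of_real u * z)" if "u \<in> {0<..<t}" for u
  proof -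
    have "(LINT q:{0<..}|lborel. f u q) = of_real (Gamma (1 - \<rho>) * (t - u) powr (\<rho> - 1)) * exp (of_real u * z)"
      using that by (simp only: f_def set_integral_mult_left set_integral_complex_of_real g(2) greaterThanLessThan_iff)
    then show ?thesis using Gp by (simp add: c_def frac_kernel_def)
  qed
  have zq: "z + of_real q \<noteq> 0" if "q > 0" for q
  proof -
    have "0 < ee * (r + q)" using ee_pos r that by simp
    also have "\<dots> \<le> norm (z + of_real q)" unfolding z_def by (rule norm_omega_add[OF s]) (use r that in auto)
    finally show ?thesis by auto
  qed
  have i2: "(LINT u:{0<..<t}|lborel. f u q) = of_real (q powr (-\<rho>)) / (z + of_real q) * exp (of_real t * z) - of_real (q powr (-\<rho>) * exp (- (q * t))) / (z + of_real q)"
    if "q > 0" for q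
  proof -
    define F where "F u = complex_of_real (q powr (-\<rho>)) * exp (- of_real (q * t)) * exp (of_real u * (z + of_real q)) / (z + of_real q)" for u
    have fe: "f u q = complex_of_real (q powr (-\<rho>)) * exp (- of_real (q * t)) * exp (of_real u * (z + of_real q))" for u
    proof -
      have "- complex_of_real (q * t) + of_real u * (z + of_real q) = of_real (- (q * (t - u))) + of_real u * z"
        by (simp add: algebra_simps)
      then show ?thesis by (simp only: f_def mult.assoc of_real_mult exp_add[symmetric] exp_of_real[symmetric])
    qed
    have "(LINT u:{0..t}|lborel. f u q) = F t - F 0"
      unfolding set_lebesgue_integral_def
    proof (rule integral_FTC_atLeastAtMost)
      show "(F has_vector_derivative f u q) (at u within {0..t})" for u
        unfolding F_def fe by (rule exp_primitive[OF zq[OF that]])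
      show "continuous_on {0..t} (\<lambda>u. f u q)" unfolding fe by (intro continuous_intros)
    qed (use t in auto)
    also have "(LINT u:{0..t}|lborel. f u q) = (LINT u:{0<..<t}|lborel. f u q)"
      by (rule set_integral_Icc_Ioo) (use t in simp)
    also have "F t = of_real (q powr (-\<rho>)) / (z + of_real q) * exp (of_real t * z)"
    proof -
      have "- complex_of_real (q * t) + of_real t * (z + of_real q) = of_real t * z" by (simp add: algebra_simps)
      then have "exp (- complex_of_real (q * t)) * exp (of_real t * (z + of_real q)) = exp (of_real t * z)"
        by (simp only: exp_add[symmetric])
      then show ?thesis by (simp add: F_def)
    qed
    also have "F 0 = of_real (q powr (-\<rho>) * exp (- (q * t))) / (z + of_real q)"
      by (simp add: F_def flip: exp_of_real)
    finally show ?thesis by simp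
  qed
  have j1: "set_integrable lborel {0<..} (\<lambda>q. of_real (q powr (-\<rho>)) / (z + of_real q) * exp (of_real t * z))"
    unfolding z_def by (intro set_integrable_mult_left stieltjes_ray s r)
  have j2: "set_integrable lborel {0<..} (\<lambda>q. of_real (q powr (-\<rho>) * exp (- (q * t))) / (z + of_real q))"
  proof (rule set_integrable_bound[OF stieltjes_ray(1)[OF s r]])
    show "set_borel_measurable lborel {0<..} (\<lambda>q. of_real (q powr (-\<rho>) * exp (- (q * t))) / (z + of_real q))"
      unfolding set_borel_measurable_def by measurable
    have "norm (of_real (q powr (-\<rho>) * exp (- (q * t))) / (z + of_real q)) \<le> norm (of_real (q powr (-\<rho>)) / (z + of_real q))" if "q > 0" for q
      using t that mult_left_le[of "exp (- (q * t))" "q powr - \<rho>"] by (simp add: norm_divide norm_mult divide_right_mono)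
    then show "AE q in lborel. q \<in> {0<..} \<longrightarrow> norm (of_real (q powr (-\<rho>) * exp (- (q * t))) / (z + of_real q)) \<le> norm (of_real (q powr (-\<rho>)) / (of_real r * \<omega> s + of_real q))"
      by (auto simp: z_def)
  qed
  have "(LINT u:{0<..<t}|lborel. of_real (frac_kernel \<rho> (t - u)) * exp (of_real u * z)) = (LINT u:{0<..<t}|lborel. c * (LINT q:{0<..}|lborel. f u q))"
    by (intro set_lebesgue_integral_cong) (auto simp: i1)
  also have "\<dots> = c * (LINT q:{0<..}|lborel. LINT u:{0<..<t}|lborel. f u q)"
    by (simp only: set_integral_mult_right F)
  also have "(LINT q:{0<..}|lborel. LINT u:{0<..<t}|lborel. f u q) =
     (LINT q:{0<..}|lborel. of_real (q powr (-\<rho>)) / (z + of_real q) * exp (of_real t * z) - of_real (q powr (-\<rho>) * exp (- (q * t))) / (z + of_real q))"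
    by (intro set_lebesgue_integral_cong) (auto simp: i2)
  also have "\<dots> = (LINT q:{0<..}|lborel. of_real (q powr (-\<rho>)) / (z + of_real q) * exp (of_real t * z)) - (LINT q:{0<..}|lborel. of_real (q powr (-\<rho>) * exp (- (q * t))) / (z + of_real q))"
    by (intro set_integral_diff j1 j2)
  also have "(LINT q:{0<..}|lborel. of_real (q powr (-\<rho>)) / (z + of_real q) * exp (of_real t * z)) =
     of_real (Gamma \<rho> * Gamma (1 - \<rho>) * r powr (-\<rho>)) / \<omega>\<rho> s * exp (of_real t * z)"
    by (simp only: z_def set_integral_mult_left stieltjes_ray(2)[OF s r])
  also have "c * (of_real (Gamma \<rho> * Gamma (1 - \<rho>) * r powr (-\<rho>)) / \<omega>\<rho> s * exp (of_real t * z) - X) =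
     exp (of_real t * z) * (of_real (r powr (-\<rho>)) / \<omega>\<rho> s) - c * X" for X
    using Gp by (simp add: c_def right_diff_distrib)
  finally show ?thesis .
qed

text \<open>Inside the contour integral, i l \<open>sym\<close> z^(-\<rho>) = \<open>sym\<close> -
  z^(-\<rho>). The first term is the resolvent again, the second is Hankel's integral for the power
  kernel, and the corrections of the two rays annihilate each other.\<close>

lemma resolvent_equation:
  assumes l: "l > 0" and t: "t > 0"
  shows "resolvent l t = of_real (frac_kernel \<rho> t) + \<i> * of_real l * (LINT u:{0<..<t}|lborel. of_real (frac_kernel \<rho> (t - u)) * resolvent l u)"
proof -
  define c where "c = complex_of_real (1 / (Gamma \<rho> * Gamma (1 - \<rho>)))"
  have Gp: "Gamma \<rho> > 0" "Gamma (1 - \<rho>) > 0" using rho by (auto intro: Gamma_real_pos)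
  define E where "E s r = exp (of_real (t * r) * \<omega> s)" for s r
  define Q where "Q s r = (LINT q:{0<..}|lborel. of_real (q powr (-\<rho>) * exp (- (q * t))) / (of_real r * \<omega> s + of_real q))" for s r
  have step1: "set_integrable lborel {0<..<t} (\<lambda>u. of_real (frac_kernel \<rho> (t - u)) * (LINT r:{0<..}|lborel. exp (of_real (u * r) * \<omega> s) * sym s l r))"
    "(LINT u:{0<..<t}|lborel. of_real (frac_kernel \<rho> (t - u)) * (LINT r:{0<..}|lborel. exp (of_real (u * r) * \<omega> s) * sym s l r)) =
     (LINT r:{0<..}|lborel. sym s l r * (LINT u:{0<..<t}|lborel. of_real (frac_kernel \<rho> (t - u)) * exp (of_real u * (of_real r * \<omega> s))))"
    if s: "s \<in> {1, -1}" for s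
  proof -
    define f where "f u r = of_real (frac_kernel \<rho> (t - u)) * (exp (of_real (u * r) * \<omega> s) * sym s l r)" for u r
    have fm: "(\<lambda>(u, r). f u r) \<in> borel_measurable borel"
      unfolding f_def borel_prod[symmetric] by measurable
    have fi: "set_integrable lborel {0<..} (f u)" if "u \<in> {0<..<t}" for u
      unfolding f_def using that l s by (intro set_integrable_mult_right ray_integrable) auto
    define K where "K = 1 / Gamma \<rho> * (1 / dd * (Gamma (1 - \<rho>) / cc powr (1 - \<rho>)))"
    have gi: "set_integrable lborel {0<..<t} (\<lambda>u. K * ((t - u) powr (\<rho> - 1) * u powr (\<rho> - 1)))"
      by (intro set_integrable_mult_right beta_interval rho t)
    have fb: "(LINT r:{0<..}|lborel. norm (f u r)) \<le> K * ((t - u) powr (\<rho> - 1) * u powr (\<rho> - 1))" if "u \<in> {0<..<t}" for u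
    proof -
      have k: "frac_kernel \<rho> (t - u) \<ge> 0" using Gp by (simp add: frac_kernel_def)
      have "(LINT r:{0<..}|lborel. norm (f u r)) = frac_kernel \<rho> (t - u) * (LINT r:{0<..}|lborel. norm (exp (of_real (u * r) * \<omega> s) * sym s l r))"
        using k by (simp only: f_def norm_mult[of "of_real (frac_kernel \<rho> (t - u))"] norm_of_real abs_of_nonneg set_integral_mult_right)
      also have "\<dots> \<le> frac_kernel \<rho> (t - u) * (1 / dd * (Gamma (1 - \<rho>) / (cc * u) powr (1 - \<rho>)))"
        using k that l s by (intro mult_left_mono ray_integrable) auto
      also have "(cc * u) powr (1 - \<rho>) = cc powr (1 - \<rho>) / u powr (\<rho> - 1)"
        using that cc_pos powr_minus_divide[of u "1 - \<rho>"] by (simp add: powr_mult)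
      finally show ?thesis by (simp add: K_def frac_kernel_def mult_ac)
    qed
    note F = set_Fubini[where A = "{0<..<t}" and B = "{0<..}" and f = f, OF _ _ fm fi gi fb, simplified]
    have e: "(LINT r:{0<..}|lborel. f u r) = of_real (frac_kernel \<rho> (t - u)) * (LINT r:{0<..}|lborel. exp (of_real (u * r) * \<omega> s) * sym s l r)" for u
      by (simp only: f_def set_integral_mult_right)
    have e2: "(LINT u:{0<..<t}|lborel. f u r) = sym s l r * (LINT u:{0<..<t}|lborel. of_real (frac_kernel \<rho> (t - u)) * exp (of_real u * (of_real r * \<omega> s)))" for r
    proof -
      have "f u r = sym s l r * (of_real (frac_kernel \<rho> (t - u)) * exp (of_real u * (of_real r * \<omega> s)))" for u
        by (simp add: f_def mult_ac)
      then show ?thesis by (simp only: set_integral_mult_right)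
    qed
    show "set_integrable lborel {0<..<t} (\<lambda>u. of_real (frac_kernel \<rho> (t - u)) * (LINT r:{0<..}|lborel. exp (of_real (u * r) * \<omega> s) * sym s l r))"
      using F(2) by (simp only: e)
    show "(LINT u:{0<..<t}|lborel. of_real (frac_kernel \<rho> (t - u)) * (LINT r:{0<..}|lborel. exp (of_real (u * r) * \<omega> s) * sym s l r)) =
     (LINT r:{0<..}|lborel. sym s l r * (LINT u:{0<..<t}|lborel. of_real (frac_kernel \<rho> (t - u)) * exp (of_real u * (of_real r * \<omega> s))))"
      using F(1) by (simp only: e e2)
  qed
  \<comment> \<open>The decay r^(-\<delta>) must leave the Stieltjes integral over r convergent and
    turn q^(-\<rho>) into q^(-\<rho>-\<delta>), which has to stay integrable at 0; hence 0 <
    \<delta> \<le> \<rho> and \<rho> + \<delta> < 1.\<close>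
  define \<delta> where "\<delta> = min \<rho> ((1 - \<rho>) / 2)"
  have d: "0 < \<delta>" "\<delta> \<le> \<rho>" "\<rho> + \<delta> < 1" "\<delta> < 1" using rho by (auto simp: \<delta>_def min_def field_simps)
  have step3: "set_integrable lborel {0<..} (\<lambda>r. sym s l r * Q s r)"
    "(LINT r:{0<..}|lborel. sym s l r * Q s r) = (LINT q:{0<..}|lborel. of_real (q powr (-\<rho>) * exp (- (q * t))) * (LINT r:{0<..}|lborel. sym s l r / (of_real r * \<omega> s + of_real q)))"
    "set_integrable lborel {0<..} (\<lambda>q. of_real (q powr (-\<rho>) * exp (- (q * t))) * (LINT r:{0<..}|lborel. sym s l r / (of_real r * \<omega> s + of_real q)))"
    if s: "s \<in> {1, -1}" for s
  proof -
    define f where "f q r = of_real (q powr (-\<rho>) * exp (- (q * t))) * (sym s l r / (of_real r * \<omega> s + of_real q))" for q r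
    define K where "K = 1 / (dd * min 1 l) * (1 / ee)"
    have Kp: "K > 0" using dd_pos ee_pos l by (simp add: K_def)
    have fm: "(\<lambda>(q, r). f q r) \<in> borel_measurable borel"
      unfolding f_def borel_prod[symmetric] by measurable
    have sb: "norm (sym s l r / (of_real r * \<omega> s + of_real q)) \<le> K * (r powr (-\<delta>) / (r + q))" if "r > 0" "q > 0" for r q
    proof -
      have "norm (sym s l r / (of_real r * \<omega> s + of_real q)) \<le> (1 / (dd * min 1 l) * r powr (-\<delta>)) / (ee * (r + q))"
        unfolding norm_divide using that d ee_pos dd_pos l
        by (intro frac_le sym_le_delta norm_omega_add s l) auto
      then show ?thesis by (simp add: K_def)
    qed
    have si: "set_integrable lborel {0<..} (\<lambda>r. K * (r powr (-\<delta>) / (r + q)))" if "q > 0" for q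
      using that d by (intro set_integrable_mult_right stieltjes_integral) auto
    have i0: "set_integrable lborel {0<..} (\<lambda>r. sym s l r / (of_real r * \<omega> s + of_real q))" if "q > 0" for q
      by (rule set_integrable_dom[OF _ _ si[OF that]]) (use sb that in auto)
    have fi: "set_integrable lborel {0<..} (f q)" if "q \<in> {0<..}" for q
      unfolding f_def using that by (intro set_integrable_mult_right i0) auto
    define L where "L = K * (Gamma (1 - \<delta>) * Gamma \<delta>)"
    have gi: "set_integrable lborel {0<..} (\<lambda>q. L * (q powr (-(\<rho> + \<delta>)) * exp (- (t * q))))"
      using d t by (intro set_integrable_mult_right gamma_integral) auto
    have fb: "(LINT r:{0<..}|lborel. norm (f q r)) \<le> L * (q powr (-(\<rho> + \<delta>)) * exp (- (t * q)))" if "q \<in> {0<..}" for q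
    proof -
      have q: "q > 0" using that by simp
      have "(LINT r:{0<..}|lborel. norm (f q r)) = (q powr (-\<rho>) * exp (- (q * t))) * (LINT r:{0<..}|lborel. norm (sym s l r / (of_real r * \<omega> s + of_real q)))"
      proof -
        have "norm (f q r) = (q powr (-\<rho>) * exp (- (q * t))) * norm (sym s l r / (of_real r * \<omega> s + of_real q))" for r
          by (simp add: f_def norm_mult norm_divide)
        then show ?thesis by (simp only: set_integral_mult_right)
      qed
      also have "\<dots> \<le> (q powr (-\<rho>) * exp (- (q * t))) * (K * (Gamma (1 - \<delta>) * Gamma \<delta> * q powr (-\<delta>)))"
      proof (rule mult_left_mono)
        have "norm (LINT r:{0<..}|lborel. norm (sym s l r / (of_real r * \<omega> s + of_real q))) \<le> (LINT r:{0<..}|lborel. K * (r powr (-\<delta>) / (r + q)))"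
          by (rule set_integral_norm_le[OF si[OF q]]) (use sb q in auto)
        also have "\<dots> = K * (Gamma (1 - \<delta>) * Gamma \<delta> * q powr (-\<delta>))"
          by (simp only: set_integral_mult_right stieltjes_integral(2)[OF d(1,4) q])
        finally show "(LINT r:{0<..}|lborel. norm (sym s l r / (of_real r * \<omega> s + of_real q))) \<le> K * (Gamma (1 - \<delta>) * Gamma \<delta> * q powr (-\<delta>))"
          by simp
      qed simp
      also have "\<dots> = L * ((q powr (-\<rho>) * q powr (-\<delta>)) * exp (- (t * q)))"
        by (simp add: L_def mult_ac)
      also have "q powr (-\<rho>) * q powr (-\<delta>) = q powr (-(\<rho> + \<delta>))"
        by (simp add: powr_add[symmetric])
      finally show ?thesis .
    qed
    note F = set_Fubini[where A = "{0<..}" and B = "{0<..}" and f = f, OF _ _ fm fi gi fb, simplified]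
    have e: "(LINT r:{0<..}|lborel. f q r) = of_real (q powr (-\<rho>) * exp (- (q * t))) * (LINT r:{0<..}|lborel. sym s l r / (of_real r * \<omega> s + of_real q))" for q
      by (simp only: f_def set_integral_mult_right)
    have e2: "(LINT q:{0<..}|lborel. f q r) = sym s l r * Q s r" for r
    proof -
      have "f q r = sym s l r * (of_real (q powr (-\<rho>) * exp (- (q * t))) / (of_real r * \<omega> s + of_real q))" for q
        by (simp add: f_def mult_ac)
      then show ?thesis by (simp only: Q_def set_integral_mult_right)
    qed
    show "set_integrable lborel {0<..} (\<lambda>r. sym s l r * Q s r)" using F(3) by (simp only: e2)
    show "(LINT r:{0<..}|lborel. sym s l r * Q s r) = (LINT q:{0<..}|lborel. of_real (q powr (-\<rho>) * exp (- (q * t))) * (LINT r:{0<..}|lborel. sym s l r / (of_real r * \<omega> s + of_real q)))"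
      using F(1) by (simp only: e e2)
    show "set_integrable lborel {0<..} (\<lambda>q. of_real (q powr (-\<rho>) * exp (- (q * t))) * (LINT r:{0<..}|lborel. sym s l r / (of_real r * \<omega> s + of_real q)))"
      using F(2) by (simp only: e)
  qed
  \<comment> \<open>With the q-integral moved outside, the sum over the two rays vanishes for each
    fixed q by \<open>sym_ray_cancel\<close>.\<close>
  have cancel: "(\<Sum>s\<in>{1, -1}. c0 s * \<omega> s * (LINT r:{0<..}|lborel. sym s l r * Q s r)) = 0"
  proof -
    define G where "G s q = of_real (q powr (-\<rho>) * exp (- (q * t))) * (LINT r:{0<..}|lborel. sym s l r / (of_real r * \<omega> s + of_real q))" for s q
    have "(\<Sum>s\<in>{1, -1}. c0 s * \<omega> s * (LINT r:{0<..}|lborel. sym s l r * Q s r)) = (\<Sum>s\<in>{1, -1}. (LINT q:{0<..}|lborel. c0 s * \<omega> s * G s q))"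
      by (intro sum.cong refl) (simp only: step3(2) G_def set_integral_mult_right)
    also have "\<dots> = (LINT q:{0<..}|lborel. c0 1 * \<omega> 1 * G 1 q + c0 (-1) * \<omega> (-1) * G (-1) q)"
      using step3(3) by (subst set_integral_add(2)) (auto simp: G_def)
    also have "\<dots> = (LINT q:{0::real<..}|lborel. 0)"
    proof (rule set_lebesgue_integral_cong)
      show "\<forall>q. q \<in> {0<..} \<longrightarrow> c0 1 * \<omega> 1 * G 1 q + c0 (-1) * \<omega> (-1) * G (-1) q = 0"
      proof (intro allI impI)
      fix q :: real assume "q \<in> {0<..}"
      then have "(\<Sum>s\<in>{1, -1}. c0 s * \<omega> s * (LINT r:{0<..}|lborel. sym s l r / (of_real r * \<omega> s + of_real q))) = 0"
        by (intro sym_ray_cancel l) auto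
      then have "of_real (q powr (-\<rho>) * exp (- (q * t))) * (\<Sum>s\<in>{1, -1}. c0 s * \<omega> s * (LINT r:{0<..}|lborel. sym s l r / (of_real r * \<omega> s + of_real q))) = 0"
        by simp
      then show "c0 1 * \<omega> 1 * G 1 q + c0 (-1) * \<omega> (-1) * G (-1) q = 0"
        by (simp add: G_def distrib_left mult_ac)
      qed
    qed simp
    finally show ?thesis by simp
  qed
  have step2: "\<i> * of_real l * (LINT r:{0<..}|lborel. sym s l r * (LINT u:{0<..<t}|lborel. of_real (frac_kernel \<rho> (t - u)) * exp (of_real u * (of_real r * \<omega> s)))) =
     (LINT r:{0<..}|lborel. E s r * sym s l r) - (LINT r:{0<..}|lborel. E s r * (of_real (r powr (-\<rho>)) / \<omega>\<rho> s)) - \<i> * of_real l * c * (LINT r:{0<..}|lborel. sym s l r * Q s r)"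
    if s: "s \<in> {1, -1}" for s
  proof -
    have "\<i> * of_real l * (LINT r:{0<..}|lborel. sym s l r * (LINT u:{0<..<t}|lborel. of_real (frac_kernel \<rho> (t - u)) * exp (of_real u * (of_real r * \<omega> s)))) =
      (LINT r:{0<..}|lborel. \<i> * of_real l * (sym s l r * (LINT u:{0<..<t}|lborel. of_real (frac_kernel \<rho> (t - u)) * exp (of_real u * (of_real r * \<omega> s)))))"
      by (rule set_integral_mult_right[symmetric])
    also have "\<dots> = (LINT r:{0<..}|lborel. (E s r * sym s l r - E s r * (of_real (r powr (-\<rho>)) / \<omega>\<rho> s)) - \<i> * of_real l * c * (sym s l r * Q s r))"
    proof (intro set_lebesgue_integral_cong allI impI)
      fix r :: real assume "r \<in> {0<..}"
      then have r: "r > 0" by simp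
      have nz: "of_real (r powr \<rho>) * \<omega>\<rho> s - \<i> * of_real l \<noteq> 0"
      proof -
        have "0 < dd * (r powr \<rho> + l)" using dd_pos l by (simp add: add_nonneg_pos)
        also have "\<dots> \<le> norm (of_real (r powr \<rho>) * \<omega>\<rho> s - \<i> * of_real l)" by (rule sym_bound[OF s]) (use l in simp)
        finally show ?thesis by auto
      qed
      \<comment> \<open>This is the resolvent identity for the symbol, divided by z^\<rho> in the
        claim \<open>m\<close>.\<close>
      have "(of_real (r powr \<rho>) * \<omega>\<rho> s - \<i> * of_real l) * sym s l r = 1" using nz by (simp add: sym_def)
      then have "\<i> * of_real l * sym s l r = of_real (r powr \<rho>) * \<omega>\<rho> s * sym s l r - 1" by (simp add: algebra_simps)
      then have m: "\<i> * of_real l * sym s l r * (of_real (r powr (-\<rho>)) / \<omega>\<rho> s) = sym s l r - of_real (r powr (-\<rho>)) / \<omega>\<rho> s"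
      proof -
        have gen: "(R * w * y - 1) * (1 / R / w) = y - 1 / R / w" if "R \<noteq> 0" "w \<noteq> 0" for R w y :: complex
          using that by (simp add: field_simps)
        have R: "of_real (r powr (-\<rho>)) = 1 / complex_of_real (r powr \<rho>)" by (simp add: powr_minus_divide)
        show ?thesis unfolding \<open>\<i> * of_real l * sym s l r = of_real (r powr \<rho>) * \<omega>\<rho> s * sym s l r - 1\<close> R
          using r by (intro gen) auto
      qed
      show "\<i> * of_real l * (sym s l r * (LINT u:{0<..<t}|lborel. of_real (frac_kernel \<rho> (t - u)) * exp (of_real u * (of_real r * \<omega> s)))) =
        (E s r * sym s l r - E s r * (of_real (r powr (-\<rho>)) / \<omega>\<rho> s)) - \<i> * of_real l * c * (sym s l r * Q s r)"
      proof -
        have Ee: "exp (of_real t * (of_real r * \<omega> s)) = E s r" by (simp add: E_def mult_ac)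
        have X: "\<i> * of_real l * (sym s l r * (E s r * (of_real (r powr (-\<rho>)) / \<omega>\<rho> s) - c * Q s r)) =
          E s r * (\<i> * of_real l * sym s l r * (of_real (r powr (-\<rho>)) / \<omega>\<rho> s)) - \<i> * of_real l * c * (sym s l r * Q s r)"
          by (simp add: right_diff_distrib mult_ac)
        show ?thesis
          unfolding frac_kernel_conv_exp[OF s r t] Q_def[symmetric] c_def[symmetric] Ee
          unfolding X m by (simp only: right_diff_distrib)
      qed
    qed simp
    also have "\<dots> = (LINT r:{0<..}|lborel. E s r * sym s l r) - (LINT r:{0<..}|lborel. E s r * (of_real (r powr (-\<rho>)) / \<omega>\<rho> s)) - \<i> * of_real l * c * (LINT r:{0<..}|lborel. sym s l r * Q s r)"
    proof -
      have i1: "set_integrable lborel {0<..} (\<lambda>r. E s r * sym s l r)"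
        unfolding E_def by (rule ray_integrable(1)[OF s less_imp_le[OF l] t])
      have i2: "set_integrable lborel {0<..} (\<lambda>r. E s r * (of_real (r powr (-\<rho>)) / \<omega>\<rho> s))"
        unfolding E_def by (rule hankel(1)[OF t s])
      have i3: "set_integrable lborel {0<..} (\<lambda>r. \<i> * of_real l * c * (sym s l r * Q s r))"
        by (rule set_integrable_mult_right) (rule step3(1)[OF s])
      show ?thesis
        by (simp only: set_integral_diff(2)[OF set_integral_diff(1)[OF i1 i2] i3] set_integral_diff(2)[OF i1 i2] set_integral_mult_right)
    qed
    finally show ?thesis .
  qed
  have "(LINT u:{0<..<t}|lborel. of_real (frac_kernel \<rho> (t - u)) * resolvent l u) =
     (LINT u:{0<..<t}|lborel. (c0 1 * \<omega> 1) * (of_real (frac_kernel \<rho> (t - u)) * (LINT r:{0<..}|lborel. exp (of_real (u * r) * \<omega> 1) * sym 1 l r)) +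
       (c0 (-1) * \<omega> (-1)) * (of_real (frac_kernel \<rho> (t - u)) * (LINT r:{0<..}|lborel. exp (of_real (u * r) * \<omega> (-1)) * sym (-1) l r)))"
    by (intro set_lebesgue_integral_cong allI impI) (simp_all add: resolvent_contour distrib_left mult_ac)
  also have "\<dots> = (\<Sum>s\<in>{1, -1}. (c0 s * \<omega> s) * (LINT r:{0<..}|lborel. sym s l r * (LINT u:{0<..<t}|lborel. of_real (frac_kernel \<rho> (t - u)) * exp (of_real u * (of_real r * \<omega> s)))))"
    using step1 by (subst set_integral_add(2)) (auto simp: set_integral_mult_right)
  finally have "\<i> * of_real l * (LINT u:{0<..<t}|lborel. of_real (frac_kernel \<rho> (t - u)) * resolvent l u) =
     (\<Sum>s\<in>{1, -1}. (c0 s * \<omega> s) * (\<i> * of_real l * (LINT r:{0<..}|lborel. sym s l r * (LINT u:{0<..<t}|lborel. of_real (frac_kernel \<rho> (t - u)) * exp (of_real u * (of_real r * \<omega> s))))))"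
    by (simp add: distrib_left mult_ac)
  also have "\<dots> = (\<Sum>s\<in>{1, -1}. c0 s * \<omega> s * (LINT r:{0<..}|lborel. E s r * sym s l r)) - (\<Sum>s\<in>{1, -1}. c0 s * \<omega> s * (LINT r:{0<..}|lborel. E s r * (of_real (r powr (-\<rho>)) / \<omega>\<rho> s)))
      - \<i> * of_real l * c * (\<Sum>s\<in>{1, -1}. c0 s * \<omega> s * (LINT r:{0<..}|lborel. sym s l r * Q s r))"
    unfolding sum_distrib_left sum_subtractf[symmetric] by (intro sum.cong refl) (simp only: step2, simp only: right_diff_distrib mult_ac)
  also have "(\<Sum>s\<in>{1, -1}. c0 s * \<omega> s * (LINT r:{0<..}|lborel. E s r * sym s l r)) = resolvent l t"
    unfolding resolvent_contour[OF t] E_def ..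
  also have "(\<Sum>s\<in>{1, -1}. c0 s * \<omega> s * (LINT r:{0<..}|lborel. E s r * (of_real (r powr (-\<rho>)) / \<omega>\<rho> s))) = of_real (frac_kernel \<rho> t)"
    unfolding E_def hankel(2)[OF t] frac_kernel_def ..
  finally have R: "\<i> * of_real l * (LINT u:{0<..<t}|lborel. of_real (frac_kernel \<rho> (t - u)) * resolvent l u) = resolvent l t - of_real (frac_kernel \<rho> t)
      - \<i> * of_real l * c * (\<Sum>s\<in>{1, -1}. c0 s * \<omega> s * (LINT r:{0<..}|lborel. sym s l r * Q s r))" .
  show ?thesis unfolding R cancel by simp
qed

end

section \<open>Convolution of weakly singular functions\<close>

lemma set_integral_nonneg:
  fixes f :: "real \<Rightarrow> real"
  assumes "\<And>x. x \<in> A \<Longrightarrow> 0 \<le> f x"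
  shows "0 \<le> (LINT x:A|M. f x)"
  unfolding set_lebesgue_integral_def using assms by (intro integral_nonneg_AE AE_I2) (auto split: split_indicator)

definition conv :: "(real \<Rightarrow> complex) \<Rightarrow> (real \<Rightarrow> complex) \<Rightarrow> real \<Rightarrow> complex" where
  "conv f g t = (LINT s:{0<..<t}|lborel. f (t - s) * g s)"

text \<open>Only measurability and a power bound are required, so the class is closed under
  \<open>conv\<close> with exponents adding, and the algebra of convolutions reduces to Fubini with
  Beta integrals as bounds.\<close>

definition weakly_singular :: "real \<Rightarrow> real \<Rightarrow> (real \<Rightarrow> complex) \<Rightarrow> bool" where
  "weakly_singular T \<alpha> f \<longleftrightarrow> f \<in> borel_measurable borel \<and> (\<exists>C\<ge>0. \<forall>s\<in>{0<..T}. norm (f s) \<le> C * s powr (\<alpha> - 1))"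

lemma weakly_singular_bound:
  assumes "weakly_singular T \<alpha> f"
  obtains C where "C \<ge> 0" "\<And>s. 0 < s \<Longrightarrow> s \<le> T \<Longrightarrow> norm (f s) \<le> C * s powr (\<alpha> - 1)"
  using assms by (auto simp: weakly_singular_def)

lemma conv_integrable:
  assumes f: "weakly_singular T \<alpha> f" and g: "weakly_singular T \<beta> g" and ab: "\<alpha> > 0" "\<beta> > 0" and t: "0 < t" "t \<le> T"
  shows "set_integrable lborel {0<..<t} (\<lambda>s. f (t - s) * g s)"
proof -
  obtain C where C: "C \<ge> 0" "\<And>s. 0 < s \<Longrightarrow> s \<le> T \<Longrightarrow> norm (f s) \<le> C * s powr (\<alpha> - 1)" using weakly_singular_bound[OF f] by blast
  obtain D where D: "D \<ge> 0" "\<And>s. 0 < s \<Longrightarrow> s \<le> T \<Longrightarrow> norm (g s) \<le> D * s powr (\<beta> - 1)" using weakly_singular_bound[OF g] by blast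
  have [measurable]: "f \<in> borel_measurable borel" "g \<in> borel_measurable borel" using f g by (auto simp: weakly_singular_def)
  show ?thesis
  proof (rule set_integrable_dom[where g = "\<lambda>s. C * D * ((t - s) powr (\<alpha> - 1) * s powr (\<beta> - 1))"])
    show "set_integrable lborel {0<..<t} (\<lambda>s. C * D * ((t - s) powr (\<alpha> - 1) * s powr (\<beta> - 1)))"
      by (intro set_integrable_mult_right beta_interval ab t)
    fix s assume s: "s \<in> {0<..<t}"
    have "norm (f (t - s)) * norm (g s) \<le> (C * (t - s) powr (\<alpha> - 1)) * (D * s powr (\<beta> - 1))"
      using s t C D by (intro mult_mono) auto
    then show "norm (f (t - s) * g s) \<le> C * D * ((t - s) powr (\<alpha> - 1) * s powr (\<beta> - 1))"
      by (simp add: norm_mult mult_ac)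
  qed measurable
qed

lemma weakly_singular_conv:
  assumes f: "weakly_singular T \<alpha> f" and g: "weakly_singular T \<beta> g" and ab: "\<alpha> > 0" "\<beta> > 0"
  shows "weakly_singular T (\<alpha> + \<beta>) (conv f g)"
    and "\<exists>C\<ge>0. \<forall>t\<in>{0<..T}. (LINT s:{0<..<t}|lborel. norm (f (t - s) * g s)) \<le> C * t powr (\<alpha> + \<beta> - 1)"
proof -
  obtain C where C: "C \<ge> 0" "\<And>s. 0 < s \<Longrightarrow> s \<le> T \<Longrightarrow> norm (f s) \<le> C * s powr (\<alpha> - 1)" using weakly_singular_bound[OF f] by blast
  obtain D where D: "D \<ge> 0" "\<And>s. 0 < s \<Longrightarrow> s \<le> T \<Longrightarrow> norm (g s) \<le> D * s powr (\<beta> - 1)" using weakly_singular_bound[OF g] by blast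
  have [measurable]: "f \<in> borel_measurable borel" "g \<in> borel_measurable borel" using f g by (auto simp: weakly_singular_def)
  define K where "K = max 0 (C * D * Beta \<beta> \<alpha>)"
  have b: "(LINT s:{0<..<t}|lborel. C * D * ((t - s) powr (\<alpha> - 1) * s powr (\<beta> - 1))) \<le> K * t powr (\<alpha> + \<beta> - 1)" if "t > 0" for t
  proof -
    have "(LINT s:{0<..<t}|lborel. C * D * ((t - s) powr (\<alpha> - 1) * s powr (\<beta> - 1))) = C * D * Beta \<beta> \<alpha> * t powr (\<alpha> + \<beta> - 1)"
      by (simp only: set_integral_mult_right beta_interval(2)[OF ab that] mult.assoc)
    also have "\<dots> \<le> K * t powr (\<alpha> + \<beta> - 1)" by (intro mult_right_mono) (auto simp: K_def)
    finally show ?thesis .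
  qed
  have i: "set_integrable lborel {0<..<t} (\<lambda>s. C * D * ((t - s) powr (\<alpha> - 1) * s powr (\<beta> - 1)))" if "t > 0" for t
    by (intro set_integrable_mult_right beta_interval ab that)
  have n: "norm (f (t - s) * g s) \<le> C * D * ((t - s) powr (\<alpha> - 1) * s powr (\<beta> - 1))" if "t \<le> T" "s \<in> {0<..<t}" for s t
  proof -
    have "norm (f (t - s)) * norm (g s) \<le> (C * (t - s) powr (\<alpha> - 1)) * (D * s powr (\<beta> - 1))"
      using that C D by (intro mult_mono) auto
    then show ?thesis by (simp add: norm_mult mult_ac)
  qed
  have "norm (conv f g t) \<le> K * t powr (\<alpha> + \<beta> - 1)" if "t \<in> {0<..T}" for t
    unfolding conv_def using that by (intro order_trans[OF set_integral_norm_le[OF i] b] n) auto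
  moreover have "conv f g \<in> borel_measurable borel"
  proof -
    have "conv f g = (\<lambda>t. LINT s|lborel. (if 0 < s \<and> s < t then f (t - s) * g s else 0))"
      unfolding conv_def set_lebesgue_integral_def by (intro ext Bochner_Integration.integral_cong) (auto simp: indicator_def)
    moreover have "(\<lambda>t. LINT s|lborel. (if 0 < s \<and> s < t then f (t - s) * g s else 0)) \<in> borel_measurable borel"
      by measurable
    ultimately show ?thesis by simp
  qed
  ultimately show "weakly_singular T (\<alpha> + \<beta>) (conv f g)"
    unfolding weakly_singular_def by (auto intro!: exI[of _ K] simp: K_def)
  have "(LINT s:{0<..<t}|lborel. norm (f (t - s) * g s)) \<le> K * t powr (\<alpha> + \<beta> - 1)" if "t \<in> {0<..T}" for t
  proof -
    have "norm (LINT s:{0<..<t}|lborel. norm (f (t - s) * g s)) \<le> (LINT s:{0<..<t}|lborel. C * D * ((t - s) powr (\<alpha> - 1) * s powr (\<beta> - 1)))"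
      using that by (intro set_integral_norm_le i) (auto intro!: n)
    then show ?thesis using b[of t] that by auto
  qed
  then show "\<exists>C\<ge>0. \<forall>t\<in>{0<..T}. (LINT s:{0<..<t}|lborel. norm (f (t - s) * g s)) \<le> C * t powr (\<alpha> + \<beta> - 1)"
    by (intro exI[of _ K]) (auto simp: K_def)
qed

lemma conv_commute: "conv f g t = conv g f t"
proof -
  have "conv f g t = \<bar>-1\<bar> *\<^sub>R (LINT s|lborel. indicator {0<..<t} (t + (-1) * s) *\<^sub>R (f (t - (t + (-1) * s)) * g (t + (-1) * s)))"
    unfolding conv_def set_lebesgue_integral_def by (rule lborel_integral_real_affine) simp
  also have "\<dots> = conv g f t"
    unfolding conv_def set_lebesgue_integral_def
    by (simp, intro Bochner_Integration.integral_cong) (auto simp: indicator_def)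
  finally show ?thesis .
qed

lemma conv_cong:
  assumes "\<And>s. 0 < s \<Longrightarrow> s < t \<Longrightarrow> f s = f' s" "\<And>s. 0 < s \<Longrightarrow> s < t \<Longrightarrow> g s = g' s"
  shows "conv f g t = conv f' g' t"
  unfolding conv_def by (intro set_lebesgue_integral_cong) (auto simp: assms)

lemma conv_cmult: "conv f (\<lambda>s. c * g s) t = c * conv f g t"
proof -
  have "(\<lambda>s. f (t - s) * (c * g s)) = (\<lambda>s. c * (f (t - s) * g s))" by (simp add: mult_ac)
  then show ?thesis by (simp add: conv_def)
qed

lemma conv_add:
  assumes "weakly_singular T \<alpha> f" "weakly_singular T \<beta> g" "weakly_singular T \<gamma> h" "\<alpha> > 0" "\<beta> > 0" "\<gamma> > 0" "0 < t" "t \<le> T"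
  shows "conv f (\<lambda>s. g s + h s) t = conv f g t + conv f h t"
  unfolding conv_def distrib_left
  by (rule set_integral_add(2)[OF conv_integrable[OF assms(1,2,4,5,7,8)] conv_integrable[OF assms(1,3,4,6,7,8)]])

lemma set_integral_indicator_sub:
  fixes h :: "real \<Rightarrow> complex"
  assumes "A \<subseteq> B"
  shows "(LINT r:B|lborel. indicator A r * h r) = (LINT r:A|lborel. h r)"
    and "set_integrable lborel B (\<lambda>r. indicator A r * h r) \<longleftrightarrow> set_integrable lborel A h"
proof -
  have "(\<lambda>r. indicator B r *\<^sub>R (indicator A r * h r)) = (\<lambda>r. indicator A r *\<^sub>R h r)"
    using assms by (intro ext) (auto split: split_indicator)
  then show "(LINT r:B|lborel. indicator A r * h r) = (LINT r:A|lborel. h r)"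
    "set_integrable lborel B (\<lambda>r. indicator A r * h r) \<longleftrightarrow> set_integrable lborel A h"
    by (simp_all add: set_lebesgue_integral_def set_integrable_def)
qed

lemma conv_assoc:
  assumes f: "weakly_singular T \<alpha> f" and g: "weakly_singular T \<beta> g" and h: "weakly_singular T \<gamma> h" and abc: "\<alpha> > 0" "\<beta> > 0" "\<gamma> > 0"
    and t: "0 < t" "t \<le> T"
  shows "conv f (conv g h) t = conv (conv f g) h t"
proof -
  have [measurable]: "f \<in> borel_measurable borel" "g \<in> borel_measurable borel" "h \<in> borel_measurable borel"
    using f g h by (auto simp: weakly_singular_def)
  \<comment> \<open>The indicator extends the triangle r < s < t to a square, so that Fubini applies
    on a product.\<close>
  define F where "F s r = f (t - s) * (indicator {0<..<s} r * (g (s - r) * h r))" for s r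
  obtain C where C: "C \<ge> 0" "\<And>s. 0 < s \<Longrightarrow> s \<le> T \<Longrightarrow> norm (f s) \<le> C * s powr (\<alpha> - 1)" using weakly_singular_bound[OF f] by blast
  obtain D where D: "D \<ge> 0" "\<And>s. s \<in> {0<..T} \<Longrightarrow> (LINT r:{0<..<s}|lborel. norm (g (s - r) * h r)) \<le> D * s powr (\<beta> + \<gamma> - 1)"
    using weakly_singular_conv(2)[OF g h abc(2,3)] by auto
  have Fm: "(\<lambda>(s, r). F s r) \<in> borel_measurable borel"
  proof -
    have "(\<lambda>(s, r). F s r) = (\<lambda>(s, r). if 0 < r \<and> r < s then f (t - s) * (g (s - r) * h r) else 0)"
      by (auto simp: F_def indicator_def)
    also have "\<dots> \<in> borel_measurable (borel \<Otimes>\<^sub>M borel)" by measurable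
    finally show ?thesis by (simp add: borel_prod)
  qed
  have Fi: "set_integrable lborel {0<..<t} (F s)" if "s \<in> {0<..<t}" for s
    unfolding F_def using that t conv_integrable[OF g h abc(2,3), of s]
    by (intro set_integrable_mult_right iffD2[OF set_integral_indicator_sub(2)]) auto
  have Fb: "(LINT r:{0<..<t}|lborel. norm (F s r)) \<le> C * D * ((t - s) powr (\<alpha> - 1) * s powr (\<beta> + \<gamma> - 1))" if s: "s \<in> {0<..<t}" for s
  proof -
    have "(LINT r:{0<..<t}|lborel. norm (F s r)) = norm (f (t - s)) * (LINT r:{0<..<t}|lborel. indicator {0<..<s} r * norm (g (s - r) * h r))"
      unfolding F_def norm_mult[of "f (t - s)"] set_integral_mult_right
      by (intro arg_cong2[where f = "(*)"] refl set_lebesgue_integral_cong) (auto simp: indicator_def)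
    also have "(LINT r:{0<..<t}|lborel. indicator {0<..<s} r * norm (g (s - r) * h r)) = (LINT r:{0<..<s}|lborel. norm (g (s - r) * h r))"
      unfolding set_lebesgue_integral_def using s by (intro Bochner_Integration.integral_cong) (auto simp: indicator_def)
    also have "norm (f (t - s)) * \<dots> \<le> (C * (t - s) powr (\<alpha> - 1)) * (D * s powr (\<beta> + \<gamma> - 1))"
      using s t C D by (intro mult_mono) (auto intro!: set_integral_nonneg)
    finally show ?thesis by (simp add: mult_ac)
  qed
  have Gi: "set_integrable lborel {0<..<t} (\<lambda>s. C * D * ((t - s) powr (\<alpha> - 1) * s powr (\<beta> + \<gamma> - 1)))"
    using abc t by (intro set_integrable_mult_right beta_interval) auto
  have "conv f (conv g h) t = (LINT s:{0<..<t}|lborel. LINT r:{0<..<t}|lborel. F s r)"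
    unfolding conv_def
  proof (intro set_lebesgue_integral_cong allI impI)
    fix s assume s: "s \<in> {0<..<t}"
    have "(LINT r:{0<..<t}|lborel. F s r) = f (t - s) * (LINT r:{0<..<t}|lborel. indicator {0<..<s} r * (g (s - r) * h r))"
      unfolding F_def by (rule set_integral_mult_right)
    also have "(LINT r:{0<..<t}|lborel. indicator {0<..<s} r * (g (s - r) * h r)) = (LINT r:{0<..<s}|lborel. g (s - r) * h r)"
      by (rule set_integral_indicator_sub) (use s in auto)
    finally show "f (t - s) * (LINT r:{0<..<s}|lborel. g (s - r) * h r) = (LINT r:{0<..<t}|lborel. F s r)" by simp
  qed simp
  also have "\<dots> = (LINT r:{0<..<t}|lborel. LINT s:{0<..<t}|lborel. F s r)"
    by (rule set_Fubini(1)[OF _ _ Fm Fi Gi Fb]) auto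
  also have "\<dots> = conv (conv f g) h t"
    unfolding conv_def
  proof (intro set_lebesgue_integral_cong allI impI)
    fix r assume r: "r \<in> {0<..<t}"
    have "(LINT s:{0<..<t}|lborel. F s r) = (LINT s|lborel. indicator {r<..<t} s *\<^sub>R (f (t - s) * (g (s - r) * h r)))"
      unfolding set_lebesgue_integral_def using r by (intro Bochner_Integration.integral_cong) (auto simp: F_def indicator_def)
    also have "\<dots> = \<bar>1\<bar> *\<^sub>R (LINT s|lborel. indicator {r<..<t} (r + 1 * s) *\<^sub>R (f (t - (r + 1 * s)) * (g ((r + 1 * s) - r) * h r)))"
      by (rule lborel_integral_real_affine) simp
    also have "\<dots> = (LINT s:{0<..<t - r}|lborel. (f (t - r - s) * g s) * h r)"
      unfolding set_lebesgue_integral_def by (simp, intro Bochner_Integration.integral_cong) (auto simp: indicator_def algebra_simps)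
    also have "\<dots> = (LINT s:{0<..<t - r}|lborel. f (t - r - s) * g s) * h r"
      by (rule set_integral_mult_left)
    finally show "(LINT s:{0<..<t}|lborel. F s r) = (LINT s:{0<..<t - r}|lborel. f (t - r - s) * g s) * h r" .
  qed simp
  finally show ?thesis .
qed

lemma weakly_singular_const: "weakly_singular T 1 (\<lambda>_. c)"
  unfolding weakly_singular_def by (auto intro!: exI[of _ "norm c"])

lemma weakly_singular_cmult: "weakly_singular T \<alpha> f \<Longrightarrow> weakly_singular T \<alpha> (\<lambda>s. c * f s)"
  unfolding weakly_singular_def
proof safe
  fix C assume "C \<ge> 0" "\<forall>s\<in>{0<..T}. norm (f s) \<le> C * s powr (\<alpha> - 1)"
  then show "\<exists>C\<ge>0. \<forall>s\<in>{0<..T}. norm (c * f s) \<le> C * s powr (\<alpha> - 1)"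
    by (intro exI[of _ "norm c * C"]) (auto simp: norm_mult mult.assoc intro!: mult_left_mono)
qed auto

context fractional_order begin

lemma weakly_singular_frac_kernel:
  assumes "a > 0"
  shows "weakly_singular T a (\<lambda>t. of_real (frac_kernel a t))"
  unfolding weakly_singular_def
proof safe
  have "Gamma a > 0" using assms by (rule Gamma_real_pos)
  then show "\<exists>C\<ge>0. \<forall>s\<in>{0<..T}. norm (complex_of_real (frac_kernel a s)) \<le> C * s powr (a - 1)"
    by (intro exI[of _ "1 / Gamma a"]) (auto simp: frac_kernel_def norm_divide)
qed measurable

lemma conv_frac_kernel:
  assumes "a > 0" "b > 0" "t > 0"
  shows "conv (\<lambda>t. of_real (frac_kernel a t)) (\<lambda>t. of_real (frac_kernel b t)) t = of_real (frac_kernel (a + b) t)"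
proof -
  have G: "Gamma a > 0" "Gamma b > 0" "Gamma (a + b) > 0" using assms by (auto intro!: Gamma_real_pos)
  have "conv (\<lambda>t. of_real (frac_kernel a t)) (\<lambda>t. of_real (frac_kernel b t)) t =
      (LINT s:{0<..<t}|lborel. of_real (1 / (Gamma a * Gamma b) * ((t - s) powr (a - 1) * s powr (b - 1))))"
    unfolding conv_def by (simp add: frac_kernel_def mult_ac)
  also have "\<dots> = of_real (1 / (Gamma a * Gamma b) * (Beta b a * t powr (a + b - 1)))"
    by (simp only: set_integral_complex_of_real set_integral_mult_right beta_interval(2)[OF assms])
  also have "1 / (Gamma a * Gamma b) * (Beta b a * t powr (a + b - 1)) = frac_kernel (a + b) t"
    using G by (simp add: Beta_def frac_kernel_def add.commute)
  finally show ?thesis .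
qed

lemma eML_measurable [measurable]: "eML \<in> borel_measurable borel"
  unfolding eML_def set_lebesgue_integral_def sym_def by measurable

definition "n0norm = (LINT y:{0<..}|lborel. norm (N0 y))"

lemma n0norm_nonneg: "0 \<le> n0norm"
  unfolding n0norm_def by (intro set_integral_nonneg) auto

lemma N0_norm_integrable: "set_integrable lborel {0<..} (\<lambda>y. norm (N0 y))"
  using integrable_norm[OF N0_integrable[unfolded set_integrable_def]] by (simp add: set_integrable_def)

text \<open>The bound is uniform in \<open>l\<close>: the cosine representation at \<kappa> = sqrt l
  replaces l-dependent estimates of the symbol.\<close>

lemma eML_bound:
  assumes "l \<ge> 0"
  shows "norm (eML l) \<le> 2 * n0norm"
proof -
  have "norm (LINT y:{0<..}|lborel. N0 y * of_real (2 * cos (sqrt l * y))) \<le> (LINT y:{0<..}|lborel. 2 * norm (N0 y))"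
  proof (rule set_integral_norm_le)
    show "set_integrable lborel {0<..} (\<lambda>y. 2 * norm (N0 y))"
      by (intro set_integrable_mult_right N0_norm_integrable)
    show "norm (N0 y * of_real (2 * cos (sqrt l * y))) \<le> 2 * norm (N0 y)" for y
    proof -
      have "norm (N0 y) * \<bar>2 * cos (sqrt l * y)\<bar> \<le> norm (N0 y) * 2"
        using abs_cos_le_one[of "sqrt l * y"] by (intro mult_left_mono) (auto simp only: abs_mult, auto)
      then show ?thesis unfolding norm_mult norm_of_real by (simp only: mult.commute)
    qed
  qed
  then show ?thesis using assms unfolding N0_cos n0norm_def by simp
qed

lemma weakly_singular_resolvent:
  assumes "l \<ge> 0"
  shows "weakly_singular T \<rho> (resolvent l)"
  unfolding weakly_singular_def
proof safe
  show "resolvent l \<in> borel_measurable borel" unfolding resolvent_def by measurable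
  show "\<exists>C\<ge>0. \<forall>s\<in>{0<..T}. norm (resolvent l s) \<le> C * s powr (\<rho> - 1)"
  proof (intro exI[of _ "2 * n0norm"] conjI ballI)
    fix s assume "s \<in> {0<..T}"
    then have "norm (eML (l * s powr \<rho>)) \<le> 2 * n0norm" using assms by (intro eML_bound) auto
    then show "norm (resolvent l s) \<le> 2 * n0norm * s powr (\<rho> - 1)"
      by (simp add: resolvent_def norm_mult mult.commute mult_left_mono)
  qed (simp add: n0norm_nonneg)
qed

text \<open>Write S for the resolvent, k and k' for the kernels of order \<rho> and 1 - \<rho>. From
  k' * k = 1 and the resolvent equation, S * k' = 1 + i l (1 * S). Convolving the given equation
  with S, the terms containing S * U cancel and Duhamel's formula remains. It appears integrated
  once because the argument never differentiates; the outer integral is removed later by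
  continuity.\<close>

lemma scalar_representation:
  assumes l: "l > 0" and U: "weakly_singular T \<rho> U" and F: "weakly_singular T \<rho> F"
    and eq: "\<And>t. 0 < t \<Longrightarrow> t \<le> T \<Longrightarrow> conv (\<lambda>t. of_real (frac_kernel (1 - \<rho>) t)) U t =
       \<phi> + \<i> * of_real l * conv (\<lambda>_. 1) U t - \<i> * conv (\<lambda>_. 1) F t"
    and t: "0 < t" "t \<le> T"
  shows "conv (\<lambda>_. 1) U t = conv (\<lambda>_. 1) (\<lambda>t. \<phi> * resolvent l t - \<i> * conv (resolvent l) F t) t"
proof -
  define S where "S = resolvent l"
  define k where "k = (\<lambda>t. complex_of_real (frac_kernel \<rho> t))"
  define k' where "k' = (\<lambda>t. complex_of_real (frac_kernel (1 - \<rho>) t))"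
  let ?il = "\<i> * of_real l"
  have r: "0 < \<rho>" "0 < 1 - \<rho>" "(0::real) < 1" using rho by auto
  have S: "weakly_singular T \<rho> S" unfolding S_def using l by (intro weakly_singular_resolvent) auto
  have k: "weakly_singular T \<rho> k" "weakly_singular T (1 - \<rho>) k'" unfolding k_def k'_def by (intro weakly_singular_frac_kernel r)+
  have one: "weakly_singular T 1 (\<lambda>_. 1)" by (rule weakly_singular_const)
  have Seq: "S t = k t + ?il * conv k S t" if "0 < t" for t
    unfolding S_def k_def conv_def by (rule resolvent_equation[OF l that])
  have kk: "conv k' k t = 1" if "0 < t" for t
    using conv_frac_kernel[of "1 - \<rho>" \<rho> t] r that by (simp add: k_def k'_def frac_kernel_def Gamma_1)
  have kS: "weakly_singular T (\<rho> + \<rho>) (conv k S)" using weakly_singular_conv(1)[OF k(1) S] r by simp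
  have SU: "weakly_singular T (\<rho> + \<rho>) (conv S U)" "weakly_singular T (\<rho> + \<rho>) (conv S F)"
    using weakly_singular_conv(1)[OF S U] weakly_singular_conv(1)[OF S F] r by auto
  have oU: "weakly_singular T (1 + \<rho>) (conv (\<lambda>_. 1) U)" "weakly_singular T (1 + \<rho>) (conv (\<lambda>_. 1) F)" "weakly_singular T (1 + \<rho>) (conv (\<lambda>_. 1) S)"
    using weakly_singular_conv(1)[OF one U] weakly_singular_conv(1)[OF one F] weakly_singular_conv(1)[OF one S] r by auto
  have k'S: "conv S k' s = 1 + ?il * conv (\<lambda>_. 1) S s" if s: "0 < s" "s \<le> T" for s
  proof -
    have "conv S k' s = conv k' S s" by (rule conv_commute)
    also have "\<dots> = conv k' (\<lambda>s. k s + ?il * conv k S s) s" by (intro conv_cong refl Seq)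
    also have "\<dots> = conv k' k s + conv k' (\<lambda>s. ?il * conv k S s) s"
      by (rule conv_add[OF k(2) k(1) weakly_singular_cmult[OF kS]]) (use r s in auto)
    also have "\<dots> = 1 + ?il * conv k' (conv k S) s" using kk s by (simp add: conv_cmult)
    also have "conv k' (conv k S) s = conv (conv k' k) S s" by (rule conv_assoc[OF k(2,1) S]) (use r s in auto)
    also have "\<dots> = conv (\<lambda>_. 1) S s" using kk by (intro conv_cong) auto
    finally show ?thesis .
  qed
  have SoneX: "conv S (conv (\<lambda>_. 1) X) t = conv (\<lambda>_. 1) (conv S X) t" if X: "weakly_singular T \<rho> X" for X
  proof -
    have "conv S (conv (\<lambda>_. 1) X) t = conv (conv S (\<lambda>_. 1)) X t" by (rule conv_assoc[OF S one X]) (use r t in auto)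
    also have "\<dots> = conv (conv (\<lambda>_. 1) S) X t" by (intro conv_cong conv_commute refl)
    also have "\<dots> = conv (\<lambda>_. 1) (conv S X) t" by (rule conv_assoc[OF one S X, symmetric]) (use r t in auto)
    finally show ?thesis .
  qed
  have "conv S (conv k' U) t = conv (conv S k') U t" by (rule conv_assoc[OF S k(2) U]) (use r t in auto)
  also have "\<dots> = conv (\<lambda>s. 1 + ?il * conv (\<lambda>_. 1) S s) U t" using t by (intro conv_cong k'S refl) auto
  also have "\<dots> = conv U (\<lambda>s. 1 + ?il * conv (\<lambda>_. 1) S s) t" by (rule conv_commute)
  also have "\<dots> = conv U (\<lambda>_. 1) t + conv U (\<lambda>s. ?il * conv (\<lambda>_. 1) S s) t"
    by (rule conv_add[OF U one weakly_singular_cmult[OF oU(3)]]) (use r t in auto)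
  also have "\<dots> = conv (\<lambda>_. 1) U t + ?il * conv (conv (\<lambda>_. 1) S) U t"
    unfolding conv_cmult by (simp only: conv_commute[of U])
  also have "conv (conv (\<lambda>_. 1) S) U t = conv (\<lambda>_. 1) (conv S U) t" by (rule conv_assoc[OF one S U, symmetric]) (use r t in auto)
  finally have A: "conv S (conv k' U) t = conv (\<lambda>_. 1) U t + ?il * conv (\<lambda>_. 1) (conv S U) t" .
  have "conv S (conv k' U) t = conv S (\<lambda>s. \<phi> * 1 + (?il * conv (\<lambda>_. 1) U s + (- \<i>) * conv (\<lambda>_. 1) F s)) t"
    using t eq by (intro conv_cong refl) (auto simp: k'_def)
  also have "\<dots> = conv S (\<lambda>s. \<phi> * 1) t + conv S (\<lambda>s. ?il * conv (\<lambda>_. 1) U s + (- \<i>) * conv (\<lambda>_. 1) F s) t"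
  proof (rule conv_add[OF S weakly_singular_const])
    show "weakly_singular T (1 + \<rho>) (\<lambda>s. ?il * conv (\<lambda>_. 1) U s + (- \<i>) * conv (\<lambda>_. 1) F s)"
    proof -
      obtain C D where "C \<ge> 0" "D \<ge> 0" "\<forall>s\<in>{0<..T}. norm (?il * conv (\<lambda>_. 1) U s) \<le> C * s powr (1 + \<rho> - 1)" "\<forall>s\<in>{0<..T}. norm ((- \<i>) * conv (\<lambda>_. 1) F s) \<le> D * s powr (1 + \<rho> - 1)"
        using weakly_singular_cmult[OF oU(1), of ?il] weakly_singular_cmult[OF oU(2), of "- \<i>"] unfolding weakly_singular_def by blast
      then have "norm (?il * conv (\<lambda>_. 1) U s + (- \<i>) * conv (\<lambda>_. 1) F s) \<le> (C + D) * s powr (1 + \<rho> - 1)" if "s \<in> {0<..T}" for s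
        using that by (intro order_trans[OF norm_triangle_ineq]) (auto simp: distrib_right intro!: add_mono)
      then show ?thesis using oU \<open>C \<ge> 0\<close> \<open>D \<ge> 0\<close> unfolding weakly_singular_def by (auto intro!: exI[of _ "C + D"])
    qed
  qed (use r t in auto)
  also have "conv S (\<lambda>s. ?il * conv (\<lambda>_. 1) U s + (- \<i>) * conv (\<lambda>_. 1) F s) t =
     conv S (\<lambda>s. ?il * conv (\<lambda>_. 1) U s) t + conv S (\<lambda>s. (- \<i>) * conv (\<lambda>_. 1) F s) t"
    by (rule conv_add[OF S weakly_singular_cmult[OF oU(1)] weakly_singular_cmult[OF oU(2)]]) (use r t in auto)
  finally have B: "conv S (conv k' U) t = \<phi> * conv S (\<lambda>_. 1) t + (?il * conv (\<lambda>_. 1) (conv S U) t + (- \<i>) * conv (\<lambda>_. 1) (conv S F) t)"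
    unfolding conv_cmult SoneX[OF U] SoneX[OF F] .
  have "conv (\<lambda>_. 1) (\<lambda>t. \<phi> * S t - \<i> * conv S F t) t = conv (\<lambda>_. 1) (\<lambda>t. \<phi> * S t + (- \<i>) * conv S F t) t" by simp
  also have "\<dots> = conv (\<lambda>_. 1) (\<lambda>t. \<phi> * S t) t + conv (\<lambda>_. 1) (\<lambda>t. (- \<i>) * conv S F t) t"
    by (rule conv_add[OF one weakly_singular_cmult[OF S] weakly_singular_cmult[OF SU(2)]]) (use r t in auto)
  finally have C: "conv (\<lambda>_. 1) (\<lambda>t. \<phi> * S t - \<i> * conv S F t) t = \<phi> * conv (\<lambda>_. 1) S t + (- \<i>) * conv (\<lambda>_. 1) (conv S F) t"
    unfolding conv_cmult .
  show ?thesis using A B C conv_commute[of S "\<lambda>_. 1" t] unfolding S_def by simp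
qed

end

section \<open>Sine coefficients and the Green operator of the second derivative\<close>

definition sine_coeff :: "nat \<Rightarrow> (real \<Rightarrow> complex) \<Rightarrow> complex" where
  "sine_coeff k g = (LINT x:{0..pi}|lborel. of_real (sin (real k * x)) * g x)"

lemma set_lborel_integral_eq_integral:
  fixes f :: "real \<Rightarrow> complex"
  assumes "continuous_on {a..b} f"
  shows "(LINT x:{a..b}|lborel. f x) = integral {a..b} f"
  by (rule set_borel_integral_eq_integral(2)[OF borel_integrable_atLeastAtMost'[OF assms]])

lemma sine_coeff_eq_integral:
  assumes "continuous_on {0..pi} g"
  shows "sine_coeff k g = integral {0..pi} (\<lambda>x. of_real (sin (real k * x)) * g x)"
  unfolding sine_coeff_def by (intro set_lborel_integral_eq_integral continuous_intros assms)

lemma sine_coeff_cmult: "sine_coeff k (\<lambda>x. c * g x) = c * sine_coeff k g"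
proof -
  have "of_real (sin (real k * x)) * (c * g x) = c * (of_real (sin (real k * x)) * g x)" for x by (simp add: mult_ac)
  then show ?thesis by (simp only: sine_coeff_def set_integral_mult_right)
qed

lemma sine_coeff_integrable:
  fixes g :: "real \<Rightarrow> complex"
  assumes "continuous_on {0..pi} g"
  shows "set_integrable lborel {0..pi} (\<lambda>x. of_real (sin (real k * x)) * g x)"
  by (intro borel_integrable_atLeastAtMost' continuous_intros assms)

lemma sine_coeff_add:
  assumes "continuous_on {0..pi} g" "continuous_on {0..pi} h"
  shows "sine_coeff k (\<lambda>x. g x + h x) = sine_coeff k g + sine_coeff k h"
  unfolding sine_coeff_def distrib_left by (rule set_integral_add(2)[OF sine_coeff_integrable[OF assms(1)] sine_coeff_integrable[OF assms(2)]])

lemma sine_coeff_diff: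
  assumes "continuous_on {0..pi} g" "continuous_on {0..pi} h"
  shows "sine_coeff k (\<lambda>x. g x - h x) = sine_coeff k g - sine_coeff k h"
  unfolding sine_coeff_def right_diff_distrib by (rule set_integral_diff(2)[OF sine_coeff_integrable[OF assms(1)] sine_coeff_integrable[OF assms(2)]])

lemma sine_coeff_cong: "(\<And>x. x \<in> {0..pi} \<Longrightarrow> g x = h x) \<Longrightarrow> sine_coeff k g = sine_coeff k h"
  unfolding sine_coeff_def by (intro set_lebesgue_integral_cong) auto

text \<open>Multiplying by cos x maps each sine to an average of two neighbouring sines, so g is
  orthogonal to sin x p(cos x) for every polynomial p. Approximating g uniformly by p(cos x) gives
  that the integral of sin x g^2 is zero, without any convergence theory of Fourier series.\<close>

lemma sine_complete_real:
  fixes g :: "real \<Rightarrow> real"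
  assumes g: "continuous_on {0..pi} g" and z: "\<And>k. integral {0..pi} (\<lambda>x. sin (real k * x) * g x) = 0"
    and x: "x \<in> {0..pi}"
  shows "g x = 0"
proof -
  have trig: "integral {0..pi} (\<lambda>x. sin (real k * x) * cos x ^ n * g x) = 0" for n k
  proof (induction n arbitrary: k)
    case 0
    then show ?case using z by simp
  next
    case (Suc n)
    show ?case
    proof (cases k)
      case 0
      then show ?thesis by simp
    next
      case (Suc m)
      have *: "sin (real k * x) * cos x = (sin (real (Suc k) * x) + sin (real m * x)) / 2" for x
        using sin_times_cos[of "real k * x" x] by (simp add: Suc algebra_simps)
      have "sin (real k * x) * cos x ^ Suc n * g x =
        (sin (real (Suc k) * x) * cos x ^ n * g x + sin (real m * x) * cos x ^ n * g x) / 2" for x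
      proof -
        have "sin (real k * x) * cos x ^ Suc n * g x = (sin (real k * x) * cos x) * (cos x ^ n * g x)" by simp
        then show ?thesis unfolding * by (simp add: algebra_simps)
      qed
      then have "integral {0..pi} (\<lambda>x. sin (real k * x) * cos x ^ Suc n * g x) =
        integral {0..pi} (\<lambda>x. (sin (real (Suc k) * x) * cos x ^ n * g x + sin (real m * x) * cos x ^ n * g x) / 2)"
        by (simp only:)
      also have "\<dots> = (integral {0..pi} (\<lambda>x. sin (real (Suc k) * x) * cos x ^ n * g x) + integral {0..pi} (\<lambda>x. sin (real m * x) * cos x ^ n * g x)) / 2"
        by (subst integral_add[symmetric]) (auto intro!: integrable_continuous_real continuous_intros g)
      finally show ?thesis unfolding Suc.IH by simp
    qed
  qed
  have poly: "integral {0..pi} (\<lambda>x. sin x * p (cos x) * g x) = 0" if p: "real_polynomial_function p" for p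
  proof -
    obtain a n where p: "p = (\<lambda>x. \<Sum>i\<le>n. a i * x ^ i)" using p real_polynomial_function_iff_sum by auto
    have "integral {0..pi} (\<lambda>x. sin x * p (cos x) * g x) = integral {0..pi} (\<lambda>x. \<Sum>i\<le>n. a i * (sin (real 1 * x) * cos x ^ i * g x))"
      unfolding p by (simp add: sum_distrib_left sum_distrib_right mult_ac)
    also have "\<dots> = (\<Sum>i\<le>n. a i * integral {0..pi} (\<lambda>x. sin (real 1 * x) * cos x ^ i * g x))"
      by (subst integral_sum) (auto intro!: integrable_continuous_real continuous_intros g)
    also have "\<dots> = 0" by (simp only: trig) simp
    finally show ?thesis .
  qed
  define J where "J = integral {0..pi} (\<lambda>x. sin x * (g x)\<^sup>2)"
  have J0: "J \<ge> 0" unfolding J_def by (intro integral_nonneg integrable_continuous_real continuous_intros g) (auto intro!: mult_nonneg_nonneg sin_ge_zero)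
  obtain M where M: "\<And>x. x \<in> {0..pi} \<Longrightarrow> \<bar>g x\<bar> \<le> M" "M > 0"
    using compact_imp_bounded[OF compact_continuous_image[OF g compact_Icc]] unfolding bounded_pos by force
  have "J \<le> 0 + e" if e: "e > 0" for e
  proof -
    define d where "d = e / (M * pi)"
    have d: "d > 0" using e M by (simp add: d_def)
    \<comment> \<open>In the variable c = cos x the function g becomes continuous on [-1, 1], where
      Weierstrass approximation is available.\<close>
    have "continuous_on {-1..1} (\<lambda>c. g (arccos c))"
      by (rule continuous_on_compose2[OF g]) (auto intro!: continuous_intros arccos_lbound arccos_ubound)
    then obtain p where p: "real_polynomial_function p" "\<And>c. c \<in> {-1..1} \<Longrightarrow> \<bar>g (arccos c) - p c\<bar> < d"
      using Stone_Weierstrass_real_polynomial_function[of "{-1..1::real}" "\<lambda>c. g (arccos c)" d] d by auto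
    have pc: "continuous_on S (\<lambda>x. p (cos x))" for S
    proof -
      have "continuous_on UNIV p"
        using p(1) by (metis continuous_on_polymonial_function continuous_at_imp_continuous_on continuous_real_polymonial_function)
      then show ?thesis by (rule continuous_on_compose2) (auto intro!: continuous_intros)
    qed
    have "J = integral {0..pi} (\<lambda>x. sin x * (g x)\<^sup>2) - integral {0..pi} (\<lambda>x. sin x * p (cos x) * g x)"
      using poly[OF p(1)] by (simp add: J_def)
    also have "\<dots> = integral {0..pi} (\<lambda>x. sin x * (g x)\<^sup>2 - sin x * p (cos x) * g x)"
      by (rule integral_diff[symmetric]) (auto intro!: integrable_continuous_real continuous_intros g pc)
    also have "\<dots> \<le> integral {0..pi} (\<lambda>x. d * M)"
    proof (rule integral_le)
      fix x assume x: "x \<in> {0..pi}"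
      have "sin x * (g x)\<^sup>2 - sin x * p (cos x) * g x = sin x * ((g x - p (cos x)) * g x)"
        by (simp add: power2_eq_square algebra_simps)
      also have "\<dots> \<le> \<bar>sin x * ((g x - p (cos x)) * g x)\<bar>" by simp
      also have "\<dots> \<le> 1 * (d * M)"
        unfolding abs_mult using p(2)[of "cos x"] M(1)[OF x] x d
        by (intro mult_mono) (auto simp: arccos_cos)
      finally show "sin x * (g x)\<^sup>2 - sin x * p (cos x) * g x \<le> d * M" by simp
    qed (auto intro!: integrable_continuous_real continuous_intros g pc)
    also have "\<dots> = e" using M by (simp add: d_def)
    finally show ?thesis by simp
  qed
  then have "J \<le> 0" by (rule field_le_epsilon)
  with J0 have "J = 0" by simp
  have "integral (cbox 0 pi) (\<lambda>x. sin x * (g x)\<^sup>2) = 0 \<longleftrightarrow> (\<forall>x\<in>cbox 0 pi. sin x * (g x)\<^sup>2 = 0)"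
  proof (rule integral_cbox_eq_0_iff)
    show "continuous_on (cbox 0 pi) (\<lambda>x. sin x * (g x)\<^sup>2)"
      unfolding box_real by (intro continuous_intros g)
    show "box 0 pi \<noteq> {}" by (simp add: box_real not_le)
    show "0 \<le> sin x * (g x)\<^sup>2" if "x \<in> cbox 0 pi" for x
      using that by (auto intro!: mult_nonneg_nonneg sin_ge_zero)
  qed
  with \<open>J = 0\<close> have zz: "\<forall>x\<in>{0..pi}. sin x * (g x)\<^sup>2 = 0" unfolding J_def by simp
  have i: "g x = 0" if "x \<in> {0<..<pi}" for x using that sin_gt_zero[of x] bspec[OF zz, of x] by auto
  have "closure {0<..<pi} \<subseteq> {x\<in>{0..pi}. g x = 0}"
  proof (rule closure_minimal)
    show "closed {x\<in>{0..pi}. g x = 0}" by (intro continuous_closed_preimage_constant g closed_atLeastAtMost)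
  qed (use i in auto)
  then show ?thesis using x by auto
qed

lemma sine_complete:
  assumes g: "continuous_on {0..pi} g" and z: "\<And>k. k \<ge> 1 \<Longrightarrow> sine_coeff k g = 0" and x: "x \<in> {0..pi}"
  shows "g x = 0"
proof -
  have i: "(\<lambda>x. of_real (sin (real k * x)) * g x) integrable_on {0..pi}" for k
    by (intro integrable_continuous_real continuous_intros g)
  have z0: "integral {0..pi} (\<lambda>x. of_real (sin (real k * x)) * g x) = 0" for k
    using z[of k] sine_coeff_eq_integral[OF g, of k] by (cases k) auto
  have zr: "integral {0..pi} (\<lambda>x. sin (real k * x) * Re (g x)) = 0" for k
    using integral_linear[OF i[of k] bounded_linear_Re] z0[of k] by (simp add: o_def)
  have zi: "integral {0..pi} (\<lambda>x. sin (real k * x) * Im (g x)) = 0" for k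
    using integral_linear[OF i[of k] bounded_linear_Im] z0[of k] by (simp add: o_def)
  have "Re (g x) = 0" by (intro sine_complete_real[OF _ zr x] continuous_intros g)
  moreover have "Im (g x) = 0" by (intro sine_complete_real[OF _ zi x] continuous_intros g)
  ultimately show ?thesis by (simp add: complex_eq_iff)
qed

section \<open>The Dirichlet Green operator\<close>

text \<open>The inverse of the second derivative with zero boundary values. The integral over
  [x, pi] is written as a difference of integrals from 0, so that every x-dependent integral has x
  as its upper limit.\<close>

definition green_op :: "(real \<Rightarrow> complex) \<Rightarrow> real \<Rightarrow> complex" where
  "green_op h x = - (of_real (pi - x) * integral {0..x} (\<lambda>y. of_real y * h y) +
     of_real x * (integral {0..pi} (\<lambda>y. of_real (pi - y) * h y) - integral {0..x} (\<lambda>y. of_real (pi - y) * h y))) / of_real pi"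

definition green_op_deriv :: "(real \<Rightarrow> complex) \<Rightarrow> real \<Rightarrow> complex" where
  "green_op_deriv h x = (integral {0..x} (\<lambda>y. of_real y * h y) -
     (integral {0..pi} (\<lambda>y. of_real (pi - y) * h y) - integral {0..x} (\<lambda>y. of_real (pi - y) * h y))) / of_real pi"

lemma green_op_derivs:
  assumes h: "continuous_on {0..pi} h" and x: "x \<in> {0..pi}"
  shows "(green_op h has_vector_derivative green_op_deriv h x) (at x within {0..pi})"
    and "(green_op_deriv h has_vector_derivative h x) (at x within {0..pi})"
proof -
  define A where "A x = integral {0..x} (\<lambda>y. of_real y * h y)" for x
  define B where "B x = integral {0..x} (\<lambda>y. of_real (pi - y) * h y)" for x
  have A: "(A has_vector_derivative of_real x * h x) (at x within {0..pi})"
    unfolding A_def by (intro integral_has_vector_derivative continuous_intros h x)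
  have B: "(B has_vector_derivative of_real (pi - x) * h x) (at x within {0..pi})"
    unfolding B_def by (intro integral_has_vector_derivative continuous_intros h x)
  have G: "green_op h = (\<lambda>x. - ((pi - x) *\<^sub>R A x + x *\<^sub>R (B pi - B x)) / of_real pi)"
    by (simp add: green_op_def A_def B_def fun_eq_iff scaleR_conv_of_real)
  have G1: "green_op_deriv h = (\<lambda>x. (A x - (B pi - B x)) / of_real pi)"
    by (simp add: green_op_deriv_def A_def B_def fun_eq_iff)
  have "(green_op h has_vector_derivative - ((pi - x) *\<^sub>R (of_real x * h x) + (- 1) *\<^sub>R A x + (x *\<^sub>R (0 - of_real (pi - x) * h x) + 1 *\<^sub>R (B pi - B x))) / of_real pi) (at x within {0..pi})"
    unfolding G
    by (intro has_vector_derivative_divide has_vector_derivative_minus has_vector_derivative_add has_vector_derivative_scaleR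
         has_vector_derivative_diff has_vector_derivative_const A B) (auto intro!: derivative_eq_intros)
  then show "(green_op h has_vector_derivative green_op_deriv h x) (at x within {0..pi})"
    by (rule has_vector_derivative_eq_rhs) (simp add: G1 scaleR_conv_of_real field_simps)
  have "(green_op_deriv h has_vector_derivative (of_real x * h x - (0 - of_real (pi - x) * h x)) / of_real pi) (at x within {0..pi})"
    unfolding G1
    by (intro has_vector_derivative_divide has_vector_derivative_diff has_vector_derivative_const A B)
  then show "(green_op_deriv h has_vector_derivative h x) (at x within {0..pi})"
    by (rule has_vector_derivative_eq_rhs) (simp add: field_simps)
qed

lemma green_op_ends [simp]: "green_op h 0 = 0" "green_op h pi = 0"
  by (simp_all add: green_op_def)

lemma green_op_continuous: "continuous_on {0..pi} h \<Longrightarrow> continuous_on {0..pi} (green_op h)"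
  by (rule continuous_on_vector_derivative) (rule green_op_derivs(1))

lemma sine_coeff_green_op:
  assumes h: "continuous_on {0..pi} h"
  shows "sine_coeff k h = - (of_nat k)\<^sup>2 * sine_coeff k (green_op h)"
proof -
  \<comment> \<open>The Wronskian of sin (k x) and the Green potential. It vanishes at both ends,
    and its derivative is the integrand of the claim.\<close>
  define P where "P x = sin (real k * x) *\<^sub>R green_op_deriv h x - (real k * cos (real k * x)) *\<^sub>R green_op h x" for x
  have d: "(P has_vector_derivative of_real (sin (real k * x)) * h x + (of_nat k)\<^sup>2 * (of_real (sin (real k * x)) * green_op h x)) (at x within {0..pi})"
    if x: "x \<in> {0..pi}" for x
  proof -
    have s: "((\<lambda>x. sin (real k * x)) has_real_derivative cos (real k * x) * real k) (at x within {0..pi})"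
      by (auto intro!: derivative_eq_intros)
    have c: "((\<lambda>x. real k * cos (real k * x)) has_real_derivative - (real k * sin (real k * x) * real k)) (at x within {0..pi})"
      by (auto intro!: derivative_eq_intros)
    have "(P has_vector_derivative
        (sin (real k * x) *\<^sub>R h x + (cos (real k * x) * real k) *\<^sub>R green_op_deriv h x) -
        ((real k * cos (real k * x)) *\<^sub>R green_op_deriv h x + (- (real k * sin (real k * x) * real k)) *\<^sub>R green_op h x)) (at x within {0..pi})"
      unfolding P_def by (intro has_vector_derivative_diff has_vector_derivative_scaleR s c green_op_derivs[OF h x])
    then show ?thesis
      by (rule has_vector_derivative_eq_rhs) (simp add: scaleR_conv_of_real power2_eq_square algebra_simps)
  qed
  have "((\<lambda>x. of_real (sin (real k * x)) * h x + (of_nat k)\<^sup>2 * (of_real (sin (real k * x)) * green_op h x)) has_integral (P pi - P 0)) {0..pi}"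
    by (rule fundamental_theorem_of_calculus) (use d in auto)
  moreover have "P pi = 0" "P 0 = 0" by (simp_all add: P_def)
  ultimately have "integral {0..pi} (\<lambda>x. of_real (sin (real k * x)) * h x + (of_nat k)\<^sup>2 * (of_real (sin (real k * x)) * green_op h x)) = 0"
    by (simp add: integral_unique)
  also have "integral {0..pi} (\<lambda>x. of_real (sin (real k * x)) * h x + (of_nat k)\<^sup>2 * (of_real (sin (real k * x)) * green_op h x)) =
     integral {0..pi} (\<lambda>x. of_real (sin (real k * x)) * h x) + integral {0..pi} (\<lambda>x. (of_nat k)\<^sup>2 * (of_real (sin (real k * x)) * green_op h x))"
    by (intro integral_add integrable_continuous_real continuous_intros h green_op_continuous)
  finally show ?thesis
    unfolding sine_coeff_eq_integral[OF h] sine_coeff_eq_integral[OF green_op_continuous[OF h]] by (simp add: add_eq_0_iff)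
qed

text \<open>Green's formula on a general interval with general boundary values, because a solution
  is twice differentiable only inside (0, pi). Multiplying through by b - a keeps every term
  continuous as the interval grows.\<close>

lemma green_representation:
  fixes g g1 g2 :: "real \<Rightarrow> complex"
  assumes ab: "a < b" and x: "x \<in> {a..b}"
    and d1: "\<And>y. y \<in> {a..b} \<Longrightarrow> (g has_vector_derivative g1 y) (at y within {a..b})"
    and d2: "\<And>y. y \<in> {a..b} \<Longrightarrow> (g1 has_vector_derivative g2 y) (at y within {a..b})"
  shows "of_real (b - a) * g x = of_real (b - x) * g a + of_real (x - a) * g b -
     (of_real (b - x) * integral {a..x} (\<lambda>y. of_real (y - a) * g2 y) + of_real (x - a) * integral {x..b} (\<lambda>y. of_real (b - y) * g2 y))"
proof -
  have l: "((\<lambda>y. of_real (y - a) * g2 y) has_integral ((x - a) *\<^sub>R g1 x - g x - ((a - a) *\<^sub>R g1 a - g a))) {a..x}"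
  proof (rule fundamental_theorem_of_calculus)
    fix y assume y: "y \<in> {a..x}"
    then have y': "y \<in> {a..b}" using x by auto
    have "((\<lambda>y. (y - a) *\<^sub>R g1 y - g y) has_vector_derivative ((y - a) *\<^sub>R g2 y + 1 *\<^sub>R g1 y) - g1 y) (at y within {a..b})"
      by (intro has_vector_derivative_diff has_vector_derivative_scaleR d1[OF y'] d2[OF y']) (auto intro!: derivative_eq_intros)
    then show "((\<lambda>y. (y - a) *\<^sub>R g1 y - g y) has_vector_derivative of_real (y - a) * g2 y) (at y within {a..x})"
      using x by (intro has_vector_derivative_within_subset[where S = "{a..b}" and T = "{a..x}"]) (auto simp: scaleR_conv_of_real)
  qed (use x in auto)
  have r: "((\<lambda>y. of_real (b - y) * g2 y) has_integral ((b - b) *\<^sub>R g1 b + g b - ((b - x) *\<^sub>R g1 x + g x))) {x..b}"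
  proof (rule fundamental_theorem_of_calculus)
    fix y assume y: "y \<in> {x..b}"
    then have y': "y \<in> {a..b}" using x by auto
    have "((\<lambda>y. (b - y) *\<^sub>R g1 y + g y) has_vector_derivative ((b - y) *\<^sub>R g2 y + (- 1) *\<^sub>R g1 y) + g1 y) (at y within {a..b})"
      by (intro has_vector_derivative_add has_vector_derivative_scaleR d1[OF y'] d2[OF y']) (auto intro!: derivative_eq_intros)
    then show "((\<lambda>y. (b - y) *\<^sub>R g1 y + g y) has_vector_derivative of_real (b - y) * g2 y) (at y within {x..b})"
      using x by (intro has_vector_derivative_within_subset[where S = "{a..b}" and T = "{x..b}"]) (auto simp: scaleR_conv_of_real)
  qed (use x in auto)
  show ?thesis
    unfolding integral_unique[OF l] integral_unique[OF r] by (simp add: scaleR_conv_of_real algebra_simps)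
qed

lemma green_op_of_deriv2:
  assumes d1: "\<And>y. y \<in> {0..pi} \<Longrightarrow> (g has_vector_derivative g1 y) (at y within {0..pi})"
    and d2: "\<And>y. y \<in> {0..pi} \<Longrightarrow> (g1 has_vector_derivative g2 y) (at y within {0..pi})"
    and c: "continuous_on {0..pi} g2" and e: "g 0 = 0" "g pi = 0" and x: "x \<in> {0..pi}"
  shows "g x = green_op g2 x"
proof -
  have "integral {0..x} (\<lambda>y. of_real (pi - y) * g2 y) + integral {x..pi} (\<lambda>y. of_real (pi - y) * g2 y) = integral {0..pi} (\<lambda>y. of_real (pi - y) * g2 y)"
    using x by (intro Henstock_Kurzweil_Integration.integral_combine integrable_continuous_real continuous_intros c) auto
  then have "integral {x..pi} (\<lambda>y. of_real (pi - y) * g2 y) = integral {0..pi} (\<lambda>y. of_real (pi - y) * g2 y) - integral {0..x} (\<lambda>y. of_real (pi - y) * g2 y)"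
    by (simp add: algebra_simps)
  with green_representation[OF pi_gt_zero x d1 d2] e
  have "of_real pi * g x = - (of_real (pi - x) * integral {0..x} (\<lambda>y. of_real y * g2 y) +
     of_real x * (integral {0..pi} (\<lambda>y. of_real (pi - y) * g2 y) - integral {0..x} (\<lambda>y. of_real (pi - y) * g2 y)))"
    by simp
  then show ?thesis unfolding green_op_def by (simp add: field_simps)
qed

section \<open>Odd periodic extensions\<close>

text \<open>The distance from x to the nearest multiple of 2 pi.\<close>

definition fold_pi :: "real \<Rightarrow> real" where "fold_pi x = arccos (cos x)"

lemma fold_pi_range: "fold_pi x \<in> {0..pi}"
  by (simp add: fold_pi_def arccos_lbound arccos_ubound)

lemma fold_pi_id: "x \<in> {0..pi} \<Longrightarrow> fold_pi x = x"
  by (simp add: fold_pi_def arccos_cos)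

lemma fold_pi_le: "fold_pi x \<le> \<bar>x - of_int k * (2 * pi)\<bar>"
proof -
  have c: "cos x = cos (x - of_int k * (2 * pi))"
    using cos.periodic_simps[of x] by (metis cos_int_2pin mult.commute cos_diff sin_int_2pin mult_zero_right add.right_neutral mult_1_right)
  show ?thesis
  proof (cases "\<bar>x - of_int k * (2 * pi)\<bar> \<le> pi")
    case True
    then show ?thesis unfolding fold_pi_def c by (simp add: arccos_cos_eq_abs)
  next
    case False
    then show ?thesis using fold_pi_range[of x] by auto
  qed
qed

lemma fold_pi_lipschitz: "\<bar>fold_pi x - fold_pi y\<bar> \<le> \<bar>x - y\<bar>"
proof -
  have "fold_pi x - fold_pi y \<le> \<bar>x - y\<bar>" for x y
  proof -
    obtain k where "fold_pi y = \<bar>y - of_int k * (2 * pi)\<bar>"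
      unfolding fold_pi_def by (rule arccos_cos_eq_abs_2pi)
    then show ?thesis using fold_pi_le[of x k] by linarith
  qed
  from this[of x y] this[of y x] show ?thesis by linarith
qed

lemma fold_pi_continuous: "continuous_on S fold_pi"
  unfolding fold_pi_def by (intro continuous_on_arccos continuous_intros) auto

lemma fold_pi_zero: "sin x = 0 \<Longrightarrow> fold_pi x = 0 \<or> fold_pi x = pi"
  unfolding fold_pi_def using sin_cos_squared_add[of x] by (auto simp: power2_eq_1_iff)

text \<open>The sign of the sine tells whether x lies in an even or a reflected copy of the
  interval; at its zeros both branches give 0 when \<open>g\<close> vanishes at the
  endpoints.\<close>

definition odd_ext :: "(real \<Rightarrow> complex) \<Rightarrow> real \<Rightarrow> complex" where
  "odd_ext g x = (if sin x \<ge> 0 then g (fold_pi x) else - g (fold_pi x))"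

lemma odd_ext_id: "x \<in> {0..pi} \<Longrightarrow> odd_ext g x = g x"
  by (simp add: odd_ext_def sin_ge_zero fold_pi_id)

lemma odd_ext_bound: "(\<And>x. x \<in> {0..pi} \<Longrightarrow> norm (g x) \<le> M) \<Longrightarrow> norm (odd_ext g x) \<le> M"
  using fold_pi_range by (simp add: odd_ext_def)

text \<open>The two branches are glued along the closed sets where the sine is nonnegative or
  nonpositive. The parameter \<open>s\<close> makes continuity joint, as time-dependent data
  require.\<close>

lemma odd_ext_continuous:
  fixes g :: "real \<Rightarrow> 'p::metric_space \<Rightarrow> complex"
  assumes c: "continuous_on ({0..pi} \<times> UNIV) (\<lambda>(x, s). g x s)" and z: "\<And>s. g 0 s = 0" "\<And>s. g pi s = 0"
  shows "continuous_on UNIV (\<lambda>(x, s). odd_ext (\<lambda>y. g y s) x)"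
proof -
  let ?A = "{p::real \<times> 'p. sin (fst p) \<ge> 0}" and ?B = "{p::real \<times> 'p. sin (fst p) \<le> 0}"
  have sf: "continuous_on UNIV (\<lambda>p::real \<times> 'p. sin (fst p))"
    by (rule continuous_on_sin[OF continuous_on_fst[OF continuous_on_id]])
  have cl: "closed ?A" by (rule closed_Collect_le[OF continuous_on_const sf])
  have cl': "closed ?B" by (rule closed_Collect_le[OF sf continuous_on_const])
  have gc: "continuous_on S (\<lambda>p. g (fold_pi (fst p)) (snd p))" for S
  proof -
    have "continuous_on S (\<lambda>p. (\<lambda>(x, s). g x s) (fold_pi (fst p), snd p))"
      by (rule continuous_on_compose2[OF c]) (use fold_pi_range in \<open>auto intro!: continuous_intros continuous_on_compose2[OF fold_pi_continuous]\<close>)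
    then show ?thesis by simp
  qed
  have "continuous_on (?A \<union> ?B) (\<lambda>p. if sin (fst p) \<ge> 0 then g (fold_pi (fst p)) (snd p) else - g (fold_pi (fst p)) (snd p))"
  proof (rule continuous_on_cases[OF cl cl' gc continuous_on_minus[OF gc]], intro allI impI)
    fix p :: "real \<times> 'p"
    assume "p \<in> ?A \<and> \<not> 0 \<le> sin (fst p) \<or> p \<in> ?B \<and> 0 \<le> sin (fst p)"
    then have "sin (fst p) = 0" by auto
    from fold_pi_zero[OF this] z show "g (fold_pi (fst p)) (snd p) = - g (fold_pi (fst p)) (snd p)" by auto
  qed
  moreover have "?A \<union> ?B = UNIV" by auto
  ultimately show ?thesis by (simp add: odd_ext_def case_prod_beta)
qed

lemma odd_ext_continuous1:
  assumes c: "continuous_on {0..pi} g" and z: "g 0 = 0" "g pi = 0"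
  shows "continuous_on UNIV (odd_ext g)"
proof -
  have "continuous_on ({0..pi} \<times> (UNIV::real set)) (\<lambda>(x, s). g x)"
    unfolding case_prod_beta by (rule continuous_on_compose2[OF c]) (auto intro!: continuous_intros)
  from odd_ext_continuous[OF this] z have "continuous_on UNIV (\<lambda>(x, s::real). odd_ext g x)" by simp
  then have "continuous_on UNIV (\<lambda>x. (\<lambda>(x, s::real). odd_ext g x) (x, 0))"
    by (rule continuous_on_compose2) (auto intro!: continuous_intros)
  then show ?thesis by simp
qed

text \<open>Folding does not increase distances, which settles points of equal sign. Otherwise a
  zero of the sine lies between the points; the extension vanishes there, and passing through it
  costs the factor 2.\<close>

lemma odd_ext_holder:
  assumes h: "\<And>x y. x \<in> {0..pi} \<Longrightarrow> y \<in> {0..pi} \<Longrightarrow> norm (g x - g y) \<le> H * sqrt \<bar>x - y\<bar>"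
    and H: "H \<ge> 0" and z: "g 0 = 0" "g pi = 0"
  shows "norm (odd_ext g x - odd_ext g y) \<le> 2 * H * sqrt \<bar>x - y\<bar>"
proof -
  have s: "norm (g (fold_pi x) - g (fold_pi y)) \<le> H * sqrt \<bar>x - y\<bar>" for x y
  proof -
    have "norm (g (fold_pi x) - g (fold_pi y)) \<le> H * sqrt \<bar>fold_pi x - fold_pi y\<bar>"
      by (intro h fold_pi_range)
    also have "\<dots> \<le> H * sqrt \<bar>x - y\<bar>" using fold_pi_lipschitz H by (intro mult_left_mono) auto
    finally show ?thesis .
  qed
  show ?thesis
  proof (cases "(sin x \<ge> 0) = (sin y \<ge> 0)")
    case True
    then have "norm (odd_ext g x - odd_ext g y) = norm (g (fold_pi x) - g (fold_pi y))"
      by (auto simp: odd_ext_def norm_minus_commute)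
    also have "\<dots> \<le> H * sqrt \<bar>x - y\<bar>" by (rule s)
    also have "\<dots> \<le> 2 * H * sqrt \<bar>x - y\<bar>" using H by (intro mult_right_mono) auto
    finally show ?thesis .
  next
    case False
    have "\<exists>z\<in>closed_segment x y. sin z = 0"
      by (rule IVT'_closed_segment_real)
        (use False in \<open>auto simp: closed_segment_eq_real_ivl intro!: continuous_intros\<close>)
    then obtain w where w: "w \<in> closed_segment x y" "sin w = 0" by blast
    have gw: "g (fold_pi w) = 0" using fold_pi_zero[OF w(2)] z by auto
    have d: "\<bar>x - w\<bar> \<le> \<bar>x - y\<bar>" "\<bar>y - w\<bar> \<le> \<bar>x - y\<bar>" using w(1) by (auto simp: closed_segment_eq_real_ivl split: if_splits)
    have b: "norm (odd_ext g v) \<le> H * sqrt \<bar>x - y\<bar>" if "\<bar>v - w\<bar> \<le> \<bar>x - y\<bar>" for v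
    proof -
      have "norm (odd_ext g v) = norm (g (fold_pi v) - g (fold_pi w))" using gw by (simp add: odd_ext_def)
      also have "\<dots> \<le> H * sqrt \<bar>v - w\<bar>" by (rule s)
      also have "\<dots> \<le> H * sqrt \<bar>x - y\<bar>" using that H by (intro mult_left_mono) auto
      finally show ?thesis .
    qed
    have "norm (odd_ext g x - odd_ext g y) \<le> norm (odd_ext g x) + norm (odd_ext g y)" by (rule norm_triangle_ineq4)
    also have "\<dots> \<le> H * sqrt \<bar>x - y\<bar> + H * sqrt \<bar>x - y\<bar>" by (intro add_mono b d)
    finally show ?thesis by simp
  qed
qed

lemma odd_ext_minus: "g 0 = 0 \<Longrightarrow> g pi = 0 \<Longrightarrow> odd_ext g (- x) = - odd_ext g x"
  using fold_pi_zero[of x] by (auto simp: odd_ext_def fold_pi_def)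

lemma odd_ext_periodic: "odd_ext g (x + 2 * pi) = odd_ext g x"
  by (simp add: odd_ext_def fold_pi_def)

lemma periodic_integral_shift:
  fixes Q :: "real \<Rightarrow> complex"
  assumes c: "continuous_on UNIV Q" and p: "\<And>x. Q (x + 2 * pi) = Q x"
  shows "integral {-pi + \<eta>..pi + \<eta>} Q = integral {-pi..pi} Q"
proof -
  define a b where "a = - pi - \<bar>\<eta>\<bar> - 1" and "b = pi + \<bar>\<eta>\<bar> + 1"
  define F where "F x = integral {a..x} Q" for x
  have F: "(F has_vector_derivative Q x) (at x within {a..b})" if "x \<in> {a..b}" for x
    unfolding F_def by (rule integral_has_vector_derivative[OF continuous_on_subset[OF c] that]) simp
  have int: "integral {x..y} Q = F y - F x" if "a \<le> x" "x \<le> y" "y \<le> b" for x y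
  proof -
    have "integral {a..x} Q + integral {x..y} Q = integral {a..y} Q"
      by (rule Henstock_Kurzweil_Integration.integral_combine) (use that in \<open>auto intro!: integrable_continuous_real continuous_on_subset[OF c]\<close>)
    then show ?thesis by (simp add: F_def algebra_simps)
  qed
  \<comment> \<open>The increment of a primitive over one full period has derivative zero, hence
    does not depend on the starting point.\<close>
  have "\<exists>c. \<forall>x\<in>{a..b - 2 * pi}. F (x + 2 * pi) - F x = c"
  proof (rule has_vector_derivative_zero_constant)
    fix x assume x: "x \<in> {a..b - 2 * pi}"
    have "((\<lambda>x. F (x + 2 * pi)) has_vector_derivative Q x) (at x within {a..b - 2 * pi})"
    proof -
      have "((F \<circ> (\<lambda>x. x + 2 * pi)) has_vector_derivative 1 *\<^sub>R Q (x + 2 * pi)) (at x within {a..b - 2 * pi})"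
      proof (rule vector_diff_chain_within)
        show "((\<lambda>x. x + 2 * pi) has_vector_derivative 1) (at x within {a..b - 2 * pi})"
          by (auto intro!: derivative_eq_intros)
        show "(F has_vector_derivative Q (x + 2 * pi)) (at (x + 2 * pi) within (\<lambda>x. x + 2 * pi) ` {a..b - 2 * pi})"
          by (rule has_vector_derivative_within_subset[OF F]) (use x pi_gt_zero in \<open>auto simp del: pi_gt_zero\<close>)
      qed
      then show ?thesis by (simp add: o_def p)
    qed
    moreover have "(F has_vector_derivative Q x) (at x within {a..b - 2 * pi})"
    proof (rule has_vector_derivative_within_subset[OF F])
      have *: "y \<le> b" if "y \<le> b - 2 * pi" for y using that pi_gt_zero by linarith
      show "x \<in> {a..b}" "{a..b - 2 * pi} \<subseteq> {a..b}" using x * by auto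
    qed
    ultimately have "((\<lambda>x. F (x + 2 * pi) - F x) has_vector_derivative Q x - Q x) (at x within {a..b - 2 * pi})"
      by (rule has_vector_derivative_diff)
    then show "((\<lambda>x. F (x + 2 * pi) - F x) has_vector_derivative 0) (at x within {a..b - 2 * pi})" by simp
  qed (simp, blast)
  then obtain C where C: "\<And>x. x \<in> {a..b - 2 * pi} \<Longrightarrow> F (x + 2 * pi) - F x = C" by blast
  have "F ((- pi + \<eta>) + 2 * pi) - F (- pi + \<eta>) = C" "F ((- pi) + 2 * pi) - F (- pi) = C"
    by (rule C, simp add: a_def b_def abs_if)+
  moreover have "integral {-pi + \<eta>..pi + \<eta>} Q = F (pi + \<eta>) - F (- pi + \<eta>)" "integral {-pi..pi} Q = F pi - F (- pi)"
    by (rule int; simp add: a_def b_def abs_if)+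
  moreover have "(- pi + \<eta>) + 2 * pi = pi + \<eta>" "- pi + 2 * pi = pi" by simp_all
  ultimately show ?thesis by metis
qed

text \<open>Reflection turns the half-range integral into one over a full period, where the shift
  can be moved onto the sine. By the addition formula a sine part and a cosine part arise, and the
  latter integrates to 0 by oddness. Shifts thus act diagonally on the modes, as in d'Alembert's
  formula.\<close>

lemma sine_coeff_odd_ext_shift:
  assumes c: "continuous_on {0..pi} g" and z: "g 0 = 0" "g pi = 0"
  shows "sine_coeff k (\<lambda>x. odd_ext g (x - \<eta>) + odd_ext g (x + \<eta>)) = of_real (2 * cos (real k * \<eta>)) * sine_coeff k g"
proof -
  define P where "P = odd_ext g"
  have P: "continuous_on S P" for S unfolding P_def by (rule continuous_on_subset[OF odd_ext_continuous1[OF c z]]) simp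
  have Pc: "continuous_on S (\<lambda>x. P (x - \<eta>))" "continuous_on S (\<lambda>x. P (x + \<eta>))" for S
    by (rule continuous_on_compose2[OF P[of UNIV]]; auto intro!: continuous_intros)+
  have odd: "P (- x) = - P x" for x unfolding P_def by (rule odd_ext_minus[OF z])
  have per: "P (x + 2 * pi) = P x" for x unfolding P_def by (rule odd_ext_periodic)
  have refl: "integral {0..pi} f = integral {-pi..0} (\<lambda>x. f (- x))" for f :: "real \<Rightarrow> complex"
    using Henstock_Kurzweil_Integration.integral_reflect_real[of pi 0 f] by simp
  have comb: "integral {-pi..0} f + integral {0..pi} f = integral {-pi..pi} f" if "continuous_on {-pi..pi} f" for f :: "real \<Rightarrow> complex"
    by (rule Henstock_Kurzweil_Integration.integral_combine) (use that in \<open>auto intro!: integrable_continuous_real\<close>)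
  define s where "s x = complex_of_real (sin (real k * x))" for x
  define co where "co x = complex_of_real (cos (real k * x))" for x
  have sc: "continuous_on S s" "continuous_on S co" for S unfolding s_def co_def by (intro continuous_intros)+
  have "sine_coeff k (\<lambda>x. odd_ext g (x - \<eta>) + odd_ext g (x + \<eta>)) = integral {0..pi} (\<lambda>x. s x * P (x - \<eta>) + s x * P (x + \<eta>))"
    by (subst sine_coeff_eq_integral) (auto simp: P_def[symmetric] s_def distrib_left intro!: continuous_intros Pc)
  also have "\<dots> = integral {0..pi} (\<lambda>x. s x * P (x - \<eta>)) + integral {0..pi} (\<lambda>x. s x * P (x + \<eta>))"
    by (intro integral_add integrable_continuous_real continuous_intros Pc sc)
  also have "integral {0..pi} (\<lambda>x. s x * P (x - \<eta>)) = integral {-pi..0} (\<lambda>x. s x * P (x + \<eta>))"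
  proof -
    have "s (- x) * P (- x - \<eta>) = s x * P (x + \<eta>)" for x
      using odd[of "x + \<eta>"] by (simp add: s_def)
    then show ?thesis by (subst refl) simp
  qed
  also have "integral {-pi..0} (\<lambda>x. s x * P (x + \<eta>)) + integral {0..pi} (\<lambda>x. s x * P (x + \<eta>)) = integral {-pi..pi} (\<lambda>x. s x * P (x + \<eta>))"
    by (intro comb continuous_intros Pc sc)
  also have "\<dots> = integral {-pi + \<eta>..pi + \<eta>} (\<lambda>x. s (x - \<eta>) * P x)"
    using integral_shift_real_ivl[of "-pi + \<eta>" \<eta> "pi + \<eta>" "\<lambda>x. s (x - \<eta>) * P x"] by simp
  also have "\<dots> = integral {-pi..pi} (\<lambda>x. s (x - \<eta>) * P x)"
  proof (rule periodic_integral_shift)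
    show "continuous_on UNIV (\<lambda>x. s (x - \<eta>) * P x)" unfolding s_def by (intro continuous_intros P)
    show "s (x + 2 * pi - \<eta>) * P (x + 2 * pi) = s (x - \<eta>) * P x" for x
    proof -
      have "sin (real k * (x - \<eta>) + 2 * of_int (int k) * pi) = sin (real k * (x - \<eta>))"
        by (simp add: sin_add)
      moreover have "real k * (x + 2 * pi - \<eta>) = real k * (x - \<eta>) + 2 * of_int (int k) * pi"
        by (simp add: algebra_simps)
      ultimately show ?thesis by (simp only: s_def per)
    qed
  qed
  also have "\<dots> = integral {-pi..pi} (\<lambda>x. of_real (cos (real k * \<eta>)) * (s x * P x) - of_real (sin (real k * \<eta>)) * (co x * P x))"
  proof -
    have "s (x - \<eta>) * P x = of_real (cos (real k * \<eta>)) * (s x * P x) - of_real (sin (real k * \<eta>)) * (co x * P x)" for x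
      by (simp add: s_def co_def right_diff_distrib sin_diff algebra_simps)
    then show ?thesis by simp
  qed
  also have "\<dots> = of_real (cos (real k * \<eta>)) * integral {-pi..pi} (\<lambda>x. s x * P x) - of_real (sin (real k * \<eta>)) * integral {-pi..pi} (\<lambda>x. co x * P x)"
    by (subst integral_diff) (auto intro!: integrable_continuous_real continuous_intros sc P)
  also have "integral {-pi..pi} (\<lambda>x. co x * P x) = 0"
  proof -
    have "co (- x) * P (- x) = - (co x * P x)" for x by (simp add: co_def odd)
    then have "integral {0..pi} (\<lambda>x. co x * P x) = - integral {-pi..0} (\<lambda>x. co x * P x)" by (subst refl) simp
    then show ?thesis using comb[of "\<lambda>x. co x * P x"] by (simp add: continuous_intros sc P)
  qed
  also have "integral {-pi..pi} (\<lambda>x. s x * P x) = 2 * sine_coeff k g"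
  proof -
    have "s (- x) * P (- x) = s x * P x" for x by (simp add: s_def odd)
    then have "integral {0..pi} (\<lambda>x. s x * P x) = integral {-pi..0} (\<lambda>x. s x * P x)" by (subst refl) simp
    then have "integral {-pi..pi} (\<lambda>x. s x * P x) = 2 * integral {0..pi} (\<lambda>x. s x * P x)" using comb[of "\<lambda>x. s x * P x"] by (simp add: continuous_intros sc P)
    also have "integral {0..pi} (\<lambda>x. s x * P x) = sine_coeff k P"
      unfolding s_def by (rule sine_coeff_eq_integral[symmetric, OF P])
    also have "\<dots> = sine_coeff k g" by (rule sine_coeff_cong) (simp add: P_def odd_ext_id)
    finally show ?thesis .
  qed
  finally show ?thesis by simp
qed

lemma sine_coeff_Fubini:
  fixes h :: "real \<Rightarrow> real \<Rightarrow> complex"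
  assumes B: "B \<in> sets borel" and m: "(\<lambda>(x, y). h x y) \<in> borel_measurable borel"
    and b: "\<And>x y. x \<in> {0..pi} \<Longrightarrow> y \<in> B \<Longrightarrow> norm (h x y) \<le> b y" and bi: "set_integrable lborel B b"
  shows "sine_coeff k (\<lambda>x. LINT y:B|lborel. h x y) = (LINT y:B|lborel. sine_coeff k (\<lambda>x. h x y))"
    and "set_integrable lborel B (\<lambda>y. sine_coeff k (\<lambda>x. h x y))"
proof -
  define f where "f x y = of_real (sin (real k * x)) * h x y" for x y
  have [measurable]: "(\<lambda>(x, y). h x y) \<in> borel_measurable (borel \<Otimes>\<^sub>M borel)" using m by (simp add: borel_prod)
  have fm: "(\<lambda>(x, y). f x y) \<in> borel_measurable borel" unfolding f_def borel_prod[symmetric] by measurable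
  have fm1: "f x \<in> borel_measurable borel" for x unfolding f_def by measurable
  have fb: "norm (f x y) \<le> b y" if "x \<in> {0..pi}" "y \<in> B" for x y
  proof -
    have "\<bar>sin (real k * x)\<bar> * norm (h x y) \<le> 1 * b y" using b[OF that] by (intro mult_mono) auto
    then show ?thesis by (simp add: f_def norm_mult)
  qed
  have fi: "set_integrable lborel B (f x)" if "x \<in> {0..pi}" for x
    by (rule set_integrable_dom[OF B fm1 bi fb[OF that]])
  have gi: "set_integrable lborel {0..pi} (\<lambda>x. LINT y:B|lborel. b y)"
    by (intro borel_integrable_atLeastAtMost' continuous_intros)
  have nb: "(LINT y:B|lborel. norm (f x y)) \<le> (LINT y:B|lborel. b y)" if "x \<in> {0..pi}" for x
  proof -
    have "norm (LINT y:B|lborel. norm (f x y)) \<le> (LINT y:B|lborel. b y)"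
      by (rule set_integral_norm_le[OF bi]) (use fb that in auto)
    then show ?thesis by simp
  qed
  note F = set_Fubini[where A = "{0..pi}" and B = B and f = f, OF _ B fm fi gi nb, simplified]
  have e: "(LINT y:B|lborel. f x y) = of_real (sin (real k * x)) * (LINT y:B|lborel. h x y)" for x
    by (simp only: f_def set_integral_mult_right)
  show "sine_coeff k (\<lambda>x. LINT y:B|lborel. h x y) = (LINT y:B|lborel. sine_coeff k (\<lambda>x. h x y))"
    using F(1) by (simp only: e) (simp only: sine_coeff_def f_def)
  show "set_integrable lborel B (\<lambda>y. sine_coeff k (\<lambda>x. h x y))"
    using F(3) by (simp only: sine_coeff_def f_def)
qed

section \<open>Kernel formulas for the second space derivative\<close>

context fractional_order begin

definition A0 :: "(real \<Rightarrow> complex) \<Rightarrow> real \<Rightarrow> real \<Rightarrow> complex" where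
  "A0 G c x = (LINT y:{0<..}|lborel. N0 y * (G (x - c * y) + G (x + c * y)))"

text \<open>
  Subtracting \<open>2 * G x\<close> makes the integral converge for Hoelder exponent 1/2, since \<open>N2\<close> is only integrable
  against \<open>sqrt y\<close>.
\<close>

definition A2 :: "(real \<Rightarrow> complex) \<Rightarrow> real \<Rightarrow> real \<Rightarrow> complex" where
  "A2 G c x = (LINT y:{0<..}|lborel. N2 y * (G (x - c * y) + G (x + c * y) - 2 * G x))"

definition "n2norm = (LINT y:{0<..}|lborel. norm (N2 y * of_real (sqrt y)))"

lemma n2norm_nonneg: "0 \<le> n2norm"
  unfolding n2norm_def by (intro set_integral_nonneg) auto

lemma N2_norm_integrable: "set_integrable lborel {0<..} (\<lambda>y. norm (N2 y * of_real (sqrt y)))"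
  using integrable_norm[OF N2_integrable[unfolded set_integrable_def]] by (simp add: set_integrable_def)

lemma A0_integrand_bound:
  assumes "\<And>x. norm (G x) \<le> M"
  shows "norm (N0 y * (G (x - c * y) + G (x + c * y))) \<le> 2 * M * norm (N0 y)"
proof -
  have "norm (N0 y) * norm (G (x - c * y) + G (x + c * y)) \<le> norm (N0 y) * (M + M)"
    by (intro mult_left_mono norm_triangle_mono assms) auto
  then show ?thesis by (simp add: norm_mult mult_ac)
qed

lemma A0_bound:
  assumes "\<And>x. norm (G x) \<le> M"
  shows "norm (A0 G c x) \<le> 2 * M * n0norm"
  unfolding A0_def n0norm_def set_integral_mult_right[symmetric]
  by (rule set_integral_norm_le) (auto intro!: A0_integrand_bound assms N0_norm_integrable)

lemma A0_continuous:
  assumes G: "continuous_on UNIV G" and M: "\<And>x. norm (G x) \<le> M"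
  shows "continuous_on UNIV (\<lambda>(x, c). A0 G c x)"
  unfolding A0_def case_prod_beta
proof (rule set_integral_continuous_param[where g = "\<lambda>y. 2 * M * norm (N0 y)"])
  have [measurable]: "G \<in> borel_measurable borel" by (rule borel_measurable_continuous_onI[OF G])
  show "(\<lambda>y. N0 y * (G (fst p - snd p * y) + G (fst p + snd p * y))) \<in> borel_measurable borel" for p
    by measurable
  show "continuous_on UNIV (\<lambda>p. N0 y * (G (fst p - snd p * y) + G (fst p + snd p * y)))" for y
    by (intro continuous_intros continuous_on_compose2[OF G]) auto
  show "set_integrable lborel {0<..} (\<lambda>y. 2 * M * norm (N0 y))"
    by (intro set_integrable_mult_right N0_norm_integrable)
qed (auto intro!: A0_integrand_bound M)

lemma A2_integrand_bound:
  assumes h: "\<And>x y. norm (G x - G y) \<le> L * sqrt \<bar>x - y\<bar>" and c: "0 \<le> c" "c \<le> R" and y: "y > 0" and L: "L \<ge> 0"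
  shows "norm (N2 y * (G (x - c * y) + G (x + c * y) - 2 * G x)) \<le> 2 * L * sqrt R * norm (N2 y * of_real (sqrt y))"
proof -
  have "norm (G (x - c * y) + G (x + c * y) - 2 * G x) = norm ((G (x - c * y) - G x) + (G (x + c * y) - G x))"
    by (simp add: algebra_simps)
  also have "\<dots> \<le> L * sqrt \<bar>(x - c * y) - x\<bar> + L * sqrt \<bar>(x + c * y) - x\<bar>"
    by (intro norm_triangle_mono h)
  also have "\<dots> = 2 * L * (sqrt c * sqrt y)" using c y by (simp add: real_sqrt_mult abs_mult)
  also have "\<dots> \<le> 2 * L * (sqrt R * sqrt y)" using c y L by (intro mult_left_mono mult_right_mono) auto
  finally have "norm (N2 y) * norm (G (x - c * y) + G (x + c * y) - 2 * G x) \<le> norm (N2 y) * (2 * L * (sqrt R * sqrt y))"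
    by (intro mult_left_mono) auto
  then show ?thesis using y by (simp add: norm_mult mult_ac)
qed

text \<open>The gain of \<open>sqrt c\<close> is what the subtraction of \<open>2 * G x\<close>
  buys; \<open>Wb\<close> needs it near coinciding times.\<close>

lemma A2_bound:
  assumes h: "\<And>x y. norm (G x - G y) \<le> L * sqrt \<bar>x - y\<bar>" and c: "0 \<le> c" and L: "L \<ge> 0"
  shows "norm (A2 G c x) \<le> 2 * L * sqrt c * n2norm"
  unfolding A2_def n2norm_def set_integral_mult_right[symmetric]
  by (rule set_integral_norm_le) (auto intro!: A2_integrand_bound h c L set_integrable_mult_right N2_norm_integrable)

lemma A2_continuous:
  assumes G: "continuous_on UNIV (\<lambda>(x, s). G x (s::real))" and h: "\<And>x y s. norm (G x s - G y s) \<le> L * sqrt \<bar>x - y\<bar>"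
    and L: "L \<ge> 0"
  shows "continuous_on (UNIV \<times> {0..R} \<times> UNIV) (\<lambda>(x, c, s). A2 (\<lambda>x. G x s) c x)"
  unfolding A2_def case_prod_beta
proof (rule set_integral_continuous_param[where g = "\<lambda>y. 2 * L * sqrt R * norm (N2 y * of_real (sqrt y))"])
  have [measurable]: "(\<lambda>(x, s). G x s) \<in> borel_measurable (borel \<Otimes>\<^sub>M borel)"
    unfolding borel_prod by (rule borel_measurable_continuous_onI[OF G])
  have Gc: "continuous_on S (\<lambda>p. G (a p) (b p))" if "continuous_on S a" "continuous_on S b" for S :: "(real \<times> real \<times> real) set" and a b
    using continuous_on_compose2[OF G continuous_on_Pair[OF that]] by simp
  show "(\<lambda>y. N2 y * (G (fst p - fst (snd p) * y) (snd (snd p)) + G (fst p + fst (snd p) * y) (snd (snd p)) - 2 * G (fst p) (snd (snd p)))) \<in> borel_measurable borel" for p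
    by measurable
  show "continuous_on (UNIV \<times> {0..R} \<times> UNIV) (\<lambda>p. N2 y * (G (fst p - fst (snd p) * y) (snd (snd p)) + G (fst p + fst (snd p) * y) (snd (snd p)) - 2 * G (fst p) (snd (snd p))))" for y
    by (intro continuous_intros Gc)
  show "set_integrable lborel {0<..} (\<lambda>y. 2 * L * sqrt R * norm (N2 y * of_real (sqrt y)))"
    by (intro set_integrable_mult_right N2_norm_integrable)
qed (auto intro!: A2_integrand_bound h L)

lemma A2_measurable:
  assumes G: "continuous_on UNIV (\<lambda>(x, s). G x (s::real))"
  shows "(\<lambda>(x, c, s). A2 (\<lambda>x. G x s) c x) \<in> borel_measurable (borel \<Otimes>\<^sub>M borel \<Otimes>\<^sub>M borel)"
proof -
  have [measurable]: "(\<lambda>(x, s). G x s) \<in> borel_measurable (borel \<Otimes>\<^sub>M borel)"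
    unfolding borel_prod by (rule borel_measurable_continuous_onI[OF G])
  show ?thesis unfolding A2_def set_lebesgue_integral_def by measurable
qed

lemma A0_measurable:
  assumes G: "continuous_on UNIV G"
  shows "(\<lambda>(x, c). A0 G c x) \<in> borel_measurable (borel \<Otimes>\<^sub>M borel)"
proof -
  have [measurable]: "G \<in> borel_measurable borel" by (rule borel_measurable_continuous_onI[OF G])
  show ?thesis unfolding A0_def set_lebesgue_integral_def by measurable
qed

lemma sine_coeff_A0:
  assumes c: "continuous_on {0..pi} g" and z: "g 0 = 0" "g pi = 0"
  shows "sine_coeff k (A0 (odd_ext g) d) = eML ((real k * d)\<^sup>2) * sine_coeff k g"
proof -
  define G where "G = odd_ext g"
  have G: "continuous_on UNIV G" unfolding G_def by (rule odd_ext_continuous1[OF c z])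
  obtain M where M: "\<And>x. x \<in> {0..pi} \<Longrightarrow> norm (g x) \<le> M"
    using compact_imp_bounded[OF compact_continuous_image[OF c compact_Icc]] unfolding bounded_iff by force
  have GM: "norm (G x) \<le> M" for x unfolding G_def by (rule odd_ext_bound[OF M])
  have [measurable]: "G \<in> borel_measurable borel" by (rule borel_measurable_continuous_onI[OF G])
  have "sine_coeff k (A0 G d) = (LINT y:{0<..}|lborel. sine_coeff k (\<lambda>x. N0 y * (G (x - d * y) + G (x + d * y))))"
    unfolding A0_def
  proof (rule sine_coeff_Fubini(1))
    show "set_integrable lborel {0<..} (\<lambda>y. 2 * M * norm (N0 y))"
      by (intro set_integrable_mult_right N0_norm_integrable)
    show "(\<lambda>(x, y). N0 y * (G (x - d * y) + G (x + d * y))) \<in> borel_measurable borel"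
      unfolding borel_prod[symmetric] by measurable
  qed (auto intro!: A0_integrand_bound GM)
  also have "\<dots> = (LINT y:{0<..}|lborel. (N0 y * of_real (2 * cos ((real k * d) * y))) * sine_coeff k g)"
    unfolding sine_coeff_cmult G_def sine_coeff_odd_ext_shift[OF c z] by (simp only: mult.assoc)
  also have "\<dots> = eML ((real k * d)\<^sup>2) * sine_coeff k g"
    by (simp only: set_integral_mult_left N0_cos)
  finally show ?thesis by (simp add: G_def)
qed

lemma sine_coeff_A2:
  assumes c: "continuous_on {0..pi} g" and z: "g 0 = 0" "g pi = 0"
    and h: "\<And>x y. x \<in> {0..pi} \<Longrightarrow> y \<in> {0..pi} \<Longrightarrow> norm (g x - g y) \<le> H * sqrt \<bar>x - y\<bar>" and H: "H \<ge> 0"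
    and d: "d \<ge> 0"
  shows "sine_coeff k (A2 (odd_ext g) d) = - (of_real (real k * d))\<^sup>2 * eML ((real k * d)\<^sup>2) * sine_coeff k g"
proof -
  define G where "G = odd_ext g"
  have G: "continuous_on UNIV G" unfolding G_def by (rule odd_ext_continuous1[OF c z])
  have Gh: "norm (G x - G y) \<le> (2 * H) * sqrt \<bar>x - y\<bar>" for x y
    unfolding G_def by (rule odd_ext_holder[OF h H z])
  have [measurable]: "G \<in> borel_measurable borel" by (rule borel_measurable_continuous_onI[OF G])
  have Gs: "continuous_on S G" for S by (rule continuous_on_subset[OF G]) simp
  have Gc: "continuous_on S (\<lambda>x. G (x - e))" "continuous_on S (\<lambda>x. G (x + e))" for S e
    by (rule continuous_on_compose2[OF G]; auto intro!: continuous_intros)+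
  have "sine_coeff k (A2 G d) = (LINT y:{0<..}|lborel. sine_coeff k (\<lambda>x. N2 y * (G (x - d * y) + G (x + d * y) - 2 * G x)))"
    unfolding A2_def
  proof (rule sine_coeff_Fubini(1))
    show "set_integrable lborel {0<..} (\<lambda>y. 2 * (2 * H) * sqrt d * norm (N2 y * of_real (sqrt y)))"
      by (intro set_integrable_mult_right N2_norm_integrable)
    show "(\<lambda>(x, y). N2 y * (G (x - d * y) + G (x + d * y) - 2 * G x)) \<in> borel_measurable borel"
      unfolding borel_prod[symmetric] by measurable
    show "norm (N2 y * (G (x - d * y) + G (x + d * y) - 2 * G x)) \<le> 2 * (2 * H) * sqrt d * norm (N2 y * of_real (sqrt y))"
      if "y \<in> {0<..}" for x y
      by (rule A2_integrand_bound[OF Gh]) (use that d H in auto)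
  qed simp
  also have "\<dots> = (LINT y:{0<..}|lborel. (N2 y * of_real (2 * cos ((real k * d) * y) - 2)) * sine_coeff k g)"
  proof -
    have "sine_coeff k (\<lambda>x. N2 y * (G (x - d * y) + G (x + d * y) - 2 * G x)) = (N2 y * of_real (2 * cos ((real k * d) * y) - 2)) * sine_coeff k g" for y
    proof -
      have "sine_coeff k (\<lambda>x. G (x - d * y) + G (x + d * y) - 2 * G x) = sine_coeff k (\<lambda>x. G (x - d * y) + G (x + d * y)) - sine_coeff k (\<lambda>x. 2 * G x)"
        by (intro sine_coeff_diff continuous_intros Gc Gs)
      also have "sine_coeff k (\<lambda>x. G (x - d * y) + G (x + d * y)) = of_real (2 * cos (real k * (d * y))) * sine_coeff k g"
        unfolding G_def by (rule sine_coeff_odd_ext_shift[OF c z])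
      also have "sine_coeff k (\<lambda>x. 2 * G x) = 2 * sine_coeff k g"
        unfolding sine_coeff_cmult by (intro arg_cong2[where f = "(*)"] refl sine_coeff_cong) (simp add: G_def odd_ext_id)
      finally have E: "sine_coeff k (\<lambda>x. G (x - d * y) + G (x + d * y) - 2 * G x) = of_real (2 * cos (real k * (d * y))) * sine_coeff k g - 2 * sine_coeff k g" .
      show ?thesis unfolding sine_coeff_cmult E by (simp add: algebra_simps)
    qed
    then show ?thesis by simp
  qed
  also have "\<dots> = - (of_real (real k * d))\<^sup>2 * eML ((real k * d)\<^sup>2) * sine_coeff k g"
    by (simp only: set_integral_mult_left N2_cos)
  finally show ?thesis by (simp add: G_def)
qed

lemma powr_half_square: "t \<ge> 0 \<Longrightarrow> (real k * t powr (\<rho> / 2))\<^sup>2 = (real k)\<^sup>2 * t powr \<rho>"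
  by (simp add: power_mult_distrib power2_eq_square powr_add[symmetric])

text \<open>Rescaling time to (0, 1) fixes the domain of integration, so that continuity in t up to
  t = 0 becomes dominated convergence. The powers combine to t^(1-\<rho>) t t^(2(\<rho>-1)) =
  t^\<rho>.\<close>

lemma conv_resolvent_scaled:
  assumes t: "t > 0"
  shows "of_real (t powr (1 - \<rho>)) * conv (resolvent l) (\<lambda>s. of_real (s powr (\<rho> - 1)) * c s) t =
    of_real (t powr \<rho>) * (LINT \<sigma>:{0<..<1}|lborel. of_real (\<sigma> powr (\<rho> - 1) * (1 - \<sigma>) powr (\<rho> - 1)) * (eML (l * (t * (1 - \<sigma>)) powr \<rho>) * c (t * \<sigma>)))"
proof -
  have "conv (resolvent l) (\<lambda>s. of_real (s powr (\<rho> - 1)) * c s) t =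
     t *\<^sub>R (LINT \<sigma>:{0<..<1}|lborel. resolvent l (t - t * \<sigma>) * (of_real ((t * \<sigma>) powr (\<rho> - 1)) * c (t * \<sigma>)))"
    unfolding conv_def by (rule set_integral_scale_interval(1)[OF t])
  also have "(LINT \<sigma>:{0<..<1}|lborel. resolvent l (t - t * \<sigma>) * (of_real ((t * \<sigma>) powr (\<rho> - 1)) * c (t * \<sigma>))) =
    (LINT \<sigma>:{0<..<1}|lborel. of_real (t powr (\<rho> - 1) * t powr (\<rho> - 1)) * (of_real (\<sigma> powr (\<rho> - 1) * (1 - \<sigma>) powr (\<rho> - 1)) * (eML (l * (t * (1 - \<sigma>)) powr \<rho>) * c (t * \<sigma>))))"
  proof (intro set_lebesgue_integral_cong allI impI)
    fix \<sigma> :: real assume s: "\<sigma> \<in> {0<..<1}"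
    have "t - t * \<sigma> = t * (1 - \<sigma>)" by (simp add: algebra_simps)
    then have "resolvent l (t - t * \<sigma>) = of_real (t powr (\<rho> - 1) * (1 - \<sigma>) powr (\<rho> - 1)) * eML (l * (t * (1 - \<sigma>)) powr \<rho>)"
      using s t by (simp add: resolvent_def powr_mult)
    then show "resolvent l (t - t * \<sigma>) * (of_real ((t * \<sigma>) powr (\<rho> - 1)) * c (t * \<sigma>)) =
       of_real (t powr (\<rho> - 1) * t powr (\<rho> - 1)) * (of_real (\<sigma> powr (\<rho> - 1) * (1 - \<sigma>) powr (\<rho> - 1)) * (eML (l * (t * (1 - \<sigma>)) powr \<rho>) * c (t * \<sigma>)))"
      using s t by (simp add: powr_mult mult_ac)
  qed simp
  also have "\<dots> = of_real (t powr (\<rho> - 1) * t powr (\<rho> - 1)) * (LINT \<sigma>:{0<..<1}|lborel. of_real (\<sigma> powr (\<rho> - 1) * (1 - \<sigma>) powr (\<rho> - 1)) * (eML (l * (t * (1 - \<sigma>)) powr \<rho>) * c (t * \<sigma>)))"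
    by (rule set_integral_mult_right)
  finally have *: "conv (resolvent l) (\<lambda>s. of_real (s powr (\<rho> - 1)) * c s) t = t *\<^sub>R (of_real (t powr (\<rho> - 1) * t powr (\<rho> - 1)) * (LINT \<sigma>:{0<..<1}|lborel. of_real (\<sigma> powr (\<rho> - 1) * (1 - \<sigma>) powr (\<rho> - 1)) * (eML (l * (t * (1 - \<sigma>)) powr \<rho>) * c (t * \<sigma>))))" .
  have "t powr (1 - \<rho>) * (t * (t powr (\<rho> - 1) * t powr (\<rho> - 1))) = t powr (1 - \<rho>) * (t powr 1 * (t powr (\<rho> - 1) * t powr (\<rho> - 1)))"
    using t by (simp only: powr_one less_imp_le)
  also have "\<dots> = t powr ((1 - \<rho>) + (1 + ((\<rho> - 1) + (\<rho> - 1))))" by (simp only: powr_add)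
  also have "\<dots> = t powr \<rho>" by (rule arg_cong[where f = "\<lambda>a. t powr a"]) simp
  finally have "t powr (1 - \<rho>) * (t * (t powr (\<rho> - 1) * t powr (\<rho> - 1))) = t powr \<rho>" .
  then have "complex_of_real (t powr \<rho>) = of_real (t powr (1 - \<rho>)) * (of_real t * of_real (t powr (\<rho> - 1) * t powr (\<rho> - 1)))"
    by (metis of_real_mult)
  then show ?thesis unfolding * scaleR_conv_of_real by (simp only: mult.assoc)
qed

definition Wa :: "(real \<Rightarrow> complex) \<Rightarrow> real \<Rightarrow> real \<Rightarrow> complex" where
  "Wa \<phi>2 x t = A0 (odd_ext \<phi>2) (t powr (\<rho> / 2)) x"

text \<open>The contribution of \<open>f\<close>. The second derivative is carried by the kernel and
  not by \<open>f\<close>: since \<open>A2\<close> supplies k^2 (t (1-\<sigma>))^\<rho>, the weight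
  has exponent -1 in place of \<rho> - 1, and the prefactor t^\<rho> is absorbed.\<close>

definition Wb :: "(real \<Rightarrow> real \<Rightarrow> complex) \<Rightarrow> real \<Rightarrow> real \<Rightarrow> complex" where
  "Wb f x t = (LINT \<sigma>:{0<..<1}|lborel. of_real (\<sigma> powr (\<rho> - 1) * (1 - \<sigma>) powr (-1)) *
     A2 (\<lambda>x. odd_ext (\<lambda>y. f y (t * \<sigma>)) x) ((t * (1 - \<sigma>)) powr (\<rho> / 2)) x)"

text \<open>The contribution of the unknown source \<open>P\<close>. Both derivatives fall on q, so
  the kernel stays as mild as that of \<open>A0\<close> and nothing about the smoothness of
  \<open>P\<close> enters.\<close>

definition Wc :: "(real \<Rightarrow> complex) \<Rightarrow> (real \<Rightarrow> complex) \<Rightarrow> real \<Rightarrow> real \<Rightarrow> complex" where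
  "Wc q2 P x t = of_real (t powr \<rho>) * (LINT \<sigma>:{0<..<1}|lborel. of_real (\<sigma> powr (\<rho> - 1) * (1 - \<sigma>) powr (\<rho> - 1)) *
     (P (t * \<sigma>) * A0 (odd_ext q2) ((t * (1 - \<sigma>)) powr (\<rho> / 2)) x))"

lemma Wa_facts:
  assumes c: "continuous_on {0..pi} g" and z: "g 0 = 0" "g pi = 0" and M: "\<And>x. x \<in> {0..pi} \<Longrightarrow> norm (g x) \<le> M"
  shows "continuous_on (UNIV \<times> {0..T}) (\<lambda>(x, t). Wa g x t)"
    and "norm (Wa g x t) \<le> 2 * M * n0norm"
    and "t \<ge> 0 \<Longrightarrow> sine_coeff k (\<lambda>x. Wa g x t) = eML ((real k)\<^sup>2 * t powr \<rho>) * sine_coeff k g"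
proof -
  have G: "continuous_on UNIV (odd_ext g)" by (rule odd_ext_continuous1[OF c z])
  have GM: "norm (odd_ext g x) \<le> M" for x by (rule odd_ext_bound[OF M])
  show "continuous_on (UNIV \<times> {0..T}) (\<lambda>(x, t). Wa g x t)"
  proof -
    have "continuous_on (UNIV \<times> {0..T}) (\<lambda>p. (\<lambda>(x, c). A0 (odd_ext g) c x) (fst p, snd p powr (\<rho> / 2)))"
      by (rule continuous_on_compose2[OF A0_continuous[OF G GM]])
        (use rho in \<open>auto intro!: continuous_intros continuous_on_powr'\<close>)
    then show ?thesis by (simp add: Wa_def case_prod_beta)
  qed
  show "norm (Wa g x t) \<le> 2 * M * n0norm" unfolding Wa_def by (rule A0_bound[OF GM])
  show "t \<ge> 0 \<Longrightarrow> sine_coeff k (\<lambda>x. Wa g x t) = eML ((real k)\<^sup>2 * t powr \<rho>) * sine_coeff k g"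
    using sine_coeff_A0[OF c z, of k "t powr (\<rho> / 2)"] unfolding Wa_def by (simp add: powr_half_square)
qed

text \<open>The weight (1-\<sigma>)^(-1) by itself is not integrable. \<open>A2_bound\<close> at
  shift scale (t (1-\<sigma>))^(\<rho>/2) gains the square root (t (1-\<sigma>))^(\<rho>/4), which
  yields an integrable Beta weight. The factor 4 is 2 from \<open>A2_bound\<close> times 2 from the
  odd extension.\<close>

lemma Wb_facts:
  assumes T: "T > 0" and c: "continuous_on ({0..pi} \<times> UNIV) (\<lambda>(x, s). f x s)"
    and z: "\<And>s. f 0 s = 0" "\<And>s. f pi s = 0"
    and h: "\<And>x y s. x \<in> {0..pi} \<Longrightarrow> y \<in> {0..pi} \<Longrightarrow> norm (f x s - f y s) \<le> H * sqrt \<bar>x - y\<bar>" and H: "H \<ge> 0"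
  shows "continuous_on (UNIV \<times> {0..T}) (\<lambda>(x, t). Wb f x t)"
    and "t \<in> {0..T} \<Longrightarrow> norm (Wb f x t) \<le> 4 * H * n2norm * T powr (\<rho> / 4) * Beta \<rho> (\<rho> / 4)"
    and "t \<in> {0..T} \<Longrightarrow> sine_coeff k (\<lambda>x. Wb f x t) = - (of_nat k)\<^sup>2 * (of_real (t powr \<rho>) *
       (LINT \<sigma>:{0<..<1}|lborel. of_real (\<sigma> powr (\<rho> - 1) * (1 - \<sigma>) powr (\<rho> - 1)) * (eML ((real k)\<^sup>2 * (t * (1 - \<sigma>)) powr \<rho>) * sine_coeff k (\<lambda>x. f x (t * \<sigma>)))))"
proof -
  define G where "G x s = odd_ext (\<lambda>y. f y s) x" for x s
  have G: "continuous_on UNIV (\<lambda>(x, s). G x s)" unfolding G_def by (rule odd_ext_continuous[OF c z])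
  have Gh: "norm (G x s - G y s) \<le> (2 * H) * sqrt \<bar>x - y\<bar>" for x y s
    unfolding G_def by (rule odd_ext_holder[OF h H z])
  have [measurable (raw)]: "(\<lambda>p. A2 (\<lambda>x. G x (s p)) (c p) (a p)) \<in> borel_measurable N"
    if "a \<in> borel_measurable N" "c \<in> borel_measurable N" "s \<in> borel_measurable N" for N :: "'n measure" and a c s
    using measurable_compose[OF measurable_Pair[OF that(1) measurable_Pair[OF that(2,3)]] A2_measurable[OF G]] by simp
  define K where "K = 4 * H * n2norm * T powr (\<rho> / 4)"
  have K: "K \<ge> 0" using H n2norm_nonneg by (simp add: K_def)
  let ?w = "\<lambda>\<sigma>::real. complex_of_real (\<sigma> powr (\<rho> - 1) * (1 - \<sigma>) powr (-1))"
  define \<Psi> where "\<Psi> x t \<sigma> = ?w \<sigma> * A2 (\<lambda>x. G x (t * \<sigma>)) ((t * (1 - \<sigma>)) powr (\<rho> / 2)) x" for x t \<sigma>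
  have W: "Wb f x t = (LINT \<sigma>:{0<..<1}|lborel. \<Psi> x t \<sigma>)" for x t
    unfolding Wb_def \<Psi>_def G_def ..
  have b: "norm (\<Psi> x t \<sigma>) \<le> K * (\<sigma> powr (\<rho> - 1) * (1 - \<sigma>) powr (\<rho> / 4 - 1))" if "t \<in> {0..T}" "\<sigma> \<in> {0<..<1}" for x t \<sigma>
  proof -
    have "norm (A2 (\<lambda>x. G x (t * \<sigma>)) ((t * (1 - \<sigma>)) powr (\<rho> / 2)) x) \<le> 2 * (2 * H) * sqrt ((t * (1 - \<sigma>)) powr (\<rho> / 2)) * n2norm"
      using H by (intro A2_bound Gh) auto
    also have "\<dots> \<le> 2 * (2 * H) * (T powr (\<rho> / 4) * (1 - \<sigma>) powr (\<rho> / 4)) * n2norm"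
    proof -
      have "sqrt ((t * (1 - \<sigma>)) powr (\<rho> / 2)) = (t * (1 - \<sigma>)) powr (\<rho> / 4)"
        by (simp add: powr_half_sqrt[symmetric] powr_powr)
      also have "\<dots> \<le> (T * (1 - \<sigma>)) powr (\<rho> / 4)"
        using that rho by (intro powr_mono2) (auto intro!: mult_right_mono)
      also have "\<dots> = T powr (\<rho> / 4) * (1 - \<sigma>) powr (\<rho> / 4)" using that T by (simp add: powr_mult)
      finally show ?thesis using H n2norm_nonneg by (intro mult_right_mono mult_left_mono) auto
    qed
    finally have "norm (A2 (\<lambda>x. G x (t * \<sigma>)) ((t * (1 - \<sigma>)) powr (\<rho> / 2)) x) \<le> K * (1 - \<sigma>) powr (\<rho> / 4)"
      by (simp add: K_def mult_ac)
    then have "norm (?w \<sigma>) * norm (A2 (\<lambda>x. G x (t * \<sigma>)) ((t * (1 - \<sigma>)) powr (\<rho> / 2)) x) \<le> norm (?w \<sigma>) * (K * (1 - \<sigma>) powr (\<rho> / 4))"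
      by (intro mult_left_mono) auto
    also have "\<dots> = K * (\<sigma> powr (\<rho> - 1) * ((1 - \<sigma>) powr (-1) * (1 - \<sigma>) powr (\<rho> / 4)))"
    proof -
      have "norm (?w \<sigma>) = \<sigma> powr (\<rho> - 1) * (1 - \<sigma>) powr (-1)"
        unfolding norm_of_real by (rule abs_of_nonneg) simp
      then show ?thesis by (simp only: mult_ac)
    qed
    also have "(1 - \<sigma>) powr (-1) * (1 - \<sigma>) powr (\<rho> / 4) = (1 - \<sigma>) powr (-1 + \<rho> / 4)"
      by (rule powr_add[symmetric])
    also have "-1 + \<rho> / 4 = \<rho> / 4 - 1" by simp
    finally show ?thesis unfolding \<Psi>_def norm_mult .
  qed
  have gi: "set_integrable lborel {0<..<1} (\<lambda>\<sigma>. K * (\<sigma> powr (\<rho> - 1) * (1 - \<sigma>) powr (\<rho> / 4 - 1)))"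
    using rho by (intro set_integrable_mult_right beta_integral) auto
  show "continuous_on (UNIV \<times> {0..T}) (\<lambda>(x, t). Wb f x t)"
    unfolding W case_prod_beta
  proof (rule set_integral_continuous_param[OF _ _ _ _ gi])
    fix \<sigma> :: real assume s: "\<sigma> \<in> {0<..<1}"
    have "continuous_on (UNIV \<times> {0..T}) (\<lambda>p. (\<lambda>(x, c, s). A2 (\<lambda>x. G x s) c x) (fst p, (snd p * (1 - \<sigma>)) powr (\<rho> / 2), snd p * \<sigma>))"
    proof (rule continuous_on_compose2[OF A2_continuous[OF G Gh, of "T powr (\<rho> / 2)"]])
      show "continuous_on (UNIV \<times> {0..T}) (\<lambda>p :: real \<times> real. (fst p, (snd p * (1 - \<sigma>)) powr (\<rho> / 2), snd p * \<sigma>))"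
        using rho s by (intro continuous_intros continuous_on_powr') auto
      show "(\<lambda>p :: real \<times> real. (fst p, (snd p * (1 - \<sigma>)) powr (\<rho> / 2), snd p * \<sigma>)) ` (UNIV \<times> {0..T}) \<subseteq> UNIV \<times> {0..T powr (\<rho> / 2)} \<times> UNIV"
      proof safe
        fix t assume t: "t \<in> {0..T}"
        have "t * (1 - \<sigma>) \<le> T * 1" using t s by (intro mult_mono) auto
        then show "(snd (x, t) * (1 - \<sigma>)) powr (\<rho> / 2) \<in> {0..T powr (\<rho> / 2)}" for x :: real
          using t s rho by (auto intro!: powr_mono2)
      qed auto
    qed (use H in auto)
    then show "continuous_on (UNIV \<times> {0..T}) (\<lambda>p. \<Psi> (fst p) (snd p) \<sigma>)"
      unfolding \<Psi>_def by (intro continuous_intros) simp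
  next
    show "\<Psi> (fst p) (snd p) \<in> borel_measurable borel" for p unfolding \<Psi>_def by measurable
  qed (auto intro!: b)
  show "norm (Wb f x t) \<le> 4 * H * n2norm * T powr (\<rho> / 4) * Beta \<rho> (\<rho> / 4)" if "t \<in> {0..T}" for x t
  proof -
    have "norm (Wb f x t) \<le> (LINT \<sigma>:{0<..<1}|lborel. K * (\<sigma> powr (\<rho> - 1) * (1 - \<sigma>) powr (\<rho> / 4 - 1)))"
      unfolding W by (rule set_integral_norm_le[OF gi b[OF that]])
    also have "\<dots> = K * Beta \<rho> (\<rho> / 4)"
      using beta_integral(2)[of \<rho> "\<rho> / 4"] rho by simp
    finally show ?thesis by (simp add: K_def)
  qed
  show "sine_coeff k (\<lambda>x. Wb f x t) = - (of_nat k)\<^sup>2 * (of_real (t powr \<rho>) *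
       (LINT \<sigma>:{0<..<1}|lborel. of_real (\<sigma> powr (\<rho> - 1) * (1 - \<sigma>) powr (\<rho> - 1)) * (eML ((real k)\<^sup>2 * (t * (1 - \<sigma>)) powr \<rho>) * sine_coeff k (\<lambda>x. f x (t * \<sigma>)))))"
    if t: "t \<in> {0..T}" for t
  proof -
    have "sine_coeff k (\<lambda>x. Wb f x t) = (LINT \<sigma>:{0<..<1}|lborel. sine_coeff k (\<lambda>x. \<Psi> x t \<sigma>))"
      unfolding W
    proof (rule sine_coeff_Fubini(1)[OF _ _ b[OF t] gi])
      show "(\<lambda>(x, \<sigma>). \<Psi> x t \<sigma>) \<in> borel_measurable borel"
        unfolding \<Psi>_def borel_prod[symmetric] by measurable
    qed auto
    also have "\<dots> = (LINT \<sigma>:{0<..<1}|lborel. (- (of_nat k)\<^sup>2 * of_real (t powr \<rho>)) *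
       (of_real (\<sigma> powr (\<rho> - 1) * (1 - \<sigma>) powr (\<rho> - 1)) * (eML ((real k)\<^sup>2 * (t * (1 - \<sigma>)) powr \<rho>) * sine_coeff k (\<lambda>x. f x (t * \<sigma>)))))"
    proof (intro set_lebesgue_integral_cong allI impI)
      fix \<sigma> :: real assume s: "\<sigma> \<in> {0<..<1}"
      have fc: "continuous_on {0..pi} (\<lambda>x. f x (t * \<sigma>))"
      proof -
        have "continuous_on {0..pi} (\<lambda>x. (x, t * \<sigma>))" by (intro continuous_intros)
        from continuous_on_compose2[OF c this] show ?thesis by auto
      qed
      have nn: "t * (1 - \<sigma>) \<ge> 0" using s t by simp
      have "sine_coeff k (\<lambda>x. \<Psi> x t \<sigma>) = ?w \<sigma> * sine_coeff k (A2 (odd_ext (\<lambda>y. f y (t * \<sigma>))) ((t * (1 - \<sigma>)) powr (\<rho> / 2)))"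
        unfolding \<Psi>_def sine_coeff_cmult G_def ..
      also have "sine_coeff k (A2 (odd_ext (\<lambda>y. f y (t * \<sigma>))) ((t * (1 - \<sigma>)) powr (\<rho> / 2))) =
         - (of_real (real k * (t * (1 - \<sigma>)) powr (\<rho> / 2)))\<^sup>2 * eML ((real k * (t * (1 - \<sigma>)) powr (\<rho> / 2))\<^sup>2) * sine_coeff k (\<lambda>x. f x (t * \<sigma>))"
        by (rule sine_coeff_A2[OF fc z h H]) auto
      also have "(complex_of_real (real k * (t * (1 - \<sigma>)) powr (\<rho> / 2)))\<^sup>2 = of_real ((real k)\<^sup>2 * (t * (1 - \<sigma>)) powr \<rho>)"
        using powr_half_square[OF nn, of k] by (metis of_real_power)
      also have "(real k * (t * (1 - \<sigma>)) powr (\<rho> / 2))\<^sup>2 = (real k)\<^sup>2 * (t * (1 - \<sigma>)) powr \<rho>"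
        by (rule powr_half_square[OF nn])
      \<comment> \<open>The factor (1-\<sigma>)^\<rho> supplied by \<open>A2\<close> restores the
        exponent \<rho> - 1 of the convolution with the resolvent.\<close>
      also have "?w \<sigma> * (- of_real ((real k)\<^sup>2 * (t * (1 - \<sigma>)) powr \<rho>) * eML ((real k)\<^sup>2 * (t * (1 - \<sigma>)) powr \<rho>) * sine_coeff k (\<lambda>x. f x (t * \<sigma>))) =
        (- (of_nat k)\<^sup>2 * of_real (t powr \<rho>)) * (of_real (\<sigma> powr (\<rho> - 1) * ((1 - \<sigma>) powr (-1) * (1 - \<sigma>) powr \<rho>)) * (eML ((real k)\<^sup>2 * (t * (1 - \<sigma>)) powr \<rho>) * sine_coeff k (\<lambda>x. f x (t * \<sigma>))))"
        using s t by (simp add: powr_mult mult_ac)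
      also have "(1 - \<sigma>) powr (-1) * (1 - \<sigma>) powr \<rho> = (1 - \<sigma>) powr (-1 + \<rho>)"
        by (rule powr_add[symmetric])
      also have "-1 + \<rho> = \<rho> - 1" by simp
      finally show "sine_coeff k (\<lambda>x. \<Psi> x t \<sigma>) = (- (of_nat k)\<^sup>2 * of_real (t powr \<rho>)) *
       (of_real (\<sigma> powr (\<rho> - 1) * (1 - \<sigma>) powr (\<rho> - 1)) * (eML ((real k)\<^sup>2 * (t * (1 - \<sigma>)) powr \<rho>) * sine_coeff k (\<lambda>x. f x (t * \<sigma>))))" .
    qed simp
    finally show ?thesis by (simp only: set_integral_mult_right mult.assoc)
  qed
qed

text \<open>The bound on the norm keeps the weakly singular integral of |P| and does not estimate it
  by \<open>D\<close>, because it is to enter a Gronwall inequality. The bound \<open>D\<close> only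
  serves as a majorant for continuity and Fubini.\<close>

lemma Wc_facts:
  assumes T: "T > 0" and c: "continuous_on {0..pi} g" and z: "g 0 = 0" "g pi = 0"
    and P: "continuous_on UNIV P" and M: "\<And>x. x \<in> {0..pi} \<Longrightarrow> norm (g x) \<le> M" and Pb: "\<And>s. norm (P s) \<le> D"
  shows "continuous_on (UNIV \<times> {0..T}) (\<lambda>(x, t). Wc g P x t)"
    and "norm (Wc g P x t) \<le> 2 * M * n0norm * (t powr \<rho> * (LINT \<sigma>:{0<..<1}|lborel. \<sigma> powr (\<rho> - 1) * (1 - \<sigma>) powr (\<rho> - 1) * norm (P (t * \<sigma>))))"
    and "t \<ge> 0 \<Longrightarrow> sine_coeff k (\<lambda>x. Wc g P x t) = of_real (t powr \<rho>) *
       (LINT \<sigma>:{0<..<1}|lborel. of_real (\<sigma> powr (\<rho> - 1) * (1 - \<sigma>) powr (\<rho> - 1)) * (eML ((real k)\<^sup>2 * (t * (1 - \<sigma>)) powr \<rho>) * (P (t * \<sigma>) * sine_coeff k g)))"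
proof -
  define G where "G = odd_ext g"
  have G: "continuous_on UNIV G" unfolding G_def by (rule odd_ext_continuous1[OF c z])
  have GM: "norm (G x) \<le> M" for x unfolding G_def by (rule odd_ext_bound[OF M])
  have M0: "M \<ge> 0" using GM[of 0] norm_ge_zero order_trans by blast
  have D0: "D \<ge> 0" using Pb[of 0] norm_ge_zero order_trans by blast
  have [measurable (raw)]: "(\<lambda>p. A0 G (c p) (a p)) \<in> borel_measurable N"
    if "a \<in> borel_measurable N" "c \<in> borel_measurable N" for N :: "'n measure" and a c
    using measurable_compose[OF measurable_Pair[OF that(1,2)] A0_measurable[OF G]] by simp
  have [measurable]: "P \<in> borel_measurable borel" by (rule borel_measurable_continuous_onI[OF P])
  define N where "N = 2 * M * n0norm"
  have N: "N \<ge> 0" using M0 n0norm_nonneg by (simp add: N_def)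
  let ?w = "\<lambda>\<sigma>::real. \<sigma> powr (\<rho> - 1) * (1 - \<sigma>) powr (\<rho> - 1)"
  define \<Psi> where "\<Psi> x t \<sigma> = complex_of_real (?w \<sigma>) * (P (t * \<sigma>) * A0 G ((t * (1 - \<sigma>)) powr (\<rho> / 2)) x)" for x t \<sigma>
  have W: "Wc g P x t = of_real (t powr \<rho>) * (LINT \<sigma>:{0<..<1}|lborel. \<Psi> x t \<sigma>)" for x t
    unfolding Wc_def \<Psi>_def G_def ..
  have b1: "norm (\<Psi> x t \<sigma>) \<le> N * (?w \<sigma> * norm (P (t * \<sigma>)))" for x t \<sigma>
  proof -
    have "norm (A0 G ((t * (1 - \<sigma>)) powr (\<rho> / 2)) x) \<le> N" unfolding N_def by (rule A0_bound[OF GM])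
    then have "(?w \<sigma> * norm (P (t * \<sigma>))) * norm (A0 G ((t * (1 - \<sigma>)) powr (\<rho> / 2)) x) \<le> (?w \<sigma> * norm (P (t * \<sigma>))) * N"
      by (intro mult_left_mono) auto
    then show ?thesis by (simp add: \<Psi>_def norm_mult mult_ac)
  qed
  have b: "norm (\<Psi> x t \<sigma>) \<le> N * D * ?w \<sigma>" for x t \<sigma>
  proof -
    have "N * (?w \<sigma> * norm (P (t * \<sigma>))) \<le> N * (?w \<sigma> * D)"
      using N Pb by (intro mult_left_mono) auto
    then show ?thesis using b1[of x t \<sigma>] by (simp add: mult_ac)
  qed
  have wi: "set_integrable lborel {0<..<1} ?w" using rho by (intro beta_integral) auto
  have gi: "set_integrable lborel {0<..<1} (\<lambda>\<sigma>. N * D * ?w \<sigma>)"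
    by (intro set_integrable_mult_right wi)
  have gi1: "set_integrable lborel {0<..<1} (\<lambda>\<sigma>. N * (?w \<sigma> * norm (P (t * \<sigma>))))" for t
  proof (rule set_integrable_mult_right, rule set_integrable_dom)
    show "set_integrable lborel {0<..<1} (\<lambda>\<sigma>. D * ?w \<sigma>)" by (intro set_integrable_mult_right wi)
    show "norm (?w \<sigma> * norm (P (t * \<sigma>))) \<le> D * ?w \<sigma>" for \<sigma>
      using mult_left_mono[OF Pb[of "t * \<sigma>"], of "?w \<sigma>"] by (simp add: abs_mult mult_ac)
  qed measurable
  show "continuous_on (UNIV \<times> {0..T}) (\<lambda>(x, t). Wc g P x t)"
    unfolding W case_prod_beta
  proof (intro continuous_on_mult)
    show "continuous_on (UNIV \<times> {0..T}) (\<lambda>p::real \<times> real. complex_of_real (snd p powr \<rho>))"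
      using rho by (intro continuous_intros continuous_on_powr') auto
    show "continuous_on (UNIV \<times> {0..T}) (\<lambda>p. LINT \<sigma>:{0<..<1}|lborel. \<Psi> (fst p) (snd p) \<sigma>)"
    proof (rule set_integral_continuous_param[OF _ _ _ _ gi])
      fix \<sigma> :: real assume s: "\<sigma> \<in> {0<..<1}"
      have "continuous_on (UNIV \<times> {0..T}) (\<lambda>p. (\<lambda>(x, c). A0 G c x) (fst p, (snd p * (1 - \<sigma>)) powr (\<rho> / 2)))"
        by (rule continuous_on_compose2[OF A0_continuous[OF G GM]])
          (use rho s in \<open>auto intro!: continuous_intros continuous_on_powr'\<close>)
      moreover have "continuous_on (UNIV \<times> {0..T}) (\<lambda>p::real \<times> real. P (snd p * \<sigma>))"
        by (rule continuous_on_compose2[OF P]) (auto intro!: continuous_intros)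
      ultimately show "continuous_on (UNIV \<times> {0..T}) (\<lambda>p. \<Psi> (fst p) (snd p) \<sigma>)"
        unfolding \<Psi>_def by (intro continuous_intros) simp_all
    next
      show "\<Psi> (fst p) (snd p) \<in> borel_measurable borel" for p unfolding \<Psi>_def by measurable
    qed (auto intro!: b)
  qed
  show "norm (Wc g P x t) \<le> 2 * M * n0norm * (t powr \<rho> * (LINT \<sigma>:{0<..<1}|lborel. ?w \<sigma> * norm (P (t * \<sigma>))))" for x t
  proof -
    have "norm (LINT \<sigma>:{0<..<1}|lborel. \<Psi> x t \<sigma>) \<le> (LINT \<sigma>:{0<..<1}|lborel. N * (?w \<sigma> * norm (P (t * \<sigma>))))"
      by (rule set_integral_norm_le[OF gi1 b1])
    also have "\<dots> = N * (LINT \<sigma>:{0<..<1}|lborel. ?w \<sigma> * norm (P (t * \<sigma>)))" by (rule set_integral_mult_right)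
    finally have "t powr \<rho> * norm (LINT \<sigma>:{0<..<1}|lborel. \<Psi> x t \<sigma>) \<le> t powr \<rho> * (N * (LINT \<sigma>:{0<..<1}|lborel. ?w \<sigma> * norm (P (t * \<sigma>))))"
      by (intro mult_left_mono) auto
    then show ?thesis by (simp add: W norm_mult N_def mult_ac)
  qed
  show "sine_coeff k (\<lambda>x. Wc g P x t) = of_real (t powr \<rho>) *
       (LINT \<sigma>:{0<..<1}|lborel. of_real (?w \<sigma>) * (eML ((real k)\<^sup>2 * (t * (1 - \<sigma>)) powr \<rho>) * (P (t * \<sigma>) * sine_coeff k g)))"
    if t: "t \<ge> 0" for t
  proof -
    have "sine_coeff k (\<lambda>x. LINT \<sigma>:{0<..<1}|lborel. \<Psi> x t \<sigma>) = (LINT \<sigma>:{0<..<1}|lborel. sine_coeff k (\<lambda>x. \<Psi> x t \<sigma>))"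
    proof (rule sine_coeff_Fubini(1)[OF _ _ b gi])
      show "(\<lambda>(x, \<sigma>). \<Psi> x t \<sigma>) \<in> borel_measurable borel"
        unfolding \<Psi>_def borel_prod[symmetric] by measurable
    qed auto
    also have "\<dots> = (LINT \<sigma>:{0<..<1}|lborel. of_real (?w \<sigma>) * (eML ((real k)\<^sup>2 * (t * (1 - \<sigma>)) powr \<rho>) * (P (t * \<sigma>) * sine_coeff k g)))"
    proof (intro set_lebesgue_integral_cong allI impI)
      fix \<sigma> :: real assume s: "\<sigma> \<in> {0<..<1}"
      then have nn: "t * (1 - \<sigma>) \<ge> 0" using t by simp
      show "sine_coeff k (\<lambda>x. \<Psi> x t \<sigma>) = of_real (?w \<sigma>) * (eML ((real k)\<^sup>2 * (t * (1 - \<sigma>)) powr \<rho>) * (P (t * \<sigma>) * sine_coeff k g))"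
        unfolding \<Psi>_def sine_coeff_cmult G_def sine_coeff_A0[OF c z] powr_half_square[OF nn] by (simp only: mult_ac)
    qed simp
    finally show ?thesis unfolding W sine_coeff_cmult by simp
  qed
qed

end

section \<open>Fourier coefficients of a solution\<close>

text \<open>The symmetric intervals [d, pi - d] exhaust (0, pi). Expressed through primitives of
  \<open>Z\<close>, Green's formula is continuous in d down to d = 0, where the boundary terms
  vanish.\<close>

lemma green_limit:
  assumes Y: "continuous_on {0..pi} Y" "Y 0 = 0" "Y pi = 0" and Z: "continuous_on {0..pi} Z"
    and eq: "\<And>a b x. 0 < a \<Longrightarrow> a < b \<Longrightarrow> b < pi \<Longrightarrow> x \<in> {a..b} \<Longrightarrow>
      of_real (b - a) * Y x = of_real (b - x) * Y a + of_real (x - a) * Y b -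
     (of_real (b - x) * integral {a..x} (\<lambda>y. of_real (y - a) * Z y) + of_real (x - a) * integral {x..b} (\<lambda>y. of_real (b - y) * Z y))"
    and x: "x \<in> {0..pi}"
  shows "Y x = green_op Z x"
proof (cases "x = 0 \<or> x = pi")
  case True
  then show ?thesis using Y by auto
next
  case False
  then have x: "0 < x" "x < pi" using x by auto
  define A0 where "A0 z = integral {0..z} Z" for z
  define A1 where "A1 z = integral {0..z} (\<lambda>y. of_real y * Z y)" for z
  have Zi: "Z integrable_on {0..pi}" "(\<lambda>y. of_real y * Z y) integrable_on {0..pi}"
    by (intro integrable_continuous_real continuous_intros Z)+
  have Ac: "continuous_on {0..pi} A0" "continuous_on {0..pi} A1"
    unfolding A0_def A1_def by (intro indefinite_integral_continuous_1 Zi)+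
  have split: "integral {c..d} Z = A0 d - A0 c" "integral {c..d} (\<lambda>y. of_real y * Z y) = A1 d - A1 c"
    "Z integrable_on {c..d}" "(\<lambda>y. of_real y * Z y) integrable_on {c..d}" if "0 \<le> c" "c \<le> d" "d \<le> pi" for c d
  proof -
    have s: "{0..d} \<subseteq> {0..pi}" "{c..d} \<subseteq> {0..pi}" using that by auto
    show "Z integrable_on {c..d}" "(\<lambda>y. of_real y * Z y) integrable_on {c..d}"
      by (rule integrable_on_subinterval[OF _ s(2)], rule Zi)+
    have "integral {0..c} Z + integral {c..d} Z = integral {0..d} Z"
      by (rule Henstock_Kurzweil_Integration.integral_combine[OF that(1,2) integrable_on_subinterval[OF Zi(1) s(1)]])
    then show "integral {c..d} Z = A0 d - A0 c" by (simp add: A0_def algebra_simps)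
    have "integral {0..c} (\<lambda>y. of_real y * Z y) + integral {c..d} (\<lambda>y. of_real y * Z y) = integral {0..d} (\<lambda>y. of_real y * Z y)"
      by (rule Henstock_Kurzweil_Integration.integral_combine[OF that(1,2) integrable_on_subinterval[OF Zi(2) s(1)]])
    then show "integral {c..d} (\<lambda>y. of_real y * Z y) = A1 d - A1 c" by (simp add: A1_def algebra_simps)
  qed
  have l: "integral {c..d} (\<lambda>y. of_real (y - e) * Z y) = (A1 d - A1 c) - of_real e * (A0 d - A0 c)" if "0 \<le> c" "c \<le> d" "d \<le> pi" for c d e
  proof -
    have "integral {c..d} (\<lambda>y. of_real (y - e) * Z y) = integral {c..d} (\<lambda>y. of_real y * Z y - of_real e * Z y)"
      by (simp add: left_diff_distrib)
    also have "\<dots> = integral {c..d} (\<lambda>y. of_real y * Z y) - integral {c..d} (\<lambda>y. of_real e * Z y)"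
      using split[OF that] by (intro integral_diff integrable_on_mult_right)
    finally show ?thesis using split[OF that] by simp
  qed
  have r: "integral {c..d} (\<lambda>y. of_real (e - y) * Z y) = of_real e * (A0 d - A0 c) - (A1 d - A1 c)" if "0 \<le> c" "c \<le> d" "d \<le> pi" for c d e
  proof -
    have "integral {c..d} (\<lambda>y. of_real (e - y) * Z y) = integral {c..d} (\<lambda>y. of_real e * Z y - of_real y * Z y)"
      by (simp add: left_diff_distrib)
    also have "\<dots> = integral {c..d} (\<lambda>y. of_real e * Z y) - integral {c..d} (\<lambda>y. of_real y * Z y)"
      using split[OF that] by (intro integral_diff integrable_on_mult_right)
    finally show ?thesis using split[OF that] by simp
  qed
  define m where "m = min x (pi - x)"
  have m: "m > 0" "m \<le> x" "m \<le> pi - x" using x by (auto simp: m_def)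
  \<comment> \<open>The defect of Green's formula on [d, pi - d]; it is zero for small d > 0 and
    continuous at d = 0.\<close>
  define E where "E d = of_real (pi - d - d) * Y x - (of_real (pi - d - x) * Y d + of_real (x - d) * Y (pi - d) -
     (of_real (pi - d - x) * ((A1 x - A1 d) - of_real d * (A0 x - A0 d)) + of_real (x - d) * (of_real (pi - d) * (A0 (pi - d) - A0 x) - (A1 (pi - d) - A1 x))))" for d
  have cont: "continuous_on {0..m} E"
  proof -
    have c1: "continuous_on {0..m} (\<lambda>d. h d)" if "continuous_on {0..pi} h" for h :: "real \<Rightarrow> complex"
      by (rule continuous_on_subset[OF that]) (use m x in auto)
    have c2: "continuous_on {0..m} (\<lambda>d. h (pi - d))" if "continuous_on {0..pi} h" for h :: "real \<Rightarrow> complex"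
      by (rule continuous_on_compose2[OF that]) (use m x in \<open>auto intro!: continuous_intros\<close>)
    show ?thesis unfolding E_def by (intro continuous_intros c1[OF Y(1)] c2[OF Y(1)] c1[OF Ac(1)] c1[OF Ac(2)] c2[OF Ac(1)] c2[OF Ac(2)])
  qed
  have Ez: "E d = 0" if "d \<in> {0<..<m}" for d
  proof -
    have "d < pi - d" "d \<le> x" "x \<le> pi - d" using that m by auto
    then show ?thesis using eq[of d "pi - d" x] l[of d x d] r[of x "pi - d" "pi - d"] that x by (simp add: E_def)
  qed
  have "closure {0<..<m} \<subseteq> {d\<in>{0..m}. E d = 0}"
  proof (rule closure_minimal)
    show "closed {d\<in>{0..m}. E d = 0}" by (intro continuous_closed_preimage_constant cont closed_atLeastAtMost)
  qed (use Ez in auto)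
  from subsetD[OF this, of 0] have "E 0 = 0" using m by simp
  then have E1: "of_real pi * Y x = - (of_real (pi - x) * (A1 x - A1 0) + of_real x * (of_real pi * (A0 pi - A0 x) - (A1 pi - A1 x)))"
    using Y by (simp add: E_def)
  have E2: "A1 0 = 0" by (simp add: A1_def)
  have E3: "of_real pi * (A0 pi - A0 x) - (A1 pi - A1 x) =
     integral {0..pi} (\<lambda>y. of_real (pi - y) * Z y) - integral {0..x} (\<lambda>y. of_real (pi - y) * Z y)"
  proof -
    have r1: "integral {0..pi} (\<lambda>y. of_real (pi - y) * Z y) = of_real pi * (A0 pi - A0 0) - (A1 pi - A1 0)"
      by (rule r) auto
    have r2: "integral {0..x} (\<lambda>y. of_real (pi - y) * Z y) = of_real pi * (A0 x - A0 0) - (A1 x - A1 0)"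
      by (rule r) (use x in auto)
    show ?thesis unfolding r1 r2 by (simp add: algebra_simps)
  qed
  have "Y x = of_real pi * Y x / of_real pi" by simp
  also have "\<dots> = green_op Z x" unfolding E1 E2 E3 green_op_def A1_def[symmetric] by simp
  finally show ?thesis .
qed

lemma weighted_integral:
  fixes w :: "real \<Rightarrow> real" and g :: "real \<Rightarrow> real \<Rightarrow> complex"
  assumes B: "B \<in> sets borel" and w: "w \<in> borel_measurable borel" "set_integrable lborel B w"
    and g: "continuous_on UNIV (\<lambda>(x, s). g x s)" and M: "\<And>x s. norm (g x s) \<le> M"
  shows "continuous_on UNIV (\<lambda>x. LINT s:B|lborel. of_real (w s) * g x s)"
    and "norm (LINT s:B|lborel. of_real (w s) * g x s) \<le> M * (LINT s:B|lborel. \<bar>w s\<bar>)"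
    and "sine_coeff k (\<lambda>x. LINT s:B|lborel. of_real (w s) * g x s) = (LINT s:B|lborel. of_real (w s) * sine_coeff k (\<lambda>x. g x s))"
    and "set_integrable lborel B (\<lambda>s. of_real (w s) * g x s)"
    and "set_integrable lborel B (\<lambda>s. of_real (w s) * sine_coeff k (\<lambda>x. g x s))"
proof -
  note w(1)[measurable]
  have gm[measurable]: "(\<lambda>(x, s). g x s) \<in> borel_measurable (borel \<Otimes>\<^sub>M borel)"
    unfolding borel_prod by (rule borel_measurable_continuous_onI[OF g])
  have gx: "continuous_on UNIV (\<lambda>x. g x s)" for s
    using continuous_on_compose2[OF g, of UNIV "\<lambda>x. (x, s)"] by (simp add: continuous_on_Pair continuous_on_id continuous_on_const)
  have ai: "set_integrable lborel B (\<lambda>s. \<bar>w s\<bar>)" using w(2) by (rule set_integrable_abs)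
  have bi: "set_integrable lborel B (\<lambda>s. M * \<bar>w s\<bar>)" by (intro set_integrable_mult_right ai)
  have b: "norm (of_real (w s) * g x s) \<le> M * \<bar>w s\<bar>" for x s
    using mult_left_mono[OF M[of x s], of "\<bar>w s\<bar>"] by (simp add: norm_mult mult.commute)
  show "continuous_on UNIV (\<lambda>x. LINT s:B|lborel. of_real (w s) * g x s)"
    by (rule set_integral_continuous_param[OF B _ _ b bi]) (auto intro!: continuous_intros gx)
  show "norm (LINT s:B|lborel. of_real (w s) * g x s) \<le> M * (LINT s:B|lborel. \<bar>w s\<bar>)"
    using set_integral_norm_le[OF bi b] by simp
  show "set_integrable lborel B (\<lambda>s. of_real (w s) * g x s)"
    by (rule set_integrable_dom[OF B _ bi b]) measurable
  have jm: "(\<lambda>(x, s). of_real (w s) * g x s) \<in> borel_measurable borel"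
    unfolding borel_prod[symmetric] by measurable
  show "sine_coeff k (\<lambda>x. LINT s:B|lborel. of_real (w s) * g x s) = (LINT s:B|lborel. of_real (w s) * sine_coeff k (\<lambda>x. g x s))"
    using sine_coeff_Fubini(1)[OF B jm b bi, of k] by (simp only: sine_coeff_cmult)
  show "set_integrable lborel B (\<lambda>s. of_real (w s) * sine_coeff k (\<lambda>x. g x s))"
    using sine_coeff_Fubini(2)[OF B jm b bi, of k] by (simp only: sine_coeff_cmult)
qed

lemma sine_coeff_tendsto:
  assumes c: "\<And>n. continuous_on {0..pi} (g n)" and b: "\<And>n x. x \<in> {0..pi} \<Longrightarrow> norm (g n x) \<le> M"
    and l: "\<And>x. x \<in> {0..pi} \<Longrightarrow> (\<lambda>n. g n x) \<longlonglongrightarrow> h x"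
  shows "(\<lambda>n::nat. sine_coeff k (g n)) \<longlonglongrightarrow> sine_coeff k h"
  unfolding sine_coeff_def set_lebesgue_integral_def
proof (rule integral_dominated_convergence[where w = "\<lambda>x. indicator {0..pi} x * M"])
  have m: "(\<lambda>x. indicator {0..pi} x *\<^sub>R (of_real (sin (real k * x)) * g n x)) \<in> borel_measurable lborel" for n
    using sine_coeff_integrable[OF c] by (simp add: set_integrable_def borel_measurable_integrable)
  then show "(\<lambda>x. indicator {0..pi} x *\<^sub>R (of_real (sin (real k * x)) * g n x)) \<in> borel_measurable lborel" for n .
  have lim: "(\<lambda>n. indicator {0..pi} x *\<^sub>R (of_real (sin (real k * x)) * g n x)) \<longlonglongrightarrow> indicator {0..pi} x *\<^sub>R (of_real (sin (real k * x)) * h x)" for x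
    by (cases "x \<in> {0..pi}") (auto intro!: tendsto_intros l)
  then show "AE x in lborel. (\<lambda>n. indicator {0..pi} x *\<^sub>R (of_real (sin (real k * x)) * g n x)) \<longlonglongrightarrow> indicator {0..pi} x *\<^sub>R (of_real (sin (real k * x)) * h x)"
    by simp
  \<comment> \<open>Measurability of the limit is inherited from the sequence; \<open>h\<close>
    enters only as a pointwise limit.\<close>
  show "(\<lambda>x. indicator {0..pi} x *\<^sub>R (of_real (sin (real k * x)) * h x)) \<in> borel_measurable lborel"
    by (rule borel_measurable_LIMSEQ_metric[OF m lim])
  have "set_integrable lborel {0..pi} (\<lambda>x. M)" by (intro borel_integrable_atLeastAtMost' continuous_intros)
  then show "integrable lborel (\<lambda>x. indicator {0..pi} x * M)" by (simp add: set_integrable_def)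
  show "AE x in lborel. norm (indicator {0..pi} x *\<^sub>R (of_real (sin (real k * x)) * g n x)) \<le> indicator {0..pi} x * M" for n
  proof (rule AE_I2)
    fix x
    have "\<bar>sin (real k * x)\<bar> * norm (g n x) \<le> 1 * M" if "x \<in> {0..pi}"
      using b[OF that, of n] by (intro mult_mono) auto
    then show "norm (indicator {0..pi} x *\<^sub>R (of_real (sin (real k * x)) * g n x)) \<le> indicator {0..pi} x * M"
      by (cases "x \<in> {0..pi}") (auto simp: norm_mult)
  qed
qed

lemma integral_eq_set_integral_diff:
  fixes h :: "real \<Rightarrow> complex"
  assumes "0 < e" "e \<le> t" "set_integrable lborel {0<..<t} h" "continuous_on {e..t} h"
  shows "integral {e..t} h = (LINT s:{0<..<t}|lborel. h s) - (LINT s:{0<..<e}|lborel. h s)"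
proof -
  have u: "{0<..<t} = {0<..<e} \<union> {e..<t}" using assms by auto
  have i: "set_integrable lborel {0<..<e} h" "set_integrable lborel {e..<t} h"
    by (rule set_integrable_subset[OF assms(3)]; use assms in auto)+
  have "(LINT s:{0<..<t}|lborel. h s) = (LINT s:{0<..<e}|lborel. h s) + (LINT s:{e..<t}|lborel. h s)"
    unfolding u by (rule set_integral_Un[OF _ i]) auto
  moreover have "(LINT s:{e..<t}|lborel. h s) = (LINT s:{e..t}|lborel. h s)"
    by (rule set_integral_discrete_difference[where X = "{t}"]) (use assms in auto)
  moreover have "(LINT s:{e..t}|lborel. h s) = integral {e..t} h"
    by (rule set_lborel_integral_eq_integral[OF assms(4)])
  ultimately show ?thesis by simp
qed

lemma powr_integral:
  fixes a t :: real
  assumes "a > 0" "t > 0"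
  shows "set_integrable lborel {0<..<t} (\<lambda>s. s powr (a - 1))"
    and "(LINT s:{0<..<t}|lborel. s powr (a - 1)) = Beta a 1 * t powr a"
proof -
  have e: "(t - s) powr (1 - 1) * s powr (a - 1) = s powr (a - 1)" if "s \<in> {0<..<t}" for s using that by auto
  note b = beta_interval[of 1 a t]
  show "set_integrable lborel {0<..<t} (\<lambda>s. s powr (a - 1))"
    by (rule iffD1[OF set_integrable_cong[OF refl refl e] b(1)]) (use assms in auto)
  have "(LINT s:{0<..<t}|lborel. s powr (a - 1)) = (LINT s:{0<..<t}|lborel. (t - s) powr (1 - 1) * s powr (a - 1))"
    by (intro set_lebesgue_integral_cong) (auto simp: e)
  then show "(LINT s:{0<..<t}|lborel. s powr (a - 1)) = Beta a 1 * t powr a" using b(2) assms by simp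
qed

lemma (in fractional_order) RL_J_conv: "RL_J (\<rho> - 1) h t = conv (\<lambda>t. of_real (frac_kernel (1 - \<rho>) t)) h t"
proof -
  have "RL_J (\<rho> - 1) h t = (1 / Gamma (1 - \<rho>)) *\<^sub>R (LINT \<xi>:{0<..<t}|lborel. (1 / (t - \<xi>) powr \<rho>) *\<^sub>R h \<xi>)"
    by (simp add: RL_J_def)
  also have "\<dots> = (LINT \<xi>:{0<..<t}|lborel. (1 / Gamma (1 - \<rho>)) *\<^sub>R ((1 / (t - \<xi>) powr \<rho>) *\<^sub>R h \<xi>))"
    by (rule set_integral_scaleR_right[symmetric])
  also have "\<dots> = conv (\<lambda>t. of_real (frac_kernel (1 - \<rho>) t)) h t"
    unfolding conv_def by (intro set_lebesgue_integral_cong) (auto simp: frac_kernel_def powr_minus_divide scaleR_conv_of_real)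
  finally show ?thesis .
qed

lemma twice_differentiable_onD:
  assumes "twice_differentiable_on g S" "x \<in> S"
  shows "(g has_vector_derivative vector_derivative g (at x within S)) (at x within S)"
    and "((\<lambda>y. vector_derivative g (at y within S)) has_vector_derivative deriv2 S g x) (at x within S)"
  using assms by (auto simp: twice_differentiable_on_def deriv2_def differentiable_on_def vector_derivative_works)

section \<open>The time-integrated equation and its sine coefficients\<close>

text \<open>The whole right-hand side is treated here as one given source \<open>F\<close>. The
  weighted functions \<open>uC\<close> and \<open>FC\<close> are taken continuous and bounded on the
  whole plane, so that integrals depending on a parameter need no domain conditions; they are tied
  to \<open>u\<close> and \<open>F\<close> only on the strip.\<close>

locale direct_problem = fractional_order +
  fixes T uM FM :: real and u F uC FC :: "real \<Rightarrow> real \<Rightarrow> complex" and \<phi> :: "real \<Rightarrow> complex"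
  assumes T: "0 < T"
    and uC: "continuous_on UNIV (\<lambda>(x, s). uC x s)" "\<And>x s. norm (uC x s) \<le> uM"
    and FC: "continuous_on UNIV (\<lambda>(x, s). FC x s)" "\<And>x s. norm (FC x s) \<le> FM"
    and u_eq: "\<And>x s. x \<in> {0..pi} \<Longrightarrow> s \<in> {0<..T} \<Longrightarrow> u x s = of_real (s powr (\<rho> - 1)) * uC x s"
    and F_eq: "\<And>x s. x \<in> {0..pi} \<Longrightarrow> s \<in> {0<..T} \<Longrightarrow> F x s = of_real (s powr (\<rho> - 1)) * FC x s"
    and RLd: "\<And>x t. x \<in> {0<..<pi} \<Longrightarrow> t \<in> {0<..T} \<Longrightarrow> RL_differentiable T \<rho> (u x) t"
    and tw: "\<And>t. t \<in> {0<..T} \<Longrightarrow> twice_differentiable_on (\<lambda>x. u x t) {0<..<pi}"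
    and cD: "continuous_on ({0<..<pi} \<times> {0<..T}) (\<lambda>(x, t). RL_deriv T \<rho> (u x) t)"
    and cxx: "continuous_on ({0<..<pi} \<times> {0<..T}) (\<lambda>(x, t). deriv2 {0<..<pi} (\<lambda>y. u y t) x)"
    and eqn: "\<And>x t. x \<in> {0<..<pi} \<Longrightarrow> t \<in> {0<..T} \<Longrightarrow>
        \<i> * RL_deriv T \<rho> (u x) t - deriv2 {0<..<pi} (\<lambda>y. u y t) x = F x t"
    and bc: "\<And>t. t \<in> {0<..T} \<Longrightarrow> u 0 t = 0" "\<And>t. t \<in> {0<..T} \<Longrightarrow> u pi t = 0"
    and ic: "\<And>x. x \<in> {0..pi} \<Longrightarrow> ((\<lambda>t. RL_J (\<rho> - 1) (u x) t) \<longlongrightarrow> \<phi> x) (at_right 0)"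
begin

text \<open>
  The weight \<open>t powr (1 - \<rho>)\<close> is factored out throughout: \<open>uC\<close> and \<open>FC\<close> are the continuous weighted versions
  of \<open>u\<close> and \<open>F\<close>.  Likewise \<open>W\<close> and \<open>Dw\<close> below are the weighted $u_{xx}$ and $\partial_t^\rho u$.
\<close>

definition wJ :: "real \<Rightarrow> real \<Rightarrow> real" where "wJ t s = frac_kernel (1 - \<rho>) (t - s) * s powr (\<rho> - 1)"

definition J :: "real \<Rightarrow> real \<Rightarrow> complex" where "J x t = (LINT s:{0<..<t}|lborel. of_real (wJ t s) * uC x s)"

definition Iw :: "(real \<Rightarrow> real \<Rightarrow> complex) \<Rightarrow> real \<Rightarrow> real \<Rightarrow> complex" where
  "Iw g x t = (LINT s:{0<..<t}|lborel. of_real (s powr (\<rho> - 1)) * g x s)"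

lemma wJ_measurable [measurable]: "wJ t \<in> borel_measurable borel"
  unfolding wJ_def by measurable

lemma wJ_nonneg: "0 \<le> wJ t s"
  using rho Gamma_real_pos[of "1 - \<rho>"] by (simp add: wJ_def frac_kernel_def)

lemma wJ_integrable:
  assumes "t > 0"
  shows "set_integrable lborel {0<..<t} (wJ t)"
    and "(LINT s:{0<..<t}|lborel. wJ t s) = Beta \<rho> (1 - \<rho>) / Gamma (1 - \<rho>)"
proof -
  have e: "wJ t = (\<lambda>s. 1 / Gamma (1 - \<rho>) * ((t - s) powr ((1 - \<rho>) - 1) * s powr (\<rho> - 1)))"
    by (simp add: wJ_def frac_kernel_def fun_eq_iff)
  note b = beta_interval[of "1 - \<rho>" \<rho> t]
  show "set_integrable lborel {0<..<t} (wJ t)"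
    unfolding e using rho assms by (intro set_integrable_mult_right b) auto
  show "(LINT s:{0<..<t}|lborel. wJ t s) = Beta \<rho> (1 - \<rho>) / Gamma (1 - \<rho>)"
    unfolding e set_integral_mult_right using b(2) rho assms by simp
qed

lemma RL_J_eq_J: "x \<in> {0..pi} \<Longrightarrow> 0 < t \<Longrightarrow> t \<le> T \<Longrightarrow> RL_J (\<rho> - 1) (u x) t = J x t"
  unfolding RL_J_conv conv_def J_def
  by (intro set_lebesgue_integral_cong) (auto simp: u_eq wJ_def)

lemma J_facts:
  assumes "t > 0"
  shows "continuous_on UNIV (\<lambda>x. J x t)"
    and "norm (J x t) \<le> uM * (Beta \<rho> (1 - \<rho>) / Gamma (1 - \<rho>))"
    and "sine_coeff k (\<lambda>x. J x t) = conv (\<lambda>t. of_real (frac_kernel (1 - \<rho>) t)) (\<lambda>s. of_real (s powr (\<rho> - 1)) * sine_coeff k (\<lambda>x. uC x s)) t"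
proof -
  note W = weighted_integral[OF _ wJ_measurable wJ_integrable(1)[OF assms] uC, simplified]
  show "continuous_on UNIV (\<lambda>x. J x t)" unfolding J_def by (rule W(1))
  show "norm (J x t) \<le> uM * (Beta \<rho> (1 - \<rho>) / Gamma (1 - \<rho>))"
    using W(2)[of x] unfolding J_def abs_of_nonneg[OF wJ_nonneg] wJ_integrable(2)[OF assms] .
  show "sine_coeff k (\<lambda>x. J x t) = conv (\<lambda>t. of_real (frac_kernel (1 - \<rho>) t)) (\<lambda>s. of_real (s powr (\<rho> - 1)) * sine_coeff k (\<lambda>x. uC x s)) t"
    unfolding J_def W(3) unfolding conv_def wJ_def by (simp only: of_real_mult mult.assoc)
qed

lemma Iw_facts:
  assumes t: "t > 0" and g: "continuous_on UNIV (\<lambda>(x, s). g x s)" and M: "\<And>x s. norm (g x s) \<le> M"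
  shows "continuous_on UNIV (\<lambda>x. Iw g x t)"
    and "norm (Iw g x t) \<le> M * (Beta \<rho> 1 * t powr \<rho>)"
    and "sine_coeff k (\<lambda>x. Iw g x t) = conv (\<lambda>_. 1) (\<lambda>s. of_real (s powr (\<rho> - 1)) * sine_coeff k (\<lambda>x. g x s)) t"
    and "set_integrable lborel {0<..<t} (\<lambda>s. of_real (s powr (\<rho> - 1)) * g x s)"
proof -
  have m: "(\<lambda>s. s powr (\<rho> - 1)) \<in> borel_measurable borel" by measurable
  note W = weighted_integral[OF _ m powr_integral(1)[OF rho(1) t] g M, simplified]
  show "continuous_on UNIV (\<lambda>x. Iw g x t)" unfolding Iw_def by (rule W(1))
  show "norm (Iw g x t) \<le> M * (Beta \<rho> 1 * t powr \<rho>)"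
    using W(2)[of x] powr_integral(2)[OF rho(1) t] unfolding Iw_def by simp
  show "sine_coeff k (\<lambda>x. Iw g x t) = conv (\<lambda>_. 1) (\<lambda>s. of_real (s powr (\<rho> - 1)) * sine_coeff k (\<lambda>x. g x s)) t"
    unfolding Iw_def W(3) conv_def by simp
  show "set_integrable lborel {0<..<t} (\<lambda>s. of_real (s powr (\<rho> - 1)) * g x s)" by (rule W(4))
qed

lemma uC_x: "continuous_on S (\<lambda>s. uC x s)" and FC_x: "continuous_on S (\<lambda>s. FC x s)"
proof -
  have p: "continuous_on S (\<lambda>s. (x, s))" by (intro continuous_intros)
  show "continuous_on S (\<lambda>s. uC x s)" using continuous_on_compose2[OF uC(1) p] by simp
  show "continuous_on S (\<lambda>s. FC x s)" using continuous_on_compose2[OF FC(1) p] by simp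
qed

lemma integral_u:
  assumes "x \<in> {0..pi}" "0 < e" "e \<le> t" "t \<le> T"
  shows "integral {e..t} (u x) = Iw uC x t - Iw uC x e" "u x integrable_on {e..t}"
    and "integral {e..t} (F x) = Iw FC x t - Iw FC x e" "F x integrable_on {e..t}"
proof -
  have c: "continuous_on {e..t} (\<lambda>s. of_real (s powr (\<rho> - 1)) * uC x s)" "continuous_on {e..t} (\<lambda>s. of_real (s powr (\<rho> - 1)) * FC x s)"
    using assms by (auto intro!: continuous_intros uC_x FC_x)
  have eu: "u x s = of_real (s powr (\<rho> - 1)) * uC x s" if "s \<in> {e..t}" for s using that assms u_eq by auto
  have eF: "F x s = of_real (s powr (\<rho> - 1)) * FC x s" if "s \<in> {e..t}" for s using that assms F_eq by auto
  have "integral {e..t} (u x) = integral {e..t} (\<lambda>s. of_real (s powr (\<rho> - 1)) * uC x s)"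
    by (rule integral_cong) (rule eu)
  also have "\<dots> = Iw uC x t - Iw uC x e" unfolding Iw_def
    by (rule integral_eq_set_integral_diff[OF assms(2,3) Iw_facts(4)[OF _ uC] c(1)]) (use assms in auto)
  finally show "integral {e..t} (u x) = Iw uC x t - Iw uC x e" .
  have "integral {e..t} (F x) = integral {e..t} (\<lambda>s. of_real (s powr (\<rho> - 1)) * FC x s)"
    by (rule integral_cong) (rule eF)
  also have "\<dots> = Iw FC x t - Iw FC x e" unfolding Iw_def
    by (rule integral_eq_set_integral_diff[OF assms(2,3) Iw_facts(4)[OF _ FC] c(2)]) (use assms in auto)
  finally show "integral {e..t} (F x) = Iw FC x t - Iw FC x e" .
  show "u x integrable_on {e..t}" by (rule integrable_eq[OF integrable_continuous_real[OF c(1)]]) (simp add: eu)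
  show "F x integrable_on {e..t}" by (rule integrable_eq[OF integrable_continuous_real[OF c(2)]]) (simp add: eF)
qed

lemma continuous_slices:
  assumes "x \<in> {0<..<pi}" "0 < e" "t \<le> T"
  shows "continuous_on {e..t} (\<lambda>s. RL_deriv T \<rho> (u x) s)"
    and "continuous_on {e..t} (\<lambda>s. deriv2 {0<..<pi} (\<lambda>y. u y s) x)"
proof -
  have p: "continuous_on {e..t} (\<lambda>s. (x, s))" by (intro continuous_intros)
  have i: "(\<lambda>s. (x, s)) ` {e..t} \<subseteq> {0<..<pi} \<times> {0<..T}" using assms by auto
  show "continuous_on {e..t} (\<lambda>s. RL_deriv T \<rho> (u x) s)" using continuous_on_compose2[OF cD p i] by simp
  show "continuous_on {e..t} (\<lambda>s. deriv2 {0<..<pi} (\<lambda>y. u y s) x)" using continuous_on_compose2[OF cxx p i] by simp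
qed

text \<open>The fractional derivative is controlled only for positive times, so the fundamental
  theorem starts at e > 0; the initial condition enters when e tends to 0.\<close>

lemma J_increment:
  assumes x: "x \<in> {0<..<pi}" and e: "0 < e" "e \<le> t" "t \<le> T"
  shows "integral {e..t} (\<lambda>s. RL_deriv T \<rho> (u x) s) = J x t - J x e"
proof -
  have "((\<lambda>s. RL_deriv T \<rho> (u x) s) has_integral (RL_J (\<rho> - 1) (u x) t - RL_J (\<rho> - 1) (u x) e)) {e..t}"
  proof (rule fundamental_theorem_of_calculus)
    fix s assume s: "s \<in> {e..t}"
    then have "(RL_J (\<rho> - 1) (u x) has_vector_derivative RL_deriv T \<rho> (u x) s) (at s within {0<..T})"
      using RLd[OF x, of s] e by (auto simp: RL_differentiable_def RL_deriv_def vector_derivative_works)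
    then show "(RL_J (\<rho> - 1) (u x) has_vector_derivative RL_deriv T \<rho> (u x) s) (at s within {e..t})"
      by (rule has_vector_derivative_within_subset) (use e in auto)
  qed (rule e)
  then show ?thesis using RL_J_eq_J x e by (simp add: integral_unique)
qed

text \<open>The time integral of u_xx over [e, t] as the equation gives it. Unlike u_xx, this
  expression makes sense and is continuous up to x = 0 and x = pi.\<close>

definition Z :: "real \<Rightarrow> real \<Rightarrow> real \<Rightarrow> complex" where
  "Z e t x = \<i> * (J x t - J x e) - (Iw FC x t - Iw FC x e)"

lemma integral_uxx:
  assumes x: "x \<in> {0<..<pi}" and e: "0 < e" "e \<le> t" "t \<le> T"
  shows "integral {e..t} (\<lambda>s. deriv2 {0<..<pi} (\<lambda>y. u y s) x) = Z e t x"
proof -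
  have "integral {e..t} (\<lambda>s. deriv2 {0<..<pi} (\<lambda>y. u y s) x) = integral {e..t} (\<lambda>s. \<i> * RL_deriv T \<rho> (u x) s - F x s)"
  proof (rule integral_cong)
    fix s assume "s \<in> {e..t}"
    then show "deriv2 {0<..<pi} (\<lambda>y. u y s) x = \<i> * RL_deriv T \<rho> (u x) s - F x s"
      using eqn[OF x, of s] e by (auto simp: algebra_simps)
  qed
  also have "\<dots> = integral {e..t} (\<lambda>s. \<i> * RL_deriv T \<rho> (u x) s) - integral {e..t} (F x)"
    using x e by (intro integral_diff integrable_on_mult_right integrable_continuous_real continuous_slices integral_u) auto
  also have "\<dots> = Z e t x"
    using integral_u(3)[of x e t] J_increment[OF assms] x e by (simp add: Z_def)
  finally show ?thesis .
qed

lemma Z_continuous: "0 < e \<Longrightarrow> 0 < t \<Longrightarrow> continuous_on S (Z e t)"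
  unfolding Z_def
  by (intro continuous_intros continuous_on_subset[OF J_facts(1)] continuous_on_subset[OF Iw_facts(1)[OF _ FC]]) auto

lemma integral_kernel_uxx:
  assumes ab: "0 < a" "a \<le> b" "b < pi" and e: "0 < e" "e \<le> t" "t \<le> T" and h: "continuous_on {a..b} h"
  shows "integral {e..t} (\<lambda>s. integral {a..b} (\<lambda>y. h y * deriv2 {0<..<pi} (\<lambda>y. u y s) y)) = integral {a..b} (\<lambda>y. h y * Z e t y)"
    and "(\<lambda>s. integral {a..b} (\<lambda>y. h y * deriv2 {0<..<pi} (\<lambda>y. u y s) y)) integrable_on {e..t}"
proof -
  let ?f = "\<lambda>s y. h y * deriv2 {0<..<pi} (\<lambda>y. u y s) y"
  have c: "continuous_on (cbox (e, a) (t, b)) (\<lambda>(s, y). ?f s y)"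
  proof -
    have "continuous_on ({e..t} \<times> {a..b}) (\<lambda>p. (\<lambda>(x, t). deriv2 {0<..<pi} (\<lambda>y. u y t) x) (snd p, fst p))"
      by (rule continuous_on_compose2[OF cxx]) (use ab e in \<open>auto intro!: continuous_intros\<close>)
    moreover have "continuous_on ({e..t} \<times> {a..b}) (\<lambda>p. h (snd p))"
      by (rule continuous_on_compose2[OF h]) (auto intro!: continuous_intros)
    ultimately have "continuous_on ({e..t} \<times> {a..b}) (\<lambda>p. h (snd p) * deriv2 {0<..<pi} (\<lambda>y. u y (fst p)) (snd p))"
      by (intro continuous_intros) auto
    then show ?thesis by (simp add: case_prod_beta cbox_Pair_eq)
  qed
  have "integral {e..t} (\<lambda>s. integral {a..b} (?f s)) = integral {a..b} (\<lambda>y. integral {e..t} (\<lambda>s. ?f s y))"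
    using integral_swap_continuous[OF c] by simp
  also have "\<dots> = integral {a..b} (\<lambda>y. h y * Z e t y)"
  proof (rule integral_cong)
    fix y assume "y \<in> {a..b}"
    then have "y \<in> {0<..<pi}" using ab by auto
    then show "integral {e..t} (\<lambda>s. ?f s y) = h y * Z e t y" using integral_uxx[OF _ e] by simp
  qed
  finally show "integral {e..t} (\<lambda>s. integral {a..b} (?f s)) = integral {a..b} (\<lambda>y. h y * Z e t y)" .
  have "continuous_on (cbox e t) (\<lambda>s. integral (cbox a b) (?f s))"
    by (rule integral_continuous_on_param) (use c in \<open>simp add: cbox_Pair_eq\<close>)
  then show "(\<lambda>s. integral {a..b} (?f s)) integrable_on {e..t}"
    by (intro integrable_continuous_real) simp
qed

text \<open>Green's formula is applied to \<open>u\<close> at each time on an interior interval,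
  then integrated in time. The boundary layer is crossed only afterwards, when u_xx has been
  replaced by the continuous function \<open>Z\<close>.\<close>

lemma time_integral_green:
  assumes e: "0 < e" "e \<le> t" "t \<le> T" and x: "x \<in> {0..pi}"
  shows "Iw uC x t - Iw uC x e = green_op (Z e t) x"
proof (rule green_limit[OF _ _ _ _ _ x])
  have t: "t > 0" using e by simp
  show "continuous_on {0..pi} (\<lambda>x. Iw uC x t - Iw uC x e)"
    by (intro continuous_intros continuous_on_subset[OF Iw_facts(1)[OF t uC]] continuous_on_subset[OF Iw_facts(1)[OF e(1) uC]]) auto
  have "integral {e..t} (u 0) = integral {e..t} (\<lambda>s. 0)" "integral {e..t} (u pi) = integral {e..t} (\<lambda>s. 0)"
    by (rule integral_cong; use bc e in auto)+
  then show "Iw uC 0 t - Iw uC 0 e = 0" "Iw uC pi t - Iw uC pi e = 0"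
    using integral_u(1)[of 0 e t] integral_u(1)[of pi e t] e by auto
  show "continuous_on {0..pi} (Z e t)" by (rule Z_continuous[OF e(1) t])
  fix a b x :: real assume ab: "0 < a" "a < b" "b < pi" and x: "x \<in> {a..b}"
  let ?uxx = "\<lambda>s y. deriv2 {0<..<pi} (\<lambda>y. u y s) y"
  have g: "of_real (b - a) * u x s = of_real (b - x) * u a s + of_real (x - a) * u b s -
     (of_real (b - x) * integral {a..x} (\<lambda>y. of_real (y - a) * ?uxx s y) + of_real (x - a) * integral {x..b} (\<lambda>y. of_real (b - y) * ?uxx s y))"
    if s: "s \<in> {e..t}" for s
  proof (rule green_representation[OF ab(2) x])
    have s': "s \<in> {0<..T}" using s e by auto
    fix y assume y: "y \<in> {a..b}"
    then have y': "y \<in> {0<..<pi}" "{a..b} \<subseteq> {0<..<pi}" using ab by auto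
    note d = twice_differentiable_onD[OF tw[OF s'] y'(1)]
    show "((\<lambda>x. u x s) has_vector_derivative vector_derivative (\<lambda>x. u x s) (at y within {0<..<pi})) (at y within {a..b})"
      by (rule has_vector_derivative_within_subset[OF d(1) y'(2)])
    show "((\<lambda>y. vector_derivative (\<lambda>x. u x s) (at y within {0<..<pi})) has_vector_derivative ?uxx s y) (at y within {a..b})"
      by (rule has_vector_derivative_within_subset[OF d(2) y'(2)])
  qed
  have i: "u y integrable_on {e..t}" "integral {e..t} (u y) = Iw uC y t - Iw uC y e" if "y \<in> {a..b}" for y
    using integral_u[of y e t] that ab e by auto
  have k1: "integral {e..t} (\<lambda>s. integral {a..x} (\<lambda>y. of_real (y - a) * ?uxx s y)) = integral {a..x} (\<lambda>y. of_real (y - a) * Z e t y)"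
    "(\<lambda>s. integral {a..x} (\<lambda>y. of_real (y - a) * ?uxx s y)) integrable_on {e..t}"
    by (rule integral_kernel_uxx; use ab x e in \<open>auto intro!: continuous_intros\<close>)+
  have k2: "integral {e..t} (\<lambda>s. integral {x..b} (\<lambda>y. of_real (b - y) * ?uxx s y)) = integral {x..b} (\<lambda>y. of_real (b - y) * Z e t y)"
    "(\<lambda>s. integral {x..b} (\<lambda>y. of_real (b - y) * ?uxx s y)) integrable_on {e..t}"
    by (rule integral_kernel_uxx; use ab x e in \<open>auto intro!: continuous_intros\<close>)+
  have "of_real (b - a) * integral {e..t} (u x) = integral {e..t} (\<lambda>s. of_real (b - a) * u x s)" by simp
  also have "\<dots> = integral {e..t} (\<lambda>s. of_real (b - x) * u a s + of_real (x - a) * u b s -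
     (of_real (b - x) * integral {a..x} (\<lambda>y. of_real (y - a) * ?uxx s y) + of_real (x - a) * integral {x..b} (\<lambda>y. of_real (b - y) * ?uxx s y)))"
    by (rule integral_cong) (rule g)
  also have "\<dots> = of_real (b - x) * integral {e..t} (u a) + of_real (x - a) * integral {e..t} (u b) -
     (of_real (b - x) * integral {e..t} (\<lambda>s. integral {a..x} (\<lambda>y. of_real (y - a) * ?uxx s y)) + of_real (x - a) * integral {e..t} (\<lambda>s. integral {x..b} (\<lambda>y. of_real (b - y) * ?uxx s y)))"
  proof -
    note ii = integrable_on_mult_right[OF i(1)] integrable_on_mult_right[OF k1(2)] integrable_on_mult_right[OF k2(2)]
    have ab': "a \<in> {a..b}" "b \<in> {a..b}" using ab by auto
    show ?thesis
      by (subst integral_diff[OF integrable_add[OF ii(1)[OF ab'(1)] ii(1)[OF ab'(2)]] integrable_add[OF ii(2) ii(3)]],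
          subst integral_add[OF ii(1)[OF ab'(1)] ii(1)[OF ab'(2)]], subst integral_add[OF ii(2) ii(3)]) simp
  qed
  finally show "of_real (b - a) * (Iw uC x t - Iw uC x e) = of_real (b - x) * (Iw uC a t - Iw uC a e) + of_real (x - a) * (Iw uC b t - Iw uC b e) -
     (of_real (b - x) * integral {a..x} (\<lambda>y. of_real (y - a) * Z e t y) + of_real (x - a) * integral {x..b} (\<lambda>y. of_real (b - y) * Z e t y))"
    unfolding k1 k2 using i x ab by simp
qed

definition Uk :: "nat \<Rightarrow> real \<Rightarrow> complex" where "Uk k s = of_real (s powr (\<rho> - 1)) * sine_coeff k (\<lambda>x. uC x s)"
definition Fk :: "nat \<Rightarrow> real \<Rightarrow> complex" where "Fk k s = of_real (s powr (\<rho> - 1)) * sine_coeff k (\<lambda>x. FC x s)"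

text \<open>On sine coefficients the Green operator becomes division by -k^2. Letting e tend to 0,
  \<open>J\<close> tends to the initial value boundedly, and the time integrals vanish like
  e^\<rho>.\<close>

lemma fourier_equation:
  assumes t: "0 < t" "t \<le> T"
  shows "conv (\<lambda>t. of_real (frac_kernel (1 - \<rho>) t)) (Uk k) t = sine_coeff k \<phi> + \<i> * of_real ((real k)\<^sup>2) * conv (\<lambda>_. 1) (Uk k) t - \<i> * conv (\<lambda>_. 1) (Fk k) t"
proof -
  \<comment> \<open>A sequence is used because the passage to the limit under the sine integral is
    by dominated convergence.\<close>
  define en where "en n = t / (real n + 2)" for n
  have en: "0 < en n" "en n \<le> t" for n using t by (auto simp: en_def field_simps)
  have en0: "en \<longlonglongrightarrow> 0" unfolding en_def by real_asymp
  have en0r: "filterlim en (at_right 0) sequentially"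
    by (rule tendsto_imp_filterlim_at_right[OF en0]) (simp add: en)
  have c: "continuous_on S (\<lambda>x. J x r)" "continuous_on S (\<lambda>x. Iw uC x r)" "continuous_on S (\<lambda>x. Iw FC x r)" if "r > 0" for r S
    using continuous_on_subset[OF J_facts(1)[OF that]] continuous_on_subset[OF Iw_facts(1)[OF that uC]] continuous_on_subset[OF Iw_facts(1)[OF that FC]] by auto
  have s: "\<i> * (sine_coeff k (\<lambda>x. J x t) - sine_coeff k (\<lambda>x. J x (en n))) - (sine_coeff k (\<lambda>x. Iw FC x t) - sine_coeff k (\<lambda>x. Iw FC x (en n))) =
      - (of_nat k)\<^sup>2 * (sine_coeff k (\<lambda>x. Iw uC x t) - sine_coeff k (\<lambda>x. Iw uC x (en n)))" for n
  proof -
    have Zc: "continuous_on {0..pi} (Z (en n) t)" by (rule Z_continuous[OF en(1) t(1)])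
    have "sine_coeff k (Z (en n) t) = - (of_nat k)\<^sup>2 * sine_coeff k (green_op (Z (en n) t))" by (rule sine_coeff_green_op[OF Zc])
    also have "sine_coeff k (green_op (Z (en n) t)) = sine_coeff k (\<lambda>x. Iw uC x t - Iw uC x (en n))"
      by (rule sine_coeff_cong) (rule time_integral_green[OF en t(2), symmetric])
    also have "\<dots> = sine_coeff k (\<lambda>x. Iw uC x t) - sine_coeff k (\<lambda>x. Iw uC x (en n))"
      by (intro sine_coeff_diff c en t)
    also have "sine_coeff k (Z (en n) t) = \<i> * (sine_coeff k (\<lambda>x. J x t) - sine_coeff k (\<lambda>x. J x (en n))) - (sine_coeff k (\<lambda>x. Iw FC x t) - sine_coeff k (\<lambda>x. Iw FC x (en n)))"
      unfolding Z_def
      by (subst sine_coeff_diff, (intro continuous_intros c en t)+, unfold sine_coeff_cmult, subst sine_coeff_diff, (intro c en t)+, subst sine_coeff_diff, (intro c en t)+, rule refl)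
    finally show ?thesis .
  qed
  have bound0: "(\<lambda>n. M * (Beta \<rho> 1 * en n powr \<rho>)) \<longlonglongrightarrow> 0" for M
  proof -
    have "(\<lambda>n. M * (Beta \<rho> 1 * en n powr \<rho>)) \<longlonglongrightarrow> M * (Beta \<rho> 1 * 0 powr \<rho>)"
      using rho en by (intro tendsto_intros tendsto_powr' en0) (auto intro!: always_eventually less_imp_le)
    then show ?thesis by simp
  qed
  have I0: "(\<lambda>n. sine_coeff k (\<lambda>x. Iw g x (en n))) \<longlonglongrightarrow> 0"
    if g: "continuous_on UNIV (\<lambda>(x, s). g x s)" "\<And>x s. norm (g x s) \<le> M" for g M
  proof -
    have "(\<lambda>n. sine_coeff k (\<lambda>x. Iw g x (en n))) \<longlonglongrightarrow> sine_coeff k (\<lambda>x. 0)"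
    proof (rule sine_coeff_tendsto[where M = "M * (Beta \<rho> 1 * t powr \<rho>)"])
      show "continuous_on {0..pi} (\<lambda>x. Iw g x (en n))" for n
        by (rule continuous_on_subset[OF Iw_facts(1)[OF en(1) g]]) simp
      have M0: "M \<ge> 0" using g(2)[of 0 0] norm_ge_zero order_trans by blast
      have B0: "Beta \<rho> 1 \<ge> 0"
        using rho Gamma_real_pos[of \<rho>] Gamma_real_pos[of "\<rho> + 1"] by (simp add: Beta_def)
      show "norm (Iw g x (en n)) \<le> M * (Beta \<rho> 1 * t powr \<rho>)" for x n
      proof -
        have "norm (Iw g x (en n)) \<le> M * (Beta \<rho> 1 * en n powr \<rho>)" by (rule Iw_facts(2)[OF en(1) g])
        also have "\<dots> \<le> M * (Beta \<rho> 1 * t powr \<rho>)"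
          using en[of n] rho M0 B0 by (intro mult_left_mono powr_mono2) auto
        finally show ?thesis .
      qed
      show "(\<lambda>n. Iw g x (en n)) \<longlonglongrightarrow> 0" for x
        by (rule Lim_null_comparison[OF _ bound0[of M]]) (intro always_eventually allI Iw_facts(2)[OF en(1) g])
    qed
    moreover have "sine_coeff k (\<lambda>x. 0) = 0" by (simp add: sine_coeff_def)
    ultimately show ?thesis by simp
  qed
  have J0: "(\<lambda>n. sine_coeff k (\<lambda>x. J x (en n))) \<longlonglongrightarrow> sine_coeff k \<phi>"
  proof (rule sine_coeff_tendsto)
    show "continuous_on {0..pi} (\<lambda>x. J x (en n))" for n by (rule c[OF en(1)])
    show "norm (J x (en n)) \<le> uM * (Beta \<rho> (1 - \<rho>) / Gamma (1 - \<rho>))" for x n by (rule J_facts(2)[OF en(1)])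
    show "(\<lambda>n. J x (en n)) \<longlonglongrightarrow> \<phi> x" if x: "x \<in> {0..pi}" for x
    proof -
      have "(\<lambda>n. RL_J (\<rho> - 1) (u x) (en n)) \<longlonglongrightarrow> \<phi> x" by (rule filterlim_compose[OF ic[OF x] en0r])
      moreover have "RL_J (\<rho> - 1) (u x) (en n) = J x (en n)" for n
        using en[of n] t by (intro RL_J_eq_J[OF x]) auto
      ultimately show ?thesis by simp
    qed
  qed
  have "(\<lambda>n. \<i> * (sine_coeff k (\<lambda>x. J x t) - sine_coeff k (\<lambda>x. J x (en n))) - (sine_coeff k (\<lambda>x. Iw FC x t) - sine_coeff k (\<lambda>x. Iw FC x (en n))))
     \<longlonglongrightarrow> \<i> * (sine_coeff k (\<lambda>x. J x t) - sine_coeff k \<phi>) - (sine_coeff k (\<lambda>x. Iw FC x t) - 0)"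
    by (intro tendsto_intros J0 I0[OF FC])
  moreover have "(\<lambda>n. - (of_nat k)\<^sup>2 * (sine_coeff k (\<lambda>x. Iw uC x t) - sine_coeff k (\<lambda>x. Iw uC x (en n)))) \<longlonglongrightarrow> - (of_nat k)\<^sup>2 * (sine_coeff k (\<lambda>x. Iw uC x t) - 0)"
    by (intro tendsto_intros I0[OF uC])
  ultimately have "\<i> * (sine_coeff k (\<lambda>x. J x t) - sine_coeff k \<phi>) - sine_coeff k (\<lambda>x. Iw FC x t) = - (of_nat k)\<^sup>2 * sine_coeff k (\<lambda>x. Iw uC x t)"
    unfolding s using LIMSEQ_unique by fastforce
  \<comment> \<open>Multiplication by i isolates the coefficient of \<open>J\<close>, giving the
    form expected by \<open>scalar_representation\<close>.\<close>
  then have "\<i> * (\<i> * (sine_coeff k (\<lambda>x. J x t) - sine_coeff k \<phi>) - sine_coeff k (\<lambda>x. Iw FC x t)) = \<i> * (- (of_nat k)\<^sup>2 * sine_coeff k (\<lambda>x. Iw uC x t))" by simp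
  then have "sine_coeff k (\<lambda>x. J x t) = sine_coeff k \<phi> + \<i> * of_real ((real k)\<^sup>2) * sine_coeff k (\<lambda>x. Iw uC x t) - \<i> * sine_coeff k (\<lambda>x. Iw FC x t)"
    by (simp add: algebra_simps)
  then show ?thesis
    unfolding J_facts(3)[OF t(1)] Iw_facts(3)[OF t(1) uC] Iw_facts(3)[OF t(1) FC] Uk_def Fk_def .
qed

end

section \<open>The second space derivative of a solution\<close>

lemma sine_coeff_norm_le:
  assumes "\<And>x. x \<in> {0..pi} \<Longrightarrow> norm (g x) \<le> M"
  shows "norm (sine_coeff k g) \<le> pi * M"
proof -
  have "norm (sine_coeff k g) \<le> (LINT x:{0..pi}|lborel. M)"
    unfolding sine_coeff_def
  proof (rule set_integral_norm_le)
    show "set_integrable lborel {0..pi} (\<lambda>x. M)" by (intro borel_integrable_atLeastAtMost' continuous_intros)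
    fix x assume "x \<in> {0..pi}"
    then have "\<bar>sin (real k * x)\<bar> * norm (g x) \<le> 1 * M" using assms[of x] by (intro mult_mono) auto
    then show "norm (of_real (sin (real k * x)) * g x) \<le> M" by (simp add: norm_mult)
  qed
  also have "\<dots> = pi * M" by (simp add: set_integral_const)
  finally show ?thesis .
qed

lemma sine_coeff_continuous:
  fixes g :: "real \<Rightarrow> real \<Rightarrow> complex"
  assumes "continuous_on ({0..pi} \<times> S) (\<lambda>(x, s). g x s)"
  shows "continuous_on S (\<lambda>s. sine_coeff k (\<lambda>x. g x s))"
proof -
  have c: "continuous_on (S \<times> {0..pi}) (\<lambda>p. of_real (sin (real k * snd p)) * g (snd p) (fst p))"
  proof -
    have "continuous_on (S \<times> {0..pi}) (\<lambda>p. (\<lambda>(x, s). g x s) (snd p, fst p))"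
      by (rule continuous_on_compose2[OF assms]) (auto intro!: continuous_intros)
    then have "continuous_on (S \<times> {0..pi}) (\<lambda>p. g (snd p) (fst p))" by simp
    then show ?thesis by (intro continuous_intros)
  qed
  have x: "continuous_on {0..pi} (\<lambda>x. g x s)" if "s \<in> S" for s
  proof -
    have "continuous_on {0..pi} (\<lambda>x. (x, s))" by (intro continuous_intros)
    moreover have "(\<lambda>x. (x, s)) ` {0..pi} \<subseteq> {0..pi} \<times> S" using that by auto
    ultimately show ?thesis using continuous_on_compose2[OF assms] by fastforce
  qed
  have "continuous_on S (\<lambda>s. integral (cbox 0 pi) (\<lambda>x. of_real (sin (real k * x)) * g x s))"
    by (rule integral_continuous_on_param) (use c in \<open>simp add: case_prod_beta\<close>)
  then show ?thesis
    by (rule continuous_on_eq) (simp add: sine_coeff_eq_integral[OF x])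
qed

lemma set_integrable_mult_bounded:
  fixes e h :: "real \<Rightarrow> complex"
  assumes h: "set_integrable lborel B h" and [measurable]: "e \<in> borel_measurable borel" and E: "\<And>s. s \<in> B \<Longrightarrow> norm (e s) \<le> E"
  shows "set_integrable lborel B (\<lambda>s. e s * h s)"
proof -
  have hi: "integrable lborel (\<lambda>s. indicator B s *\<^sub>R h s)" using h by (simp add: set_integrable_def)
  then have [measurable]: "(\<lambda>s. indicator B s *\<^sub>R h s) \<in> borel_measurable borel" using borel_measurable_integrable by fastforce
  have "integrable lborel (\<lambda>s. e s * (indicator B s *\<^sub>R h s))"
  proof (rule Bochner_Integration.integrable_bound)
    show "integrable lborel (\<lambda>s. E *\<^sub>R norm (indicator B s *\<^sub>R h s))"
      by (intro integrable_scaleR_right integrable_norm hi)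
    show "(\<lambda>s. e s * (indicator B s *\<^sub>R h s)) \<in> borel_measurable lborel"
      by (intro borel_measurable_times) simp_all
    show "AE s in lborel. norm (e s * (indicator B s *\<^sub>R h s)) \<le> norm (E *\<^sub>R norm (indicator B s *\<^sub>R h s))"
    proof (rule AE_I2)
      fix s
      show "norm (e s * (indicator B s *\<^sub>R h s)) \<le> norm (E *\<^sub>R norm (indicator B s *\<^sub>R h s))"
      proof (cases "s \<in> B")
        case True
        then have "norm (e s) \<le> \<bar>E\<bar>" using E[of s] by linarith
        then show ?thesis using True by (simp add: norm_mult abs_mult mult_right_mono)
      qed simp
    qed
  qed
  moreover have "e s * (indicator B s *\<^sub>R h s) = indicator B s *\<^sub>R (e s * h s)" for s by simp
  ultimately show ?thesis by (simp only: set_integrable_def)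
qed

text \<open>Near \<open>t\<close> the singularity at 0 contributes a constant: splitting at t/2
  leaves a continuous integrand. The one-sided derivative at T is covered by taking it within the
  interval.\<close>

lemma singular_FTC:
  fixes h :: "real \<Rightarrow> complex"
  assumes i: "set_integrable lborel {0<..<T} h" and c: "continuous_on {0<..T} h" and t: "t \<in> {0<..T}"
  shows "((\<lambda>t. LINT s:{0<..<t}|lborel. h s) has_vector_derivative h t) (at t within {0<..T})"
proof -
  define e where "e = t / 2"
  have e: "0 < e" "e < t" "e < T" using t by (auto simp: e_def)
  have ce: "continuous_on {e..T} h" by (rule continuous_on_subset[OF c]) (use e in auto)
  have d: "((\<lambda>r. integral {e..r} h) has_vector_derivative h t) (at t within {e..T})"
    by (rule integral_has_vector_derivative[OF ce]) (use e t in auto)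
  have eq: "(LINT s:{0<..<r}|lborel. h s) = integral {e..r} h + (LINT s:{0<..<e}|lborel. h s)" if "r \<in> {e..T}" for r
  proof -
    have "set_integrable lborel {0<..<r} h" by (rule set_integrable_subset[OF i]) (use that in auto)
    moreover have "continuous_on {e..r} h" by (rule continuous_on_subset[OF ce]) (use that in auto)
    ultimately show ?thesis using integral_eq_set_integral_diff[OF e(1), of r h] that by auto
  qed
  have "((\<lambda>r. integral {e..r} h + (LINT s:{0<..<e}|lborel. h s)) has_vector_derivative h t + 0) (at t within {e..T})"
    by (intro has_vector_derivative_add d has_vector_derivative_const)
  then have d': "((\<lambda>r. integral {e..r} h + (LINT s:{0<..<e}|lborel. h s)) has_vector_derivative h t) (at t within {e..T})"
    by (simp only: add_0_right)
  have "t \<in> {e..T}" using e t by auto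
  then have "((\<lambda>t. LINT s:{0<..<t}|lborel. h s) has_vector_derivative h t) (at t within {e..T})"
    by (rule has_vector_derivative_transform[OF _ eq d'])
  moreover have "at t within {e..T} = at t within {0<..T}"
    by (rule at_within_nhd[of t "{e<..}"]) (use e t in auto)
  ultimately show ?thesis by simp
qed

lemma vector_derivative_unique_interval:
  fixes f :: "real \<Rightarrow> complex"
  assumes "(f has_vector_derivative a) (at t within {0<..T})" "(f has_vector_derivative b) (at t within {0<..T})" "t \<in> {0<..T}"
  shows "a = b"
proof (rule vector_derivative_unique_within[OF _ assms(1,2)])
  have "t islimpt {0<..<t}" using assms(3) by (simp add: islimpt_greaterThanLessThan2)
  then have "t islimpt {0<..T}" by (rule islimpt_subset) (use assms(3) in auto)
  then show "at t within {0<..T} \<noteq> bot" by (simp add: trivial_limit_within)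
qed

lemma deriv2_green_op:
  assumes h: "continuous_on {0..pi} h" and g: "\<And>x. x \<in> {0<..<pi} \<Longrightarrow> g x = c * green_op h x" and x: "x \<in> {0<..<pi}"
  shows "deriv2 {0<..<pi} g x = c * h x"
proof -
  have nb: "at y within {0<..<pi} \<noteq> bot" if "y \<in> {0<..<pi}" for y :: real
    using at_within_open[OF that open_greaterThanLessThan] by simp
  have s: "{0<..<pi} \<subseteq> {0..pi}" by auto
  have d1: "vector_derivative g (at y within {0<..<pi}) = c * green_op_deriv h y" if y: "y \<in> {0<..<pi}" for y
  proof (rule vector_derivative_within[OF nb[OF y]])
    have "(green_op h has_vector_derivative green_op_deriv h y) (at y within {0<..<pi})"
      by (rule has_vector_derivative_within_subset[OF green_op_derivs(1)[OF h] s]) (use y in auto)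
    then have "((\<lambda>x. c * green_op h x) has_vector_derivative c * green_op_deriv h y) (at y within {0<..<pi})"
      by (rule has_vector_derivative_mult_right)
    then show "(g has_vector_derivative c * green_op_deriv h y) (at y within {0<..<pi})"
      by (rule has_vector_derivative_transform[OF y, rotated]) (simp add: g)
  qed
  show ?thesis unfolding deriv2_def
  proof (rule vector_derivative_within[OF nb[OF x]])
    have "(green_op_deriv h has_vector_derivative h x) (at x within {0<..<pi})"
      by (rule has_vector_derivative_within_subset[OF green_op_derivs(2)[OF h] s]) (use x in auto)
    then have "((\<lambda>x. c * green_op_deriv h x) has_vector_derivative c * h x) (at x within {0<..<pi})"
      by (rule has_vector_derivative_mult_right)
    then show "((\<lambda>y. vector_derivative g (at y within {0<..<pi})) has_vector_derivative c * h x) (at x within {0<..<pi})"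
      by (rule has_vector_derivative_transform[OF x, rotated]) (simp add: d1)
  qed
qed

section \<open>Identification of the kernel formula with u_xx\<close>

text \<open>The source is split into the unknown part \<open>P\<close> times q and the weighted data
  \<open>fC\<close>. Representing \<phi> and q through \<open>green_op\<close> encodes their second
  derivatives together with the zero boundary values; \<open>H\<close> is a Hoelder constant of
  exponent 1/2, uniform in time.\<close>

locale inverse_data = direct_problem +
  fixes \<phi>2 q q2 P :: "real \<Rightarrow> complex" and fC :: "real \<Rightarrow> real \<Rightarrow> complex" and H D fM :: real
  assumes phi2: "continuous_on {0..pi} \<phi>2" "\<phi>2 0 = 0" "\<phi>2 pi = 0" and phi: "\<And>x. x \<in> {0..pi} \<Longrightarrow> \<phi> x = green_op \<phi>2 x"
    and q2: "continuous_on {0..pi} q2" "q2 0 = 0" "q2 pi = 0" and q: "\<And>x. x \<in> {0..pi} \<Longrightarrow> q x = green_op q2 x"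
    and P: "continuous_on UNIV P" "\<And>s. norm (P s) \<le> D"
    and fC: "continuous_on UNIV (\<lambda>(x, s). fC x s)" "\<And>x s. norm (fC x s) \<le> fM"
    and fC0: "\<And>s. fC 0 s = 0" "\<And>s. fC pi s = 0"
    and fH: "\<And>x y s. x \<in> {0..pi} \<Longrightarrow> y \<in> {0..pi} \<Longrightarrow> norm (fC x s - fC y s) \<le> H * sqrt \<bar>x - y\<bar>" and H: "H \<ge> 0"
    and FC_split: "\<And>x s. x \<in> {0..pi} \<Longrightarrow> FC x s = P s * q x + fC x s"
begin

definition W :: "real \<Rightarrow> real \<Rightarrow> complex" where
  "W x t = Wa \<phi>2 x t + (- \<i>) * (Wb fC x t + Wc q2 P x t)"

lemma fC': "continuous_on ({0..pi} \<times> UNIV) (\<lambda>(x, s). fC x s)"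
  by (rule continuous_on_subset[OF fC(1)]) simp

lemma ex_bound:
  fixes g :: "real \<Rightarrow> complex"
  assumes "continuous_on {0..pi} g"
  shows "\<exists>M. \<forall>x\<in>{0..pi}. norm (g x) \<le> M"
  using compact_imp_bounded[OF compact_continuous_image[OF assms compact_Icc]] unfolding bounded_iff by blast

lemma Wa_cont: "continuous_on (UNIV \<times> {0..T}) (\<lambda>(x, t). Wa \<phi>2 x t)"
  using ex_bound[OF phi2(1)] Wa_facts(1)[OF phi2] by blast

lemma Wb_cont: "continuous_on (UNIV \<times> {0..T}) (\<lambda>(x, t). Wb fC x t)"
  by (rule Wb_facts(1)[OF T fC' fC0 fH H])

lemma Wc_cont: "continuous_on (UNIV \<times> {0..T}) (\<lambda>(x, t). Wc q2 P x t)"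
  using ex_bound[OF q2(1)] Wc_facts(1)[OF T q2 P(1) _ P(2)] by blast

lemma W_cont: "continuous_on (UNIV \<times> {0..T}) (\<lambda>(x, t). W x t)"
  using Wa_cont Wb_cont Wc_cont unfolding W_def case_prod_beta by (intro continuous_intros)

lemma slice_cont:
  assumes "continuous_on (UNIV \<times> {0..T}) (\<lambda>(x, t). g x t)" "t \<in> {0..T}"
  shows "continuous_on S (\<lambda>x. g x t)"
proof -
  have "continuous_on S (\<lambda>x. (x, t))" by (intro continuous_intros)
  moreover have "(\<lambda>x. (x, t)) ` S \<subseteq> UNIV \<times> {0..T}" using assms(2) by auto
  ultimately show ?thesis using continuous_on_compose2[OF assms(1)] by fastforce
qed

text \<open>The right-hand side is -k^2 times Duhamel's formula. For the initial value and for q the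
  factor -k^2 comes from passing to their second derivatives, for \<open>fC\<close> it comes from
  the kernel of \<open>A2\<close>.\<close>

lemma sine_coeff_W:
  assumes t: "t \<in> {0<..T}"
  shows "of_real (t powr (\<rho> - 1)) * sine_coeff k (\<lambda>x. W x t) =
     - (of_nat k)\<^sup>2 * (sine_coeff k \<phi> * resolvent ((real k)\<^sup>2) t - \<i> * conv (resolvent ((real k)\<^sup>2)) (Fk k) t)"
proof -
  have t': "t \<in> {0..T}" "t \<ge> 0" "t > 0" using t by auto
  let ?w = "\<lambda>\<sigma>::real. \<sigma> powr (\<rho> - 1) * (1 - \<sigma>) powr (\<rho> - 1)"
  let ?e = "\<lambda>\<sigma>. eML ((real k)\<^sup>2 * (t * (1 - \<sigma>)) powr \<rho>)"
  obtain Ma where Ma: "\<And>x. x \<in> {0..pi} \<Longrightarrow> norm (\<phi>2 x) \<le> Ma" using ex_bound[OF phi2(1)] by blast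
  obtain Mq where Mq: "\<And>x. x \<in> {0..pi} \<Longrightarrow> norm (q2 x) \<le> Mq" using ex_bound[OF q2(1)] by blast
  have p2: "sine_coeff k \<phi>2 = - (of_nat k)\<^sup>2 * sine_coeff k \<phi>"
    unfolding sine_coeff_green_op[OF phi2(1)] by (intro arg_cong2[where f = "(*)"] refl sine_coeff_cong) (simp add: phi)
  have qq2: "sine_coeff k q2 = - (of_nat k)\<^sup>2 * sine_coeff k q"
    unfolding sine_coeff_green_op[OF q2(1)] by (intro arg_cong2[where f = "(*)"] refl sine_coeff_cong) (simp add: q)
  have qc: "continuous_on {0..pi} q"
    by (rule continuous_on_eq[OF green_op_continuous[OF q2(1)]]) (simp add: q)
  have fs: "continuous_on S (\<lambda>x. fC x s)" for S s
  proof -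
    have "continuous_on S (\<lambda>x. (x, s))" by (intro continuous_intros)
    from continuous_on_compose2[OF fC(1) this] show ?thesis by simp
  qed
  have sF: "sine_coeff k (\<lambda>x. FC x s) = P s * sine_coeff k q + sine_coeff k (\<lambda>x. fC x s)" for s
  proof -
    have "sine_coeff k (\<lambda>x. FC x s) = sine_coeff k (\<lambda>x. P s * q x + fC x s)" by (rule sine_coeff_cong) (rule FC_split)
    also have "\<dots> = sine_coeff k (\<lambda>x. P s * q x) + sine_coeff k (\<lambda>x. fC x s)" by (intro sine_coeff_add continuous_intros qc fs)
    finally show ?thesis by (simp add: sine_coeff_cmult)
  qed
  have wi: "set_integrable lborel {0<..<1} ?w" using rho by (intro beta_integral) auto
  have em: "?e \<in> borel_measurable borel" by measurable
  have eb: "norm (?e \<sigma>) \<le> 2 * n0norm" for \<sigma> by (rule eML_bound) simp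
  have wm: "?w \<in> borel_measurable borel" by measurable
  have ia: "set_integrable lborel {0<..<1} (\<lambda>\<sigma>. of_real (?w \<sigma>) * (?e \<sigma> * sine_coeff k (\<lambda>x. fC x (t * \<sigma>))))"
  proof -
    have g: "continuous_on UNIV (\<lambda>(x, s). fC x (t * s))"
    proof -
      have "continuous_on UNIV (\<lambda>p::real \<times> real. (fst p, t * snd p))" by (intro continuous_intros)
      from continuous_on_compose2[OF fC(1) this] show ?thesis by (simp add: case_prod_beta)
    qed
    have "set_integrable lborel {0<..<1} (\<lambda>\<sigma>. of_real (?w \<sigma>) * sine_coeff k (\<lambda>x. fC x (t * \<sigma>)))"
      by (rule weighted_integral(5)[OF _ wm wi g fC(2)]) simp
    from set_integrable_mult_bounded[OF this em eb] show ?thesis by (simp only: mult_ac)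
  qed
  have ib: "set_integrable lborel {0<..<1} (\<lambda>\<sigma>. of_real (?w \<sigma>) * (?e \<sigma> * (P (t * \<sigma>) * sine_coeff k q)))"
  proof -
    have [measurable]: "P \<in> borel_measurable borel" by (rule borel_measurable_continuous_onI[OF P(1)])
    have "set_integrable lborel {0<..<1} (\<lambda>\<sigma>. (?e \<sigma> * P (t * \<sigma>)) * complex_of_real (?w \<sigma>))"
    proof (rule set_integrable_mult_bounded[OF set_integrable_of_real[OF wi]])
      show "(\<lambda>\<sigma>. ?e \<sigma> * P (t * \<sigma>)) \<in> borel_measurable borel" by measurable
      show "norm (?e \<sigma> * P (t * \<sigma>)) \<le> 2 * n0norm * D" for \<sigma>
        unfolding norm_mult by (intro mult_mono eb P(2)) (use n0norm_nonneg in auto)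
    qed
    then have "set_integrable lborel {0<..<1} (\<lambda>\<sigma>. sine_coeff k q * ((?e \<sigma> * P (t * \<sigma>)) * complex_of_real (?w \<sigma>)))"
      by (rule set_integrable_mult_right)
    then show ?thesis by (simp only: mult_ac)
  qed
  define Ia where "Ia = (LINT \<sigma>:{0<..<1}|lborel. of_real (?w \<sigma>) * (?e \<sigma> * sine_coeff k (\<lambda>x. fC x (t * \<sigma>))))"
  define Ib where "Ib = (LINT \<sigma>:{0<..<1}|lborel. of_real (?w \<sigma>) * (?e \<sigma> * (P (t * \<sigma>) * sine_coeff k q)))"
  have cv: "of_real (t powr (1 - \<rho>)) * conv (resolvent ((real k)\<^sup>2)) (Fk k) t = of_real (t powr \<rho>) * (Ib + Ia)"
  proof -
    have "of_real (t powr (1 - \<rho>)) * conv (resolvent ((real k)\<^sup>2)) (Fk k) t =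
       of_real (t powr \<rho>) * (LINT \<sigma>:{0<..<1}|lborel. of_real (?w \<sigma>) * (?e \<sigma> * sine_coeff k (\<lambda>x. FC x (t * \<sigma>))))"
      unfolding Fk_def by (rule conv_resolvent_scaled[OF t'(3)])
    also have "(LINT \<sigma>:{0<..<1}|lborel. of_real (?w \<sigma>) * (?e \<sigma> * sine_coeff k (\<lambda>x. FC x (t * \<sigma>)))) = Ib + Ia"
      unfolding sF distrib_left Ia_def Ib_def by (rule set_integral_add(2)[OF ib ia])
    finally show ?thesis .
  qed
  have a: "sine_coeff k (\<lambda>x. Wa \<phi>2 x t) = - (of_nat k)\<^sup>2 * (eML ((real k)\<^sup>2 * t powr \<rho>) * sine_coeff k \<phi>)"
    using Wa_facts(3)[OF phi2 Ma t'(2), of k] p2 by simp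
  have b: "sine_coeff k (\<lambda>x. Wb fC x t) = - (of_nat k)\<^sup>2 * (of_real (t powr \<rho>) * Ia)"
    unfolding Ia_def by (rule Wb_facts(3)[OF T fC' fC0 fH H t'(1)])
  have c: "sine_coeff k (\<lambda>x. Wc q2 P x t) = - (of_nat k)\<^sup>2 * (of_real (t powr \<rho>) * Ib)"
  proof -
    have "sine_coeff k (\<lambda>x. Wc q2 P x t) = of_real (t powr \<rho>) * (LINT \<sigma>:{0<..<1}|lborel. of_real (?w \<sigma>) * (?e \<sigma> * (P (t * \<sigma>) * sine_coeff k q2)))"
      by (rule Wc_facts(3)[OF T q2 P(1) Mq P(2) t'(2)])
    also have "(LINT \<sigma>:{0<..<1}|lborel. of_real (?w \<sigma>) * (?e \<sigma> * (P (t * \<sigma>) * sine_coeff k q2))) = (LINT \<sigma>:{0<..<1}|lborel. (- (of_nat k)\<^sup>2) * (of_real (?w \<sigma>) * (?e \<sigma> * (P (t * \<sigma>) * sine_coeff k q))))"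
      unfolding qq2 by (simp add: mult_ac)
    also have "\<dots> = (- (of_nat k)\<^sup>2) * Ib" unfolding Ib_def by (rule set_integral_mult_right)
    finally show ?thesis by simp
  qed
  have "sine_coeff k (\<lambda>x. W x t) = sine_coeff k (\<lambda>x. Wa \<phi>2 x t) + (- \<i>) * (sine_coeff k (\<lambda>x. Wb fC x t) + sine_coeff k (\<lambda>x. Wc q2 P x t))"
    unfolding W_def
    by (subst sine_coeff_add, (intro continuous_intros slice_cont[OF Wa_cont t'(1)] slice_cont[OF Wb_cont t'(1)] slice_cont[OF Wc_cont t'(1)])+,
        unfold sine_coeff_cmult, subst sine_coeff_add, (intro slice_cont[OF Wb_cont t'(1)] slice_cont[OF Wc_cont t'(1)])+, rule refl)
  also have "\<dots> = - (of_nat k)\<^sup>2 * (eML ((real k)\<^sup>2 * t powr \<rho>) * sine_coeff k \<phi> - \<i> * (of_real (t powr \<rho>) * (Ib + Ia)))"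
    unfolding a b c by (simp add: algebra_simps)
  finally have s: "sine_coeff k (\<lambda>x. W x t) = - (of_nat k)\<^sup>2 * (eML ((real k)\<^sup>2 * t powr \<rho>) * sine_coeff k \<phi> - \<i> * (of_real (t powr (1 - \<rho>)) * conv (resolvent ((real k)\<^sup>2)) (Fk k) t))"
    unfolding cv .
  have one: "of_real (t powr (\<rho> - 1)) * (of_real (t powr (1 - \<rho>)) * z) = z" for z :: complex
  proof -
    have "t powr (\<rho> - 1) * t powr (1 - \<rho>) = 1" using t'(3) by (simp add: powr_add[symmetric])
    then have "complex_of_real (t powr (\<rho> - 1) * t powr (1 - \<rho>)) = 1" by simp
    then show ?thesis by (simp add: mult.assoc[symmetric])
  qed
  have r: "of_real (t powr (\<rho> - 1)) * (eML ((real k)\<^sup>2 * t powr \<rho>) * sine_coeff k \<phi>) = sine_coeff k \<phi> * resolvent ((real k)\<^sup>2) t"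
    by (simp add: resolvent_def mult_ac)
  have "of_real (t powr (\<rho> - 1)) * sine_coeff k (\<lambda>x. W x t) = - (of_nat k)\<^sup>2 * (of_real (t powr (\<rho> - 1)) * (eML ((real k)\<^sup>2 * t powr \<rho>) * sine_coeff k \<phi>) - \<i> * (of_real (t powr (\<rho> - 1)) * (of_real (t powr (1 - \<rho>)) * conv (resolvent ((real k)\<^sup>2)) (Fk k) t)))"
    unfolding s by (simp add: algebra_simps)
  then show ?thesis unfolding one r .
qed

lemma weakly_singular_weighted:
  assumes g: "continuous_on UNIV (\<lambda>(x, s). g x s)" and M: "\<And>x s. norm (g x s) \<le> M"
  shows "weakly_singular T \<rho> (\<lambda>s. of_real (s powr (\<rho> - 1)) * sine_coeff k (\<lambda>x. g x s))"
proof -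
  have c: "continuous_on UNIV (\<lambda>s. sine_coeff k (\<lambda>x. g x s))"
    by (rule sine_coeff_continuous) (rule continuous_on_subset[OF g], simp)
  have [measurable]: "(\<lambda>s. sine_coeff k (\<lambda>x. g x s)) \<in> borel_measurable borel" by (rule borel_measurable_continuous_onI[OF c])
  have M0: "M \<ge> 0" using M[of 0 0] norm_ge_zero order_trans by blast
  show ?thesis unfolding weakly_singular_def
  proof safe
    show "(\<lambda>s. of_real (s powr (\<rho> - 1)) * sine_coeff k (\<lambda>x. g x s)) \<in> borel_measurable borel" by measurable
    show "\<exists>C\<ge>0. \<forall>s\<in>{0<..T}. norm (of_real (s powr (\<rho> - 1)) * sine_coeff k (\<lambda>x. g x s)) \<le> C * s powr (\<rho> - 1)"
    proof (intro exI[of _ "pi * M"] conjI ballI)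
      fix s assume "s \<in> {0<..T}"
      have "norm (sine_coeff k (\<lambda>x. g x s)) \<le> pi * M" by (rule sine_coeff_norm_le[OF M])
      then show "norm (of_real (s powr (\<rho> - 1)) * sine_coeff k (\<lambda>x. g x s)) \<le> pi * M * s powr (\<rho> - 1)"
        using mult_left_mono[of "norm (sine_coeff k (\<lambda>x. g x s))" "pi * M" "s powr (\<rho> - 1)"] by (simp add: norm_mult mult_ac)
    qed (use M0 in simp)
  qed
qed

text \<open>\<open>scalar_representation\<close> equates only the primitives of the coefficient and
  of Duhamel's formula. Both functions are continuous on (0, T], so the fundamental theorem makes
  them equal at each time.\<close>

lemma sine_coeff_W_eq:
  assumes k: "k \<ge> 1" and t: "t \<in> {0<..T}"
  shows "sine_coeff k (\<lambda>x. W x t) = - (of_nat k)\<^sup>2 * sine_coeff k (\<lambda>x. uC x t)"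
proof -
  define l where "l = (real k)\<^sup>2"
  have l: "l > 0" using k by (simp add: l_def)
  have sU: "weakly_singular T \<rho> (Uk k)" and sF: "weakly_singular T \<rho> (Fk k)"
    unfolding Uk_def Fk_def using weakly_singular_weighted[OF uC] weakly_singular_weighted[OF FC] by auto
  define R where "R s = sine_coeff k \<phi> * resolvent l s - \<i> * conv (resolvent l) (Fk k) s" for s
  have rep: "conv (\<lambda>_. 1) (Uk k) s = conv (\<lambda>_. 1) R s" if "0 < s" "s \<le> T" for s
    unfolding R_def by (rule scalar_representation[OF l sU sF _ that]) (unfold l_def, rule fourier_equation)
  have WR: "of_real (s powr (\<rho> - 1)) * sine_coeff k (\<lambda>x. W x s) = - (of_nat k)\<^sup>2 * R s" if "s \<in> {0<..T}" for s
    unfolding R_def l_def by (rule sine_coeff_W[OF that])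
  have k0: "(of_nat k :: complex)\<^sup>2 \<noteq> 0" using k by simp
  \<comment> \<open>Continuity of Duhamel's formula is read off from the continuity of
    \<open>W\<close>, of which it is a sine coefficient up to a nonzero factor.\<close>
  have Rc: "continuous_on {0<..T} R"
  proof -
    have "continuous_on {0..T} (\<lambda>s. sine_coeff k (\<lambda>x. W x s))"
      by (rule sine_coeff_continuous) (rule continuous_on_subset[OF W_cont], auto)
    then have "continuous_on {0<..T} (\<lambda>s. sine_coeff k (\<lambda>x. W x s))" by (rule continuous_on_subset) auto
    then have c: "continuous_on {0<..T} (\<lambda>s. - (of_real (s powr (\<rho> - 1)) * sine_coeff k (\<lambda>x. W x s)) / (of_nat k)\<^sup>2)"
      using k0 by (intro continuous_intros) auto
    show ?thesis
      by (rule continuous_on_eq[OF c]) (use WR k0 in auto)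
  qed
  have Uc: "continuous_on {0<..T} (Uk k)"
  proof -
    have "continuous_on {0<..T} (\<lambda>s. sine_coeff k (\<lambda>x. uC x s))"
      by (rule sine_coeff_continuous) (rule continuous_on_subset[OF uC(1)], simp)
    then show ?thesis unfolding Uk_def by (intro continuous_intros) auto
  qed
  have one: "weakly_singular T 1 (\<lambda>_. 1)" by (rule weakly_singular_const)
  have sS: "weakly_singular T \<rho> (resolvent l)" using l by (intro weakly_singular_resolvent) auto
  have sSF: "weakly_singular T (\<rho> + \<rho>) (conv (resolvent l) (Fk k))" using weakly_singular_conv(1)[OF sS sF] rho by auto
  have iU: "set_integrable lborel {0<..<T} (Uk k)"
    using conv_integrable[OF one sU, of T] T rho by simp
  have iR: "set_integrable lborel {0<..<T} R"
  proof -
    have "set_integrable lborel {0<..<T} (\<lambda>s. 1 * (sine_coeff k \<phi> * resolvent l s))" "set_integrable lborel {0<..<T} (\<lambda>s. 1 * (\<i> * conv (resolvent l) (Fk k) s))"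
      using conv_integrable[OF one weakly_singular_cmult[OF sS], of T "sine_coeff k \<phi>"] conv_integrable[OF one weakly_singular_cmult[OF sSF], of T \<i>] T rho by auto
    then show ?thesis unfolding R_def using set_integral_diff(1) by force
  qed
  have "Uk k t = R t"
  proof (rule vector_derivative_unique_interval[OF singular_FTC[OF iU Uc t] _ t])
    have "((\<lambda>t. LINT s:{0<..<t}|lborel. R s) has_vector_derivative R t) (at t within {0<..T})"
      by (rule singular_FTC[OF iR Rc t])
    then show "((\<lambda>t. LINT s:{0<..<t}|lborel. Uk k s) has_vector_derivative R t) (at t within {0<..T})"
      by (rule has_vector_derivative_transform[OF t, rotated]) (use rep in \<open>auto simp: conv_def\<close>)
  qed
  then have "of_real (t powr (\<rho> - 1)) * sine_coeff k (\<lambda>x. W x t) = of_real (t powr (\<rho> - 1)) * (- (of_nat k)\<^sup>2 * sine_coeff k (\<lambda>x. uC x t))"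
    unfolding WR[OF t] Uk_def by (metis mult.left_commute)
  moreover have "complex_of_real (t powr (\<rho> - 1)) \<noteq> 0" using t by simp
  ultimately show ?thesis using mult_left_cancel by blast
qed

text \<open>The comparison is made after two integrations in x, where both sides are continuous on
  the closed interval and completeness applies; u_xx itself is not yet known to extend to the
  endpoints.\<close>

lemma uC_eq_green_op:
  assumes t: "t \<in> {0<..T}" and x: "x \<in> {0..pi}"
  shows "uC x t = green_op (\<lambda>x. W x t) x"
proof -
  have t': "t \<in> {0..T}" using t by auto
  have Wc: "continuous_on {0..pi} (\<lambda>x. W x t)" by (rule slice_cont[OF W_cont t'])
  have uc: "continuous_on {0..pi} (\<lambda>x. uC x t)"
  proof -
    have "continuous_on {0..pi} (\<lambda>x. (x, t))" by (intro continuous_intros)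
    from continuous_on_compose2[OF uC(1) this] show ?thesis by simp
  qed
  have "uC x t - green_op (\<lambda>x. W x t) x = 0"
  proof (rule sine_complete[OF _ _ x])
    show "continuous_on {0..pi} (\<lambda>x. uC x t - green_op (\<lambda>x. W x t) x)"
      by (intro continuous_intros uc green_op_continuous Wc)
    fix k :: nat assume k: "k \<ge> 1"
    have "sine_coeff k (\<lambda>x. W x t) = - (of_nat k)\<^sup>2 * sine_coeff k (green_op (\<lambda>x. W x t))" by (rule sine_coeff_green_op[OF Wc])
    then have "- (of_nat k)\<^sup>2 * sine_coeff k (\<lambda>x. uC x t) = - (of_nat k)\<^sup>2 * sine_coeff k (green_op (\<lambda>x. W x t))"
      unfolding sine_coeff_W_eq[OF k t] .
    then have "sine_coeff k (\<lambda>x. uC x t) = sine_coeff k (green_op (\<lambda>x. W x t))" using k by simp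
    then show "sine_coeff k (\<lambda>x. uC x t - green_op (\<lambda>x. W x t) x) = 0"
      by (subst sine_coeff_diff[OF uc green_op_continuous[OF Wc]]) simp
  qed
  then show ?thesis by simp
qed

lemma deriv2_u:
  assumes t: "t \<in> {0<..T}" and x: "x \<in> {0<..<pi}"
  shows "deriv2 {0<..<pi} (\<lambda>y. u y t) x = of_real (t powr (\<rho> - 1)) * W x t"
proof (rule deriv2_green_op[OF _ _ x])
  show "continuous_on {0..pi} (\<lambda>x. W x t)" by (rule slice_cont[OF W_cont]) (use t in auto)
  fix y :: real assume "y \<in> {0<..<pi}"
  then have y: "y \<in> {0..pi}" by auto
  show "u y t = of_real (t powr (\<rho> - 1)) * green_op (\<lambda>x. W x t) y"
    unfolding u_eq[OF y t] uC_eq_green_op[OF t y] ..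
qed

end

section \<open>Hoelder bounds, functionals and a singular Gronwall inequality\<close>

lemma holder_bound_nonneg: "holder_bound a g C \<Longrightarrow> 0 \<le> C"
proof -
  assume "holder_bound a g C"
  moreover have "(0::real) \<in> {0..pi}" by simp
  ultimately have "cmod (g 0 - g 0) \<le> C * 1 powr a"
    unfolding holder_bound_def by (metis abs_zero diff_self zero_less_one zero_le_one)
  then show "0 \<le> C" by simp
qed

text \<open>Lowering the exponent a to 1/2 is harmless only for distances at most 1. Since pi < 4,
  four equal steps suffice, and four terms C sqrt (|x - y| / 4) add up to the constant 2 C, which
  does not involve a.\<close>

lemma holder_half:
  assumes h: "holder_bound a g C" and a: "a > 1/2" and xy: "x \<in> {0..pi}" "y \<in> {0..pi}"
  shows "norm (g x - g y) \<le> 2 * C * sqrt \<bar>x - y\<bar>"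
proof (cases "x = y")
  case False
  define d where "d = \<bar>x - y\<bar> / 4"
  have d: "0 < d" "d \<le> 1" using False xy pi_less_4 by (auto simp: d_def)
  define z where "z i = x + (y - x) * (real i / 4)" for i
  have zin: "z i \<in> {0..pi}" if "i \<le> 4" for i
  proof -
    have "z i = (1 - real i / 4) *\<^sub>R x + (real i / 4) *\<^sub>R y" by (simp add: z_def field_simps)
    also have "\<dots> \<in> {0..pi}" using that by (intro convexD[OF convex_closed_interval[of 0 pi, unfolded box_real]] xy) auto
    finally show ?thesis .
  qed
  have step: "norm (g (z i) - g (z (Suc i))) \<le> C * sqrt d" if "i < 4" for i
  proof -
    have "\<bar>z i - z (Suc i)\<bar> = d" by (simp add: z_def d_def abs_mult[symmetric] algebra_simps add_divide_distrib) 
    then have "norm (g (z i) - g (z (Suc i))) \<le> C * d powr a"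
      using h d zin[of i] zin[of "Suc i"] that unfolding holder_bound_def by auto
    also have "\<dots> \<le> C * d powr (1/2)"
      using d a holder_bound_nonneg[OF h] by (intro mult_left_mono powr_mono') auto
    finally show ?thesis using d by (simp add: powr_half_sqrt)
  qed
  have "norm (g (z 0) - g (z 4)) \<le> norm (g (z 0) - g (z 1)) + norm (g (z 1) - g (z 2)) + norm (g (z 2) - g (z 3)) + norm (g (z 3) - g (z 4))"
    by (smt (verit) dist_norm dist_triangle)
  also have "\<dots> \<le> 4 * (C * sqrt d)"
    using step[of 0] step[of 1] step[of 2] step[of 3] by (simp add: numeral_eq_Suc)
  also have "\<dots> = 2 * C * sqrt \<bar>x - y\<bar>" by (simp add: d_def real_sqrt_divide)
  finally show ?thesis by (simp add: z_def)
qed simp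

text \<open>The defining inequality is linear in the constant, so the infimum of admissible
  constants is admissible; the Hoelder norms are attained.\<close>

lemma holder_bound_Inf:
  assumes "S \<noteq> {}" "\<And>C. C \<in> S \<Longrightarrow> holder_bound a g C"
  shows "holder_bound a g (Inf S)"
  unfolding holder_bound_def
proof (intro allI impI ballI)
  fix \<delta> x1 x2 :: real assume *: "0 < \<delta>" "x1 \<in> {0..pi}" "x2 \<in> {0..pi}" "\<bar>x1 - x2\<bar> \<le> \<delta>"
  have "cmod (g x1 - g x2) / \<delta> powr a \<le> Inf S"
  proof (rule cInf_greatest[OF assms(1)])
    fix C assume "C \<in> S"
    then have "cmod (g x1 - g x2) \<le> C * \<delta> powr a" using assms(2) * unfolding holder_bound_def by blast
    then show "cmod (g x1 - g x2) / \<delta> powr a \<le> C" using * by (simp add: field_simps)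
  qed
  then show "cmod (g x1 - g x2) \<le> Inf S * \<delta> powr a" using * by (simp add: field_simps)
qed

lemma Ca_norm_bound: "g \<in> Ca a \<Longrightarrow> holder_bound a g (Ca_norm a g)"
  unfolding Ca_norm_def by (rule holder_bound_Inf) (auto simp: Ca_def)

lemma Cxa_norm_bound: "h \<in> Cxa a T \<Longrightarrow> t \<in> {0..T} \<Longrightarrow> holder_bound a (\<lambda>x. h (x, t)) (Cxa_norm a T h)"
  unfolding Cxa_norm_def by (rule holder_bound_Inf) (auto simp: Cxa_def)

text \<open>The zero boundary value converts the Hoelder constant into a bound on the values: 2 C
  sqrt 4 = 4 C, again without a. This is the origin of the factors 4 in the estimates.\<close>

lemma holder_sup:
  assumes h: "holder_bound a g C" and a: "a > 1/2" and z: "g 0 = 0" and x: "x \<in> {0..pi}"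
  shows "norm (g x) \<le> 4 * C"
proof -
  have "norm (g x - g 0) \<le> 2 * C * sqrt \<bar>x - 0\<bar>" by (rule holder_half[OF h a x]) simp
  also have "\<dots> \<le> 2 * C * sqrt 4"
    using x pi_less_4 holder_bound_nonneg[OF h] by (intro mult_left_mono real_sqrt_le_mono) auto
  finally show ?thesis using z by simp
qed

lemma max_norm_upper:
  assumes "compact K" "continuous_on K g" "z \<in> K"
  shows "norm (g z) \<le> max_norm K g"
  unfolding max_norm_def
proof (rule cSUP_upper[OF assms(3)])
  have "compact ((\<lambda>z. cmod (g z)) ` K)" by (intro compact_continuous_image continuous_intros assms)
  then show "bdd_above ((\<lambda>z. cmod (g z)) ` K)" by (intro bounded_imp_bdd_above compact_imp_bounded)
qed

lemma max_norm_least: "K \<noteq> {} \<Longrightarrow> (\<And>z. z \<in> K \<Longrightarrow> norm (g z) \<le> b) \<Longrightarrow> max_norm K g \<le> b"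
  unfolding max_norm_def by (rule cSUP_least)

section \<open>Bounded functionals under time integrals\<close>

lemma bounded_functional:
  assumes "bounded_functional_C B"
  shows "\<And>g h. continuous_on {0..pi} g \<Longrightarrow> continuous_on {0..pi} h \<Longrightarrow> B (\<lambda>x. g x + h x) = B g + B h"
    and "\<And>c g. continuous_on {0..pi} g \<Longrightarrow> B (\<lambda>x. c * g x) = c * B g"
    and "\<exists>K\<ge>0. \<forall>g b. continuous_on {0..pi} g \<longrightarrow> (\<forall>x\<in>{0..pi}. norm (g x) \<le> b) \<longrightarrow> norm (B g) \<le> K * b"
proof -
  show "\<And>g h. continuous_on {0..pi} g \<Longrightarrow> continuous_on {0..pi} h \<Longrightarrow> B (\<lambda>x. g x + h x) = B g + B h"
    "\<And>c g. continuous_on {0..pi} g \<Longrightarrow> B (\<lambda>x. c * g x) = c * B g"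
    using assms by (auto simp: bounded_functional_C_def)
  obtain K where K: "\<And>g. continuous_on {0..pi} g \<Longrightarrow> cmod (B g) \<le> K * max_norm {0..pi} g"
    using assms by (auto simp: bounded_functional_C_def)
  have "norm (B g) \<le> \<bar>K\<bar> * b" if g: "continuous_on {0..pi} g" and b: "\<forall>x\<in>{0..pi}. norm (g x) \<le> b" for g b
  proof -
    have m: "max_norm {0..pi} g \<le> b" by (rule max_norm_least) (use b in auto)
    have "0 \<le> norm (g 0)" by simp
    also have "\<dots> \<le> max_norm {0..pi} g" by (rule max_norm_upper[OF compact_Icc g]) simp
    finally have p: "0 \<le> max_norm {0..pi} g" .
    have "norm (B g) \<le> K * max_norm {0..pi} g" by (rule K[OF g])
    also have "\<dots> \<le> \<bar>K\<bar> * max_norm {0..pi} g" using p by (intro mult_right_mono) auto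
    also have "\<dots> \<le> \<bar>K\<bar> * b" using m by (intro mult_left_mono) auto
    finally show ?thesis .
  qed
  then show "\<exists>K\<ge>0. \<forall>g b. continuous_on {0..pi} g \<longrightarrow> (\<forall>x\<in>{0..pi}. norm (g x) \<le> b) \<longrightarrow> norm (B g) \<le> K * b"
    by (intro exI[of _ "\<bar>K\<bar>"]) auto
qed

lemma bounded_functional_diff:
  assumes B: "bounded_functional_C B" and "continuous_on {0..pi} g" "continuous_on {0..pi} h"
  shows "B (\<lambda>x. g x - h x) = B g - B h"
proof -
  have "B (\<lambda>x. g x + (-1) * h x) = B g + B (\<lambda>x. (-1) * h x)"
    by (intro bounded_functional(1)[OF B] continuous_intros assms)
  also have "B (\<lambda>x. (-1) * h x) = (-1) * B h" by (rule bounded_functional(2)[OF B assms(3)])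
  finally show ?thesis by simp
qed

text \<open>A difference that vanishes on [0, pi] has bound 0 there, and boundedness forces its
  image to be 0.\<close>

lemma bounded_functional_cong:
  assumes B: "bounded_functional_C B" and g: "continuous_on {0..pi} g" and eq: "\<And>x. x \<in> {0..pi} \<Longrightarrow> g x = h x"
  shows "B g = B h"
proof -
  have h: "continuous_on {0..pi} h" by (rule continuous_on_eq[OF g eq])
  obtain K where K: "\<And>g b. continuous_on {0..pi} g \<Longrightarrow> (\<forall>x\<in>{0..pi}. norm (g x) \<le> b) \<Longrightarrow> norm (B g) \<le> K * b"
    using bounded_functional(3)[OF B] by blast
  have "norm (B (\<lambda>x. g x - h x)) \<le> K * 0"
    by (intro K continuous_intros g h) (simp add: eq)
  then show ?thesis using bounded_functional_diff[OF B g h] by simp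
qed

text \<open>No representing measure for \<open>B\<close> is used. The time interval is cut into
  pieces on which g(x, s) varies by at most e, uniformly in x. On each piece g is replaced by its
  value at the left end, where the exchange is mere linearity, and the total error is at most 2 K e
  times the integral of |w|.\<close>

lemma functional_exchange:
  fixes w :: "real \<Rightarrow> real" and g :: "real \<Rightarrow> real \<Rightarrow> complex"
  assumes B: "bounded_functional_C B" and t: "t > 0"
    and w: "w \<in> borel_measurable borel" "set_integrable lborel {0<..<t} w"
    and g: "continuous_on UNIV (\<lambda>(x, s). g x s)" and M: "\<And>x s. norm (g x s) \<le> M"
  shows "B (\<lambda>x. LINT s:{0<..<t}|lborel. of_real (w s) * g x s) = (LINT s:{0<..<t}|lborel. of_real (w s) * B (\<lambda>x. g x s))"
    and "continuous_on UNIV (\<lambda>s. B (\<lambda>x. g x s))"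
proof -
  obtain K where K0: "K \<ge> 0" and K: "\<And>g b. continuous_on {0..pi} g \<Longrightarrow> (\<forall>x\<in>{0..pi}. norm (g x) \<le> b) \<Longrightarrow> norm (B g) \<le> K * b"
    using bounded_functional(3)[OF B] by blast
  have gx: "continuous_on S (\<lambda>x. g x s)" for S s
  proof -
    have "continuous_on S (\<lambda>x. (x, s))" by (intro continuous_intros)
    from continuous_on_compose2[OF g this] show ?thesis by simp
  qed
  define L where "L s = B (\<lambda>x. g x s)" for s
  have Ldiff: "norm (L s - L r) \<le> K * b" if "\<And>x. x \<in> {0..pi} \<Longrightarrow> norm (g x s - g x r) \<le> b" for s r b
    unfolding L_def bounded_functional_diff[OF B gx gx, symmetric]
    by (intro K continuous_intros gx) (use that in auto)
  have uc: "\<exists>d>0. \<forall>s\<in>{a..b}. \<forall>r\<in>{a..b}. \<bar>s - r\<bar> < d \<longrightarrow> (\<forall>x\<in>{0..pi}. norm (g x s - g x r) < e)" if e: "e > 0" for a b e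
  proof -
    have "uniformly_continuous_on ({0..pi} \<times> {a..b}) (\<lambda>(x, s). g x s)"
      by (rule compact_uniformly_continuous[OF continuous_on_subset[OF g]]) (auto intro: compact_Times)
    then obtain d where d: "d > 0" "\<And>p q. p \<in> {0..pi} \<times> {a..b} \<Longrightarrow> q \<in> {0..pi} \<times> {a..b} \<Longrightarrow> dist q p < d \<Longrightarrow> dist (case q of (x, s) \<Rightarrow> g x s) (case p of (x, s) \<Rightarrow> g x s) < e"
      using e unfolding uniformly_continuous_on_def by metis
    show ?thesis
    proof (intro exI[of _ d] conjI ballI impI d(1))
      fix s r x assume "s \<in> {a..b}" "r \<in> {a..b}" "\<bar>s - r\<bar> < d" "x \<in> {0..pi}"
      then show "norm (g x s - g x r) < e"
        using d(2)[of "(x, r)" "(x, s)"] by (simp add: dist_Pair_Pair dist_norm)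
    qed
  qed
  show Lc: "continuous_on UNIV (\<lambda>s. B (\<lambda>x. g x s))"
    unfolding L_def[symmetric]
  proof (rule continuous_at_imp_continuous_on, rule ballI)
    fix s :: real
    show "isCont L s"
      unfolding continuous_at_eps_delta
    proof (intro allI impI)
      fix e :: real assume e: "e > 0"
      define e' where "e' = e / (K + 1)"
      have e': "e' > 0" "K * e' < e" using e K0 by (auto simp: e'_def field_simps)
      obtain d where d: "d > 0" "\<forall>r\<in>{s - 1..s + 1}. \<forall>s'\<in>{s - 1..s + 1}. \<bar>r - s'\<bar> < d \<longrightarrow> (\<forall>x\<in>{0..pi}. norm (g x r - g x s') < e')"
        using uc[OF e'(1)] by blast
      show "\<exists>d>0. \<forall>x'. dist x' s < d \<longrightarrow> dist (L x') (L s) < e"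
      proof (intro exI[of _ "min d 1"] conjI allI impI)
        fix r assume "dist r s < min d 1"
        then have "r \<in> {s - 1..s + 1}" "\<bar>r - s\<bar> < d" by (auto simp: dist_real_def)
        then have "norm (L r - L s) \<le> K * e'" using d(2) by (intro Ldiff) (auto intro!: less_imp_le)
        then show "dist (L r) (L s) < e" using e' by (simp add: dist_norm)
      qed (use d in auto)
    qed
  qed
  have Lm[measurable]: "L \<in> borel_measurable borel"
    using borel_measurable_continuous_onI[OF Lc] by (simp add: L_def[symmetric])
  have Lb: "norm (L s) \<le> K * M" for s unfolding L_def by (intro K gx) (auto intro: M)
  \<comment> \<open>Half-open pieces tile without overlap; adding the endpoint \<open>t\<close>
    changes no integral and is undone at the end.\<close>
  have wt: "set_integrable lborel {0<..t} w"
    unfolding set_integrable_def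
    by (rule integrable_discrete_difference[where X = "{t}", THEN iffD1, OF _ _ _ _ w(2)[unfolded set_integrable_def]])
      (use t in \<open>auto simp: indicator_def\<close>)
  \<comment> \<open>The defect of the exchange up to time r.\<close>
  define E where "E r = B (\<lambda>x. LINT s:{0<..r}|lborel. of_real (w s) * g x s) - (LINT s:{0<..r}|lborel. of_real (w s) * L s)" for r
  have sub: "set_integrable lborel S w" if "S \<subseteq> {0<..t}" "S \<in> sets borel" for S
    by (rule set_integrable_subset[OF wt]) (use that in auto)
  have Li: "set_integrable lborel S (\<lambda>s. of_real (w s) * L s)" if "S \<subseteq> {0<..t}" "S \<in> sets borel" for S
    using set_integrable_mult_bounded[OF set_integrable_of_real[OF sub[OF that]] Lm Lb] by (simp only: mult.commute)
  note WI = weighted_integral[OF _ w(1) _ g M]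
  have Estep: "norm (E d) \<le> norm (E c) + 2 * K * e * (LINT s:{c<..d}|lborel. \<bar>w s\<bar>)"
    if cd: "0 \<le> c" "c \<le> d" "d \<le> t" and e: "\<And>s x. s \<in> {c<..d} \<Longrightarrow> x \<in> {0..pi} \<Longrightarrow> norm (g x s - g x c) \<le> e" and e0: "e \<ge> 0" for c d e
  proof -
    have un: "{0<..d} = {0<..c} \<union> {c<..d}" "{0<..c} \<inter> {c<..d} = {}" using cd by auto
    have S: "{0<..c} \<subseteq> {0<..t}" "{c<..d} \<subseteq> {0<..t}" using cd by auto
    have wi: "set_integrable lborel {0<..c} w" "set_integrable lborel {c<..d} w" by (rule sub; use S in auto)+
    have ci: "continuous_on {0..pi} (\<lambda>x. LINT s:{0<..c}|lborel. of_real (w s) * g x s)" "continuous_on {0..pi} (\<lambda>x. LINT s:{c<..d}|lborel. of_real (w s) * g x s)"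
      by (rule continuous_on_subset[OF WI(1)]; use wi in auto)+
    have "(\<lambda>x. LINT s:{0<..d}|lborel. of_real (w s) * g x s) = (\<lambda>x. (LINT s:{0<..c}|lborel. of_real (w s) * g x s) + (LINT s:{c<..d}|lborel. of_real (w s) * g x s))"
      unfolding un(1) by (intro ext set_integral_Un un(2) WI(4) wi) auto
    then have B1: "B (\<lambda>x. LINT s:{0<..d}|lborel. of_real (w s) * g x s) = B (\<lambda>x. LINT s:{0<..c}|lborel. of_real (w s) * g x s) + B (\<lambda>x. LINT s:{c<..d}|lborel. of_real (w s) * g x s)"
      using bounded_functional(1)[OF B ci] by simp
    have L1: "(LINT s:{0<..d}|lborel. of_real (w s) * L s) = (LINT s:{0<..c}|lborel. of_real (w s) * L s) + (LINT s:{c<..d}|lborel. of_real (w s) * L s)"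
      unfolding un(1) by (intro set_integral_Un un(2) Li S) auto
    define Iw' where "Iw' = (LINT s:{c<..d}|lborel. \<bar>w s\<bar>)"
    have ai: "set_integrable lborel {c<..d} (\<lambda>s. e' * \<bar>w s\<bar>)" for e' by (intro set_integrable_mult_right set_integrable_abs wi)
    have wci: "set_integrable lborel {c<..d} (\<lambda>s. of_real (w s) * z)" for z :: complex
      by (intro set_integrable_mult_left set_integrable_of_real wi)
    define I0 where "I0 = (LINT s:{c<..d}|lborel. complex_of_real (w s))"
    have gsplit: "(LINT s:{c<..d}|lborel. of_real (w s) * g x s) = (LINT s:{c<..d}|lborel. of_real (w s) * (g x s - g x c)) + I0 * g x c" for x
    proof -
      have "(LINT s:{c<..d}|lborel. of_real (w s) * (g x s - g x c)) = (LINT s:{c<..d}|lborel. of_real (w s) * g x s) - (LINT s:{c<..d}|lborel. of_real (w s) * g x c)"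
        unfolding right_diff_distrib by (rule set_integral_diff(2)[OF WI(4) wci]) (use wi in auto)
      then show ?thesis by (simp add: I0_def)
    qed
    have Lsplit: "(LINT s:{c<..d}|lborel. of_real (w s) * L s) = (LINT s:{c<..d}|lborel. of_real (w s) * (L s - L c)) + I0 * L c"
    proof -
      have "(LINT s:{c<..d}|lborel. of_real (w s) * (L s - L c)) = (LINT s:{c<..d}|lborel. of_real (w s) * L s) - (LINT s:{c<..d}|lborel. of_real (w s) * L c)"
        unfolding right_diff_distrib by (rule set_integral_diff(2)[OF Li wci]) (use S in auto)
      then show ?thesis by (simp add: I0_def)
    qed
    define R where "R x = (LINT s:{c<..d}|lborel. of_real (w s) * (g x s - g x c))" for x
    have Rc: "continuous_on {0..pi} R"
    proof -
      have "R = (\<lambda>x. (LINT s:{c<..d}|lborel. of_real (w s) * g x s) - I0 * g x c)"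
        using gsplit by (auto simp: R_def fun_eq_iff algebra_simps)
      then show ?thesis using ci(2) gx by (auto intro!: continuous_intros)
    qed
    have Rb: "norm (R x) \<le> e * Iw'" if "x \<in> {0..pi}" for x
      unfolding R_def Iw'_def set_integral_mult_right[symmetric]
    proof (rule set_integral_norm_le[OF ai])
      fix s assume s: "s \<in> {c<..d}"
      show "norm (of_real (w s) * (g x s - g x c)) \<le> e * \<bar>w s\<bar>"
        using mult_left_mono[OF e[OF s that], of "\<bar>w s\<bar>"] by (simp add: norm_mult mult.commute)
    qed
    have B2: "B (\<lambda>x. LINT s:{c<..d}|lborel. of_real (w s) * g x s) = B R + I0 * L c"
    proof -
      have "B (\<lambda>x. LINT s:{c<..d}|lborel. of_real (w s) * g x s) = B (\<lambda>x. R x + I0 * g x c)"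
        using gsplit by (simp add: R_def)
      also have "\<dots> = B R + B (\<lambda>x. I0 * g x c)" by (intro bounded_functional(1)[OF B] Rc continuous_intros gx)
      also have "B (\<lambda>x. I0 * g x c) = I0 * L c" unfolding L_def by (rule bounded_functional(2)[OF B gx])
      finally show ?thesis .
    qed
    have BR: "norm (B R) \<le> K * (e * Iw')" by (intro K Rc) (use Rb in auto)
    have LR: "norm (LINT s:{c<..d}|lborel. of_real (w s) * (L s - L c)) \<le> K * e * Iw'"
      unfolding Iw'_def set_integral_mult_right[symmetric]
    proof (rule set_integral_norm_le[OF ai])
      fix s assume s: "s \<in> {c<..d}"
      have "norm (L s - L c) \<le> K * e" by (rule Ldiff[OF e[OF s]])
      then show "norm (of_real (w s) * (L s - L c)) \<le> K * e * \<bar>w s\<bar>"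
        using mult_left_mono[of "norm (L s - L c)" "K * e" "\<bar>w s\<bar>"] by (simp add: norm_mult mult_ac)
    qed
    have "E d = E c + (B R - (LINT s:{c<..d}|lborel. of_real (w s) * (L s - L c)))"
      unfolding E_def B1 L1 B2 Lsplit by simp
    then have "norm (E d) \<le> norm (E c) + (norm (B R) + norm (LINT s:{c<..d}|lborel. of_real (w s) * (L s - L c)))"
      using norm_triangle_ineq norm_triangle_ineq4 by (smt (verit))
    also have "\<dots> \<le> norm (E c) + (K * (e * Iw') + K * e * Iw')" by (intro add_mono order_refl BR LR)
    finally show ?thesis unfolding Iw'_def by (simp add: mult_ac)
  qed
  have Esmall: "norm (E t) \<le> 2 * K * e * (LINT s:{0<..t}|lborel. \<bar>w s\<bar>)" if e: "e > 0" for e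
  proof -
    obtain d where d: "d > 0" "\<forall>s\<in>{0..t}. \<forall>r\<in>{0..t}. \<bar>s - r\<bar> < d \<longrightarrow> (\<forall>x\<in>{0..pi}. norm (g x s - g x r) < e)"
      using uc[OF e] by blast
    obtain n :: nat where n: "t / d < real n" using reals_Archimedean2 by blast
    then have n0: "n > 0" using t d by (cases n) (auto simp: field_simps)
    define h where "h = t / real n"
    have h: "h > 0" "h < d" using n n0 t d by (auto simp: h_def field_simps)
    have "norm (E (real m * h)) \<le> 2 * K * e * (LINT s:{0<..real m * h}|lborel. \<bar>w s\<bar>)" if "m \<le> n" for m
      using that
    proof (induction m)
      case 0
      \<comment> \<open>Over the empty interval the integral is the zero function, which homogeneity
        with factor 0 sends to 0.\<close>
      have "B (\<lambda>x. 0 * 0) = 0 * B (\<lambda>x. 0)" by (rule bounded_functional(2)[OF B]) simp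
      then show ?case by (simp add: E_def set_lebesgue_integral_def)
    next
      case (Suc m)
      define c where "c = real m * h"
      define d' where "d' = real (Suc m) * h"
      have dc: "d' = c + h" by (simp add: d'_def c_def algebra_simps)
      have c0: "0 \<le> c" using h by (simp add: c_def)
      have "d' \<le> real n * h" unfolding d'_def using Suc.prems h by (intro mult_right_mono) auto
      then have dt: "d' \<le> t" using n0 by (simp add: h_def)
      have cd: "c \<le> d'" using dc h by simp
      have "norm (E d') \<le> norm (E c) + 2 * K * e * (LINT s:{c<..d'}|lborel. \<bar>w s\<bar>)"
      proof (rule Estep[OF c0 cd dt])
        fix s x assume "s \<in> {c<..d'}" "x \<in> {0..pi}"
        then show "norm (g x s - g x c) \<le> e" using d(2) dc h c0 dt by (intro less_imp_le) auto
      qed (use e in auto)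
      also have "norm (E c) \<le> 2 * K * e * (LINT s:{0<..c}|lborel. \<bar>w s\<bar>)"
        using Suc by (simp add: c_def)
      also have "2 * K * e * (LINT s:{0<..c}|lborel. \<bar>w s\<bar>) + 2 * K * e * (LINT s:{c<..d'}|lborel. \<bar>w s\<bar>) = 2 * K * e * (LINT s:{0<..d'}|lborel. \<bar>w s\<bar>)"
      proof -
        have un: "{0<..d'} = {0<..c} \<union> {c<..d'}" "{0<..c} \<inter> {c<..d'} = {}" using cd c0 by auto
        have "(LINT s:{0<..d'}|lborel. \<bar>w s\<bar>) = (LINT s:{0<..c}|lborel. \<bar>w s\<bar>) + (LINT s:{c<..d'}|lborel. \<bar>w s\<bar>)"
          unfolding un(1) by (intro set_integral_Un un(2) set_integrable_abs sub) (use cd c0 dt in auto)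
        then show ?thesis by (simp add: distrib_left)
      qed
      finally show ?case by (simp add: d'_def)
    qed
    from this[of n] show ?thesis using n0 by (simp add: h_def)
  qed
  define X where "X = 2 * K * (LINT s:{0<..t}|lborel. \<bar>w s\<bar>)"
  have X0: "X \<ge> 0" using K0 by (auto simp: X_def intro!: mult_nonneg_nonneg set_integral_nonneg)
  have "norm (E t) \<le> 0 + e" if "e > 0" for e
  proof -
    have "norm (E t) \<le> X * (e / (X + 1))" using Esmall[of "e / (X + 1)"] that X0 by (simp add: X_def mult_ac)
    also have "\<dots> \<le> e" using that X0 by (simp add: field_simps)
    finally show ?thesis by simp
  qed
  then have "norm (E t) \<le> 0" by (rule field_le_epsilon)
  then have "E t = 0" by simp
  moreover have "(LINT s:{0<..t}|lborel. f s) = (LINT s:{0<..<t}|lborel. f s)" for f :: "real \<Rightarrow> complex"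
    by (rule set_integral_discrete_difference[where X = "{t}"]) (use t in auto)
  ultimately show "B (\<lambda>x. LINT s:{0<..<t}|lborel. of_real (w s) * g x s) = (LINT s:{0<..<t}|lborel. of_real (w s) * B (\<lambda>x. g x s))"
    by (simp add: E_def L_def)
qed

section \<open>A Gronwall inequality with a two-sided weak singularity\<close>

text \<open>Trades exponential decay for a negative power; in the Gronwall argument this extracts a
  negative power of the weight parameter.\<close>

lemma exp_minus_le_powr:
  fixes x b :: real
  assumes "x > 0" "0 < b" "b \<le> 1"
  shows "exp (- x) \<le> x powr (- b)"
proof -
  have "x powr b \<le> exp x"
  proof (cases "x \<le> 1")
    case True
    then have "x powr b \<le> 1" using assms powr_le1[of b x] by simp
    also have "\<dots> \<le> exp x" using assms by simp
    finally show ?thesis .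
  next
    case False
    then have "x powr b \<le> x powr 1" using assms by (intro powr_mono) auto
    also have "x powr 1 \<le> exp x" proof -
      have "x powr 1 = x" using assms by simp
      then show ?thesis using exp_ge_add_one_self[of x] by linarith
    qed
    finally show ?thesis .
  qed
  then show ?thesis using assms by (simp add: exp_minus powr_minus le_imp_inverse_le)
qed

text \<open>In the norm weighted by exp (-\<gamma> t) the integral operator has size at most a
  multiple of \<gamma>^(-\<rho>/2). For large \<gamma> this is below 1/2, and the weighted supremum
  M satisfies M \<le> A + M/2. Continuity of v up to t = 0 makes M finite, so that it can be
  absorbed.\<close>

lemma singular_gronwall:
  fixes \<rho> T c :: real
  assumes rho: "0 < \<rho>" "\<rho> < 1" and T: "T > 0" and c: "c \<ge> 0"
  shows "\<exists>G\<ge>0. \<forall>v A. continuous_on {0..T} v \<longrightarrow> v \<in> borel_measurable borel \<longrightarrow> (\<forall>s. 0 \<le> v s) \<longrightarrow> A \<ge> 0 \<longrightarrow>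
    (\<forall>t\<in>{0<..T}. v t \<le> A + c * (t powr \<rho> * (LINT \<sigma>:{0<..<1}|lborel. \<sigma> powr (\<rho> - 1) * (1 - \<sigma>) powr (\<rho> - 1) * v (t * \<sigma>)))) \<longrightarrow>
    (\<forall>t\<in>{0<..T}. v t \<le> G * A)"
proof -
  define \<beta> where "\<beta> = Beta \<rho> (\<rho> / 2)"
  \<comment> \<open>The parameter is chosen from \<rho>, T and c before v and A appear, so the
    resulting constant is uniform in both.\<close>
  have "((\<lambda>\<gamma>. c * (\<gamma> powr (- (\<rho> / 2)) * T powr (\<rho> / 2) * \<beta>)) \<longlongrightarrow> c * (0 * T powr (\<rho> / 2) * \<beta>)) at_top"
    using rho by (intro tendsto_intros) real_asymp
  then have "\<forall>\<^sub>F \<gamma> in at_top. c * (\<gamma> powr (- (\<rho> / 2)) * T powr (\<rho> / 2) * \<beta>) < 1/2"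
    by (rule order_tendstoD) simp
  then have "\<forall>\<^sub>F \<gamma> in at_top. \<gamma> > 0 \<and> c * (\<gamma> powr (- (\<rho> / 2)) * T powr (\<rho> / 2) * \<beta>) < 1/2"
    by (intro eventually_conj eventually_gt_at_top)
  from eventually_happens'[OF trivial_limit_at_top_linorder this]
  obtain \<gamma> where g: "\<gamma> > 0" "c * (\<gamma> powr (- (\<rho> / 2)) * T powr (\<rho> / 2) * \<beta>) < 1/2" by blast
  show ?thesis
  proof (intro exI[of _ "2 * exp (\<gamma> * T)"] conjI allI impI ballI)
    fix v :: "real \<Rightarrow> real" and A t
    assume v: "continuous_on {0..T} v" "v \<in> borel_measurable borel" "\<forall>s. 0 \<le> v s" and A: "A \<ge> 0"
      and ineq: "\<forall>t\<in>{0<..T}. v t \<le> A + c * (t powr \<rho> * (LINT \<sigma>:{0<..<1}|lborel. \<sigma> powr (\<rho> - 1) * (1 - \<sigma>) powr (\<rho> - 1) * v (t * \<sigma>)))"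
      and t: "t \<in> {0<..T}"
    define M where "M = (SUP s\<in>{0<..T}. exp (- (\<gamma> * s)) * v s)"
    have "bounded ((\<lambda>s. exp (- (\<gamma> * s)) * v s) ` {0..T})"
      by (intro compact_imp_bounded compact_continuous_image continuous_intros v) auto
    then have bdd: "bdd_above ((\<lambda>s. exp (- (\<gamma> * s)) * v s) ` {0<..T})"
      by (rule bounded_imp_bdd_above[OF bounded_subset[OF _ image_mono]]) (simp add: greaterThanAtMost_subseteq_atLeastAtMost_iff)
    have up: "v s \<le> M * exp (\<gamma> * s)" if "s \<in> {0<..T}" for s
    proof -
      have "exp (- (\<gamma> * s)) * v s \<le> M" unfolding M_def by (rule cSUP_upper[OF that bdd])
      then have "exp (\<gamma> * s) * (exp (- (\<gamma> * s)) * v s) \<le> exp (\<gamma> * s) * M" by (intro mult_left_mono) auto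
      moreover have "exp (\<gamma> * s) * (exp (- (\<gamma> * s)) * v s) = v s" by (simp add: exp_minus)
      ultimately show ?thesis by (simp only: mult.commute)
    qed
    have M0: "M \<ge> 0"
    proof -
      have "0 \<le> exp (- (\<gamma> * t)) * v t" using v by simp
      also have "\<dots> \<le> M" unfolding M_def by (rule cSUP_upper[OF t bdd])
      finally show ?thesis .
    qed
    have "M \<le> A + M / 2"
      unfolding M_def
    proof (rule cSUP_least)
      fix s assume s: "s \<in> {0<..T}"
      then have s0: "s > 0" "s \<le> T" by auto
      \<comment> \<open>Half of the kernel exponent pays for the decay: (1-\<sigma>)^(\<rho>-1)
        becomes the still integrable (1-\<sigma>)^(\<rho>/2-1), and (\<gamma> s)^(-\<rho>/2) is
        gained.\<close>
      define X where "X = M * exp (\<gamma> * s) * (\<gamma> * s) powr (- (\<rho> / 2))"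
      have "norm (LINT \<sigma>:{0<..<1}|lborel. \<sigma> powr (\<rho> - 1) * (1 - \<sigma>) powr (\<rho> - 1) * v (s * \<sigma>)) \<le>
         (LINT \<sigma>:{0<..<1}|lborel. X * (\<sigma> powr (\<rho> - 1) * (1 - \<sigma>) powr (\<rho> / 2 - 1)))"
      proof (rule set_integral_norm_le)
        show "set_integrable lborel {0<..<1} (\<lambda>\<sigma>. X * (\<sigma> powr (\<rho> - 1) * (1 - \<sigma>) powr (\<rho> / 2 - 1)))"
          using rho by (intro set_integrable_mult_right beta_integral) auto
        fix \<sigma> :: real assume sg: "\<sigma> \<in> {0<..<1}"
        have "s * \<sigma> \<le> T * 1" using sg s0 by (intro mult_mono) auto
        then have ss: "s * \<sigma> \<in> {0<..T}" using sg s0 by auto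
        have "v (s * \<sigma>) \<le> M * exp (\<gamma> * (s * \<sigma>))" by (rule up[OF ss])
        also have "\<dots> = M * exp (\<gamma> * s) * exp (- (\<gamma> * s * (1 - \<sigma>)))"
          by (simp add: mult.assoc exp_add[symmetric] algebra_simps)
        also have "\<dots> \<le> M * exp (\<gamma> * s) * (\<gamma> * s * (1 - \<sigma>)) powr (- (\<rho> / 2))"
          using M0 sg s0 g rho by (intro mult_left_mono exp_minus_le_powr) auto
        also have "(\<gamma> * s * (1 - \<sigma>)) powr (- (\<rho> / 2)) = (\<gamma> * s) powr (- (\<rho> / 2)) * (1 - \<sigma>) powr (- (\<rho> / 2))"
          using sg s0 g by (simp add: powr_mult)
        finally have "v (s * \<sigma>) \<le> X * (1 - \<sigma>) powr (- (\<rho> / 2))" by (simp add: X_def mult_ac)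
        then have "\<sigma> powr (\<rho> - 1) * (1 - \<sigma>) powr (\<rho> - 1) * v (s * \<sigma>) \<le> \<sigma> powr (\<rho> - 1) * (1 - \<sigma>) powr (\<rho> - 1) * (X * (1 - \<sigma>) powr (- (\<rho> / 2)))"
          by (intro mult_left_mono) auto
        also have "\<dots> = X * (\<sigma> powr (\<rho> - 1) * ((1 - \<sigma>) powr (\<rho> - 1) * (1 - \<sigma>) powr (- (\<rho> / 2))))" by simp
        also have "(1 - \<sigma>) powr (\<rho> - 1) * (1 - \<sigma>) powr (- (\<rho> / 2)) = (1 - \<sigma>) powr (\<rho> - 1 + - (\<rho> / 2))"
          by (rule powr_add[symmetric])
        also have "\<rho> - 1 + - (\<rho> / 2) = \<rho> / 2 - 1" by simp
        finally show "norm (\<sigma> powr (\<rho> - 1) * (1 - \<sigma>) powr (\<rho> - 1) * v (s * \<sigma>)) \<le> X * (\<sigma> powr (\<rho> - 1) * (1 - \<sigma>) powr (\<rho> / 2 - 1))"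
          using v by (simp add: abs_mult)
      qed
      also have "\<dots> = X * \<beta>" unfolding \<beta>_def using beta_integral(2)[of \<rho> "\<rho> / 2"] rho by simp
      finally have I: "(LINT \<sigma>:{0<..<1}|lborel. \<sigma> powr (\<rho> - 1) * (1 - \<sigma>) powr (\<rho> - 1) * v (s * \<sigma>)) \<le> X * \<beta>" by simp
      have b0: "\<beta> \<ge> 0" using rho Gamma_real_pos[of \<rho>] Gamma_real_pos[of "\<rho> / 2"] Gamma_real_pos[of "\<rho> + \<rho> / 2"]
        by (simp add: \<beta>_def Beta_def)
      have "s powr \<rho> * (\<gamma> * s) powr (- (\<rho> / 2)) = \<gamma> powr (- (\<rho> / 2)) * (s powr \<rho> * s powr (- (\<rho> / 2)))"
        using s0 g by (simp add: powr_mult)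
      also have "s powr \<rho> * s powr (- (\<rho> / 2)) = s powr (\<rho> + - (\<rho> / 2))" by (rule powr_add[symmetric])
      also have "\<rho> + - (\<rho> / 2) = \<rho> / 2" by simp
      also have "\<gamma> powr (- (\<rho> / 2)) * s powr (\<rho> / 2) \<le> \<gamma> powr (- (\<rho> / 2)) * T powr (\<rho> / 2)"
        using s0 rho by (intro mult_left_mono powr_mono2) auto
      finally have sp: "s powr \<rho> * (\<gamma> * s) powr (- (\<rho> / 2)) \<le> \<gamma> powr (- (\<rho> / 2)) * T powr (\<rho> / 2)" .
      have "c * (s powr \<rho> * (LINT \<sigma>:{0<..<1}|lborel. \<sigma> powr (\<rho> - 1) * (1 - \<sigma>) powr (\<rho> - 1) * v (s * \<sigma>))) \<le> c * (s powr \<rho> * (X * \<beta>))"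
        using c I by (intro mult_left_mono) auto
      also have "\<dots> = M * exp (\<gamma> * s) * (c * ((s powr \<rho> * (\<gamma> * s) powr (- (\<rho> / 2))) * \<beta>))" by (simp add: X_def)
      also have "\<dots> \<le> M * exp (\<gamma> * s) * (c * ((\<gamma> powr (- (\<rho> / 2)) * T powr (\<rho> / 2)) * \<beta>))"
        using M0 c b0 sp by (intro mult_left_mono mult_right_mono) auto
      also have "\<dots> \<le> M * exp (\<gamma> * s) * (1/2)" using g M0 by (intro mult_left_mono) auto
      finally have "v s \<le> A + M * exp (\<gamma> * s) * (1/2)" using bspec[OF ineq s] by linarith
      then have "exp (- (\<gamma> * s)) * v s \<le> exp (- (\<gamma> * s)) * (A + M * exp (\<gamma> * s) * (1/2))" by (intro mult_left_mono) auto
      also have "\<dots> = exp (- (\<gamma> * s)) * A + M / 2" by (simp add: distrib_left exp_minus)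
      also have "exp (- (\<gamma> * s)) * A \<le> 1 * A" using A g s0 by (intro mult_right_mono) auto
      finally show "exp (- (\<gamma> * s)) * v s \<le> A + (SUP s\<in>{0<..T}. exp (- (\<gamma> * s)) * v s) / 2" by (simp add: M_def)
    qed (use t in auto)
    then have "M \<le> 2 * A" by simp
    have "v t \<le> M * exp (\<gamma> * t)" by (rule up[OF t])
    also have "\<dots> \<le> 2 * A * exp (\<gamma> * T)" using \<open>M \<le> 2 * A\<close> A t g by (intro mult_mono) auto
    finally show "v t \<le> 2 * exp (\<gamma> * T) * A" by (simp add: mult_ac)
  qed simp
qed

section \<open>A priori estimates\<close>

text \<open>Clamping both coordinates to the rectangle provides the globally continuous and bounded
  versions that the locales ask for, with unchanged values on the rectangle.\<close>

lemma clamped_extension: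
  fixes g :: "real \<times> real \<Rightarrow> complex"
  assumes T: "0 < T" and g: "continuous_on ({0..pi} \<times> {0..T}) g"
  shows "continuous_on UNIV (\<lambda>(x, s). g (max 0 (min pi x), max 0 (min T s)))"
    and "\<exists>M. \<forall>x s. norm (g (max 0 (min pi x), max 0 (min T s))) \<le> M"
proof -
  have r: "(max 0 (min pi x), max 0 (min T s)) \<in> {0..pi} \<times> {0..T}" for x s using T by auto
  have "continuous_on UNIV (\<lambda>p::real \<times> real. g (max 0 (min pi (fst p)), max 0 (min T (snd p))))"
    by (rule continuous_on_compose2[OF g]) (use r in \<open>auto intro!: continuous_intros simp del: max_def min_def\<close>)
  then show "continuous_on UNIV (\<lambda>(x, s). g (max 0 (min pi x), max 0 (min T s)))" by (simp add: case_prod_beta)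
  have "compact (g ` ({0..pi} \<times> {0..T}))" by (intro compact_continuous_image g compact_Times) auto
  from compact_imp_bounded[OF this] obtain M where "\<forall>z\<in>g ` ({0..pi} \<times> {0..T}). norm z \<le> M"
    unfolding bounded_iff by blast
  then have "norm (g (max 0 (min pi x), max 0 (min T s))) \<le> M" for x s using r[of x s] by blast
  then show "\<exists>M. \<forall>x s. norm (g (max 0 (min pi x), max 0 (min T s))) \<le> M" by blast
qed

context inverse_data
begin

definition Dw :: "real \<Rightarrow> real \<Rightarrow> complex" where "Dw x t = - \<i> * (W x t + FC x t)"

definition DwC :: "real \<Rightarrow> real \<Rightarrow> complex" where "DwC x s = Dw (max 0 (min pi x)) (max 0 (min T s))"

lemma RL_deriv_u:
  assumes x: "x \<in> {0<..<pi}" and t: "t \<in> {0<..T}"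
  shows "RL_deriv T \<rho> (u x) t = of_real (t powr (\<rho> - 1)) * Dw x t"
proof -
  have x': "x \<in> {0..pi}" using x by auto
  have "\<i> * RL_deriv T \<rho> (u x) t = of_real (t powr (\<rho> - 1)) * (W x t + FC x t)"
    using eqn[OF x t] unfolding deriv2_u[OF t x] F_eq[OF x' t] by (simp add: algebra_simps)
  then have "- \<i> * (\<i> * RL_deriv T \<rho> (u x) t) = - \<i> * (of_real (t powr (\<rho> - 1)) * (W x t + FC x t))" by simp
  then show ?thesis by (simp add: Dw_def algebra_simps)
qed

lemma Dw_cont: "continuous_on (UNIV \<times> {0..T}) (\<lambda>(x, t). Dw x t)"
proof -
  have "continuous_on (UNIV \<times> {0..T}) (\<lambda>(x, t). FC x t)" by (rule continuous_on_subset[OF FC(1)]) simp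
  then show ?thesis using W_cont unfolding Dw_def case_prod_beta by (intro continuous_intros)
qed

lemma DwC_cont: "continuous_on UNIV (\<lambda>(x, s). DwC x s)"
  and DwC_bounded: "\<exists>M. \<forall>x s. norm (DwC x s) \<le> M"
proof -
  have "continuous_on ({0..pi} \<times> {0..T}) (\<lambda>(x, t). Dw x t)" by (rule continuous_on_subset[OF Dw_cont]) auto
  note c = clamped_extension[OF T this]
  show "continuous_on UNIV (\<lambda>(x, s). DwC x s)" using c(1) by (simp add: DwC_def)
  show "\<exists>M. \<forall>x s. norm (DwC x s) \<le> M" using c(2) by (simp add: DwC_def)
qed

lemma DwC_eq: "x \<in> {0..pi} \<Longrightarrow> t \<in> {0..T} \<Longrightarrow> DwC x t = Dw x t"
  by (simp add: DwC_def)

lemma phi_continuous: "continuous_on {0..pi} \<phi>"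
  by (rule continuous_on_eq[OF green_op_continuous[OF phi2(1)]]) (simp add: phi)

text \<open>In the interior this is the fundamental theorem together with the initial condition.
  Both sides are continuous on [0, pi], so the identity reaches the endpoints; only then can
  \<open>B\<close> be applied to it.\<close>

lemma J_representation:
  assumes x: "x \<in> {0..pi}" and t: "t \<in> {0<..T}"
  shows "J x t = \<phi> x + Iw DwC x t"
proof -
  obtain M where M: "\<And>x s. norm (DwC x s) \<le> M" using DwC_bounded by blast
  have t0: "t > 0" using t by simp
  note IwD = Iw_facts[OF _ DwC_cont M]
  have inner: "J x t - (\<phi> x + Iw DwC x t) = 0" if x: "x \<in> {0<..<pi}" for x
  proof -
    have x': "x \<in> {0..pi}" using x by auto
    \<comment> \<open>The difference of the two functions does not depend on e, so its value at t is
      the limit as e tends to 0.\<close>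
    have inc: "J x e - Iw DwC x e = J x t - Iw DwC x t" if e: "0 < e" "e \<le> t" for e
    proof -
      have p: "continuous_on S (\<lambda>s. DwC x s)" for S
      proof -
        have "continuous_on S (\<lambda>s. (x, s))" by (intro continuous_intros)
        from continuous_on_compose2[OF DwC_cont this] show ?thesis by simp
      qed
      have c: "continuous_on {e..t} (\<lambda>s. of_real (s powr (\<rho> - 1)) * DwC x s)"
        using e by (auto intro!: continuous_intros p)
      have "J x t - J x e = integral {e..t} (\<lambda>s. RL_deriv T \<rho> (u x) s)"
        by (rule J_increment[OF x e, symmetric]) (use t in auto)
      also have "\<dots> = integral {e..t} (\<lambda>s. of_real (s powr (\<rho> - 1)) * DwC x s)"
      proof (rule integral_cong)
        fix s assume "s \<in> {e..t}"
        then have s: "s \<in> {0<..T}" "s \<in> {0..T}" using e t by auto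
        show "RL_deriv T \<rho> (u x) s = of_real (s powr (\<rho> - 1)) * DwC x s"
          unfolding RL_deriv_u[OF x s(1)] DwC_eq[OF x' s(2)] ..
      qed
      also have "\<dots> = Iw DwC x t - Iw DwC x e"
        unfolding Iw_def by (rule integral_eq_set_integral_diff[OF e IwD(4)[OF t0] c])
      finally show ?thesis by (simp add: algebra_simps)
    qed
    have "((\<lambda>e. M * (Beta \<rho> 1 * e powr \<rho>)) \<longlongrightarrow> M * (Beta \<rho> 1 * 0)) (at_right 0)"
      using rho by (intro tendsto_intros) real_asymp
    then have bound0: "((\<lambda>e. M * (Beta \<rho> 1 * e powr \<rho>)) \<longlongrightarrow> 0) (at_right 0)" by simp
    have I0: "((\<lambda>e. Iw DwC x e) \<longlongrightarrow> 0) (at_right 0)"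
      by (rule Lim_null_comparison[OF _ bound0])
        (use IwD(2) in \<open>auto simp: eventually_at_right_less intro!: eventually_mono[OF eventually_at_right_less[of 0]]\<close>)
    have ev: "\<forall>\<^sub>F e in at_right 0. 0 < e \<and> e < t"
      using eventually_at_right_less[of 0] eventually_at_right[of 0 t] t0 by (auto simp: eventually_at_filter)
    have "((\<lambda>e. J x e) \<longlongrightarrow> \<phi> x) (at_right 0)"
      by (rule Lim_transform_eventually[OF ic[OF x'] eventually_mono[OF ev]]) (use RL_J_eq_J[OF x'] t in auto)
    then have "((\<lambda>e. J x e - Iw DwC x e) \<longlongrightarrow> \<phi> x - 0) (at_right 0)" by (intro tendsto_diff I0)
    moreover have "\<forall>\<^sub>F e in at_right 0. J x e - Iw DwC x e = J x t - Iw DwC x t"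
      by (rule eventually_mono[OF ev], rule inc) auto
    ultimately have "((\<lambda>e. J x t - Iw DwC x t) \<longlongrightarrow> \<phi> x - 0) (at_right (0::real))"
      by (rule Lim_transform_eventually)
    then have "J x t - Iw DwC x t = \<phi> x - 0" by (rule tendsto_const_iff[THEN iffD1, rotated]) simp
    then show ?thesis by (simp add: algebra_simps)
  qed
  have cl: "closure {0<..<pi} = {0..pi}" by simp
  have "J x t - (\<phi> x + Iw DwC x t) = 0"
  proof (rule continuous_constant_on_closure[of "{0<..<pi}" "\<lambda>x. J x t - (\<phi> x + Iw DwC x t)"])
    show "continuous_on (closure {0<..<pi}) (\<lambda>x. J x t - (\<phi> x + Iw DwC x t))"
      unfolding cl by (intro continuous_intros phi_continuous continuous_on_subset[OF J_facts(1)[OF t0]] continuous_on_subset[OF IwD(1)[OF t0]]) auto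
    show "x \<in> closure {0<..<pi}" unfolding cl by (rule x)
  qed (rule inner)
  then show ?thesis by simp
qed

text \<open>The derivative in t is never moved through \<open>B\<close>. Instead \<open>B\<close> is
  exchanged with the integrals defining \<open>J\<close> and \<open>Iw\<close>, which shows that the
  fractional integral of \<psi> is a constant plus a primitive; differentiating that primitive gives
  the claim.\<close>

lemma RL_deriv_functional:
  assumes B: "bounded_functional_C B" and psi: "\<And>t. t \<in> {0<..T} \<Longrightarrow> B (\<lambda>x. u x t) = \<psi> t" and t: "t \<in> {0<..T}"
  shows "RL_deriv T \<rho> \<psi> t = of_real (t powr (\<rho> - 1)) * B (\<lambda>x. Dw x t)"
proof -
  obtain M where M: "\<And>x s. norm (DwC x s) \<le> M" using DwC_bounded by blast
  have slice: "continuous_on S (\<lambda>x. g x s)" if "continuous_on UNIV (\<lambda>(x, s). g x s)" for g :: "real \<Rightarrow> real \<Rightarrow> complex" and S s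
  proof -
    have "continuous_on S (\<lambda>x. (x, s))" by (intro continuous_intros)
    from continuous_on_compose2[OF that this] show ?thesis by simp
  qed
  define h where "h s = of_real (s powr (\<rho> - 1)) * B (\<lambda>x. DwC x s)" for s
  have psi': "\<psi> s = of_real (s powr (\<rho> - 1)) * B (\<lambda>x. uC x s)" if s: "s \<in> {0<..T}" for s
  proof -
    have "\<psi> s = B (\<lambda>x. u x s)" by (rule psi[OF s, symmetric])
    also have "\<dots> = B (\<lambda>x. of_real (s powr (\<rho> - 1)) * uC x s)"
      by (rule bounded_functional_cong[OF B, symmetric]) (use u_eq[OF _ s] in \<open>auto intro!: continuous_intros slice[OF uC(1)]\<close>)
    also have "\<dots> = of_real (s powr (\<rho> - 1)) * B (\<lambda>x. uC x s)" by (rule bounded_functional(2)[OF B slice[OF uC(1)]])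
    finally show ?thesis .
  qed
  have m: "(\<lambda>s. s powr (\<rho> - 1)) \<in> borel_measurable borel" by measurable
  have RJ: "RL_J (\<rho> - 1) \<psi> r = B \<phi> + (LINT s:{0<..<r}|lborel. h s)" if r: "r \<in> {0<..T}" for r
  proof -
    have r0: "r > 0" using r by simp
    have "RL_J (\<rho> - 1) \<psi> r = (LINT s:{0<..<r}|lborel. of_real (wJ r s) * B (\<lambda>x. uC x s))"
      unfolding RL_J_conv conv_def by (intro set_lebesgue_integral_cong) (use r in \<open>auto simp: psi' wJ_def\<close>)
    also have "\<dots> = B (\<lambda>x. J x r)"
      unfolding J_def by (rule functional_exchange(1)[OF B r0 wJ_measurable wJ_integrable(1)[OF r0] uC, symmetric])
    also have "\<dots> = B (\<lambda>x. \<phi> x + Iw DwC x r)"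
      by (rule bounded_functional_cong[OF B continuous_on_subset[OF J_facts(1)[OF r0]] J_representation[OF _ r]]) auto
    also have "\<dots> = B \<phi> + B (\<lambda>x. Iw DwC x r)"
      by (intro bounded_functional(1)[OF B] phi_continuous continuous_on_subset[OF Iw_facts(1)[OF r0 DwC_cont M]]) auto
    also have "B (\<lambda>x. Iw DwC x r) = (LINT s:{0<..<r}|lborel. h s)"
      unfolding Iw_def h_def by (rule functional_exchange(1)[OF B r0 m powr_integral(1)[OF rho(1) r0] DwC_cont M])
    finally show ?thesis .
  qed
  have Lc: "continuous_on UNIV (\<lambda>s. B (\<lambda>x. DwC x s))"
    by (rule functional_exchange(2)[OF B T m powr_integral(1)[OF rho(1) T] DwC_cont M])
  have Lm: "(\<lambda>s. B (\<lambda>x. DwC x s)) \<in> borel_measurable borel" by (rule borel_measurable_continuous_onI[OF Lc])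
  obtain K where K: "\<And>g b. continuous_on {0..pi} g \<Longrightarrow> (\<forall>x\<in>{0..pi}. norm (g x) \<le> b) \<Longrightarrow> norm (B g) \<le> K * b"
    using bounded_functional(3)[OF B] by blast
  have Lb: "norm (B (\<lambda>x. DwC x s)) \<le> K * M" for s by (intro K slice[OF DwC_cont]) (auto intro: M)
  have hi: "set_integrable lborel {0<..<T} h"
    using set_integrable_mult_bounded[OF set_integrable_of_real[OF powr_integral(1)[OF rho(1) T]] Lm Lb]
    unfolding h_def by (simp only: mult.commute)
  have hc: "continuous_on {0<..T} h"
    unfolding h_def by (intro continuous_intros continuous_on_subset[OF Lc]) auto
  have "((\<lambda>r. B \<phi> + (LINT s:{0<..<r}|lborel. h s)) has_vector_derivative 0 + h t) (at t within {0<..T})"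
    by (intro has_vector_derivative_add has_vector_derivative_const singular_FTC[OF hi hc t])
  then have "((\<lambda>r. B \<phi> + (LINT s:{0<..<r}|lborel. h s)) has_vector_derivative h t) (at t within {0<..T})" by simp
  then have d: "(RL_J (\<rho> - 1) \<psi> has_vector_derivative h t) (at t within {0<..T})"
    by (rule has_vector_derivative_transform[OF t RJ, rotated])
  then have "(RL_J (\<rho> - 1) \<psi> has_vector_derivative RL_deriv T \<rho> \<psi> t) (at t within {0<..T})"
    unfolding RL_deriv_def using vector_derivative_works differentiableI_vector by blast
  then have "RL_deriv T \<rho> \<psi> t = h t" using d t by (rule vector_derivative_unique_interval)
  also have "h t = of_real (t powr (\<rho> - 1)) * B (\<lambda>x. Dw x t)"
    unfolding h_def by (rule arg_cong2[where f = "(*)", OF refl bounded_functional_cong[OF B slice[OF DwC_cont]]]) (use t in \<open>auto simp: DwC_eq\<close>)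
  finally show ?thesis .
qed

text \<open>\<open>B\<close> applied to the weighted equation, in which \<open>Dw\<close> and
  \<open>W\<close> stand for the extensions of both derivatives to [0, pi]. Since B q is nonzero, it
  can be solved for \<open>P\<close>.\<close>

lemma functional_identity:
  assumes B: "bounded_functional_C B" and psi: "\<And>t. t \<in> {0<..T} \<Longrightarrow> B (\<lambda>x. u x t) = \<psi> t" and t: "t \<in> {0<..T}"
  shows "P t * B q = \<i> * (of_real (t powr (1 - \<rho>)) * RL_deriv T \<rho> \<psi> t) - B (\<lambda>x. W x t) - B (\<lambda>x. fC x t)"
proof -
  have t': "t \<in> {0..T}" using t by auto
  have qc: "continuous_on {0..pi} q"
    by (rule continuous_on_eq[OF green_op_continuous[OF q2(1)]]) (simp add: q)
  have fc: "continuous_on {0..pi} (\<lambda>x. fC x t)"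
    by (rule slice_cont[OF continuous_on_subset[OF fC(1)] t']) simp
  have Wc: "continuous_on {0..pi} (\<lambda>x. W x t)" by (rule slice_cont[OF W_cont t'])
  have Dc: "continuous_on {0..pi} (\<lambda>x. Dw x t)" by (rule slice_cont[OF Dw_cont t'])
  have "RL_deriv T \<rho> \<psi> t = of_real (t powr (\<rho> - 1)) * B (\<lambda>x. Dw x t)" by (rule RL_deriv_functional[OF B psi t])
  then have "of_real (t powr (1 - \<rho>)) * RL_deriv T \<rho> \<psi> t = of_real (t powr (1 - \<rho>) * t powr (\<rho> - 1)) * B (\<lambda>x. Dw x t)"
    by (simp only: of_real_mult mult.assoc)
  also have "t powr (1 - \<rho>) * t powr (\<rho> - 1) = 1" using t by (simp add: powr_add[symmetric])
  finally have "\<i> * (of_real (t powr (1 - \<rho>)) * RL_deriv T \<rho> \<psi> t) = B (\<lambda>x. \<i> * Dw x t)"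
    using bounded_functional(2)[OF B Dc] by simp
  also have "\<dots> = B (\<lambda>x. W x t + (P t * q x + fC x t))"
    by (rule bounded_functional_cong[OF B continuous_on_mult_left[OF Dc]]) (simp add: Dw_def FC_split algebra_simps)
  also have "\<dots> = B (\<lambda>x. W x t) + (P t * B q + B (\<lambda>x. fC x t))"
    by (subst bounded_functional(1)[OF B], (intro continuous_intros Wc qc fc)+,
        subst bounded_functional(1)[OF B], (intro continuous_intros qc fc)+, simp only: bounded_functional(2)[OF B qc])
  finally show ?thesis by simp
qed

end

context fractional_order
begin

text \<open>The first 8 is 2 from \<open>A0_bound\<close> times 4 from \<open>holder_sup\<close>;
  the second is 4 from \<open>Wb_facts\<close> times 2 from \<open>holder_half\<close>.\<close>

definition cW :: "real \<Rightarrow> real" where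
  "cW T = 8 * n0norm + 8 * n2norm * T powr (\<rho> / 4) * Beta \<rho> (\<rho> / 4)"

lemma Beta_nonneg: "0 < a \<Longrightarrow> 0 < b \<Longrightarrow> 0 \<le> Beta a (b::real)"
  using Gamma_real_pos[of a] Gamma_real_pos[of b] Gamma_real_pos[of "a + b"] by (simp add: Beta_def)

lemma cW_nonneg: "0 \<le> cW T"
  using n0norm_nonneg n2norm_nonneg rho Beta_nonneg[of \<rho> "\<rho> / 4"] by (simp add: cW_def)

end

lemma (in inverse_data) W_bound:
  assumes S: "\<And>x. x \<in> {0..pi} \<Longrightarrow> norm (\<phi>2 x) \<le> 4 * S" "H \<le> 2 * S" and M: "\<And>x. x \<in> {0..pi} \<Longrightarrow> norm (q2 x) \<le> M"
    and t: "t \<in> {0..T}"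
  shows "norm (W x t) \<le> cW T * S +
    2 * M * n0norm * (t powr \<rho> * (LINT \<sigma>:{0<..<1}|lborel. \<sigma> powr (\<rho> - 1) * (1 - \<sigma>) powr (\<rho> - 1) * norm (P (t * \<sigma>))))" (is "_ \<le> _ + ?R")
proof -
  have a: "norm (Wa \<phi>2 x t) \<le> 2 * (4 * S) * n0norm" by (rule Wa_facts(2)[OF phi2 S(1)])
  have "norm (Wb fC x t) \<le> 4 * H * n2norm * T powr (\<rho> / 4) * Beta \<rho> (\<rho> / 4)" by (rule Wb_facts(2)[OF T fC' fC0 fH H t])
  also have "\<dots> \<le> 4 * (2 * S) * n2norm * T powr (\<rho> / 4) * Beta \<rho> (\<rho> / 4)"
    using S(2) n2norm_nonneg rho Beta_nonneg[of \<rho> "\<rho> / 4"] by (intro mult_right_mono mult_left_mono) auto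
  finally have b: "norm (Wb fC x t) \<le> 4 * (2 * S) * n2norm * T powr (\<rho> / 4) * Beta \<rho> (\<rho> / 4)" .
  have c: "norm (Wc q2 P x t) \<le> ?R" by (rule Wc_facts(2)[OF T q2 P(1) M P(2)])
  have "norm (W x t) \<le> norm (Wa \<phi>2 x t) + (norm (Wb fC x t) + norm (Wc q2 P x t))"
    unfolding W_def using norm_triangle_ineq[of "Wa \<phi>2 x t" "- \<i> * (Wb fC x t + Wc q2 P x t)"] norm_triangle_ineq[of "Wb fC x t" "Wc q2 P x t"]
    by (simp add: norm_mult)
  also have "\<dots> \<le> 2 * (4 * S) * n0norm + (4 * (2 * S) * n2norm * T powr (\<rho> / 4) * Beta \<rho> (\<rho> / 4) + ?R)"
    by (intro add_mono a b c)
  finally show ?thesis by (simp add: cW_def algebra_simps)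
qed

text \<open>The bound for \<open>W\<close> contains a weakly singular integral of |P|, while
  \<open>functional_identity\<close> bounds |P| by that of \<open>W\<close>. Gronwall closes this
  loop for \<open>P\<close> with factor \<open>a\<close>; feeding the result back bounds
  \<open>W\<close>, and the equation then bounds \<open>Dw\<close>.\<close>

lemma (in inverse_data) estimates:
  assumes B: "bounded_functional_C B" and psi: "\<And>t. t \<in> {0<..T} \<Longrightarrow> B (\<lambda>x. u x t) = \<psi> t" and Bq: "B q \<noteq> 0"
    and K: "K \<ge> 0" "\<And>g b. continuous_on {0..pi} g \<Longrightarrow> (\<forall>x\<in>{0..pi}. norm (g x) \<le> b) \<Longrightarrow> norm (B g) \<le> K * b"
    and S: "\<And>x. x \<in> {0..pi} \<Longrightarrow> norm (\<phi>2 x) \<le> 4 * S" "H \<le> 2 * S" "\<And>x s. x \<in> {0..pi} \<Longrightarrow> norm (fC x s) \<le> 4 * S"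
      "\<And>t. t \<in> {0<..T} \<Longrightarrow> norm (of_real (t powr (1 - \<rho>)) * RL_deriv T \<rho> \<psi> t) \<le> S"
    and M: "\<And>x. x \<in> {0..pi} \<Longrightarrow> norm (q2 x) \<le> M" and N: "\<And>x. x \<in> {0..pi} \<Longrightarrow> norm (q x) \<le> N"
    and G: "G \<ge> 0" "\<And>v A. continuous_on {0..T} v \<Longrightarrow> v \<in> borel_measurable borel \<Longrightarrow> (\<forall>s. 0 \<le> v s) \<Longrightarrow> A \<ge> 0 \<Longrightarrow>
      (\<forall>t\<in>{0<..T}. v t \<le> A + K * (2 * M * n0norm) / norm (B q) * (t powr \<rho> * (LINT \<sigma>:{0<..<1}|lborel. \<sigma> powr (\<rho> - 1) * (1 - \<sigma>) powr (\<rho> - 1) * v (t * \<sigma>)))) \<Longrightarrow>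
      (\<forall>t\<in>{0<..T}. v t \<le> G * A)"
    and a: "a = G * ((1 + K * (cW T + 4)) / norm (B q))"
    and b: "b = cW T + 2 * M * n0norm * (T powr \<rho> * Beta \<rho> \<rho> * a)"
    and t: "t \<in> {0..T}" and x: "x \<in> {0..pi}"
  shows "norm (P t) \<le> a * S" "norm (W x t) \<le> b * S" "norm (Dw x t) \<le> (b + a * N + 4) * S"
proof -
  have "norm (\<phi>2 0) \<le> 4 * S" by (rule S(1)) simp
  then have S0: "S \<ge> 0" using norm_ge_zero[of "\<phi>2 0"] by linarith
  have M0: "M \<ge> 0" using order_trans[OF norm_ge_zero M[of 0]] by simp
  have nb: "norm (B q) > 0" using Bq by simp
  let ?I = "\<lambda>t. t powr \<rho> * (LINT \<sigma>:{0<..<1}|lborel. \<sigma> powr (\<rho> - 1) * (1 - \<sigma>) powr (\<rho> - 1) * norm (P (t * \<sigma>)))"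
  have ineq: "norm (P t) \<le> (1 + K * (cW T + 4)) / norm (B q) * S + K * (2 * M * n0norm) / norm (B q) * ?I t" if t: "t \<in> {0<..T}" for t
  proof -
    have t': "t \<in> {0..T}" using t by auto
    have Wn: "norm (B (\<lambda>x. W x t)) \<le> K * (cW T * S + 2 * M * n0norm * ?I t)"
      by (intro K slice_cont[OF W_cont t'] ballI W_bound[OF S(1,2) M t'])
    have fn: "norm (B (\<lambda>x. fC x t)) \<le> K * (4 * S)"
    proof (intro K ballI S(3))
      show "continuous_on {0..pi} (\<lambda>x. fC x t)" by (rule slice_cont[OF continuous_on_subset[OF fC(1)] t']) simp
    qed
    have Pq: "P t * B q = \<i> * (of_real (t powr (1 - \<rho>)) * RL_deriv T \<rho> \<psi> t) - B (\<lambda>x. W x t) - B (\<lambda>x. fC x t)"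
      by (rule functional_identity[OF B psi t])
    have "norm (P t) * norm (B q) = norm (P t * B q)" by (simp add: norm_mult)
    also have "\<dots> \<le> norm (\<i> * (of_real (t powr (1 - \<rho>)) * RL_deriv T \<rho> \<psi> t)) + norm (B (\<lambda>x. W x t)) + norm (B (\<lambda>x. fC x t))"
      unfolding Pq
      using norm_triangle_ineq4[of "\<i> * (of_real (t powr (1 - \<rho>)) * RL_deriv T \<rho> \<psi> t) - B (\<lambda>x. W x t)" "B (\<lambda>x. fC x t)"]
        norm_triangle_ineq4[of "\<i> * (of_real (t powr (1 - \<rho>)) * RL_deriv T \<rho> \<psi> t)" "B (\<lambda>x. W x t)"]
      by linarith
    also have "norm (\<i> * (of_real (t powr (1 - \<rho>)) * RL_deriv T \<rho> \<psi> t)) = norm (of_real (t powr (1 - \<rho>)) * RL_deriv T \<rho> \<psi> t)"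
      by (simp only: norm_mult norm_ii mult_1)
    also have "norm (of_real (t powr (1 - \<rho>)) * RL_deriv T \<rho> \<psi> t) + norm (B (\<lambda>x. W x t)) + norm (B (\<lambda>x. fC x t)) \<le> S + K * (cW T * S + 2 * M * n0norm * ?I t) + K * (4 * S)" by (intro add_mono S(4) t Wn fn)
    also have "\<dots> = (1 + K * (cW T + 4)) * S + K * (2 * M * n0norm) * ?I t" by (simp add: algebra_simps)
    finally have "norm (P t) \<le> ((1 + K * (cW T + 4)) * S + K * (2 * M * n0norm) * ?I t) / norm (B q)"
      unfolding pos_le_divide_eq[OF nb] .
    then show ?thesis by (simp only: add_divide_distrib[of "(1 + K * (cW T + 4)) * S"] times_divide_eq_left)
  qed
  have "\<forall>t\<in>{0<..T}. norm (P t) \<le> G * ((1 + K * (cW T + 4)) / norm (B q) * S)"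
  proof (rule G(2))
    show "continuous_on {0..T} (\<lambda>t. norm (P t))" by (intro continuous_intros continuous_on_subset[OF P(1)]) simp
    show "(\<lambda>t. norm (P t)) \<in> borel_measurable borel"
      by (intro borel_measurable_continuous_onI continuous_intros P(1))
    show "0 \<le> (1 + K * (cW T + 4)) / norm (B q) * S" using K(1) cW_nonneg[of T] S0 by simp
    show "\<forall>t\<in>{0<..T}. norm (P t) \<le> (1 + K * (cW T + 4)) / norm (B q) * S + K * (2 * M * n0norm) / norm (B q) * ?I t"
      using ineq by blast
  qed simp
  then have Pb: "norm (P t) \<le> a * S" if "t \<in> {0<..T}" for t using that unfolding a by (simp only: mult.assoc)
  have cl: "closure {0<..T} = {0..T}" using T by simp
  \<comment> \<open>Gronwall covers positive times only; continuity of \<open>P\<close> adds t = 0,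
    where the weighted function is an extension.\<close>
  have Pb': "norm (P t) \<le> a * S" if t: "t \<in> {0..T}" for t
  proof (rule continuous_le_on_closure[of "{0<..T}" "\<lambda>t. norm (P t)"])
    show "continuous_on (closure {0<..T}) (\<lambda>t. norm (P t))" by (intro continuous_intros continuous_on_subset[OF P(1)]) simp
    show "t \<in> closure {0<..T}" using t cl by simp
  qed (use Pb in auto)
  then show "norm (P t) \<le> a * S" using t by blast
  have a0: "a \<ge> 0" unfolding a using G(1) K(1) cW_nonneg[of T] by simp
  have I: "?I t \<le> T powr \<rho> * (Beta \<rho> \<rho> * (a * S))"
  proof (rule mult_mono)
    show "t powr \<rho> \<le> T powr \<rho>" using t rho by (intro powr_mono2) auto
    have "norm (LINT \<sigma>:{0<..<1}|lborel. \<sigma> powr (\<rho> - 1) * (1 - \<sigma>) powr (\<rho> - 1) * norm (P (t * \<sigma>))) \<le>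
      (LINT \<sigma>:{0<..<1}|lborel. \<sigma> powr (\<rho> - 1) * (1 - \<sigma>) powr (\<rho> - 1) * (a * S))"
    proof (rule set_integral_norm_le)
      show "set_integrable lborel {0<..<1} (\<lambda>\<sigma>. \<sigma> powr (\<rho> - 1) * (1 - \<sigma>) powr (\<rho> - 1) * (a * S))"
        using rho by (intro set_integrable_mult_left beta_integral) auto
      fix \<sigma> :: real assume s: "\<sigma> \<in> {0<..<1}"
      have "t * \<sigma> \<le> T * 1" using s t by (intro mult_mono) auto
      then have "t * \<sigma> \<in> {0..T}" using s t by auto
      from Pb'[OF this] show "norm (\<sigma> powr (\<rho> - 1) * (1 - \<sigma>) powr (\<rho> - 1) * norm (P (t * \<sigma>))) \<le> \<sigma> powr (\<rho> - 1) * (1 - \<sigma>) powr (\<rho> - 1) * (a * S)"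
        by (simp add: abs_mult mult_left_mono)
    qed
    also have "\<dots> = Beta \<rho> \<rho> * (a * S)" using beta_integral(2)[of \<rho> \<rho>] rho by simp
    finally show "(LINT \<sigma>:{0<..<1}|lborel. \<sigma> powr (\<rho> - 1) * (1 - \<sigma>) powr (\<rho> - 1) * norm (P (t * \<sigma>))) \<le> Beta \<rho> \<rho> * (a * S)" by simp
  qed (auto intro!: set_integral_nonneg)
  have "norm (W x t) \<le> cW T * S + 2 * M * n0norm * ?I t" by (rule W_bound[OF S(1,2) M t])
  also have "\<dots> \<le> cW T * S + 2 * M * n0norm * (T powr \<rho> * (Beta \<rho> \<rho> * (a * S)))"
    using I M0 n0norm_nonneg by (intro add_left_mono mult_left_mono) auto
  also have "\<dots> = b * S" by (simp add: b algebra_simps)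
  finally show Wb: "norm (W x t) \<le> b * S" .
  have "norm (Dw x t) \<le> norm (W x t) + (norm (P t) * norm (q x) + norm (fC x t))"
    unfolding Dw_def FC_split[OF x]
    using norm_triangle_ineq[of "W x t" "P t * q x + fC x t"] norm_triangle_ineq[of "P t * q x" "fC x t"]
    by (simp add: norm_mult)
  also have "\<dots> \<le> b * S + (a * S * N + 4 * S)"
    by (intro add_mono mult_mono Wb Pb' t N x S(3)) (use a0 S0 in auto)
  finally show "norm (Dw x t) \<le> (b + a * N + 4) * S" by (simp add: algebra_simps)
qed

lemma C2a_green_op:
  assumes g: "g \<in> C2a a"
  shows "continuous_on {0..pi} (deriv2 {0..pi} g)" "deriv2 {0..pi} g 0 = 0" "deriv2 {0..pi} g pi = 0"
    and "x \<in> {0..pi} \<Longrightarrow> g x = green_op (deriv2 {0..pi} g) x"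
proof -
  have tw: "twice_differentiable_on g {0..pi}" and e: "g 0 = 0" "g pi = 0" and d: "deriv2 {0..pi} g \<in> Ca a"
    using g by (auto simp: C2a_def)
  then show c: "continuous_on {0..pi} (deriv2 {0..pi} g)" "deriv2 {0..pi} g 0 = 0" "deriv2 {0..pi} g pi = 0"
    by (auto simp: Ca_def)
  show "x \<in> {0..pi} \<Longrightarrow> g x = green_op (deriv2 {0..pi} g) x"
    by (rule green_op_of_deriv2[OF twice_differentiable_onD[OF tw] c(1) e])
qed

theorem theorem1p3:
  fixes \<rho> T :: real
    and q :: "real \<Rightarrow> complex"
    and B :: "(real \<Rightarrow> complex) \<Rightarrow> complex"
  assumes "0 < \<rho>" and "\<rho> < 1" and "0 < T"
    and "bounded_functional_C B"
    and "B q \<noteq> 0"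
  shows "\<exists>C::real. \<forall>(a::real) (f :: real \<Rightarrow> real \<Rightarrow> complex) (\<phi> :: real \<Rightarrow> complex)
           (\<psi> :: real \<Rightarrow> complex) (u :: real \<Rightarrow> real \<Rightarrow> complex) (p :: real \<Rightarrow> complex).
      a > 1 / 2 \<longrightarrow>
      wext2 \<rho> T {0..pi} f \<in> Cxa a T \<longrightarrow>
      \<phi> \<in> C2a a \<longrightarrow> \<phi> \<in> Ca a \<longrightarrow>
      continuous_on {0..T} (wext \<rho> T \<psi>) \<longrightarrow>
      (\<forall>t\<in>{0<..T}. RL_differentiable T \<rho> \<psi> t) \<longrightarrow>
      continuous_on {0..T} (wext \<rho> T (RL_deriv T \<rho> \<psi>)) \<longrightarrow>
      q \<in> C2a a \<longrightarrow>
      inverse_solution \<rho> T B q f \<phi> \<psi> u p \<longrightarrow>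
        (let Du = wext2 \<rho> T {0<..<pi} (\<lambda>x t. RL_deriv T \<rho> (u x) t);
             uxx = wext2 \<rho> T {0<..<pi} (\<lambda>x t. deriv2 {0<..<pi} (\<lambda>y. u y t) x)
         in continuous_on ({0..pi} \<times> {0..T}) Du \<and>
            continuous_on ({0..pi} \<times> {0..T}) uxx \<and>
            max_norm ({0..pi} \<times> {0..T}) Du + max_norm ({0..pi} \<times> {0..T}) uxx
              + max_norm {0..T} (wext \<rho> T p)
            \<le> C * (Ca_norm a (deriv2 {0..pi} \<phi>) + max_norm {0..T} (wext \<rho> T \<psi>)
                   + max_norm {0..T} (wext \<rho> T (RL_deriv T \<rho> \<psi>))
                   + Cxa_norm a T (wext2 \<rho> T {0..pi} f)))"
proof -
  interpret fractional_order \<rho> by unfold_locales (use assms in auto)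
  note T = \<open>0 < T\<close> and B = \<open>bounded_functional_C B\<close> and Bq = \<open>B q \<noteq> 0\<close>
  obtain K where K: "K \<ge> 0" "\<And>g b. continuous_on {0..pi} g \<Longrightarrow> (\<forall>x\<in>{0..pi}. norm (g x) \<le> b) \<Longrightarrow> norm (B g) \<le> K * b"
    using bounded_functional(3)[OF B] by blast
  \<comment> \<open>The constants must be fixed before the regularity of q is available, since that
    hypothesis stands inside the quantifiers; the absolute values secure nonnegativity in the
    meantime.\<close>
  define M where "M = \<bar>max_norm {0..pi} (deriv2 {0..pi} q)\<bar>"
  define N where "N = \<bar>max_norm {0..pi} q\<bar>"
  have "0 \<le> K * (2 * M * n0norm) / norm (B q)" using K(1) n0norm_nonneg by (simp add: M_def)
  from singular_gronwall[OF rho T this] obtain G where G: "G \<ge> 0"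
    "\<And>v A. continuous_on {0..T} v \<Longrightarrow> v \<in> borel_measurable borel \<Longrightarrow> (\<forall>s. 0 \<le> v s) \<Longrightarrow> A \<ge> 0 \<Longrightarrow>
      (\<forall>t\<in>{0<..T}. v t \<le> A + K * (2 * M * n0norm) / norm (B q) * (t powr \<rho> * (LINT \<sigma>:{0<..<1}|lborel. \<sigma> powr (\<rho> - 1) * (1 - \<sigma>) powr (\<rho> - 1) * v (t * \<sigma>)))) \<Longrightarrow>
      (\<forall>t\<in>{0<..T}. v t \<le> G * A)" by blast
  define \<alpha> where "\<alpha> = G * ((1 + K * (cW T + 4)) / norm (B q))"
  define \<beta> where "\<beta> = cW T + 2 * M * n0norm * (T powr \<rho> * Beta \<rho> \<rho> * \<alpha>)"
  \<comment> \<open>The three bounds of \<open>estimates\<close>, for \<open>Dw\<close>,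
    \<open>W\<close> and \<open>P\<close>, added up. The exponent a does not occur, while T does,
    through \<open>cW\<close> and the Gronwall constant.\<close>
  define C where "C = (\<beta> + \<alpha> * N + 4) + \<beta> + \<alpha>"
  show ?thesis
  proof (intro exI[of _ C] allI impI)
    fix a :: real and f u :: "real \<Rightarrow> real \<Rightarrow> complex" and \<phi> \<psi> p :: "real \<Rightarrow> complex"
    assume a: "a > 1 / 2" and f: "wext2 \<rho> T {0..pi} f \<in> Cxa a T" and phi: "\<phi> \<in> C2a a"
      and psi: "continuous_on {0..T} (wext \<rho> T \<psi>)" "continuous_on {0..T} (wext \<rho> T (RL_deriv T \<rho> \<psi>))"
      and q: "q \<in> C2a a" and sol: "inverse_solution \<rho> T B q f \<phi> \<psi> u p"
    define A where "A = Ca_norm a (deriv2 {0..pi} \<phi>)"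
    define E where "E = Cxa_norm a T (wext2 \<rho> T {0..pi} f)"
    define S where "S = A + max_norm {0..T} (wext \<rho> T \<psi>) + max_norm {0..T} (wext \<rho> T (RL_deriv T \<rho> \<psi>)) + E"
    have hA: "holder_bound a (deriv2 {0..pi} \<phi>) A" unfolding A_def using phi by (intro Ca_norm_bound) (simp add: C2a_def)
    have hE: "holder_bound a (\<lambda>x. wext2 \<rho> T {0..pi} f (x, s)) E" if "s \<in> {0..T}" for s
      unfolding E_def by (rule Cxa_norm_bound[OF f that])
    have A0: "A \<ge> 0" by (rule holder_bound_nonneg[OF hA])
    have E0: "E \<ge> 0" by (rule holder_bound_nonneg[OF hE[of 0]]) (use T in simp)
    have nonneg: "0 \<le> max_norm {0..T} g" if "continuous_on {0..T} g" for g
      using max_norm_upper[OF compact_Icc that, of 0] T order_trans[OF norm_ge_zero] by simp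
    have S: "A \<le> S" "E \<le> S" "max_norm {0..T} (wext \<rho> T (RL_deriv T \<rho> \<psi>)) \<le> S"
      using A0 E0 nonneg[OF psi(1)] nonneg[OF psi(2)] by (auto simp: S_def)

    \<comment> \<open>Clamped coordinates, giving the weighted data values on the whole
      plane.\<close>
    define xc :: "real \<Rightarrow> real" where "xc x = max 0 (min pi x)" for x
    define tc where "tc s = max 0 (min T s)" for s
    have xc: "xc x \<in> {0..pi}" "x \<in> {0..pi} \<Longrightarrow> xc x = x" for x by (auto simp: xc_def)
    have tc: "tc s \<in> {0..T}" "s \<in> {0..T} \<Longrightarrow> tc s = s" for s using T by (auto simp: tc_def)
    define uC where "uC x s = wext2 \<rho> T {0..pi} u (xc x, tc s)" for x s
    define fC where "fC x s = wext2 \<rho> T {0..pi} f (xc x, tc s)" for x s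
    define P where "P s = wext \<rho> T p (tc s)" for s
    define F where "F x s = p s * q x + f x s" for x s
    define FC where "FC x s = P s * q (xc x) + fC x s" for x s

    have cu: "continuous_on ({0..pi} \<times> {0..T}) (wext2 \<rho> T {0..pi} u)" and cp: "continuous_on {0..T} (wext \<rho> T p)"
      using sol by (auto simp: inverse_solution_def)
    have cf: "continuous_on ({0..pi} \<times> {0..T}) (wext2 \<rho> T {0..pi} f)"
      and zf: "\<And>s. s \<in> {0..T} \<Longrightarrow> wext2 \<rho> T {0..pi} f (0, s) = 0" "\<And>s. s \<in> {0..T} \<Longrightarrow> wext2 \<rho> T {0..pi} f (pi, s) = 0"
      using f by (auto simp: Cxa_def)
    note q2 = C2a_green_op[OF q] and phi2 = C2a_green_op[OF phi]
    have qc: "continuous_on {0..pi} q" by (rule continuous_on_eq[OF green_op_continuous[OF q2(1)]]) (simp add: q2(4))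
    obtain uM where uM: "continuous_on UNIV (\<lambda>(x, s). uC x s)" "\<And>x s. norm (uC x s) \<le> uM"
      using clamped_extension[OF T cu] unfolding uC_def xc_def tc_def by blast
    obtain fM where fM: "continuous_on UNIV (\<lambda>(x, s). fC x s)" "\<And>x s. norm (fC x s) \<le> fM"
      using clamped_extension[OF T cf] unfolding fC_def xc_def tc_def by blast
    have Pc: "continuous_on UNIV P"
      unfolding P_def by (rule continuous_on_compose2[OF cp]) (use tc in \<open>auto simp: tc_def intro!: continuous_intros\<close>)
    \<comment> \<open>This bound involves the unknown p itself; it only licenses the qualitative
      arguments and does not enter C.\<close>
    have Pb: "norm (P s) \<le> max_norm {0..T} (wext \<rho> T p)" for s
      unfolding P_def by (rule max_norm_upper[OF compact_Icc cp tc(1)])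
    have qb: "norm (q x) \<le> N" if "x \<in> {0..pi}" for x
      using max_norm_upper[OF compact_Icc qc that] by (simp add: N_def)
    have q2b: "norm (deriv2 {0..pi} q x) \<le> M" if "x \<in> {0..pi}" for x
      using max_norm_upper[OF compact_Icc q2(1) that] by (simp add: M_def)
    have FCc: "continuous_on UNIV (\<lambda>(x, s). FC x s)"
    proof -
      have "continuous_on UNIV (\<lambda>z::real \<times> real. P (snd z))" by (rule continuous_on_compose2[OF Pc]) (auto intro!: continuous_intros)
      moreover have "continuous_on UNIV (\<lambda>z::real \<times> real. q (xc (fst z)))"
        by (rule continuous_on_compose2[OF qc]) (use xc in \<open>auto simp: xc_def intro!: continuous_intros\<close>)
      ultimately show ?thesis using fM(1) unfolding FC_def case_prod_beta by (intro continuous_intros)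
    qed
    have FCb: "norm (FC x s) \<le> max_norm {0..T} (wext \<rho> T p) * N + fM" for x s
    proof -
      have "norm (FC x s) \<le> norm (P s) * norm (q (xc x)) + norm (fC x s)"
        unfolding FC_def by (rule order_trans[OF norm_triangle_ineq]) (simp add: norm_mult)
      also have "\<dots> \<le> max_norm {0..T} (wext \<rho> T p) * N + fM"
        by (intro add_mono mult_mono Pb qb[OF xc(1)] fM(2) nonneg[OF cp]) auto
      finally show ?thesis .
    qed
    have cancel: "complex_of_real (t powr (\<rho> - 1)) * ((t powr (1 - \<rho>)) *\<^sub>R z) = z"
      "(t powr (1 - \<rho>)) *\<^sub>R (complex_of_real (t powr (\<rho> - 1)) * z) = z" if "t \<in> {0<..T}" for t z
    proof -
      have e: "t powr (\<rho> - 1) * t powr (1 - \<rho>) = 1" using that by (simp add: powr_add[symmetric])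
      have "complex_of_real (t powr (\<rho> - 1)) * ((t powr (1 - \<rho>)) *\<^sub>R z) = complex_of_real (t powr (\<rho> - 1) * t powr (1 - \<rho>)) * z"
        by (simp only: scaleR_conv_of_real of_real_mult mult.assoc)
      then show "complex_of_real (t powr (\<rho> - 1)) * ((t powr (1 - \<rho>)) *\<^sub>R z) = z" unfolding e by simp
      then show "(t powr (1 - \<rho>)) *\<^sub>R (complex_of_real (t powr (\<rho> - 1)) * z) = z" by (simp add: scaleR_conv_of_real mult.left_commute)
    qed
    have wext2_eq: "wext2 \<rho> T {0..pi} h (xc x, tc s) = (s powr (1 - \<rho>)) *\<^sub>R h x s" if "x \<in> {0..pi}" "s \<in> {0<..T}" for h x s
      using that xc(2)[of x] tc(2)[of s] by (simp add: wext2_def cont_ext_def)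
    have wext_eq: "wext \<rho> T h (tc s) = (s powr (1 - \<rho>)) *\<^sub>R h s" if "s \<in> {0<..T}" for h s
      using that tc(2)[of s] by (simp add: wext_def cont_ext_def)
    have u_eq: "u x s = of_real (s powr (\<rho> - 1)) * uC x s" if "x \<in> {0..pi}" "s \<in> {0<..T}" for x s
      unfolding uC_def wext2_eq[OF that] cancel(1)[OF that(2)] ..
    have F_eq: "F x s = of_real (s powr (\<rho> - 1)) * FC x s" if "x \<in> {0..pi}" "s \<in> {0<..T}" for x s
    proof -
      have "of_real (s powr (\<rho> - 1)) * FC x s = (of_real (s powr (\<rho> - 1)) * ((s powr (1 - \<rho>)) *\<^sub>R p s)) * q x + of_real (s powr (\<rho> - 1)) * ((s powr (1 - \<rho>)) *\<^sub>R f x s)"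
        using wext2_eq[OF that, of f] wext_eq[OF that(2), of p] xc(2)[OF that(1)]
        by (simp only: FC_def P_def fC_def distrib_left mult.assoc)
      then show ?thesis unfolding cancel(1)[OF that(2)] F_def by simp
    qed
    have fC0: "fC 0 s = 0" "fC pi s = 0" for s
      using zf[OF tc(1)] xc(2)[of 0] xc(2)[of pi] by (simp_all add: fC_def)
    have fH: "norm (fC x s - fC y s) \<le> 2 * E * sqrt \<bar>x - y\<bar>" if "x \<in> {0..pi}" "y \<in> {0..pi}" for x y s
      using holder_half[OF hE[OF tc(1)] a that] xc(2)[OF that(1)] xc(2)[OF that(2)] by (simp add: fC_def)
    \<comment> \<open>The Hoelder constant \<open>2 * E\<close> of exponent 1/2 comes from
      \<open>holder_half\<close>.\<close>
    interpret inverse_data \<rho> T uM "max_norm {0..T} (wext \<rho> T p) * N + fM" u F uC FC \<phi> "deriv2 {0..pi} \<phi>" q "deriv2 {0..pi} q" P fC "2 * E" "max_norm {0..T} (wext \<rho> T p)" fM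
    proof unfold_locales
      show "\<i> * RL_deriv T \<rho> (u x) t - deriv2 {0<..<pi} (\<lambda>y. u y t) x = F x t" if "x \<in> {0<..<pi}" "t \<in> {0<..T}" for x t
        using sol that by (simp add: inverse_solution_def F_def)
      show "FC x s = P s * q x + fC x s" if "x \<in> {0..pi}" for x s
        by (simp add: FC_def xc(2)[OF that])
    qed (use sol T uM FCc FCb u_eq F_eq phi2 q2 Pc Pb fM fC0 fH E0 in \<open>auto simp: inverse_solution_def\<close>)

    have sp: "\<And>t. t \<in> {0<..T} \<Longrightarrow> B (\<lambda>x. u x t) = \<psi> t" using sol by (simp add: inverse_solution_def)
    have S1: "norm (deriv2 {0..pi} \<phi> x) \<le> 4 * S" if "x \<in> {0..pi}" for x
      using holder_sup[OF hA a phi2(2) that] S(1) by linarith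
    have S3: "norm (fC x s) \<le> 4 * S" if "x \<in> {0..pi}" for x s
      using holder_sup[OF hE[OF tc(1)] a zf(1)[OF tc(1)] xc(1), of x s] S(2) unfolding fC_def by linarith
    have S4: "norm (of_real (t powr (1 - \<rho>)) * RL_deriv T \<rho> \<psi> t) \<le> S" if t: "t \<in> {0<..T}" for t
    proof -
      have "norm (wext \<rho> T (RL_deriv T \<rho> \<psi>) (tc t)) \<le> max_norm {0..T} (wext \<rho> T (RL_deriv T \<rho> \<psi>))"
        by (rule max_norm_upper[OF compact_Icc psi(2) tc(1)])
      then show ?thesis using S(3) unfolding wext_eq[OF t] scaleR_conv_of_real by linarith
    qed
    have S2: "2 * E \<le> 2 * S" using S(2) by simp
    have est: "norm (P t) \<le> \<alpha> * S" "norm (W x t) \<le> \<beta> * S" "norm (Dw x t) \<le> (\<beta> + \<alpha> * N + 4) * S"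
      if "t \<in> {0..T}" "x \<in> {0..pi}" for t x
      by (rule estimates[OF B sp Bq K S1 S2 S3 S4 q2b qb G \<alpha>_def \<beta>_def that]; assumption)+

    have cl: "closure ({0<..<pi} \<times> {0<..T}) = {0..pi} \<times> {0..T}" using T by (simp add: closure_Times)
    \<comment> \<open>The limits defining \<open>cont_ext\<close> are identified through a
      continuous function that agrees with the weighted derivative inside. This is how continuity of
      both derivatives up to x = 0, x = pi and t = 0 is obtained.\<close>
    have ext: "wext2 \<rho> T {0<..<pi} h z = (\<lambda>(x, t). g x t) z"
      if g: "continuous_on (UNIV \<times> {0..T}) (\<lambda>(x, t). g x t)" and z: "z \<in> {0..pi} \<times> {0..T}"
        and h: "\<And>x t. x \<in> {0<..<pi} \<Longrightarrow> t \<in> {0<..T} \<Longrightarrow> h x t = of_real (t powr (\<rho> - 1)) * g x t" for g h z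
      unfolding wext2_def
    proof (rule cont_ext_eqI)
      show "continuous_on (closure ({0<..<pi} \<times> {0<..T})) (\<lambda>(x, t). g x t)"
        unfolding cl by (rule continuous_on_subset[OF g]) auto
      show "z \<in> closure ({0<..<pi} \<times> {0<..T})" using z unfolding cl .
      fix w :: "real \<times> real" assume "w \<in> {0<..<pi} \<times> {0<..T}"
      then obtain x t where w: "w = (x, t)" "x \<in> {0<..<pi}" "t \<in> {0<..T}" by blast
      show "(case w of (x, t) \<Rightarrow> g x t) = (case w of (x, t) \<Rightarrow> (t powr (1 - \<rho>)) *\<^sub>R h x t)"
        unfolding w(1) prod.case h[OF w(2,3)] cancel(2)[OF w(3)] ..
    qed
    define Du where "Du = wext2 \<rho> T {0<..<pi} (\<lambda>x t. RL_deriv T \<rho> (u x) t)"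
    define uxx where "uxx = wext2 \<rho> T {0<..<pi} (\<lambda>x t. deriv2 {0<..<pi} (\<lambda>y. u y t) x)"
    have Du: "Du z = (\<lambda>(x, t). Dw x t) z" if "z \<in> {0..pi} \<times> {0..T}" for z
      unfolding Du_def by (rule ext[OF Dw_cont that RL_deriv_u])
    have uxx: "uxx z = (\<lambda>(x, t). W x t) z" if "z \<in> {0..pi} \<times> {0..T}" for z
      unfolding uxx_def by (rule ext[OF W_cont that deriv2_u])
    have cDu: "continuous_on ({0..pi} \<times> {0..T}) Du"
      by (rule continuous_on_eq[OF continuous_on_subset[OF Dw_cont] Du[symmetric]]) auto
    have cuxx: "continuous_on ({0..pi} \<times> {0..T}) uxx"
      by (rule continuous_on_eq[OF continuous_on_subset[OF W_cont] uxx[symmetric]]) auto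
    have ne: "{0..pi} \<times> {0..T} \<noteq> {}" "{0..T} \<noteq> {}" using T by auto
    have "max_norm ({0..pi} \<times> {0..T}) Du \<le> (\<beta> + \<alpha> * N + 4) * S"
    proof (rule max_norm_least[OF ne(1)])
      fix z assume "z \<in> {0..pi} \<times> {0..T}"
      then obtain x t where z: "z = (x, t)" "x \<in> {0..pi}" "t \<in> {0..T}" by blast
      show "norm (Du z) \<le> (\<beta> + \<alpha> * N + 4) * S" unfolding Du[OF \<open>z \<in> _\<close>] unfolding z(1) prod.case by (rule est(3)[OF z(3,2)])
    qed
    moreover have "max_norm ({0..pi} \<times> {0..T}) uxx \<le> \<beta> * S"
    proof (rule max_norm_least[OF ne(1)])
      fix z assume "z \<in> {0..pi} \<times> {0..T}"
      then obtain x t where z: "z = (x, t)" "x \<in> {0..pi}" "t \<in> {0..T}" by blast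
      show "norm (uxx z) \<le> \<beta> * S" unfolding uxx[OF \<open>z \<in> _\<close>] unfolding z(1) prod.case by (rule est(2)[OF z(3,2)])
    qed
    moreover have "max_norm {0..T} (wext \<rho> T p) \<le> \<alpha> * S"
    proof (rule max_norm_least[OF ne(2)])
      fix t assume t: "t \<in> {0..T}"
      show "norm (wext \<rho> T p t) \<le> \<alpha> * S" using est(1)[OF t, of 0] tc(2)[OF t] by (simp add: P_def)
    qed
    ultimately have "max_norm ({0..pi} \<times> {0..T}) Du + max_norm ({0..pi} \<times> {0..T}) uxx + max_norm {0..T} (wext \<rho> T p) \<le> C * S"
      by (simp add: C_def distrib_right)
    with cDu cuxx show "let Du = wext2 \<rho> T {0<..<pi} (\<lambda>x t. RL_deriv T \<rho> (u x) t);
             uxx = wext2 \<rho> T {0<..<pi} (\<lambda>x t. deriv2 {0<..<pi} (\<lambda>y. u y t) x)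
         in continuous_on ({0..pi} \<times> {0..T}) Du \<and>
            continuous_on ({0..pi} \<times> {0..T}) uxx \<and>
            max_norm ({0..pi} \<times> {0..T}) Du + max_norm ({0..pi} \<times> {0..T}) uxx
              + max_norm {0..T} (wext \<rho> T p)
            \<le> C * (Ca_norm a (deriv2 {0..pi} \<phi>) + max_norm {0..T} (wext \<rho> T \<psi>)
                   + max_norm {0..T} (wext \<rho> T (RL_deriv T \<rho> \<psi>))
                   + Cxa_norm a T (wext2 \<rho> T {0..pi} f))"
      unfolding Let_def Du_def[symmetric] uxx_def[symmetric] S_def A_def E_def by (intro conjI)
  qed
qed

end
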